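(* Let $\mathcal C$ and $\mathcal D$ be small categories, $\mathcal E$ a Grothendieck topos and $P:\mathcal C\to[\mathcal D^{\mathrm{op}},\mathbf{Set}]$ a functor. Let $\widetilde{(-)}:[\mathcal D,\mathcal E]\to[\mathcal C,\mathcal E]$ be the functor sending any functor $F:\mathcal D\to\mathcal E$ to the functor $\widetilde F$ defined by: for any $c\in\mathcal C$, $\widetilde F(c)=colim(F\circ\pi_c)$; for any arrow $f:c\to c'$ in $\mathcal C$, $\widetilde F(f):colim(F\circ\pi_c)\to colim(F\circ\pi_{c'})$ is defined by the conditions $\widetilde F(f)\circ\kappa^F_{(d,z)}=\kappa^F_{(d,P(f)(d)(z))}$ for every object $(d,z)$ of $\int P(c)$; and which acts on natural transformations in the obvious way. Let $(-)_r:[\mathcal C,\mathcal E]\to[\mathcal D,\mathcal E]$ be the functor assigning to any functor $G:\mathcal C\to\mathcal E$ the functor $d\mapsto Hom^{\mathcal E}_{[\mathcal C,\mathcal E]}(\gamma_{\mathcal E}^{\ast}\circ\widetilde{y_{\mathcal D}d},\,G)$, and acting on arrows in the obvious way. Then $\widetilde{(-)}$ is left adjoint to $(-)_r$. The unit $\eta^F:F\to(\widetilde F)_r$ and the counit $\epsilon^G:\widetilde{(G_r)}\to G$ are as follows. For any $d\in\mathcal D$, $\eta^F(d):F(d)\to(\widetilde F)_r(d)$ is the arrow of $\mathcal E$ which sends any generalized element $E\to F(d)$, regarded as a natural transformation $\gamma_{\mathcal E/E}^{\ast}\circ y_{\mathcal D}d\to{!}_E^{\ast}\circ F$, to the image $\gamma_{\mathcal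 E/E}^{\ast}\circ\widetilde{y_{\mathcal D}d}\to{!}_E^{\ast}\circ\widetilde F$ of this transformation under the functor $\widetilde{(-)}$, regarded as a generalized element $E\to Hom^{\mathcal E}_{[\mathcal C,\mathcal E]}(\gamma_{\mathcal E}^{\ast}\circ\widetilde{y_{\mathcal D}d},\widetilde F)=(\widetilde F)_r(d)$. For any $c\in\mathcal C$, $\epsilon^G(c):\widetilde{(G_r)}(c)=colim(G_r\circ\pi_c)\to G(c)$ is the arrow such that, for each object $(d,z)$ of $\int P(c)$, $\epsilon^G(c)\circ\kappa^{G_r}_{(d,z)}:G_r(d)\to G(c)$ sends a generalized element $x:E\to G_r(d)$, corresponding to a natural transformation $\overline x:\gamma_{\mathcal E/E}^{\ast}\circ\widetilde{y_{\mathcal D}d}\to{!}_E^{\ast}\circ G$, to the arrow $E\to G(c)$ obtained by composing $\overline x(c)$ with the coproduct component of $\gamma_{\mathcal E/E}^{\ast}(\widetilde{y_{\mathcal D}d}(c))$ corresponding to the element of $\widetilde{y_{\mathcal D}d}(c)$ given by the image of the identity on $d$ under the colimit arrow $\kappa^{y_{\mathcal D}d}_{(d,z)}:(y_{\mathcal D}d)(d)\to\widetilde{y_{\mathcal D}d}(c)$.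
   Context: $[\mathcal D,\mathcal E]$ denotes the category of functors $\mathcal D\to\mathcal E$ and natural transformations. $\int P(c)$ is the category of elements of $P(c):\mathcal D^{\mathrm{op}}\to\mathbf{Set}$ (objects: pairs $(d,z)$ with $d\in\mathcal D$, $z\in P(c)(d)$; arrows $(d,z)\to(d',z')$: arrows $g:d\to d'$ with $P(c)(g)(z')=z$) and $\pi_c:\int P(c)\to\mathcal D$ is the projection. For $H:\mathcal D\to\mathcal E$ and $(d,z)\in\int P(c)$, $\kappa^H_{(d,z)}:H(d)\to colim(H\circ\pi_c)$ is the colimit arrow. $y_{\mathcal D}:\mathcal D^{\mathrm{op}}\to[\mathcal D,\mathbf{Set}]$ is the Yoneda embedding, $y_{\mathcal D}d=Hom_{\mathcal D}(d,-)$, and $\widetilde{y_{\mathcal D}d}:\mathcal C\to\mathbf{Set}$ is obtained from it by the operation $\widetilde{(-)}$ for $\mathcal E=\mathbf{Set}$. $\gamma_{\mathcal E}:\mathcal E\to\mathbf{Set}$ is the unique geometric morphism and $!_E^{\ast}:\mathcal E\to\mathcal E/E$ is pullback along $E\to1$; for a set $S$, $\gamma_{\mathcal E/E}^{\ast}(S)=\coprod_{s\in S}1_{\mathcal E/E}$. The operation $\widetilde{(-)}$ commutes (up to canonical isomorphism) with inverse image functors. For functors $F,G:\mathcal C\to\mathcal E$, $Hom^{\mathcal E}_{[\mathcal C,\mathcal E]}(F,G)$ is the object of $\mathcal E$ such that, for any $E\in\mathcal E$, arrows $E\to Hom^{\mathcal E}_{[\mathcal C,\mathcal E]}(F,G)$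 correspond bijectively, naturally in $E$, to natural transformations $!_E^{\ast}\circ F\to{!}_E^{\ast}\circ G$; such an object always exists. A generalized element of an object $X$ of $\mathcal E$ is an arrow $E\to X$ in $\mathcal E$. *)

theory Defs
  imports Main "HOL-Library.FuncSet" "HOL-Library.Equipollence"
begin

section \<open>Universes\<close>

text \<open>
  A type of class \<open>universe\<close> plays the role of a Grothendieck universe: its small subsets, those of
  smaller cardinality than the type itself, are closed under power sets and small unions, i.e. the
  cardinality of the type is a regular strong limit. Uncountability is not required, so that
  \<^typ>\<open>nat\<close> (whose small sets are the finite ones) is an instance, as are the types of strongly
  inaccessible cardinality. Up to isomorphism, the sets and small categories relative
  to the universe are the small subsets of the type and the categories whose objects and arrows form
  small subsets of it.
\<close>

class universe =
  assumes infinite_universe: "infinite (UNIV :: 'a set)"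
    and Pow_universe: "\<And>A :: 'a set. A \<prec> (UNIV :: 'a set) \<Longrightarrow> Pow A \<prec> (UNIV :: 'a set)"
    and Union_universe: "\<And>(A :: 'a set) (B :: 'a \<Rightarrow> 'a set).
      A \<prec> (UNIV :: 'a set) \<Longrightarrow> (\<And>a. a \<in> A \<Longrightarrow> B a \<prec> (UNIV :: 'a set))
        \<Longrightarrow> (\<Union>a\<in>A. B a) \<prec> (UNIV :: 'a set)"

definition small :: "'u::universe set \<Rightarrow> bool" where
  "small A \<longleftrightarrow> A \<prec> (UNIV :: 'u set)"

lemma lesspoll_UNIV_nat: "A \<prec> (UNIV :: nat set) \<longleftrightarrow> finite A"
proof
  assume "A \<prec> (UNIV :: nat set)"
  then have "\<not> (UNIV :: nat set) \<lesssim> A"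
    using lepoll_antisym unfolding lesspoll_def by blast
  then show "finite A"
    unfolding infinite_le_lepoll[symmetric] by simp
next
  assume "finite A"
  then show "A \<prec> (UNIV :: nat set)"
    by (rule finite_lesspoll_infinite[OF infinite_UNIV_nat])
qed

instance nat :: universe
  by standard (simp_all add: lesspoll_UNIV_nat)

section \<open>Categories, functors, natural transformations\<close>

record ('o, 'a) cat =
  Obj :: "'o set"
  Arr :: "'a set"
  Dom :: "'a \<Rightarrow> 'o"
  Cod :: "'a \<Rightarrow> 'o"
  Ide :: "'o \<Rightarrow> 'a"
  Comp :: "'a \<Rightarrow> 'a \<Rightarrow> 'a"  (infixl \<open>\<cdot>\<index>\<close> 70)

definition hom :: "('o, 'a) cat \<Rightarrow> 'o \<Rightarrow> 'o \<Rightarrow> 'a set" where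
  "hom C a b = {f \<in> Arr C. Dom C f = a \<and> Cod C f = b}"

definition category :: "('o, 'a) cat \<Rightarrow> bool" where
  "category C \<longleftrightarrow>
     (\<forall>f\<in>Arr C. Dom C f \<in> Obj C \<and> Cod C f \<in> Obj C) \<and>
     (\<forall>a\<in>Obj C. Ide C a \<in> hom C a a) \<and>
     (\<forall>f\<in>Arr C. \<forall>g\<in>Arr C. Cod C f = Dom C g \<longrightarrow> g \<cdot>\<^bsub>C\<^esub> f \<in> hom C (Dom C f) (Cod C g)) \<and>
     (\<forall>f\<in>Arr C. f \<cdot>\<^bsub>C\<^esub> Ide C (Dom C f) = f \<and> Ide C (Cod C f) \<cdot>\<^bsub>C\<^esub> f = f) \<and>
     (\<forall>f\<in>Arr C. \<forall>g\<in>Arr C. \<forall>h\<in>Arr C. Cod C f = Dom C g \<longrightarrow> Cod C g = Dom C h \<longrightarrow>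
        h \<cdot>\<^bsub>C\<^esub> (g \<cdot>\<^bsub>C\<^esub> f) = (h \<cdot>\<^bsub>C\<^esub> g) \<cdot>\<^bsub>C\<^esub> f)"

definition small_category :: "('u::universe, 'u) cat \<Rightarrow> bool" where
  "small_category C \<longleftrightarrow> category C \<and> small (Obj C) \<and> small (Arr C)"

definition opp :: "('o, 'a) cat \<Rightarrow> ('o, 'a) cat" where
  "opp C = \<lparr>Obj = Obj C, Arr = Arr C, Dom = Cod C, Cod = Dom C, Ide = Ide C,
     Comp = (\<lambda>g f. f \<cdot>\<^bsub>C\<^esub> g)\<rparr>"

definition iso :: "('o, 'a) cat \<Rightarrow> 'a \<Rightarrow> bool" where
  "iso C f \<longleftrightarrow> f \<in> Arr C \<and>
     (\<exists>g\<in>hom C (Cod C f) (Dom C f). g \<cdot>\<^bsub>C\<^esub> f = Ide C (Dom C f) \<and> f \<cdot>\<^bsub>C\<^esub> g = Ide C (Cod C f))"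

definition inverse_arr :: "('o, 'a) cat \<Rightarrow> 'a \<Rightarrow> 'a" where
  "inverse_arr C f = (THE g. g \<in> hom C (Cod C f) (Dom C f) \<and>
     g \<cdot>\<^bsub>C\<^esub> f = Ide C (Dom C f) \<and> f \<cdot>\<^bsub>C\<^esub> g = Ide C (Cod C f))"

record ('o, 'a, 'p, 'b) ftr =
  FO :: "'o \<Rightarrow> 'p"
  FA :: "'a \<Rightarrow> 'b"

text \<open>Functors and transformations are \<^const>\<open>undefined\<close> outside of their domain, so that equality of
  records is equality of functors and of transformations.\<close>

definition is_functor :: "('o, 'a) cat \<Rightarrow> ('p, 'b) cat \<Rightarrow> ('o, 'a, 'p, 'b) ftr \<Rightarrow> bool" where
  "is_functor C D F \<longleftrightarrow> category C \<and> category D \<and>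
     FO F \<in> Obj C \<rightarrow>\<^sub>E Obj D \<and> FA F \<in> Arr C \<rightarrow>\<^sub>E Arr D \<and>
     (\<forall>f\<in>Arr C. FA F f \<in> hom D (FO F (Dom C f)) (FO F (Cod C f))) \<and>
     (\<forall>a\<in>Obj C. FA F (Ide C a) = Ide D (FO F a)) \<and>
     (\<forall>f\<in>Arr C. \<forall>g\<in>Arr C. Cod C f = Dom C g \<longrightarrow> FA F (g \<cdot>\<^bsub>C\<^esub> f) = FA F g \<cdot>\<^bsub>D\<^esub> FA F f)"

definition id_functor :: "('o, 'a) cat \<Rightarrow> ('o, 'a, 'o, 'a) ftr" where
  "id_functor C = \<lparr>FO = \<lambda>a\<in>Obj C. a, FA = \<lambda>f\<in>Arr C. f\<rparr>"

definition fcomp ::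
  "('o, 'a) cat \<Rightarrow> ('p, 'b, 'q, 'c) ftr \<Rightarrow> ('o, 'a, 'p, 'b) ftr \<Rightarrow> ('o, 'a, 'q, 'c) ftr"
  (infixl \<open>\<circ>\<index>\<close> 75) \<comment> \<open>\<^term>\<open>G \<circ>\<^bsub>C\<^esub> F\<close>, where \<open>C\<close> is the domain of \<open>F\<close>\<close> where
  "G \<circ>\<^bsub>C\<^esub> F = \<lparr>FO = \<lambda>a\<in>Obj C. FO G (FO F a), FA = \<lambda>f\<in>Arr C. FA G (FA F f)\<rparr>"

record ('o, 'a, 'p, 'b) ntr =
  NS :: "('o, 'a, 'p, 'b) ftr"
  NT :: "('o, 'a, 'p, 'b) ftr"
  NC :: "'o \<Rightarrow> 'b"

definition natural_transformation ::
  "('o, 'a) cat \<Rightarrow> ('p, 'b) cat \<Rightarrow> ('o, 'a, 'p, 'b) ntr \<Rightarrow> bool" where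
  "natural_transformation C D t \<longleftrightarrow> is_functor C D (NS t) \<and> is_functor C D (NT t) \<and>
     NC t \<in> extensional (Obj C) \<and>
     (\<forall>a\<in>Obj C. NC t a \<in> hom D (FO (NS t) a) (FO (NT t) a)) \<and>
     (\<forall>f\<in>Arr C. NC t (Cod C f) \<cdot>\<^bsub>D\<^esub> FA (NS t) f = FA (NT t) f \<cdot>\<^bsub>D\<^esub> NC t (Dom C f))"

definition fcat ::
  "('o, 'a) cat \<Rightarrow> ('p, 'b) cat \<Rightarrow> (('o, 'a, 'p, 'b) ftr, ('o, 'a, 'p, 'b) ntr) cat" where
  "fcat C D = \<lparr>Obj = {F. is_functor C D F}, Arr = {t. natural_transformation C D t},
     Dom = NS, Cod = NT,
     Ide = (\<lambda>F. \<lparr>NS = F, NT = F, NC = \<lambda>a\<in>Obj C. Ide D (FO F a)\<rparr>),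
     Comp = (\<lambda>s t. \<lparr>NS = NS t, NT = NT s, NC = \<lambda>a\<in>Obj C. NC s a \<cdot>\<^bsub>D\<^esub> NC t a\<rparr>)\<rparr>"

definition whisker_left ::
  "('o, 'a) cat \<Rightarrow> ('p, 'b, 'q, 'c) ftr \<Rightarrow> ('o, 'a, 'p, 'b) ntr \<Rightarrow> ('o, 'a, 'q, 'c) ntr" where
  "whisker_left C L t =
     \<lparr>NS = L \<circ>\<^bsub>C\<^esub> NS t, NT = L \<circ>\<^bsub>C\<^esub> NT t, NC = \<lambda>a\<in>Obj C. FA L (NC t a)\<rparr>"

definition whisker_right ::
  "('o, 'a) cat \<Rightarrow> ('p, 'b, 'q, 'c) ntr \<Rightarrow> ('o, 'a, 'p, 'b) ftr \<Rightarrow> ('o, 'a, 'q, 'c) ntr" where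
  "whisker_right C t F =
     \<lparr>NS = NS t \<circ>\<^bsub>C\<^esub> F, NT = NT t \<circ>\<^bsub>C\<^esub> F, NC = \<lambda>a\<in>Obj C. NC t (FO F a)\<rparr>"

definition equivalent_categories :: "('o, 'a) cat \<Rightarrow> ('p, 'b) cat \<Rightarrow> bool" where
  "equivalent_categories A B \<longleftrightarrow> (\<exists>F G. is_functor A B F \<and> is_functor B A G \<and>
     (\<exists>s\<in>hom (fcat A A) (id_functor A) (G \<circ>\<^bsub>A\<^esub> F). iso (fcat A A) s) \<and>
     (\<exists>t\<in>hom (fcat B B) (F \<circ>\<^bsub>B\<^esub> G) (id_functor B). iso (fcat B B) t))"

text \<open>\<open>L \<stileturn> R\<close> with unit \<open>\<eta>\<close> and counit \<open>\<epsilon>\<close>.\<close>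

definition adjunction ::
  "('o, 'a) cat \<Rightarrow> ('p, 'b) cat \<Rightarrow> ('o, 'a, 'p, 'b) ftr \<Rightarrow> ('p, 'b, 'o, 'a) ftr
    \<Rightarrow> ('o, 'a, 'o, 'a) ntr \<Rightarrow> ('p, 'b, 'p, 'b) ntr \<Rightarrow> bool" where
  "adjunction A B L R \<eta> \<epsilon> \<longleftrightarrow> is_functor A B L \<and> is_functor B A R \<and>
     \<eta> \<in> hom (fcat A A) (id_functor A) (R \<circ>\<^bsub>A\<^esub> L) \<and>
     \<epsilon> \<in> hom (fcat B B) (L \<circ>\<^bsub>B\<^esub> R) (id_functor B) \<and>
     (\<forall>a\<in>Obj A. NC \<epsilon> (FO L a) \<cdot>\<^bsub>B\<^esub> FA L (NC \<eta> a) = Ide B (FO L a)) \<and>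
     (\<forall>b\<in>Obj B. FA R (NC \<epsilon> b) \<cdot>\<^bsub>A\<^esub> NC \<eta> (FO R b) = Ide A (FO R b))"

section \<open>The category of sets, presheaves, sheaves\<close>

record 'u sfun =
  SD :: "'u set"
  SC :: "'u set"
  SF :: "'u \<Rightarrow> 'u"

definition setcat :: "('u::universe set, 'u sfun) cat" where
  "setcat = \<lparr>Obj = {A. small A},
     Arr = {f. small (SD f) \<and> small (SC f) \<and> SF f \<in> SD f \<rightarrow>\<^sub>E SC f},
     Dom = SD, Cod = SC, Ide = (\<lambda>A. \<lparr>SD = A, SC = A, SF = \<lambda>x\<in>A. x\<rparr>),
     Comp = (\<lambda>g f. \<lparr>SD = SD f, SC = SC g, SF = \<lambda>x\<in>SD f. SF g (SF f x)\<rparr>)\<rparr>"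

type_synonym 'u psh = "('u, 'u, 'u set, 'u sfun) ftr"
type_synonym 'u psh_ntr = "('u, 'u, 'u set, 'u sfun) ntr"

definition sieve :: "('o, 'a) cat \<Rightarrow> 'o \<Rightarrow> 'a set \<Rightarrow> bool" where
  "sieve C c S \<longleftrightarrow> S \<subseteq> {f \<in> Arr C. Cod C f = c} \<and>
     (\<forall>f\<in>S. \<forall>g\<in>Arr C. Cod C g = Dom C f \<longrightarrow> f \<cdot>\<^bsub>C\<^esub> g \<in> S)"

definition sieve_pullback :: "('o, 'a) cat \<Rightarrow> 'a \<Rightarrow> 'a set \<Rightarrow> 'a set" where
  "sieve_pullback C f S = {g \<in> Arr C. Cod C g = Dom C f \<and> f \<cdot>\<^bsub>C\<^esub> g \<in> S}"

definition grothendieck_topology :: "('o, 'a) cat \<Rightarrow> ('o \<Rightarrow> 'a set set) \<Rightarrow> bool" where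
  "grothendieck_topology C J \<longleftrightarrow> (\<forall>c\<in>Obj C.
     (\<forall>S\<in>J c. sieve C c S) \<and>
     {f \<in> Arr C. Cod C f = c} \<in> J c \<and>
     (\<forall>S\<in>J c. \<forall>f\<in>Arr C. Cod C f = c \<longrightarrow> sieve_pullback C f S \<in> J (Dom C f)) \<and>
     (\<forall>S\<in>J c. \<forall>R. sieve C c R \<longrightarrow> (\<forall>f\<in>S. sieve_pullback C f R \<in> J (Dom C f)) \<longrightarrow> R \<in> J c))"

definition matching_family ::
  "('u::universe, 'u) cat \<Rightarrow> 'u psh \<Rightarrow> 'u set \<Rightarrow> ('u \<Rightarrow> 'u) \<Rightarrow> bool" where
  "matching_family C X S m \<longleftrightarrow> (\<forall>f\<in>S. m f \<in> FO X (Dom C f)) \<and>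
     (\<forall>f\<in>S. \<forall>g\<in>Arr C. Cod C g = Dom C f \<longrightarrow> SF (FA X g) (m f) = m (f \<cdot>\<^bsub>C\<^esub> g))"

definition sheaf :: "('u::universe, 'u) cat \<Rightarrow> ('u \<Rightarrow> 'u set set) \<Rightarrow> 'u psh \<Rightarrow> bool" where
  "sheaf C J X \<longleftrightarrow> is_functor (opp C) setcat X \<and>
     (\<forall>c\<in>Obj C. \<forall>S\<in>J c. \<forall>m. matching_family C X S m \<longrightarrow>
        (\<exists>!x. x \<in> FO X c \<and> (\<forall>f\<in>S. SF (FA X f) x = m f)))"

definition sheaves ::
  "('u::universe, 'u) cat \<Rightarrow> ('u \<Rightarrow> 'u set set) \<Rightarrow> ('u psh, 'u psh_ntr) cat" where
  "sheaves C J = (fcat (opp C) setcat)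
     \<lparr>Obj := {X. sheaf C J X},
      Arr := {t. natural_transformation (opp C) setcat t \<and> sheaf C J (NS t) \<and> sheaf C J (NT t)}\<rparr>"

definition grothendieck_topos :: "'u::universe itself \<Rightarrow> ('o, 'a) cat \<Rightarrow> bool" where
  "grothendieck_topos U E \<longleftrightarrow> (\<exists>(C :: ('u, 'u) cat) J.
     small_category C \<and> grothendieck_topology C J \<and> equivalent_categories E (sheaves C J))"

section \<open>Limits and colimits\<close>

text \<open>Universal constructions are chosen by Hilbert choice; in a Grothendieck topos and its slices
  the ones used below exist.\<close>

definition cocone ::
  "('o, 'a) cat \<Rightarrow> ('j, 'b) cat \<Rightarrow> ('j, 'b, 'o, 'a) ftr \<Rightarrow> 'o \<Rightarrow> ('j \<Rightarrow> 'a) \<Rightarrow> bool" where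
  "cocone E I F X k \<longleftrightarrow> X \<in> Obj E \<and> (\<forall>i\<in>Obj I. k i \<in> hom E (FO F i) X) \<and>
     (\<forall>f\<in>Arr I. k (Cod I f) \<cdot>\<^bsub>E\<^esub> FA F f = k (Dom I f))"

definition is_colimit ::
  "('o, 'a) cat \<Rightarrow> ('j, 'b) cat \<Rightarrow> ('j, 'b, 'o, 'a) ftr \<Rightarrow> 'o \<Rightarrow> ('j \<Rightarrow> 'a) \<Rightarrow> bool" where
  "is_colimit E I F X k \<longleftrightarrow> cocone E I F X k \<and>
     (\<forall>Y l. cocone E I F Y l \<longrightarrow> (\<exists>!h. h \<in> hom E X Y \<and> (\<forall>i\<in>Obj I. h \<cdot>\<^bsub>E\<^esub> k i = l i)))"

definition colim_data ::
  "('o, 'a) cat \<Rightarrow> ('j, 'b) cat \<Rightarrow> ('j, 'b, 'o, 'a) ftr \<Rightarrow> 'o \<times> ('j \<Rightarrow> 'a)" where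
  "colim_data E I F = (SOME (X, k). is_colimit E I F X k)"

definition colim :: "('o, 'a) cat \<Rightarrow> ('j, 'b) cat \<Rightarrow> ('j, 'b, 'o, 'a) ftr \<Rightarrow> 'o" where
  "colim E I F = fst (colim_data E I F)"

definition colim_arr :: "('o, 'a) cat \<Rightarrow> ('j, 'b) cat \<Rightarrow> ('j, 'b, 'o, 'a) ftr \<Rightarrow> 'j \<Rightarrow> 'a" where
  "colim_arr E I F = snd (colim_data E I F)"

definition is_terminal :: "('o, 'a) cat \<Rightarrow> 'o \<Rightarrow> bool" where
  "is_terminal E T \<longleftrightarrow> T \<in> Obj E \<and> (\<forall>X\<in>Obj E. \<exists>!h. h \<in> hom E X T)"

definition terminal :: "('o, 'a) cat \<Rightarrow> 'o" where
  "terminal E = (SOME T. is_terminal E T)"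

definition to_terminal :: "('o, 'a) cat \<Rightarrow> 'o \<Rightarrow> 'a" where
  "to_terminal E X = (THE h. h \<in> hom E X (terminal E))"

definition is_pullback :: "('o, 'a) cat \<Rightarrow> 'a \<Rightarrow> 'a \<Rightarrow> 'a \<Rightarrow> 'a \<Rightarrow> bool" where
  "is_pullback E f g p q \<longleftrightarrow> p \<in> Arr E \<and> q \<in> Arr E \<and> Dom E p = Dom E q \<and>
     Cod E p = Dom E f \<and> Cod E q = Dom E g \<and> f \<cdot>\<^bsub>E\<^esub> p = g \<cdot>\<^bsub>E\<^esub> q \<and>
     (\<forall>r\<in>Arr E. \<forall>s\<in>Arr E. Dom E r = Dom E s \<longrightarrow> Cod E r = Dom E f \<longrightarrow> Cod E s = Dom E g \<longrightarrow>
        f \<cdot>\<^bsub>E\<^esub> r = g \<cdot>\<^bsub>E\<^esub> s \<longrightarrow>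
        (\<exists>!h. h \<in> hom E (Dom E r) (Dom E p) \<and> p \<cdot>\<^bsub>E\<^esub> h = r \<and> q \<cdot>\<^bsub>E\<^esub> h = s))"

definition pullback :: "('o, 'a) cat \<Rightarrow> 'a \<Rightarrow> 'a \<Rightarrow> 'a \<times> 'a" where
  "pullback E f g = (SOME (p, q). is_pullback E f g p q)"

section \<open>Slices and the functors \<open>!\<^sub>A\<^sup>*\<close>\<close>

text \<open>An arrow of the slice over \<open>A\<close> is a triple (source, underlying arrow, target).\<close>

definition slice :: "('o, 'a) cat \<Rightarrow> 'o \<Rightarrow> ('a, 'a \<times> 'a \<times> 'a) cat" where
  "slice E A = \<lparr>Obj = {p \<in> Arr E. Cod E p = A},
     Arr = {(p, h, q). p \<in> Arr E \<and> Cod E p = A \<and> q \<in> Arr E \<and> Cod E q = A \<and>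
       h \<in> hom E (Dom E p) (Dom E q) \<and> q \<cdot>\<^bsub>E\<^esub> h = p},
     Dom = (\<lambda>(p, h, q). p), Cod = (\<lambda>(p, h, q). q),
     Ide = (\<lambda>p. (p, Ide E (Dom E p), p)),
     Comp = (\<lambda>(q', k, r) (p, h, q). (p, k \<cdot>\<^bsub>E\<^esub> h, r))\<rparr>"

definition underlying :: "'a \<times> 'a \<times> 'a \<Rightarrow> 'a" where
  "underlying t = fst (snd t)"

text \<open>The two projections of the chosen product \<open>A \<times> X\<close>, the pullback of \<open>X \<rightarrow> 1\<close> along \<open>A \<rightarrow> 1\<close>.\<close>

definition proj1 :: "('o, 'a) cat \<Rightarrow> 'o \<Rightarrow> 'o \<Rightarrow> 'a" where
  "proj1 E A X = fst (pullback E (to_terminal E A) (to_terminal E X))"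

definition proj2 :: "('o, 'a) cat \<Rightarrow> 'o \<Rightarrow> 'o \<Rightarrow> 'a" where
  "proj2 E A X = snd (pullback E (to_terminal E A) (to_terminal E X))"

definition prod_arr :: "('o, 'a) cat \<Rightarrow> 'a \<Rightarrow> 'a \<Rightarrow> 'a" where
  "prod_arr E u f = (THE h.
     h \<in> hom E (Dom E (proj1 E (Dom E u) (Dom E f))) (Dom E (proj1 E (Cod E u) (Cod E f))) \<and>
     proj1 E (Cod E u) (Cod E f) \<cdot>\<^bsub>E\<^esub> h = u \<cdot>\<^bsub>E\<^esub> proj1 E (Dom E u) (Dom E f) \<and>
     proj2 E (Cod E u) (Cod E f) \<cdot>\<^bsub>E\<^esub> h = f \<cdot>\<^bsub>E\<^esub> proj2 E (Dom E u) (Dom E f))"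

definition base_change :: "('o, 'a) cat \<Rightarrow> 'o \<Rightarrow> ('o, 'a, 'a, 'a \<times> 'a \<times> 'a) ftr" where
  "base_change E A = \<lparr>FO = \<lambda>X\<in>Obj E. proj1 E A X,
     FA = \<lambda>f\<in>Arr E. (proj1 E A (Dom E f), prod_arr E (Ide E A) f, proj1 E A (Cod E f))\<rparr>"

text \<open>The arrow \<open>1 \<rightarrow> !\<^sub>A\<^sup>*(X)\<close> of the slice over \<open>A\<close> corresponding to a generalized element
  \<open>x : A \<rightarrow> X\<close>. The chosen terminal object of the slice is itself an (invertible) arrow of \<open>E\<close>
  with codomain \<open>A\<close>.\<close>

definition global_element :: "('o, 'a) cat \<Rightarrow> 'o \<Rightarrow> 'o \<Rightarrow> 'a \<Rightarrow> 'a \<times> 'a \<times> 'a" where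
  "global_element E A X x =
     (THE k. k \<in> hom (slice E A) (terminal (slice E A)) (FO (base_change E A) X) \<and>
       proj2 E A X \<cdot>\<^bsub>E\<^esub> underlying k = x \<cdot>\<^bsub>E\<^esub> terminal (slice E A))"

section \<open>The functors \<open>\<gamma>\<^sup>*\<close>\<close>

definition discrete :: "'s set \<Rightarrow> ('s, 's) cat" where
  "discrete S = \<lparr>Obj = S, Arr = S, Dom = (\<lambda>s. s), Cod = (\<lambda>s. s), Ide = (\<lambda>s. s), Comp = (\<lambda>t s. s)\<rparr>"

definition const_functor :: "('j, 'b) cat \<Rightarrow> ('o, 'a) cat \<Rightarrow> 'o \<Rightarrow> ('j, 'b, 'o, 'a) ftr" where
  "const_functor I E X = \<lparr>FO = \<lambda>i\<in>Obj I. X, FA = \<lambda>f\<in>Arr I. Ide E X\<rparr>"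

definition copower :: "('o, 'a) cat \<Rightarrow> 's set \<Rightarrow> 'o" where
  "copower E S = colim E (discrete S) (const_functor (discrete S) E (terminal E))"

definition coproj :: "('o, 'a) cat \<Rightarrow> 's set \<Rightarrow> 's \<Rightarrow> 'a" where
  "coproj E S = colim_arr E (discrete S) (const_functor (discrete S) E (terminal E))"

definition gamma :: "('o, 'a) cat \<Rightarrow> ('u::universe set, 'u sfun, 'o, 'a) ftr" where
  "gamma E = \<lparr>FO = \<lambda>S\<in>Obj setcat. copower E S,
     FA = \<lambda>f\<in>Arr setcat. THE h. h \<in> hom E (copower E (SD f)) (copower E (SC f)) \<and>
       (\<forall>s\<in>SD f. h \<cdot>\<^bsub>E\<^esub> coproj E (SD f) s = coproj E (SC f) (SF f s))\<rparr>"

text \<open>The canonical isomorphism from \<open>\<gamma>\<^sup>*\<close> of the slice over \<open>A\<close> to \<open>!\<^sub>A\<^sup>* \<circ> \<gamma>\<^sup>*\<close>.\<close>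

definition gamma_slice ::
  "('o, 'a) cat \<Rightarrow> 'o \<Rightarrow> ('u::universe set, 'u sfun, 'a, 'a \<times> 'a \<times> 'a) ntr" where
  "gamma_slice E A = \<lparr>NS = gamma (slice E A), NT = base_change E A \<circ>\<^bsub>setcat\<^esub> gamma E,
     NC = \<lambda>S\<in>Obj setcat. THE h.
       h \<in> hom (slice E A) (copower (slice E A) S) (FO (base_change E A) (copower E S)) \<and>
       (\<forall>s\<in>S. h \<cdot>\<^bsub>slice E A\<^esub> coproj (slice E A) S s = FA (base_change E A) (coproj E S s) \<cdot>\<^bsub>slice E A\<^esub>
          (THE k. k \<in> hom (slice E A) (terminal (slice E A)) (FO (base_change E A) (terminal E))))\<rparr>"

section \<open>The objects of natural transformations\<close>

text \<open>For \<open>u : B \<rightarrow> A\<close>, the functor \<open>!\<^sub>B\<^sup>*\<close> is canonically isomorphic to \<open>u\<^sup>* \<circ> !\<^sub>A\<^sup>*\<close>, since \<open>B \<times> X\<close> is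
  the pullback of \<open>A \<times> X\<close> along \<open>u\<close>. The following is \<open>u\<^sup>*\<close> applied to a transformation
  \<open>t : !\<^sub>A\<^sup>* \<circ> F \<rightarrow> !\<^sub>A\<^sup>* \<circ> G\<close>, transported along these isomorphisms.\<close>

definition reindex ::
  "('c, 'd) cat \<Rightarrow> ('o, 'a) cat \<Rightarrow> 'a \<Rightarrow> ('c, 'd, 'o, 'a) ftr \<Rightarrow> ('c, 'd, 'o, 'a) ftr
    \<Rightarrow> ('c, 'd, 'a, 'a \<times> 'a \<times> 'a) ntr \<Rightarrow> ('c, 'd, 'a, 'a \<times> 'a \<times> 'a) ntr" where
  "reindex C E u F G t = (THE s.
     s \<in> hom (fcat C (slice E (Dom E u)))
           (base_change E (Dom E u) \<circ>\<^bsub>C\<^esub> F) (base_change E (Dom E u) \<circ>\<^bsub>C\<^esub> G) \<and>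
     (\<forall>c\<in>Obj C. prod_arr E u (Ide E (FO G c)) \<cdot>\<^bsub>E\<^esub> underlying (NC s c) =
                underlying (NC t c) \<cdot>\<^bsub>E\<^esub> prod_arr E u (Ide E (FO F c))))"

definition is_hom_object ::
  "('c, 'd) cat \<Rightarrow> ('o, 'a) cat \<Rightarrow> ('c, 'd, 'o, 'a) ftr \<Rightarrow> ('c, 'd, 'o, 'a) ftr
    \<Rightarrow> 'o \<Rightarrow> ('o \<Rightarrow> 'a \<Rightarrow> ('c, 'd, 'a, 'a \<times> 'a \<times> 'a) ntr) \<Rightarrow> bool" where
  "is_hom_object C E F G H \<Phi> \<longleftrightarrow> H \<in> Obj E \<and>
     (\<forall>A\<in>Obj E. bij_betw (\<Phi> A) (hom E A H)
        (hom (fcat C (slice E A)) (base_change E A \<circ>\<^bsub>C\<^esub> F) (base_change E A \<circ>\<^bsub>C\<^esub> G))) \<and>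
     (\<forall>u\<in>Arr E. \<forall>x\<in>hom E (Cod E u) H.
        \<Phi> (Dom E u) (x \<cdot>\<^bsub>E\<^esub> u) = reindex C E u F G (\<Phi> (Cod E u) x))"

definition hom_data ::
  "('c, 'd) cat \<Rightarrow> ('o, 'a) cat \<Rightarrow> ('c, 'd, 'o, 'a) ftr \<Rightarrow> ('c, 'd, 'o, 'a) ftr
    \<Rightarrow> 'o \<times> ('o \<Rightarrow> 'a \<Rightarrow> ('c, 'd, 'a, 'a \<times> 'a \<times> 'a) ntr)" where
  "hom_data C E F G = (SOME (H, \<Phi>). is_hom_object C E F G H \<Phi>)"

definition hom_object ::
  "('c, 'd) cat \<Rightarrow> ('o, 'a) cat \<Rightarrow> ('c, 'd, 'o, 'a) ftr \<Rightarrow> ('c, 'd, 'o, 'a) ftr \<Rightarrow> 'o" where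
  "hom_object C E F G = fst (hom_data C E F G)"

text \<open>The transformation \<open>!\<^sub>A\<^sup>* \<circ> F \<rightarrow> !\<^sub>A\<^sup>* \<circ> G\<close> corresponding to \<open>x : A \<rightarrow> hom_object C E F G\<close>.\<close>

definition hom_elem ::
  "('c, 'd) cat \<Rightarrow> ('o, 'a) cat \<Rightarrow> ('c, 'd, 'o, 'a) ftr \<Rightarrow> ('c, 'd, 'o, 'a) ftr
    \<Rightarrow> 'o \<Rightarrow> 'a \<Rightarrow> ('c, 'd, 'a, 'a \<times> 'a \<times> 'a) ntr" where
  "hom_elem C E F G = snd (hom_data C E F G)"

text \<open>For \<open>a : F' \<rightarrow> F\<close> and \<open>b : G \<rightarrow> G'\<close>, the arrow
  \<open>hom_object C E F G \<rightarrow> hom_object C E F' G'\<close> given by composition with \<open>a\<close> and \<open>b\<close>.\<close>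

definition hom_map ::
  "('c, 'd) cat \<Rightarrow> ('o, 'a) cat \<Rightarrow> ('c, 'd, 'o, 'a) ntr \<Rightarrow> ('c, 'd, 'o, 'a) ntr \<Rightarrow> 'a" where
  "hom_map C E a b = (THE h.
     h \<in> hom E (hom_object C E (NT a) (NS b)) (hom_object C E (NS a) (NT b)) \<and>
     (\<forall>A\<in>Obj E. \<forall>x\<in>hom E A (hom_object C E (NT a) (NS b)).
        hom_elem C E (NS a) (NT b) A (h \<cdot>\<^bsub>E\<^esub> x) =
          whisker_left C (base_change E A) b \<cdot>\<^bsub>fcat C (slice E A)\<^esub>
          hom_elem C E (NT a) (NS b) A x \<cdot>\<^bsub>fcat C (slice E A)\<^esub>
          whisker_left C (base_change E A) a))"

section \<open>Categories of elements and the functor \<open>tilde\<close>\<close>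

text \<open>An arrow of the category of elements is a triple (source, underlying arrow, target).\<close>

definition elements ::
  "('u::universe, 'u) cat \<Rightarrow> 'u psh \<Rightarrow> ('u \<times> 'u, ('u \<times> 'u) \<times> 'u \<times> ('u \<times> 'u)) cat" where
  "elements D X = \<lparr>Obj = {(d, z). d \<in> Obj D \<and> z \<in> FO X d},
     Arr = {((d, z), g, (d', z')). d \<in> Obj D \<and> z \<in> FO X d \<and> d' \<in> Obj D \<and> z' \<in> FO X d' \<and>
       g \<in> hom D d d' \<and> SF (FA X g) z' = z},
     Dom = (\<lambda>(i, g, j). i), Cod = (\<lambda>(i, g, j). j),
     Ide = (\<lambda>(d, z). ((d, z), Ide D d, (d, z))),
     Comp = (\<lambda>(j', h, k) (i, g, j). (i, h \<cdot>\<^bsub>D\<^esub> g, k))\<rparr>"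

definition elements_proj :: "('u::universe, 'u) cat \<Rightarrow> 'u psh
    \<Rightarrow> ('u \<times> 'u, ('u \<times> 'u) \<times> 'u \<times> ('u \<times> 'u), 'u, 'u) ftr" where
  "elements_proj D X = \<lparr>FO = \<lambda>(d, z)\<in>Obj (elements D X). d,
     FA = \<lambda>(i, g, j)\<in>Arr (elements D X). g\<rparr>"

type_synonym 'u prof = "('u, 'u, 'u psh, 'u psh_ntr) ftr"

definition tilde_obj_obj ::
  "('u::universe, 'u) cat \<Rightarrow> 'u prof \<Rightarrow> ('o, 'a) cat \<Rightarrow> ('u, 'u, 'o, 'a) ftr \<Rightarrow> 'u \<Rightarrow> 'o" where
  "tilde_obj_obj D P E F c =
     colim E (elements D (FO P c)) (F \<circ>\<^bsub>elements D (FO P c)\<^esub> elements_proj D (FO P c))"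

definition kappa ::
  "('u::universe, 'u) cat \<Rightarrow> 'u prof \<Rightarrow> ('o, 'a) cat \<Rightarrow> ('u, 'u, 'o, 'a) ftr \<Rightarrow> 'u
    \<Rightarrow> 'u \<times> 'u \<Rightarrow> 'a" where
  "kappa D P E F c =
     colim_arr E (elements D (FO P c)) (F \<circ>\<^bsub>elements D (FO P c)\<^esub> elements_proj D (FO P c))"

definition tilde_obj ::
  "('u::universe, 'u) cat \<Rightarrow> ('u, 'u) cat \<Rightarrow> 'u prof \<Rightarrow> ('o, 'a) cat
    \<Rightarrow> ('u, 'u, 'o, 'a) ftr \<Rightarrow> ('u, 'u, 'o, 'a) ftr" where
  "tilde_obj C D P E F = \<lparr>FO = \<lambda>c\<in>Obj C. tilde_obj_obj D P E F c,
     FA = \<lambda>f\<in>Arr C. THE h.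
       h \<in> hom E (tilde_obj_obj D P E F (Dom C f)) (tilde_obj_obj D P E F (Cod C f)) \<and>
       (\<forall>(d, z)\<in>Obj (elements D (FO P (Dom C f))).
          h \<cdot>\<^bsub>E\<^esub> kappa D P E F (Dom C f) (d, z) =
          kappa D P E F (Cod C f) (d, SF (NC (FA P f) d) z))\<rparr>"

definition tilde_arr ::
  "('u::universe, 'u) cat \<Rightarrow> ('u, 'u) cat \<Rightarrow> 'u prof \<Rightarrow> ('o, 'a) cat
    \<Rightarrow> ('u, 'u, 'o, 'a) ntr \<Rightarrow> ('u, 'u, 'o, 'a) ntr" where
  "tilde_arr C D P E t = \<lparr>NS = tilde_obj C D P E (NS t), NT = tilde_obj C D P E (NT t),
     NC = \<lambda>c\<in>Obj C. THE h.
       h \<in> hom E (tilde_obj_obj D P E (NS t) c) (tilde_obj_obj D P E (NT t) c) \<and>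
       (\<forall>(d, z)\<in>Obj (elements D (FO P c)).
          h \<cdot>\<^bsub>E\<^esub> kappa D P E (NS t) c (d, z) = kappa D P E (NT t) c (d, z) \<cdot>\<^bsub>E\<^esub> NC t d)\<rparr>"

definition tilde ::
  "('u::universe, 'u) cat \<Rightarrow> ('u, 'u) cat \<Rightarrow> 'u prof \<Rightarrow> ('o, 'a) cat
    \<Rightarrow> (('u, 'u, 'o, 'a) ftr, ('u, 'u, 'o, 'a) ntr, ('u, 'u, 'o, 'a) ftr, ('u, 'u, 'o, 'a) ntr) ftr"
  where
  "tilde C D P E = \<lparr>FO = \<lambda>F\<in>Obj (fcat D E). tilde_obj C D P E F,
     FA = \<lambda>t\<in>Arr (fcat D E). tilde_arr C D P E t\<rparr>"

text \<open>For a functor \<open>L : E \<rightarrow> E'\<close>, the canonical comparison from \<open>tilde\<close> of \<open>L \<circ> F\<close> to the composite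
  of \<open>L\<close> with \<open>tilde\<close> of \<open>F\<close>; it is invertible if \<open>L\<close> preserves colimits.\<close>

definition tilde_comparison ::
  "('u::universe, 'u) cat \<Rightarrow> ('u, 'u) cat \<Rightarrow> 'u prof \<Rightarrow> ('o, 'a) cat \<Rightarrow> ('p, 'b) cat
    \<Rightarrow> ('o, 'a, 'p, 'b) ftr \<Rightarrow> ('u, 'u, 'o, 'a) ftr \<Rightarrow> ('u, 'u, 'p, 'b) ntr" where
  "tilde_comparison C D P E E' L F =
     \<lparr>NS = FO (tilde C D P E') (L \<circ>\<^bsub>D\<^esub> F), NT = L \<circ>\<^bsub>C\<^esub> FO (tilde C D P E) F,
      NC = \<lambda>c\<in>Obj C. THE h.
        h \<in> hom E' (tilde_obj_obj D P E' (L \<circ>\<^bsub>D\<^esub> F) c) (FO L (tilde_obj_obj D P E F c)) \<and>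
        (\<forall>(d, z)\<in>Obj (elements D (FO P c)).
           h \<cdot>\<^bsub>E'\<^esub> kappa D P E' (L \<circ>\<^bsub>D\<^esub> F) c (d, z) = FA L (kappa D P E F c (d, z)))\<rparr>"

section \<open>The functor \<open>right\<close>\<close>

definition yoneda_obj :: "('u::universe, 'u) cat \<Rightarrow> 'u \<Rightarrow> 'u psh" where
  "yoneda_obj D d = \<lparr>FO = \<lambda>e\<in>Obj D. hom D d e,
     FA = \<lambda>g\<in>Arr D. \<lparr>SD = hom D d (Dom D g), SC = hom D d (Cod D g),
       SF = \<lambda>h\<in>hom D d (Dom D g). g \<cdot>\<^bsub>D\<^esub> h\<rparr>\<rparr>"

definition yoneda :: "('u::universe, 'u) cat \<Rightarrow> ('u, 'u, 'u psh, 'u psh_ntr) ftr" where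
  "yoneda D = \<lparr>FO = \<lambda>d\<in>Obj D. yoneda_obj D d,
     FA = \<lambda>g\<in>Arr D. \<lparr>NS = yoneda_obj D (Cod D g), NT = yoneda_obj D (Dom D g),
       NC = \<lambda>e\<in>Obj D. \<lparr>SD = hom D (Cod D g) e, SC = hom D (Dom D g) e,
         SF = \<lambda>h\<in>hom D (Cod D g) e. h \<cdot>\<^bsub>D\<^esub> g\<rparr>\<rparr>\<rparr>"

definition tilde_yoneda ::
  "('u::universe, 'u) cat \<Rightarrow> ('u, 'u) cat \<Rightarrow> 'u prof \<Rightarrow> 'u \<Rightarrow> 'u psh" where
  "tilde_yoneda C D P d = FO (tilde C D P setcat) (FO (yoneda D) d)"

definition right_obj ::
  "('u::universe, 'u) cat \<Rightarrow> ('u, 'u) cat \<Rightarrow> 'u prof \<Rightarrow> ('o, 'a) cat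
    \<Rightarrow> ('u, 'u, 'o, 'a) ftr \<Rightarrow> ('u, 'u, 'o, 'a) ftr" where
  "right_obj C D P E G =
     \<lparr>FO = \<lambda>d\<in>Obj D. hom_object C E (gamma E \<circ>\<^bsub>C\<^esub> tilde_yoneda C D P d) G,
      FA = \<lambda>g\<in>Arr D. hom_map C E
        (whisker_left C (gamma E) (FA (tilde C D P setcat) (FA (yoneda D) g))) (Ide (fcat C E) G)\<rparr>"

definition right_arr ::
  "('u::universe, 'u) cat \<Rightarrow> ('u, 'u) cat \<Rightarrow> 'u prof \<Rightarrow> ('o, 'a) cat
    \<Rightarrow> ('u, 'u, 'o, 'a) ntr \<Rightarrow> ('u, 'u, 'o, 'a) ntr" where
  "right_arr C D P E t =
     \<lparr>NS = right_obj C D P E (NS t), NT = right_obj C D P E (NT t),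
      NC = \<lambda>d\<in>Obj D. hom_map C E (Ide (fcat C E) (gamma E \<circ>\<^bsub>C\<^esub> tilde_yoneda C D P d)) t\<rparr>"

definition right ::
  "('u::universe, 'u) cat \<Rightarrow> ('u, 'u) cat \<Rightarrow> 'u prof \<Rightarrow> ('o, 'a) cat
    \<Rightarrow> (('u, 'u, 'o, 'a) ftr, ('u, 'u, 'o, 'a) ntr, ('u, 'u, 'o, 'a) ftr, ('u, 'u, 'o, 'a) ntr) ftr"
  where
  "right C D P E = \<lparr>FO = \<lambda>G\<in>Obj (fcat C E). right_obj C D P E G,
     FA = \<lambda>t\<in>Arr (fcat C E). right_arr C D P E t\<rparr>"

section \<open>Generalized elements as natural transformations\<close>

text \<open>The transformation \<open>\<gamma>\<^sup>* \<circ> y d \<rightarrow> !\<^sub>A\<^sup>* \<circ> F\<close> over \<open>A\<close> corresponding by the Yoneda lemma to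
  \<open>x : A \<rightarrow> F(d)\<close>: at \<open>e\<close>, its component at \<open>g : d \<rightarrow> e\<close> is the image of \<open>x\<close> under \<open>F(g)\<close>.\<close>

definition yoneda_elem ::
  "('u::universe, 'u) cat \<Rightarrow> ('o, 'a) cat \<Rightarrow> ('u, 'u, 'o, 'a) ftr \<Rightarrow> 'u \<Rightarrow> 'o \<Rightarrow> 'a
    \<Rightarrow> ('u, 'u, 'a, 'a \<times> 'a \<times> 'a) ntr" where
  "yoneda_elem D E F d A x =
     \<lparr>NS = gamma (slice E A) \<circ>\<^bsub>D\<^esub> FO (yoneda D) d, NT = base_change E A \<circ>\<^bsub>D\<^esub> F,
      NC = \<lambda>e\<in>Obj D. THE h.
        h \<in> hom (slice E A) (copower (slice E A) (hom D d e)) (FO (base_change E A) (FO F e)) \<and>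
        (\<forall>g\<in>hom D d e. h \<cdot>\<^bsub>slice E A\<^esub> coproj (slice E A) (hom D d e) g =
           FA (base_change E A) (FA F g) \<cdot>\<^bsub>slice E A\<^esub> global_element E A (FO F d) x)\<rparr>"

text \<open>The image of a transformation \<open>t : \<gamma>\<^sup>* \<circ> y d \<rightarrow> !\<^sub>A\<^sup>* \<circ> F\<close> under \<open>tilde\<close>, as a transformation
  from \<open>\<gamma>\<^sup>* \<circ> tilde (y d)\<close> to \<open>!\<^sub>A\<^sup>* \<circ> tilde F\<close>.\<close>

definition tilde_image ::
  "('u::universe, 'u) cat \<Rightarrow> ('u, 'u) cat \<Rightarrow> 'u prof \<Rightarrow> ('o, 'a) cat
    \<Rightarrow> ('u, 'u, 'o, 'a) ftr \<Rightarrow> 'u \<Rightarrow> 'o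
    \<Rightarrow> ('u, 'u, 'a, 'a \<times> 'a \<times> 'a) ntr \<Rightarrow> ('u, 'u, 'a, 'a \<times> 'a \<times> 'a) ntr" where
  "tilde_image C D P E F d A t =
     tilde_comparison C D P E (slice E A) (base_change E A) F \<cdot>\<^bsub>fcat C (slice E A)\<^esub>
     FA (tilde C D P (slice E A)) t \<cdot>\<^bsub>fcat C (slice E A)\<^esub>
     inverse_arr (fcat C (slice E A))
       (tilde_comparison C D P setcat (slice E A) (gamma (slice E A)) (FO (yoneda D) d))"

text \<open>The transformation \<open>\<gamma>\<^sup>* \<circ> tilde (y d) \<rightarrow> !\<^sub>A\<^sup>* \<circ> G\<close> over \<open>A\<close> corresponding to a generalized
  element \<open>x : A \<rightarrow> (right G)(d)\<close>.\<close>

definition right_elem ::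
  "('u::universe, 'u) cat \<Rightarrow> ('u, 'u) cat \<Rightarrow> 'u prof \<Rightarrow> ('o, 'a) cat
    \<Rightarrow> ('u, 'u, 'o, 'a) ftr \<Rightarrow> 'u \<Rightarrow> 'o \<Rightarrow> 'a \<Rightarrow> ('u, 'u, 'a, 'a \<times> 'a \<times> 'a) ntr" where
  "right_elem C D P E G d A x =
     hom_elem C E (gamma E \<circ>\<^bsub>C\<^esub> tilde_yoneda C D P d) G A x \<cdot>\<^bsub>fcat C (slice E A)\<^esub>
     whisker_right C (gamma_slice E A) (tilde_yoneda C D P d)"

end

theory Submission
  imports Defs
begin

text \<open>The functors \<open>tilde\<close> and \<open>right\<close> are adjoint because both are computed from the elements of
\<open>P\<close>: one as a colimit, the other as a limit of the same shape.

By definition \<open>tilde F (c)\<close> is the colimit of the objects \<open>F(d)\<close> over the pairs \<open>(d, z)\<close> with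
\<open>z \<in> P(c)(d)\<close>, with injections \<open>kappa\<close>. For \<open>right G\<close>, consider any functor \<open>T : C \<rightarrow> Set\<close>. Since
\<open>A \<times> \<Coprod>\<^sub>S 1\<close> is the coproduct of \<open>S\<close> copies of \<open>A\<close>, a transformation
\<open>!\<^sub>A\<^sup>* \<circ> \<gamma>\<^sup>* \<circ> T \<rightarrow> !\<^sub>A\<^sup>* \<circ> G\<close> is a natural family of maps \<open>T(c) \<rightarrow> Hom(A, G(c))\<close>
(\<open>family_surj\<close>, \<open>family_eqI\<close>), and under this correspondence reindexing is composition (\<open>reindex\<close>).
So the object of transformations from \<open>\<gamma>\<^sup>* \<circ> T\<close> to \<open>G\<close> is the limit of \<open>G\<close> weighted by \<open>T\<close>
(\<open>hom_object_exists\<close>, \<open>hom_proj_universal\<close>). For \<open>T = tilde (y d)\<close> the co-Yoneda isomorphism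
\<open>T(c) \<cong> P(c)(d)\<close> (\<open>point_bij\<close>) turns this into a limit over the elements of \<open>P(-)(d)\<close>: there are
projections \<open>rproj : right G (d) \<rightarrow> G(c)\<close> for all \<open>z \<in> P(c)(d)\<close>, and they are universal
(\<open>rproj_universal\<close>).

Hence an arrow \<open>tilde F \<rightarrow> G\<close> and an arrow \<open>F \<rightarrow> right G\<close> are the same thing, namely a family of arrows
\<open>F(d) \<rightarrow> G(c)\<close> indexed by \<open>z \<in> P(c)(d)\<close> and natural in \<open>c\<close> and \<open>d\<close>. The unit and the counit are
characterized by \<open>rproj \<circ> unit = kappa\<close> and \<open>counit \<circ> kappa = rproj\<close>; the triangle identities follow
at once (\<open>tilde_right_adjunction\<close>), and evaluation at generalized elements gives the two descriptions
(\<open>unit_description\<close>, \<open>counit_description\<close>).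

It remains to see that a Grothendieck topos has limits, colimits and the distributive law used above.
An equivalence with sheaves on a site is first weakened to a notion of section for the objects of \<open>E\<close>
(\<open>topos_sheaf_model\<close>). Limits are then sets of compatible families of sections. A section of a colimit
is something that is locally a section of the diagram, modulo the least local congruence. Its universal
property is proved with an additional parameter in an object \<open>A\<close> (\<open>stable_colimit_exists\<close>); the case
\<open>A = 1\<close> gives colimits, and the general case says that \<open>A \<times> -\<close> preserves them, which contains the
distributive law (\<open>product_copower\<close>). Sets are an instance of the same construction, and slices inherit
their colimits from \<open>E\<close>. That all these sets of sections are small follows from
the closure of small sets under power sets and dependent sums and products.\<close>

section \<open>Categories, functors and transformations\<close>

lemma homD:
  assumes "f \<in> hom C a b"
  shows "f \<in> Arr C" "Dom C f = a" "Cod C f = b"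
  using assms by (auto simp: hom_def)

lemma arr_hom: "f \<in> Arr C \<Longrightarrow> f \<in> hom C (Dom C f) (Cod C f)"
  by (auto simp: hom_def)

lemma Dom_obj: "category C \<Longrightarrow> f \<in> Arr C \<Longrightarrow> Dom C f \<in> Obj C"
  and Cod_obj: "category C \<Longrightarrow> f \<in> Arr C \<Longrightarrow> Cod C f \<in> Obj C"
  by (auto simp: category_def)

lemma hom_obj:
  assumes "category C" "f \<in> hom C a b"
  shows "a \<in> Obj C" "b \<in> Obj C"
  using assms by (auto simp: category_def hom_def)

lemma ide_hom: "category C \<Longrightarrow> a \<in> Obj C \<Longrightarrow> Ide C a \<in> hom C a a"
  by (auto simp: category_def)

lemma comp_hom: "category C \<Longrightarrow> f \<in> hom C a b \<Longrightarrow> g \<in> hom C b c \<Longrightarrow> g \<cdot>\<^bsub>C\<^esub> f \<in> hom C a c"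
  by (auto simp: category_def hom_def)

lemma comp_assoc:
  "category C \<Longrightarrow> f \<in> hom C a b \<Longrightarrow> g \<in> hom C b c \<Longrightarrow> h \<in> hom C c d \<Longrightarrow>
    (h \<cdot>\<^bsub>C\<^esub> g) \<cdot>\<^bsub>C\<^esub> f = h \<cdot>\<^bsub>C\<^esub> (g \<cdot>\<^bsub>C\<^esub> f)"
  by (auto simp: category_def hom_def)

lemma comp_ide:
  assumes "category C" "f \<in> hom C a b"
  shows "f \<cdot>\<^bsub>C\<^esub> Ide C a = f" "Ide C b \<cdot>\<^bsub>C\<^esub> f = f"
  using assms by (auto simp: category_def hom_def)

lemma categoryI:
  assumes "\<And>f. f \<in> Arr C \<Longrightarrow> Dom C f \<in> Obj C" "\<And>f. f \<in> Arr C \<Longrightarrow> Cod C f \<in> Obj C"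
    and "\<And>a. a \<in> Obj C \<Longrightarrow> Ide C a \<in> hom C a a"
    and "\<And>f g. f \<in> Arr C \<Longrightarrow> g \<in> Arr C \<Longrightarrow> Cod C f = Dom C g \<Longrightarrow>
      g \<cdot>\<^bsub>C\<^esub> f \<in> hom C (Dom C f) (Cod C g)"
    and "\<And>f. f \<in> Arr C \<Longrightarrow> f \<cdot>\<^bsub>C\<^esub> Ide C (Dom C f) = f"
    and "\<And>f. f \<in> Arr C \<Longrightarrow> Ide C (Cod C f) \<cdot>\<^bsub>C\<^esub> f = f"
    and "\<And>f g h. f \<in> Arr C \<Longrightarrow> g \<in> Arr C \<Longrightarrow> h \<in> Arr C \<Longrightarrow> Cod C f = Dom C g \<Longrightarrow>
      Cod C g = Dom C h \<Longrightarrow> h \<cdot>\<^bsub>C\<^esub> (g \<cdot>\<^bsub>C\<^esub> f) = (h \<cdot>\<^bsub>C\<^esub> g) \<cdot>\<^bsub>C\<^esub> f"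
  shows "category C"
  using assms by (simp add: category_def)

lemma opp_simps [simp]:
  "Obj (opp C) = Obj C" "Arr (opp C) = Arr C" "Dom (opp C) = Cod C" "Cod (opp C) = Dom C"
  "Ide (opp C) = Ide C" "g \<cdot>\<^bsub>opp C\<^esub> f = f \<cdot>\<^bsub>C\<^esub> g"
  by (auto simp: opp_def)

lemma hom_opp [simp]: "hom (opp C) a b = hom C b a"
  by (auto simp: hom_def)

lemma category_opp: "category C \<Longrightarrow> category (opp C)"
  by (rule categoryI) (auto simp: category_def hom_def)

lemma functor_category:
  assumes "is_functor C D F"
  shows "category C" "category D"
  using assms by (auto simp: is_functor_def)

lemma functor_obj: "is_functor C D F \<Longrightarrow> a \<in> Obj C \<Longrightarrow> FO F a \<in> Obj D"
  by (auto simp: is_functor_def)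

lemma functor_hom: "is_functor C D F \<Longrightarrow> f \<in> hom C a b \<Longrightarrow> FA F f \<in> hom D (FO F a) (FO F b)"
  by (auto simp: is_functor_def hom_def)

lemma functor_ide: "is_functor C D F \<Longrightarrow> a \<in> Obj C \<Longrightarrow> FA F (Ide C a) = Ide D (FO F a)"
  by (auto simp: is_functor_def)

lemma functor_comp:
  "is_functor C D F \<Longrightarrow> f \<in> hom C a b \<Longrightarrow> g \<in> hom C b c \<Longrightarrow>
    FA F (g \<cdot>\<^bsub>C\<^esub> f) = FA F g \<cdot>\<^bsub>D\<^esub> FA F f"
  by (auto simp: is_functor_def hom_def)

lemma functorI:
  assumes "category C" "category D"
    and "FO F \<in> extensional (Obj C)" "FA F \<in> extensional (Arr C)"
    and "\<And>a. a \<in> Obj C \<Longrightarrow> FO F a \<in> Obj D"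
    and "\<And>f a b. f \<in> hom C a b \<Longrightarrow> a \<in> Obj C \<Longrightarrow> b \<in> Obj C \<Longrightarrow> FA F f \<in> hom D (FO F a) (FO F b)"
    and "\<And>a. a \<in> Obj C \<Longrightarrow> FA F (Ide C a) = Ide D (FO F a)"
    and "\<And>f g a b c. f \<in> hom C a b \<Longrightarrow> g \<in> hom C b c \<Longrightarrow> FA F (g \<cdot>\<^bsub>C\<^esub> f) = FA F g \<cdot>\<^bsub>D\<^esub> FA F f"
  shows "is_functor C D F"
proof -
  have 1: "FA F f \<in> hom D (FO F (Dom C f)) (FO F (Cod C f))" if "f \<in> Arr C" for f
    using assms(6)[OF arr_hom[OF that]] assms(1) that by (auto simp: category_def)
  have 2: "FO F \<in> Obj C \<rightarrow>\<^sub>E Obj D" using assms(3,5) by (auto simp: PiE_def)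
  have 3: "FA F \<in> Arr C \<rightarrow>\<^sub>E Arr D" using assms(4) 1 by (auto simp: PiE_def hom_def)
  have 4: "FA F (g \<cdot>\<^bsub>C\<^esub> f) = FA F g \<cdot>\<^bsub>D\<^esub> FA F f"
    if "f \<in> Arr C" "g \<in> Arr C" "Cod C f = Dom C g" for f g
    using assms(8)[of f "Dom C f" "Cod C f" g "Cod C g"] that by (auto simp: hom_def)
  show ?thesis using assms(1,2,7) 1 2 3 4 by (simp add: is_functor_def)
qed

lemma functor_eqI:
  assumes "is_functor C D F" "is_functor C D G"
    and "\<And>a. a \<in> Obj C \<Longrightarrow> FO F a = FO G a" "\<And>f. f \<in> Arr C \<Longrightarrow> FA F f = FA G f"
  shows "F = (G :: ('a, 'b, 'c, 'd) ftr)"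
proof -
  have "FO F = FO G" using assms(1,2,3) by (intro PiE_ext[of _ "Obj C"]) (auto simp: is_functor_def)
  moreover have "FA F = FA G"
    using assms(1,2,4) by (intro PiE_ext[of _ "Arr C"]) (auto simp: is_functor_def)
  ultimately show ?thesis by simp
qed

lemma fcomp_FO [simp]: "a \<in> Obj C \<Longrightarrow> FO (G \<circ>\<^bsub>C\<^esub> F) a = FO G (FO F a)"
  and fcomp_FA [simp]: "f \<in> Arr C \<Longrightarrow> FA (G \<circ>\<^bsub>C\<^esub> F) f = FA G (FA F f)"
  by (auto simp: fcomp_def)

lemma functor_fcomp:
  assumes F: "is_functor C D F" and G: "is_functor D E G"
  shows "is_functor C E (G \<circ>\<^bsub>C\<^esub> F)"
proof (rule functorI)
  note C = functor_category(1)[OF F]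
  fix f a b assume f: "f \<in> hom C a b"
  then show "FA (G \<circ>\<^bsub>C\<^esub> F) f \<in> hom E (FO (G \<circ>\<^bsub>C\<^esub> F) a) (FO (G \<circ>\<^bsub>C\<^esub> F) b)"
    using functor_hom[OF G functor_hom[OF F f]] hom_obj[OF C f] by (simp add: homD)
next
  note C = functor_category(1)[OF F]
  fix f g a b c assume f: "f \<in> hom C a b" and g: "g \<in> hom C b c"
  show "FA (G \<circ>\<^bsub>C\<^esub> F) (g \<cdot>\<^bsub>C\<^esub> f) = FA (G \<circ>\<^bsub>C\<^esub> F) g \<cdot>\<^bsub>E\<^esub> FA (G \<circ>\<^bsub>C\<^esub> F) f"
    using functor_comp[OF F f g] functor_comp[OF G functor_hom[OF F f] functor_hom[OF F g]]
      homD[OF f] homD[OF g] homD[OF comp_hom[OF C f g]] by simp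
next
  note C = functor_category(1)[OF F]
  fix a assume a: "a \<in> Obj C"
  show "FA (G \<circ>\<^bsub>C\<^esub> F) (Ide C a) = Ide E (FO (G \<circ>\<^bsub>C\<^esub> F) a)"
    using functor_ide[OF F a] functor_ide[OF G functor_obj[OF F a]] a homD[OF ide_hom[OF C a]]
    by simp
qed (use functor_category[OF F] functor_category[OF G] functor_obj[OF G functor_obj[OF F]] in
    \<open>auto simp: fcomp_def\<close>)

lemma id_functor_FO [simp]: "a \<in> Obj C \<Longrightarrow> FO (id_functor C) a = a"
  and id_functor_FA [simp]: "f \<in> Arr C \<Longrightarrow> FA (id_functor C) f = f"
  by (auto simp: id_functor_def)

lemma functor_id: "category C \<Longrightarrow> is_functor C C (id_functor C)"
  by (rule functorI) (auto simp: id_functor_def hom_def category_def)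

lemma nat_hom: "natural_transformation C D t \<Longrightarrow> a \<in> Obj C \<Longrightarrow> NC t a \<in> hom D (FO (NS t) a) (FO (NT t) a)"
  by (auto simp: natural_transformation_def)

lemma nat_natural:
  "natural_transformation C D t \<Longrightarrow> f \<in> hom C a b \<Longrightarrow>
    NC t b \<cdot>\<^bsub>D\<^esub> FA (NS t) f = FA (NT t) f \<cdot>\<^bsub>D\<^esub> NC t a"
  by (auto simp: natural_transformation_def hom_def)

text \<open>Stated for arrows with given source and target, as this is the form in which composites, components and
naturality are used throughout.\<close>

lemma natI:
  assumes "is_functor C D F" "is_functor C D G" "NS t = F" "NT t = G" "NC t \<in> extensional (Obj C)"
    and "\<And>a. a \<in> Obj C \<Longrightarrow> NC t a \<in> hom D (FO F a) (FO G a)"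
    and "\<And>f a b. f \<in> hom C a b \<Longrightarrow> a \<in> Obj C \<Longrightarrow> b \<in> Obj C \<Longrightarrow>
      NC t b \<cdot>\<^bsub>D\<^esub> FA F f = FA G f \<cdot>\<^bsub>D\<^esub> NC t a"
  shows "t \<in> hom (fcat C D) F G"
proof -
  have "NC t (Cod C f) \<cdot>\<^bsub>D\<^esub> FA F f = FA G f \<cdot>\<^bsub>D\<^esub> NC t (Dom C f)" if "f \<in> Arr C" for f
    using assms(7)[OF arr_hom[OF that]] functor_category(1)[OF assms(1)] that
    by (auto simp: category_def)
  then show ?thesis
    using assms(1-6) by (auto simp: hom_def fcat_def natural_transformation_def)
qed

lemma fcat_simps [simp]:
  "Obj (fcat C D) = {F. is_functor C D F}" "Arr (fcat C D) = {t. natural_transformation C D t}"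
  "Dom (fcat C D) = NS" "Cod (fcat C D) = NT"
  "Ide (fcat C D) F = \<lparr>NS = F, NT = F, NC = \<lambda>a\<in>Obj C. Ide D (FO F a)\<rparr>"
  "s \<cdot>\<^bsub>fcat C D\<^esub> t = \<lparr>NS = NS t, NT = NT s, NC = \<lambda>a\<in>Obj C. NC s a \<cdot>\<^bsub>D\<^esub> NC t a\<rparr>"
  by (auto simp: fcat_def)

lemma hom_fcat:
  assumes "t \<in> hom (fcat C D) F G"
  shows "natural_transformation C D t" "NS t = F" "NT t = G" "is_functor C D F" "is_functor C D G"
    "NC t \<in> extensional (Obj C)"
  using assms by (auto simp: hom_def natural_transformation_def)

lemma hom_fcat_comp:
  "t \<in> hom (fcat C D) F G \<Longrightarrow> a \<in> Obj C \<Longrightarrow> NC t a \<in> hom D (FO F a) (FO G a)"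
  using nat_hom hom_fcat by metis

lemma hom_fcat_natural:
  "t \<in> hom (fcat C D) F G \<Longrightarrow> f \<in> hom C a b \<Longrightarrow>
    NC t b \<cdot>\<^bsub>D\<^esub> FA F f = FA G f \<cdot>\<^bsub>D\<^esub> NC t a"
  using nat_natural hom_fcat by metis

lemma ntr_eqI:
  assumes "s \<in> hom (fcat C D) F G" "t \<in> hom (fcat C D) F G" "\<And>a. a \<in> Obj C \<Longrightarrow> NC s a = NC t a"
  shows "s = t"
proof -
  have "NC s = NC t"
    using hom_fcat(6)[OF assms(1)] hom_fcat(6)[OF assms(2)] assms(3) by (auto intro: extensionalityI)
  then show ?thesis
    using hom_fcat(2,3)[OF assms(1)] hom_fcat(2,3)[OF assms(2)] by simp
qed

lemma fcat_ide_hom: "is_functor C D F \<Longrightarrow> Ide (fcat C D) F \<in> hom (fcat C D) F F"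
proof (rule natI)
  assume F: "is_functor C D F"
  fix f a b assume f: "f \<in> hom C a b" and ab: "a \<in> Obj C" "b \<in> Obj C"
  show "NC (Ide (fcat C D) F) b \<cdot>\<^bsub>D\<^esub> FA F f = FA F f \<cdot>\<^bsub>D\<^esub> NC (Ide (fcat C D) F) a"
    using comp_ide[OF functor_category(2)[OF F] functor_hom[OF F f]] ab by simp
qed (auto intro: ide_hom functor_obj functor_category)

lemma fcat_comp_hom:
  assumes t: "t \<in> hom (fcat C D) F G" and s: "s \<in> hom (fcat C D) G H"
  shows "s \<cdot>\<^bsub>fcat C D\<^esub> t \<in> hom (fcat C D) F H"
proof (rule natI)
  have D: "category D" using hom_fcat(4)[OF t] functor_category by blast
  fix f a b assume f: "f \<in> hom C a b" and ab: "a \<in> Obj C" "b \<in> Obj C"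
  note ta = hom_fcat_comp[OF t ab(1)] and tb = hom_fcat_comp[OF t ab(2)]
    and sa = hom_fcat_comp[OF s ab(1)] and sb = hom_fcat_comp[OF s ab(2)]
  have "(NC s b \<cdot>\<^bsub>D\<^esub> NC t b) \<cdot>\<^bsub>D\<^esub> FA F f = NC s b \<cdot>\<^bsub>D\<^esub> (FA G f \<cdot>\<^bsub>D\<^esub> NC t a)"
    using comp_assoc[OF D functor_hom[OF hom_fcat(4)[OF t] f] tb sb] hom_fcat_natural[OF t f] by simp
  also have "\<dots> = FA H f \<cdot>\<^bsub>D\<^esub> (NC s a \<cdot>\<^bsub>D\<^esub> NC t a)"
    using comp_assoc[OF D ta functor_hom[OF hom_fcat(4)[OF s] f] sb] hom_fcat_natural[OF s f]
      comp_assoc[OF D ta sa functor_hom[OF hom_fcat(5)[OF s] f]] by simp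
  finally show "NC (s \<cdot>\<^bsub>fcat C D\<^esub> t) b \<cdot>\<^bsub>D\<^esub> FA F f = FA H f \<cdot>\<^bsub>D\<^esub> NC (s \<cdot>\<^bsub>fcat C D\<^esub> t) a"
    using ab by simp
next
  have D: "category D" using hom_fcat(4)[OF t] functor_category by blast
  fix a assume a: "a \<in> Obj C"
  show "NC (s \<cdot>\<^bsub>fcat C D\<^esub> t) a \<in> hom D (FO F a) (FO H a)"
    using comp_hom[OF D hom_fcat_comp[OF t a] hom_fcat_comp[OF s a]] a by simp
qed (use hom_fcat[OF t] hom_fcat[OF s] in auto)

lemma category_fcat:
  assumes "category C" "category D"
  shows "category (fcat C D)"
proof (rule categoryI)
  fix F assume "F \<in> Obj (fcat C D)"
  then show "Ide (fcat C D) F \<in> hom (fcat C D) F F" using fcat_ide_hom by auto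
next
  fix f g assume "f \<in> Arr (fcat C D)" "g \<in> Arr (fcat C D)" "Cod (fcat C D) f = Dom (fcat C D) g"
  then show "g \<cdot>\<^bsub>fcat C D\<^esub> f \<in> hom (fcat C D) (Dom (fcat C D) f) (Cod (fcat C D) g)"
    using fcat_comp_hom[of f C D "NS f" "NT f" g "NT g"] by (simp add: hom_def)
next
  fix f assume "f \<in> Arr (fcat C D)"
  then have f: "f \<in> hom (fcat C D) (NS f) (NT f)" by (auto simp: hom_def)
  show "f \<cdot>\<^bsub>fcat C D\<^esub> Ide (fcat C D) (Dom (fcat C D) f) = f"
    unfolding fcat_simps(3) by (rule ntr_eqI[OF fcat_comp_hom[OF fcat_ide_hom] f])
       (use f hom_fcat[OF f] comp_ide[OF assms(2) hom_fcat_comp[OF f]] in auto)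
  show "Ide (fcat C D) (Cod (fcat C D) f) \<cdot>\<^bsub>fcat C D\<^esub> f = f"
    unfolding fcat_simps(4) by (rule ntr_eqI[OF fcat_comp_hom[OF _ fcat_ide_hom] f])
       (use f hom_fcat[OF f] comp_ide[OF assms(2) hom_fcat_comp[OF f]] in auto)
next
  fix f g h assume "f \<in> Arr (fcat C D)" "g \<in> Arr (fcat C D)" "h \<in> Arr (fcat C D)"
    "Cod (fcat C D) f = Dom (fcat C D) g" "Cod (fcat C D) g = Dom (fcat C D) h"
  then have f: "f \<in> hom (fcat C D) (NS f) (NT f)" and g: "g \<in> hom (fcat C D) (NT f) (NT g)"
    and h: "h \<in> hom (fcat C D) (NT g) (NT h)" by (auto simp: hom_def)
  show "h \<cdot>\<^bsub>fcat C D\<^esub> (g \<cdot>\<^bsub>fcat C D\<^esub> f) = (h \<cdot>\<^bsub>fcat C D\<^esub> g) \<cdot>\<^bsub>fcat C D\<^esub> f"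
    by (rule ntr_eqI[OF fcat_comp_hom[OF fcat_comp_hom[OF f g] h]
          fcat_comp_hom[OF f fcat_comp_hom[OF g h]]])
       (use comp_assoc[OF assms(2) hom_fcat_comp[OF f] hom_fcat_comp[OF g] hom_fcat_comp[OF h]]
         in auto)
qed (auto simp: natural_transformation_def)

lemma whisker_left_simps [simp]:
  "NS (whisker_left C L t) = L \<circ>\<^bsub>C\<^esub> NS t" "NT (whisker_left C L t) = L \<circ>\<^bsub>C\<^esub> NT t"
  "a \<in> Obj C \<Longrightarrow> NC (whisker_left C L t) a = FA L (NC t a)"
  by (auto simp: whisker_left_def)

lemma whisker_left_hom:
  assumes t: "t \<in> hom (fcat C D) F G" and L: "is_functor D E L"
  shows "whisker_left C L t \<in> hom (fcat C E) (L \<circ>\<^bsub>C\<^esub> F) (L \<circ>\<^bsub>C\<^esub> G)"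
proof (rule natI)
  fix f a b assume f: "f \<in> hom C a b" and ab: "a \<in> Obj C" "b \<in> Obj C"
  show "NC (whisker_left C L t) b \<cdot>\<^bsub>E\<^esub> FA (L \<circ>\<^bsub>C\<^esub> F) f = FA (L \<circ>\<^bsub>C\<^esub> G) f \<cdot>\<^bsub>E\<^esub> NC (whisker_left C L t) a"
    using functor_comp[OF L functor_hom[OF hom_fcat(4)[OF t] f] hom_fcat_comp[OF t ab(2)]]
      functor_comp[OF L hom_fcat_comp[OF t ab(1)] functor_hom[OF hom_fcat(5)[OF t] f]]
      hom_fcat_natural[OF t f] ab homD[OF f] by simp
qed (use hom_fcat[OF t] functor_fcomp[OF _ L] functor_hom[OF L hom_fcat_comp[OF t]] in
    \<open>auto simp: whisker_left_def\<close>)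

lemma whisker_right_hom:
  assumes t: "t \<in> hom (fcat D E) G H" and F: "is_functor C D F"
  shows "whisker_right C t F \<in> hom (fcat C E) (G \<circ>\<^bsub>C\<^esub> F) (H \<circ>\<^bsub>C\<^esub> F)"
proof (rule natI)
  fix f a b assume f: "f \<in> hom C a b" and ab: "a \<in> Obj C" "b \<in> Obj C"
  show "NC (whisker_right C t F) b \<cdot>\<^bsub>E\<^esub> FA (G \<circ>\<^bsub>C\<^esub> F) f = FA (H \<circ>\<^bsub>C\<^esub> F) f \<cdot>\<^bsub>E\<^esub> NC (whisker_right C t F) a"
    using hom_fcat_natural[OF t functor_hom[OF F f]] ab homD[OF f] by (simp add: whisker_right_def)
qed (use hom_fcat[OF t] functor_fcomp[OF F] hom_fcat_comp[OF t functor_obj[OF F]] in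
    \<open>auto simp: whisker_right_def\<close>)

text \<open>The inverses of the components of a transformation are automatically natural, and an inverse is
  unique, so that \<^const>\<open>inverse_arr\<close> is computed componentwise.\<close>

lemma inverse_ntr:
  assumes C: "category C" and D: "category D" and t: "t \<in> hom (fcat C D) F G"
    and r: "\<And>a. a \<in> Obj C \<Longrightarrow> r a \<in> hom D (FO G a) (FO F a)"
    and r1: "\<And>a. a \<in> Obj C \<Longrightarrow> r a \<cdot>\<^bsub>D\<^esub> NC t a = Ide D (FO F a)"
    and r2: "\<And>a. a \<in> Obj C \<Longrightarrow> NC t a \<cdot>\<^bsub>D\<^esub> r a = Ide D (FO G a)"
  shows "inverse_arr (fcat C D) t \<in> hom (fcat C D) G F"
    "\<And>a. a \<in> Obj C \<Longrightarrow> NC (inverse_arr (fcat C D) t) a = r a"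
proof -
  define s where "s = \<lparr>NS = G, NT = F, NC = \<lambda>a\<in>Obj C. r a\<rparr>"
  note F = hom_fcat(4)[OF t] and G = hom_fcat(5)[OF t]
  have s: "s \<in> hom (fcat C D) G F"
  proof (rule natI[OF G F])
    fix f a b assume f: "f \<in> hom C a b" and ab: "a \<in> Obj C" "b \<in> Obj C"
    note tb = hom_fcat_comp[OF t ab(2)] and ta = hom_fcat_comp[OF t ab(1)]
    note Gf = functor_hom[OF G f] and Ff = functor_hom[OF F f]
    have "r b \<cdot>\<^bsub>D\<^esub> FA G f = r b \<cdot>\<^bsub>D\<^esub> (FA G f \<cdot>\<^bsub>D\<^esub> (NC t a \<cdot>\<^bsub>D\<^esub> r a))"
      using comp_ide(1)[OF D Gf] r2[OF ab(1)] by simp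
    also have "\<dots> = r b \<cdot>\<^bsub>D\<^esub> (NC t b \<cdot>\<^bsub>D\<^esub> (FA F f \<cdot>\<^bsub>D\<^esub> r a))"
      using comp_assoc[OF D r[OF ab(1)] ta Gf] comp_assoc[OF D r[OF ab(1)] Ff tb]
        hom_fcat_natural[OF t f] by simp
    also have "\<dots> = FA F f \<cdot>\<^bsub>D\<^esub> r a"
      using comp_assoc[OF D comp_hom[OF D r[OF ab(1)] Ff] tb r[OF ab(2)]] r1[OF ab(2)]
        comp_ide(2)[OF D comp_hom[OF D r[OF ab(1)] Ff]] by simp
    finally show "NC s b \<cdot>\<^bsub>D\<^esub> FA G f = FA F f \<cdot>\<^bsub>D\<^esub> NC s a" using ab by (simp add: s_def)
  qed (use r in \<open>auto simp: s_def\<close>)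
  have inv: "s \<in> hom (fcat C D) (Cod (fcat C D) t) (Dom (fcat C D) t) \<and>
     s \<cdot>\<^bsub>fcat C D\<^esub> t = Ide (fcat C D) (Dom (fcat C D) t) \<and>
     t \<cdot>\<^bsub>fcat C D\<^esub> s = Ide (fcat C D) (Cod (fcat C D) t)"
    using s hom_fcat[OF t] r1 r2 by (auto simp: s_def restrict_def)
  have "inverse_arr (fcat C D) t = s" unfolding inverse_arr_def
  proof (rule the_equality, rule inv)
    fix s' assume s': "s' \<in> hom (fcat C D) (Cod (fcat C D) t) (Dom (fcat C D) t) \<and>
      s' \<cdot>\<^bsub>fcat C D\<^esub> t = Ide (fcat C D) (Dom (fcat C D) t) \<and>
      t \<cdot>\<^bsub>fcat C D\<^esub> s' = Ide (fcat C D) (Cod (fcat C D) t)"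
    note FC = category_fcat[OF C D]
    have s'h: "s' \<in> hom (fcat C D) G F" using s' hom_fcat[OF t] by simp
    have "s' = s' \<cdot>\<^bsub>fcat C D\<^esub> (t \<cdot>\<^bsub>fcat C D\<^esub> s)"
      using comp_ide(1)[OF FC s'h] inv hom_fcat[OF t] by (metis fcat_simps(4))
    also have "\<dots> = s" using comp_assoc[OF FC s t s'h] comp_ide(2)[OF FC s] s' hom_fcat[OF t]
      by (metis fcat_simps(3))
    finally show "s' = s" .
  qed
  then show "inverse_arr (fcat C D) t \<in> hom (fcat C D) G F"
    "\<And>a. a \<in> Obj C \<Longrightarrow> NC (inverse_arr (fcat C D) t) a = r a"
    using s by (auto simp: s_def)
qed

section \<open>Small sets of arbitrary type\<close>

text \<open>Vertices of diagrams and sections under construction are pairs, functions and sets. Their smallness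
is measured against the universe \<open>'u\<close> without encoding them in it.\<close>

definition small_in :: "'u::universe itself \<Rightarrow> 'a set \<Rightarrow> bool" where
  "small_in U A \<longleftrightarrow> A \<prec> (UNIV :: 'u set)"

lemma small_in_self: "small_in TYPE('u::universe) (A :: 'u set) \<longleftrightarrow> small A"
  by (simp add: small_in_def small_def)

lemma small_in_lepoll: "A \<lesssim> B \<Longrightarrow> small_in U B \<Longrightarrow> small_in U A"
  unfolding small_in_def by (rule lesspoll_trans1)

lemma small_in_subset: "A \<subseteq> B \<Longrightarrow> small_in U B \<Longrightarrow> small_in U A"
  by (rule small_in_lepoll[OF subset_imp_lepoll])

lemma small_in_image: "small_in U A \<Longrightarrow> small_in U (f ` A)"
  by (rule small_in_lepoll[OF image_lepoll])

lemma small_in_finite: "finite A \<Longrightarrow> small_in U A"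
  unfolding small_in_def using finite_lesspoll_infinite infinite_universe by blast

lemma small_in_encode:
  assumes "small_in TYPE('u::universe) A"
  obtains f :: "'a \<Rightarrow> 'u::universe" where "inj_on f A" "small (f ` A)"
proof -
  obtain f :: "'a \<Rightarrow> 'u" where "inj_on f A"
    using assms unfolding small_in_def lesspoll_def lepoll_def by blast
  then show ?thesis
    using that small_in_image[OF assms, of f] small_in_self by blast
qed

lemma small_in_Pow:
  assumes "small_in (U :: 'u::universe itself) A"
  shows "small_in U (Pow A)"
proof -
  have "small_in TYPE('u) A" using assms unfolding small_in_def .
  then obtain f :: "'a \<Rightarrow> 'u" where f: "inj_on f A" "small (f ` A)" by (rule small_in_encode)
  have "Pow A \<lesssim> Pow (f ` A)"
    unfolding lepoll_def using inj_on_image_Pow[OF f(1)] by blast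
  then show ?thesis
    using Pow_universe[of "f ` A"] f(2) lesspoll_trans1 unfolding small_in_def small_def by blast
qed

text \<open>An infinite cardinal is equal to its square.\<close>

lemma pairing_universe: "\<exists>pr :: 'u::universe \<times> 'u \<Rightarrow> 'u. inj pr"
proof -
  have "(card_of (UNIV \<times> UNIV :: ('u \<times> 'u) set), card_of (UNIV :: 'u set)) \<in> ordLeq"
    using Card_order_Times_same_infinite[OF card_of_Card_order, of "UNIV :: 'u set"]
      infinite_universe unfolding Field_card_of by blast
  then show ?thesis
    using card_of_ordLeq[of "UNIV \<times> UNIV :: ('u \<times> 'u) set" "UNIV :: 'u set"] by auto
qed

text \<open>After encoding \<open>A\<close> and the sets \<open>B a\<close> in the universe, the pairs of codes form a small union of small
sets.\<close>

lemma small_in_Sigma: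
  assumes "small_in (U :: 'u::universe itself) A" "\<And>a. a \<in> A \<Longrightarrow> small_in U (B a)"
  shows "small_in U (Sigma A B)"
proof -
  obtain pr :: "'u \<times> 'u \<Rightarrow> 'u" where pr: "inj pr" using pairing_universe by blast
  have A: "small_in TYPE('u) A" and B: "\<And>a. a \<in> A \<Longrightarrow> small_in TYPE('u) (B a)"
    using assms unfolding small_in_def by auto
  obtain f :: "'a \<Rightarrow> 'u" where f: "inj_on f A" "small (f ` A)" using small_in_encode[OF A] by blast
  have "\<exists>g :: 'b \<Rightarrow> 'u. inj_on g (B a)" if "a \<in> A" for a using small_in_encode[OF B[OF that]] by blast
  then obtain g :: "'a \<Rightarrow> 'b \<Rightarrow> 'u" where g: "\<And>a. a \<in> A \<Longrightarrow> inj_on (g a) (B a)" by metis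
  let ?h = "\<lambda>(a, b). pr (f a, g a b)"
  let ?U = "\<Union>x\<in>f ` A. (\<lambda>b. pr (x, g (inv_into A f x) b)) ` B (inv_into A f x)"
  have "?U \<prec> (UNIV :: 'u set)"
  proof (rule Union_universe)
    show "f ` A \<prec> (UNIV :: 'u set)" using f(2) by (simp add: small_def)
    fix x assume "x \<in> f ` A"
    then have "inv_into A f x \<in> A" by (rule inv_into_into)
    from small_in_image[OF B[OF this]]
    show "(\<lambda>b. pr (x, g (inv_into A f x) b)) ` B (inv_into A f x) \<prec> (UNIV :: 'u set)"
      unfolding small_in_def by blast
  qed
  moreover have "inj_on ?h (Sigma A B)"
  proof (rule inj_onI, clarify)
    fix a b a' b' assume *: "a \<in> A" "b \<in> B a" "a' \<in> A" "b' \<in> B a'" "pr (f a, g a b) = pr (f a', g a' b')"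
    then have "f a = f a'" "g a b = g a' b'" using injD[OF pr *(5)] by auto
    then show "a = a' \<and> b = b'" using * f(1) g[of a] by (auto dest: inj_onD)
  qed
  moreover have "?h ` Sigma A B \<subseteq> ?U"
  proof clarify
    fix a b assume ab: "a \<in> A" "b \<in> B a"
    show "pr (f a, g a b) \<in> ?U"
      by (rule UN_I[of "f a"]) (use ab inv_into_f_f[OF f(1) ab(1)] in auto)
  qed
  ultimately have "Sigma A B \<lesssim> ?U" unfolding lepoll_def by blast
  then show ?thesis using \<open>?U \<prec> UNIV\<close> unfolding small_in_def by (rule lesspoll_trans1)
qed

text \<open>Functions are subsets of the dependent sum, by way of their graphs.\<close>

lemma small_in_PiE:
  assumes "small_in (U :: 'u::universe itself) A" "\<And>a. a \<in> A \<Longrightarrow> small_in U (B a)"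
  shows "small_in U (PiE A B)"
proof -
  have "inj_on (\<lambda>f. (\<lambda>a. (a, f a)) ` A) (PiE A B)"
  proof (rule inj_onI)
    fix f g assume f: "f \<in> PiE A B" and g: "g \<in> PiE A B" and *: "(\<lambda>a. (a, f a)) ` A = (\<lambda>a. (a, g a)) ` A"
    show "f = g" by (rule PiE_ext[OF f g]) (use * in blast)
  qed
  moreover have "(\<lambda>f. (\<lambda>a. (a, f a)) ` A) ` PiE A B \<subseteq> Pow (Sigma A B)" by auto
  ultimately have "PiE A B \<lesssim> Pow (Sigma A B)" unfolding lepoll_def by blast
  then show ?thesis by (rule small_in_lepoll[OF _ small_in_Pow[OF small_in_Sigma[OF assms]]])
qed

section \<open>The category of sets\<close>

lemma setcat_simps [simp]:
  "Obj setcat = {A. small A}"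
  "Arr setcat = {f. small (SD f) \<and> small (SC f) \<and> SF f \<in> SD f \<rightarrow>\<^sub>E SC f}"
  "Dom setcat = SD" "Cod setcat = SC" "Ide setcat A = \<lparr>SD = A, SC = A, SF = \<lambda>x\<in>A. x\<rparr>"
  "g \<cdot>\<^bsub>setcat\<^esub> f = \<lparr>SD = SD f, SC = SC g, SF = \<lambda>x\<in>SD f. SF g (SF f x)\<rparr>"
  by (auto simp: setcat_def)

lemma hom_setcat:
  "f \<in> hom setcat A B \<longleftrightarrow> small A \<and> small B \<and> SD f = A \<and> SC f = B \<and> SF f \<in> A \<rightarrow>\<^sub>E B"
  by (auto simp: hom_def)

lemma setcat_eqI:
  assumes "f \<in> hom setcat A B" "g \<in> hom setcat A B" "\<And>x. x \<in> A \<Longrightarrow> SF f x = SF g x"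
  shows "f = g"
proof -
  have "SF f = SF g" using assms by (intro PiE_ext[of _ A "\<lambda>_. B"]) (auto simp: hom_setcat)
  then show ?thesis using assms by (simp add: hom_setcat)
qed

lemma category_setcat: "category setcat"
  by (rule categoryI) (auto simp: hom_def restrict_def PiE_iff fun_eq_iff extensional_def intro!: sfun.equality)

section \<open>Categories of sheaves, seen through sections\<close>

text \<open>The data \<open>Z\<close> and \<open>r\<close> are a sheaf whose sets of sections have an arbitrary type, so that sections
  can be given by whatever describes them best before they are encoded in the universe.\<close>

definition sheaf_on ::
  "('u, 'u) cat \<Rightarrow> ('u \<Rightarrow> 'u set set) \<Rightarrow> ('u \<Rightarrow> 't set) \<Rightarrow> ('u \<Rightarrow> 't \<Rightarrow> 't) \<Rightarrow> bool" where
  "sheaf_on B J Z r \<longleftrightarrow>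
     (\<forall>f\<in>Arr B. \<forall>x\<in>Z (Cod B f). r f x \<in> Z (Dom B f)) \<and>
     (\<forall>b\<in>Obj B. \<forall>x\<in>Z b. r (Ide B b) x = x) \<and>
     (\<forall>f\<in>Arr B. \<forall>g\<in>Arr B. Cod B g = Dom B f \<longrightarrow>
        (\<forall>x\<in>Z (Cod B f). r g (r f x) = r (f \<cdot>\<^bsub>B\<^esub> g) x)) \<and>
     (\<forall>b\<in>Obj B. \<forall>S\<in>J b. \<forall>m. (\<forall>f\<in>S. m f \<in> Z (Dom B f)) \<longrightarrow>
        (\<forall>f\<in>S. \<forall>g\<in>Arr B. Cod B g = Dom B f \<longrightarrow> r g (m f) = m (f \<cdot>\<^bsub>B\<^esub> g)) \<longrightarrow>
        (\<exists>!x. x \<in> Z b \<and> (\<forall>f\<in>S. r f x = m f)))"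

lemma sheaf_on_in: "sheaf_on B J Z r \<Longrightarrow> f \<in> hom B a b \<Longrightarrow> x \<in> Z b \<Longrightarrow> r f x \<in> Z a"
  by (auto simp: sheaf_on_def hom_def)

lemma sheaf_on_ide: "sheaf_on B J Z r \<Longrightarrow> b \<in> Obj B \<Longrightarrow> x \<in> Z b \<Longrightarrow> r (Ide B b) x = x"
  by (simp add: sheaf_on_def)

lemma sheaf_on_comp:
  "sheaf_on B J Z r \<Longrightarrow> f \<in> hom B b c \<Longrightarrow> g \<in> hom B a b \<Longrightarrow> x \<in> Z c \<Longrightarrow>
    r g (r f x) = r (f \<cdot>\<^bsub>B\<^esub> g) x"
  by (auto simp: sheaf_on_def hom_def)

lemma sheaf_on_glue:
  assumes "sheaf_on B J Z r" "b \<in> Obj B" "S \<in> J b" "\<And>f. f \<in> S \<Longrightarrow> m f \<in> Z (Dom B f)"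
    and "\<And>f g. f \<in> S \<Longrightarrow> g \<in> Arr B \<Longrightarrow> Cod B g = Dom B f \<Longrightarrow> r g (m f) = m (f \<cdot>\<^bsub>B\<^esub> g)"
  shows "\<exists>!x. x \<in> Z b \<and> (\<forall>f\<in>S. r f x = m f)"
proof -
  have *: "\<forall>b\<in>Obj B. \<forall>S\<in>J b. \<forall>m. (\<forall>f\<in>S. m f \<in> Z (Dom B f)) \<longrightarrow>
        (\<forall>f\<in>S. \<forall>g\<in>Arr B. Cod B g = Dom B f \<longrightarrow> r g (m f) = m (f \<cdot>\<^bsub>B\<^esub> g)) \<longrightarrow>
        (\<exists>!x. x \<in> Z b \<and> (\<forall>f\<in>S. r f x = m f))"
    using assms(1) unfolding sheaf_on_def by (elim conjE)
  show ?thesis by (rule *[rule_format]) (use assms in auto)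
qed

text \<open>Sections that agree on a cover are equal: they glue the same matching family.\<close>

lemma sheaf_on_separated:
  assumes Z: "sheaf_on B J Z r" and B: "category B" and b: "b \<in> Obj B" and S: "S \<in> J b" "sieve B b S"
    and x: "x \<in> Z b" and y: "y \<in> Z b" and eq: "\<And>f. f \<in> S \<Longrightarrow> r f x = r f y"
  shows "x = y"
proof -
  have S': "f \<in> Arr B" "Cod B f = b" if "f \<in> S" for f using S(2) that by (auto simp: sieve_def)
  have "\<exists>!z. z \<in> Z b \<and> (\<forall>f\<in>S. r f z = r f y)"
  proof (rule sheaf_on_glue[OF Z b S(1)])
    fix f assume "f \<in> S"
    then show "r f y \<in> Z (Dom B f)"
      using sheaf_on_in[OF Z _ y, of f "Dom B f"] S' by (simp add: hom_def)
  next
    fix f g assume "f \<in> S" "g \<in> Arr B" "Cod B g = Dom B f"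
    then show "r g (r f y) = r (f \<cdot>\<^bsub>B\<^esub> g) y"
      using sheaf_on_comp[OF Z _ _ y, of f "Dom B f" g "Dom B g"] S' by (simp add: hom_def)
  qed
  then obtain z where z: "\<forall>w. w \<in> Z b \<and> (\<forall>f\<in>S. r f w = r f y) \<longrightarrow> w = z" by (elim ex1E)
  have "x = z" using z[rule_format, of x] x eq by blast
  moreover have "y = z" using z[rule_format, of y] y by blast
  ultimately show ?thesis by simp
qed

text \<open>A category of sheaves, presented as a category \<open>E\<close> of objects with sections over the objects of a
  site \<open>(B, J)\<close>, whose arrows are the maps of sections commuting with restriction, and in which every
  sheaf occurs. This is invariant under equivalence of categories, and it lets limits and
  colimits in \<open>E\<close> be constructed by elements.\<close>

locale sheaf_model =
  fixes E :: "('o, 'a) cat" (structure) and B :: "('u::universe, 'u) cat" and J :: "'u \<Rightarrow> 'u set set"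
    and sec :: "'o \<Rightarrow> 'u \<Rightarrow> 'u set" and res :: "'o \<Rightarrow> 'u \<Rightarrow> 'u \<Rightarrow> 'u" and app :: "'a \<Rightarrow> 'u \<Rightarrow> 'u \<Rightarrow> 'u"
  assumes E: "category E" and small_B: "small_category B" and J: "grothendieck_topology B J"
    and sec_sheaf: "e \<in> Obj E \<Longrightarrow> sheaf_on B J (sec e) (res e)"
    and sec_small: "e \<in> Obj E \<Longrightarrow> b \<in> Obj B \<Longrightarrow> small (sec e b)"
    and app_in: "f \<in> hom E e e' \<Longrightarrow> b \<in> Obj B \<Longrightarrow> x \<in> sec e b \<Longrightarrow> app f b x \<in> sec e' b"
    and app_res: "f \<in> hom E e e' \<Longrightarrow> h \<in> hom B a b \<Longrightarrow> x \<in> sec e b \<Longrightarrow>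
      app f a (res e h x) = res e' h (app f b x)"
    and app_comp: "f \<in> hom E e e' \<Longrightarrow> g \<in> hom E e' e'' \<Longrightarrow> b \<in> Obj B \<Longrightarrow> x \<in> sec e b \<Longrightarrow>
      app (g \<cdot> f) b x = app g b (app f b x)"
    and app_ide: "e \<in> Obj E \<Longrightarrow> b \<in> Obj B \<Longrightarrow> x \<in> sec e b \<Longrightarrow> app (Ide E e) b x = x"
    and app_ext: "f \<in> hom E e e' \<Longrightarrow> g \<in> hom E e e' \<Longrightarrow>
      (\<And>b x. b \<in> Obj B \<Longrightarrow> x \<in> sec e b \<Longrightarrow> app f b x = app g b x) \<Longrightarrow> f = g"
    and app_full: "e \<in> Obj E \<Longrightarrow> e' \<in> Obj E \<Longrightarrow>
      (\<And>b x. b \<in> Obj B \<Longrightarrow> x \<in> sec e b \<Longrightarrow> \<phi> b x \<in> sec e' b) \<Longrightarrow>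
      (\<And>a b g x. g \<in> hom B a b \<Longrightarrow> x \<in> sec e b \<Longrightarrow> \<phi> a (res e g x) = res e' g (\<phi> b x)) \<Longrightarrow>
      \<exists>f\<in>hom E e e'. \<forall>b\<in>Obj B. \<forall>x\<in>sec e b. app f b x = \<phi> b x"
    and realise_universe: "sheaf_on B J (Z :: 'u \<Rightarrow> 'u set) r \<Longrightarrow> (\<And>b. b \<in> Obj B \<Longrightarrow> small (Z b)) \<Longrightarrow>
      \<exists>e\<in>Obj E. \<exists>\<phi>. (\<forall>b\<in>Obj B. bij_betw (\<phi> b) (Z b) (sec e b)) \<and>
        (\<forall>a b. \<forall>g\<in>hom B a b. \<forall>x\<in>Z b. \<phi> a (r g x) = res e g (\<phi> b x))"

text \<open>The presheaf of a sheaf supplies its own sections and restrictions.\<close>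

lemma sheaf_sheaf_on: "sheaf B J X \<Longrightarrow> sheaf_on B J (FO X) (\<lambda>f. SF (FA X f))"
proof -
  assume X: "sheaf B J X"
  then have F: "is_functor (opp B) setcat X" by (simp add: sheaf_def)
  have h: "FA X f \<in> hom setcat (FO X (Cod B f)) (FO X (Dom B f))" if "f \<in> Arr B" for f
    by (rule functor_hom[OF F]) (simp add: hom_def that)
  have c: "FA X (f \<cdot>\<^bsub>B\<^esub> g) = FA X g \<cdot>\<^bsub>setcat\<^esub> FA X f" if "f \<in> Arr B" "g \<in> Arr B" "Cod B g = Dom B f" for f g
    using functor_comp[OF F, of f "Cod B f" "Dom B f" g "Dom B g"] that by (simp add: hom_def)
  have i: "FA X (Ide B b) = Ide setcat (FO X b)" if "b \<in> Obj B" for b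
    using functor_ide[OF F, of b] that by simp
  have s: "\<forall>b\<in>Obj B. \<forall>S\<in>J b. \<forall>m. (\<forall>f\<in>S. m f \<in> FO X (Dom B f)) \<longrightarrow>
        (\<forall>f\<in>S. \<forall>g\<in>Arr B. Cod B g = Dom B f \<longrightarrow> SF (FA X g) (m f) = m (f \<cdot>\<^bsub>B\<^esub> g)) \<longrightarrow>
        (\<exists>!x. x \<in> FO X b \<and> (\<forall>f\<in>S. SF (FA X f) x = m f))"
    using X unfolding sheaf_def matching_family_def by blast
  show ?thesis unfolding sheaf_on_def
  proof (intro conjI s ballI impI)
    fix f x assume f: "f \<in> Arr B" "x \<in> FO X (Cod B f)"
    show "SF (FA X f) x \<in> FO X (Dom B f)" using h[OF f(1)] f(2) by (auto simp: hom_setcat)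
  next
    fix f g x assume f: "f \<in> Arr B" "g \<in> Arr B" "Cod B g = Dom B f" "x \<in> FO X (Cod B f)"
    show "SF (FA X g) (SF (FA X f) x) = SF (FA X (f \<cdot>\<^bsub>B\<^esub> g)) x"
      using c[OF f(1-3)] h[OF f(1)] f(4) by (simp add: hom_setcat)
  qed (simp add: i)
qed

subsection \<open>Sheaves on a site and categories equivalent to them\<close>

text \<open>The inverse in the functor category, seen componentwise and without its bookkeeping of source and
target.\<close>

lemma iso_fcat_components:
  assumes C: "category C" and D: "category D" and s: "s \<in> hom (fcat C D) F G" and iso: "iso (fcat C D) s"
  obtains r where "\<And>a. a \<in> Obj C \<Longrightarrow> r a \<in> hom D (FO G a) (FO F a)"
    "\<And>a. a \<in> Obj C \<Longrightarrow> r a \<cdot>\<^bsub>D\<^esub> NC s a = Ide D (FO F a)"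
    "\<And>a. a \<in> Obj C \<Longrightarrow> NC s a \<cdot>\<^bsub>D\<^esub> r a = Ide D (FO G a)"
    "\<And>f a b. f \<in> hom C a b \<Longrightarrow> r b \<cdot>\<^bsub>D\<^esub> FA G f = FA F f \<cdot>\<^bsub>D\<^esub> r a"
proof -
  obtain t where t: "t \<in> hom (fcat C D) G F" and 1: "t \<cdot>\<^bsub>fcat C D\<^esub> s = Ide (fcat C D) F"
    and 2: "s \<cdot>\<^bsub>fcat C D\<^esub> t = Ide (fcat C D) G"
    using iso hom_fcat(2,3)[OF s] unfolding iso_def fcat_simps(3,4) by blast
  have "NC t a \<cdot>\<^bsub>D\<^esub> NC s a = Ide D (FO F a)" "NC s a \<cdot>\<^bsub>D\<^esub> NC t a = Ide D (FO G a)"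
    if "a \<in> Obj C" for a
    using arg_cong[OF 1, of "\<lambda>t. NC t a"] arg_cong[OF 2, of "\<lambda>t. NC t a"] that by simp_all
  then show ?thesis using that[of "NC t"] hom_fcat_comp[OF t] hom_fcat_natural[OF t] by blast
qed

text \<open>A functor with a retraction up to natural isomorphism is faithful: an arrow is recovered from its
  image by conjugation.\<close>

lemma retract_faithful:
  assumes F: "is_functor A B F" and G: "is_functor B A G"
    and s: "\<And>a. a \<in> Obj A \<Longrightarrow> s a \<in> hom A a (FO G (FO F a))"
    and r: "\<And>a. a \<in> Obj A \<Longrightarrow> r a \<in> hom A (FO G (FO F a)) a"
    and rs: "\<And>a. a \<in> Obj A \<Longrightarrow> r a \<cdot>\<^bsub>A\<^esub> s a = Ide A a"
    and nat: "\<And>f a b. f \<in> hom A a b \<Longrightarrow> s b \<cdot>\<^bsub>A\<^esub> f = FA G (FA F f) \<cdot>\<^bsub>A\<^esub> s a"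
    and f: "f \<in> hom A a b" and g: "g \<in> hom A a b" and eq: "FA F f = FA F g"
  shows "f = g"
proof -
  note A = functor_category(1)[OF F]
  note b = hom_obj(2)[OF A f]
  have "h = r b \<cdot>\<^bsub>A\<^esub> (FA G (FA F h) \<cdot>\<^bsub>A\<^esub> s a)" if "h \<in> hom A a b" for h
    using comp_assoc[OF A that s[OF b] r[OF b]] comp_ide(2)[OF A that] nat[OF that] rs[OF b] by simp
  then show ?thesis using f g eq by metis
qed

text \<open>Both functors have a retraction up to natural isomorphism, hence are faithful; fullness of one follows
from faithfulness of the other.\<close>

lemma equivalence_full_faithful:
  assumes "equivalent_categories A B"
  obtains K where "is_functor A B K"
    "\<And>a b f g. f \<in> hom A a b \<Longrightarrow> g \<in> hom A a b \<Longrightarrow> FA K f = FA K g \<Longrightarrow> f = g"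
    "\<And>a b h. a \<in> Obj A \<Longrightarrow> b \<in> Obj A \<Longrightarrow> h \<in> hom B (FO K a) (FO K b) \<Longrightarrow> \<exists>f\<in>hom A a b. FA K f = h"
    "\<And>X. X \<in> Obj B \<Longrightarrow> \<exists>a\<in>Obj A. \<exists>u\<in>hom B X (FO K a). \<exists>v\<in>hom B (FO K a) X.
       v \<cdot>\<^bsub>B\<^esub> u = Ide B X \<and> u \<cdot>\<^bsub>B\<^esub> v = Ide B (FO K a)"
proof -
  obtain F G s t where F: "is_functor A B F" and G: "is_functor B A G"
    and s: "s \<in> hom (fcat A A) (id_functor A) (G \<circ>\<^bsub>A\<^esub> F)" "iso (fcat A A) s"
    and t: "t \<in> hom (fcat B B) (F \<circ>\<^bsub>B\<^esub> G) (id_functor B)" "iso (fcat B B) t"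
    using assms unfolding equivalent_categories_def by blast
  note A = functor_category(1)[OF F] and B = functor_category(2)[OF F]
  obtain r where "\<And>a. a \<in> Obj A \<Longrightarrow> r a \<in> hom A (FO (G \<circ>\<^bsub>A\<^esub> F) a) (FO (id_functor A) a)"
    "\<And>a. a \<in> Obj A \<Longrightarrow> r a \<cdot>\<^bsub>A\<^esub> NC s a = Ide A (FO (id_functor A) a)"
    "\<And>a. a \<in> Obj A \<Longrightarrow> NC s a \<cdot>\<^bsub>A\<^esub> r a = Ide A (FO (G \<circ>\<^bsub>A\<^esub> F) a)"
    by (rule iso_fcat_components[OF A A s]) blast
  then have r: "\<And>a. a \<in> Obj A \<Longrightarrow> r a \<in> hom A (FO G (FO F a)) a"
    "\<And>a. a \<in> Obj A \<Longrightarrow> r a \<cdot>\<^bsub>A\<^esub> NC s a = Ide A a"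
    "\<And>a. a \<in> Obj A \<Longrightarrow> NC s a \<cdot>\<^bsub>A\<^esub> r a = Ide A (FO G (FO F a))" by auto
  have s': "\<And>a. a \<in> Obj A \<Longrightarrow> NC s a \<in> hom A a (FO G (FO F a))"
    using hom_fcat_comp[OF s(1)] by auto
  have snat: "NC s b \<cdot>\<^bsub>A\<^esub> f = FA G (FA F f) \<cdot>\<^bsub>A\<^esub> NC s a" if "f \<in> hom A a b" for f a b
    using hom_fcat_natural[OF s(1) that] homD[OF that] by simp
  obtain q where "\<And>a. a \<in> Obj B \<Longrightarrow> q a \<in> hom B (FO (id_functor B) a) (FO (F \<circ>\<^bsub>B\<^esub> G) a)"
    "\<And>a. a \<in> Obj B \<Longrightarrow> q a \<cdot>\<^bsub>B\<^esub> NC t a = Ide B (FO (F \<circ>\<^bsub>B\<^esub> G) a)"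
    "\<And>a. a \<in> Obj B \<Longrightarrow> NC t a \<cdot>\<^bsub>B\<^esub> q a = Ide B (FO (id_functor B) a)"
    and qn: "\<And>f a b. f \<in> hom B a b \<Longrightarrow> q b \<cdot>\<^bsub>B\<^esub> FA (id_functor B) f = FA (F \<circ>\<^bsub>B\<^esub> G) f \<cdot>\<^bsub>B\<^esub> q a"
    by (rule iso_fcat_components[OF B B t]) blast
  then have q: "\<And>a. a \<in> Obj B \<Longrightarrow> q a \<in> hom B a (FO F (FO G a))"
    "\<And>a. a \<in> Obj B \<Longrightarrow> q a \<cdot>\<^bsub>B\<^esub> NC t a = Ide B (FO F (FO G a))"
    "\<And>a. a \<in> Obj B \<Longrightarrow> NC t a \<cdot>\<^bsub>B\<^esub> q a = Ide B a" by auto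
  have t': "\<And>a. a \<in> Obj B \<Longrightarrow> NC t a \<in> hom B (FO F (FO G a)) a"
    using hom_fcat_comp[OF t(1)] by auto
  have qnat: "q b \<cdot>\<^bsub>B\<^esub> f = FA F (FA G f) \<cdot>\<^bsub>B\<^esub> q a" if "f \<in> hom B a b" for f a b
    using qn[OF that] homD[OF that] by simp
  note faithful_F = retract_faithful[where s = "NC s" and r = r, OF F G s' r(1,2) snat]
  note faithful_G = retract_faithful[where s = q and r = "NC t", OF G F q(1) t' q(3) qnat]
  show ?thesis
  proof (rule that[OF F])
    show "f = g" if "f \<in> hom A a b" "g \<in> hom A a b" "FA F f = FA F g" for f g a b
      by (rule faithful_F[OF _ _ _ _ that])
  next
    fix a b h assume a: "a \<in> Obj A" and b: "b \<in> Obj A" and h: "h \<in> hom B (FO F a) (FO F b)"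
    \<comment> \<open>The preimage of \<open>h\<close> is the conjugate of \<open>G h\<close>; that \<open>F\<close> maps it to \<open>h\<close> follows as \<open>G\<close> is faithful.\<close>
    define f where "f = r b \<cdot>\<^bsub>A\<^esub> (FA G h \<cdot>\<^bsub>A\<^esub> NC s a)"
    note Gh = functor_hom[OF G h] and sa = s'[OF a] and sb = s'[OF b]
    note Ghs = comp_hom[OF A sa Gh]
    have f: "f \<in> hom A a b" unfolding f_def by (rule comp_hom[OF A Ghs r(1)[OF b]])
    note GFf = functor_hom[OF G functor_hom[OF F f]]
    have "NC s b \<cdot>\<^bsub>A\<^esub> f = FA G h \<cdot>\<^bsub>A\<^esub> NC s a"
      using comp_assoc[OF A Ghs r(1)[OF b] sb] r(3)[OF b] comp_ide(2)[OF A Ghs] unfolding f_def by simp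
    then have *: "FA G (FA F f) \<cdot>\<^bsub>A\<^esub> NC s a = FA G h \<cdot>\<^bsub>A\<^esub> NC s a" using snat[OF f] by simp
    have "FA G (FA F f) = (FA G (FA F f) \<cdot>\<^bsub>A\<^esub> NC s a) \<cdot>\<^bsub>A\<^esub> r a"
      using comp_assoc[OF A r(1)[OF a] sa GFf] r(3)[OF a] comp_ide(1)[OF A GFf] by simp
    also have "\<dots> = FA G h"
      using comp_assoc[OF A r(1)[OF a] sa Gh] r(3)[OF a] comp_ide(1)[OF A Gh] by (simp add: *)
    finally have eq: "FA G (FA F f) = FA G h" .
    have "FA F f = h" by (rule faithful_G[OF _ _ _ _ functor_hom[OF F f] h eq])
    then show "\<exists>f\<in>hom A a b. FA F f = h" using f by blast
  next
    fix X assume X: "X \<in> Obj B"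
    show "\<exists>a\<in>Obj A. \<exists>u\<in>hom B X (FO F a). \<exists>v\<in>hom B (FO F a) X.
       v \<cdot>\<^bsub>B\<^esub> u = Ide B X \<and> u \<cdot>\<^bsub>B\<^esub> v = Ide B (FO F a)"
      using q(1,2,3)[OF X] t'[OF X] functor_obj[OF G X] by blast
  qed
qed

lemma hom_sheaves:
  "t \<in> hom (sheaves B J) X Y \<longleftrightarrow> t \<in> hom (fcat (opp B) setcat) X Y \<and> sheaf B J X \<and> sheaf B J Y"
  by (auto simp: hom_def sheaves_def)

lemma sheaves_simps:
  "Obj (sheaves B J) = {X. sheaf B J X}" "Ide (sheaves B J) = Ide (fcat (opp B) setcat)"
  "s \<cdot>\<^bsub>sheaves B J\<^esub> t = s \<cdot>\<^bsub>fcat (opp B) setcat\<^esub> t"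
  by (simp_all add: sheaves_def fcat_def del: fcat_simps)

lemma psh_map:
  assumes "t \<in> hom (fcat (opp B) setcat) X Y" "b \<in> Obj B" "x \<in> FO X b"
  shows "SF (NC t b) x \<in> FO Y b" "SD (NC t b) = FO X b"
  using hom_fcat_comp[OF assms(1), of b] assms(2,3) by (auto simp: hom_setcat)

lemma psh_map_natural:
  assumes t: "t \<in> hom (fcat (opp B) setcat) X Y" and g: "g \<in> hom B a b" and x: "x \<in> FO X b"
    and B: "category B"
  shows "SF (NC t a) (SF (FA X g) x) = SF (FA Y g) (SF (NC t b) x)"
proof -
  have g': "g \<in> hom (opp B) b a" using g by simp
  note ab = hom_obj[OF B g]
  have "SD (FA X g) = FO X b" using functor_hom[OF hom_fcat(4)[OF t] g'] by (simp add: hom_setcat)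
  then show ?thesis
    using arg_cong[OF hom_fcat_natural[OF t g'], of "\<lambda>f. SF f x"] x psh_map(2)[OF t ab(2) x] by simp
qed

text \<open>Conversely, sections and restrictions in the universe are made into a presheaf, with the value
\<^const>\<open>undefined\<close> outside of the domains.\<close>

lemma sheaf_on_psh:
  assumes B: "category B" and Z: "sheaf_on B J Z r" and small: "\<And>b. b \<in> Obj B \<Longrightarrow> small (Z b)"
  defines "X \<equiv> \<lparr>FO = \<lambda>b\<in>Obj B. Z b, FA = \<lambda>f\<in>Arr B. \<lparr>SD = Z (Cod B f), SC = Z (Dom B f),
    SF = \<lambda>x\<in>Z (Cod B f). r f x\<rparr>\<rparr>"
  assumes sv: "\<And>b S. b \<in> Obj B \<Longrightarrow> S \<in> J b \<Longrightarrow> sieve B b S"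
  shows "sheaf B J X"
proof -
  have F: "is_functor (opp B) setcat X"
  proof (rule functorI)
    fix f a b assume "f \<in> hom (opp B) a b"
    then have f: "f \<in> hom B b a" by simp
    note ab = hom_obj[OF B f] and fD = homD[OF f]
    show "FA X f \<in> hom setcat (FO X a) (FO X b)"
      using fD ab small sheaf_on_in[OF Z f] by (auto simp: hom_setcat X_def)
  next
    fix a assume a: "a \<in> Obj (opp B)"
    then show "FA X (Ide (opp B) a) = Ide setcat (FO X a)"
      using homD[OF ide_hom[OF B, of a]] sheaf_on_ide[OF Z] by (auto simp: X_def)
  next
    fix f g a b c assume "f \<in> hom (opp B) a b" "g \<in> hom (opp B) b c"
    then have f: "f \<in> hom B b a" and g: "g \<in> hom B c b" by auto
    note fD = homD[OF f] and gD = homD[OF g] and fgD = homD[OF comp_hom[OF B g f]]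
    show "FA X (g \<cdot>\<^bsub>opp B\<^esub> f) = FA X g \<cdot>\<^bsub>setcat\<^esub> FA X f"
      using fD gD fgD sheaf_on_comp[OF Z f g] sheaf_on_in[OF Z f] by (auto simp: X_def)
  qed (use B small in \<open>auto simp: X_def category_opp category_setcat\<close>)
  have obj: "Dom B f \<in> Obj B" "Cod B f \<in> Obj B" if "f \<in> Arr B" for f
    using Dom_obj[OF B that] Cod_obj[OF B that] by auto
  have "\<exists>!x. x \<in> FO X b \<and> (\<forall>f\<in>S. SF (FA X f) x = m f)"
    if b: "b \<in> Obj B" and S: "S \<in> J b" and m: "matching_family B X S m" for b S m
  proof -
    have S': "f \<in> Arr B" "Cod B f = b" if "f \<in> S" for f using sv[OF b S] that by (auto simp: sieve_def)
    have m': "m f \<in> Z (Dom B f)" if "f \<in> S" for f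
      using m S'[OF that] that obj by (auto simp: matching_family_def X_def)
    have "\<exists>!x. x \<in> Z b \<and> (\<forall>f\<in>S. r f x = m f)"
    proof (rule sheaf_on_glue[OF Z b S m'])
      fix f g assume f: "f \<in> S" and g: "g \<in> Arr B" "Cod B g = Dom B f"
      then have "SF (FA X g) (m f) = m (f \<cdot>\<^bsub>B\<^esub> g)"
        using m by (auto simp: matching_family_def)
      then show "r g (m f) = m (f \<cdot>\<^bsub>B\<^esub> g)" using g m'[OF f] by (simp add: X_def)
    qed
    moreover have "x \<in> FO X b \<and> (\<forall>f\<in>S. SF (FA X f) x = m f) \<longleftrightarrow> x \<in> Z b \<and> (\<forall>f\<in>S. r f x = m f)" for x
      using S' b by (auto simp: X_def)
    ultimately show ?thesis by simp
  qed
  then show ?thesis using F by (auto simp: sheaf_def)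
qed

text \<open>The sections of an object are those of the sheaf to which the equivalence \<open>K\<close> maps it. Fullness and
faithfulness of \<open>K\<close> describe the arrows, and essential surjectivity realises every sheaf.\<close>

theorem topos_sheaf_model:
  assumes "grothendieck_topos TYPE('u::universe) (E :: ('o, 'a) cat)"
  obtains B :: "('u::universe, 'u) cat" and J and sec :: "'o \<Rightarrow> 'u \<Rightarrow> 'u set" and res :: "'o \<Rightarrow> 'u \<Rightarrow> 'u \<Rightarrow> 'u"
    and app :: "'a \<Rightarrow> 'u \<Rightarrow> 'u \<Rightarrow> 'u"
  where "sheaf_model E B J sec res app"
proof -
  obtain B :: "('u, 'u) cat" and J where sB: "small_category B" and J: "grothendieck_topology B J"
    and eqv: "equivalent_categories E (sheaves B J)"
    using assms unfolding grothendieck_topos_def by blast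
  have B: "category B" using sB by (simp add: small_category_def)
  have sv: "sieve B b S" if "b \<in> Obj B" "S \<in> J b" for b S
    using J that by (auto simp: grothendieck_topology_def)
  obtain K where K: "is_functor E (sheaves B J) K"
    and faithful: "\<And>a b f g. f \<in> hom E a b \<Longrightarrow> g \<in> hom E a b \<Longrightarrow> FA K f = FA K g \<Longrightarrow> f = g"
    and full: "\<And>a b h. a \<in> Obj E \<Longrightarrow> b \<in> Obj E \<Longrightarrow> h \<in> hom (sheaves B J) (FO K a) (FO K b)
      \<Longrightarrow> \<exists>f\<in>hom E a b. FA K f = h"
    and surj: "\<And>X. X \<in> Obj (sheaves B J) \<Longrightarrow> \<exists>a\<in>Obj E. \<exists>u\<in>hom (sheaves B J) X (FO K a).
       \<exists>v\<in>hom (sheaves B J) (FO K a) X. v \<cdot>\<^bsub>sheaves B J\<^esub> u = Ide (sheaves B J) X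
         \<and> u \<cdot>\<^bsub>sheaves B J\<^esub> v = Ide (sheaves B J) (FO K a)"
    by (rule equivalence_full_faithful[OF eqv]) blast
  let ?sec = "\<lambda>e. FO (FO K e)" and ?res = "\<lambda>e f. SF (FA (FO K e) f)" and ?app = "\<lambda>f b. SF (NC (FA K f) b)"
  have Ko: "sheaf B J (FO K e)" "is_functor (opp B) setcat (FO K e)" if "e \<in> Obj E" for e
    using functor_obj[OF K that] by (auto simp: sheaves_simps sheaf_def)
  have Kh: "FA K f \<in> hom (fcat (opp B) setcat) (FO K e) (FO K e')" if "f \<in> hom E e e'" for f e e'
    using functor_hom[OF K that] by (simp add: hom_sheaves)
  have "sheaf_model E B J ?sec ?res ?app"
  proof (unfold_locales)
    show E: "category E" by (rule functor_category[OF K])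
    show "small_category B" "grothendieck_topology B J" by (fact sB J)+
    show "sheaf_on B J (?sec e) (?res e)" if "e \<in> Obj E" for e
      by (rule sheaf_sheaf_on[OF Ko(1)[OF that]])
    show "small (?sec e b)" if "e \<in> Obj E" "b \<in> Obj B" for e b
      using functor_obj[OF Ko(2)[OF that(1)], of b] that by simp
    show "?app f b x \<in> ?sec e' b" if "f \<in> hom E e e'" "b \<in> Obj B" "x \<in> ?sec e b" for f e e' b x
      using psh_map(1)[OF Kh] that by blast
    show "?app f a (?res e h x) = ?res e' h (?app f b x)"
      if "f \<in> hom E e e'" "h \<in> hom B a b" "x \<in> ?sec e b" for f e e' h a b x
      using psh_map_natural[OF Kh that(2,3) B] that(1) by blast
    show "?app (g \<cdot>\<^bsub>E\<^esub> f) b x = ?app g b (?app f b x)"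
      if "f \<in> hom E e e'" "g \<in> hom E e' e''" "b \<in> Obj B" "x \<in> ?sec e b" for f g e e' e'' b x
      using functor_comp[OF K that(1,2)] that psh_map(2)[OF Kh[OF that(1)] that(3,4)]
      by (simp add: sheaves_simps)
    show "?app (Ide E e) b x = x" if "e \<in> Obj E" "b \<in> Obj B" "x \<in> ?sec e b" for e b x
      using functor_ide[OF K that(1)] that by (simp add: sheaves_simps)
    show "f = g" if "f \<in> hom E e e'" "g \<in> hom E e e'"
      "\<And>b x. b \<in> Obj B \<Longrightarrow> x \<in> ?sec e b \<Longrightarrow> ?app f b x = ?app g b x" for f g e e'
    proof (rule faithful[OF that(1,2) ntr_eqI[OF Kh[OF that(1)] Kh[OF that(2)]]])
      fix b assume "b \<in> Obj (opp B)"
      then show "NC (FA K f) b = NC (FA K g) b"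
        using setcat_eqI[OF hom_fcat_comp[OF Kh[OF that(1)]] hom_fcat_comp[OF Kh[OF that(2)]]] that(3)
        by simp
    qed
  next
    fix e e' \<phi> assume e: "e \<in> Obj E" and e': "e' \<in> Obj E"
      and \<phi>: "\<And>b x. b \<in> Obj B \<Longrightarrow> x \<in> ?sec e b \<Longrightarrow> \<phi> b x \<in> ?sec e' b"
      and nat: "\<And>a b g x. g \<in> hom B a b \<Longrightarrow> x \<in> ?sec e b \<Longrightarrow> \<phi> a (?res e g x) = ?res e' g (\<phi> b x)"
    define t where "t = \<lparr>NS = FO K e, NT = FO K e', NC = \<lambda>b\<in>Obj B.
      \<lparr>SD = ?sec e b, SC = ?sec e' b, SF = \<lambda>x\<in>?sec e b. \<phi> b x\<rparr>\<rparr>"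
    have "t \<in> hom (fcat (opp B) setcat) (FO K e) (FO K e')"
    proof (rule natI[OF Ko(2)[OF e] Ko(2)[OF e']])
      fix b assume b: "b \<in> Obj (opp B)"
      then show "NC t b \<in> hom setcat (FO (FO K e) b) (FO (FO K e') b)"
        using functor_obj[OF Ko(2)[OF e] b] functor_obj[OF Ko(2)[OF e'] b] \<phi>
        by (auto simp: t_def hom_setcat)
    next
      fix f a b assume f: "f \<in> hom (opp B) a b" and ab: "a \<in> Obj (opp B)" "b \<in> Obj (opp B)"
      then show "NC t b \<cdot>\<^bsub>setcat\<^esub> FA (FO K e) f = FA (FO K e') f \<cdot>\<^bsub>setcat\<^esub> NC t a"
        using functor_hom[OF Ko(2)[OF e] f] functor_hom[OF Ko(2)[OF e'] f] nat[of f b a]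
        by (auto simp: t_def hom_setcat PiE_iff restrict_def fun_eq_iff)
    qed (auto simp: t_def)
    then have "t \<in> hom (sheaves B J) (FO K e) (FO K e')" using Ko e e' by (simp add: hom_sheaves)
    then obtain f where "f \<in> hom E e e'" "FA K f = t" using full[OF e e'] by blast
    then show "\<exists>f\<in>hom E e e'. \<forall>b\<in>Obj B. \<forall>x\<in>?sec e b. ?app f b x = \<phi> b x"
      by (intro bexI[of _ f]) (auto simp: t_def)
  next
    fix Z :: "'u \<Rightarrow> 'u set" and r assume Z: "sheaf_on B J Z r" and small: "\<And>b. b \<in> Obj B \<Longrightarrow> small (Z b)"
    define X where "X = (\<lparr>FO = \<lambda>b\<in>Obj B. Z b, FA = \<lambda>f\<in>Arr B. \<lparr>SD = Z (Cod B f), SC = Z (Dom B f),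
      SF = \<lambda>x\<in>Z (Cod B f). r f x\<rparr>\<rparr> :: 'u psh)"
    have "X \<in> Obj (sheaves B J)"
      using sheaf_on_psh[OF B Z small sv] by (simp add: sheaves_simps X_def)
    from surj[OF this] obtain e u v where e: "e \<in> Obj E"
      and "u \<in> hom (sheaves B J) X (FO K e)" "v \<in> hom (sheaves B J) (FO K e) X"
      "v \<cdot>\<^bsub>sheaves B J\<^esub> u = Ide (sheaves B J) X" "u \<cdot>\<^bsub>sheaves B J\<^esub> v = Ide (sheaves B J) (FO K e)"
      by blast
    then have
      u: "u \<in> hom (fcat (opp B) setcat) X (FO K e)" and v: "v \<in> hom (fcat (opp B) setcat) (FO K e) X"
      and vu: "v \<cdot>\<^bsub>fcat (opp B) setcat\<^esub> u = Ide (fcat (opp B) setcat) X"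
      and uv: "u \<cdot>\<^bsub>fcat (opp B) setcat\<^esub> v = Ide (fcat (opp B) setcat) (FO K e)"
      unfolding hom_sheaves sheaves_simps by blast+
    have X: "FO X b = Z b" if "b \<in> Obj B" for b using that by (simp add: X_def)
    show "\<exists>e\<in>Obj E. \<exists>\<phi>. (\<forall>b\<in>Obj B. bij_betw (\<phi> b) (Z b) (?sec e b)) \<and>
        (\<forall>a b. \<forall>g\<in>hom B a b. \<forall>x\<in>Z b. \<phi> a (r g x) = ?res e g (\<phi> b x))"
    proof (intro bexI[OF _ e] exI[of _ "\<lambda>b. SF (NC u b)"] conjI ballI allI)
      fix b assume b: "b \<in> Obj B"
      show "bij_betw (SF (NC u b)) (Z b) (?sec e b)"
      proof (rule bij_betw_byWitness[where f' = "SF (NC v b)"])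
        have "SF (NC v b) (SF (NC u b) x) = x" if "x \<in> Z b" for x
          using arg_cong[OF vu, of "\<lambda>t. SF (NC t b) x"] psh_map(2)[OF u b, unfolded X[OF b], OF that] that b X[OF b] by simp
        then show "\<forall>x\<in>Z b. SF (NC v b) (SF (NC u b) x) = x" by blast
        have "SF (NC u b) (SF (NC v b) x) = x" if "x \<in> ?sec e b" for x
          using arg_cong[OF uv, of "\<lambda>t. SF (NC t b) x"] psh_map(2)[OF v b that] that b by simp
        then show "\<forall>x\<in>?sec e b. SF (NC u b) (SF (NC v b) x) = x" by blast
        show "SF (NC u b) ` Z b \<subseteq> ?sec e b" using psh_map(1)[OF u b] X[OF b] by auto
        show "SF (NC v b) ` ?sec e b \<subseteq> Z b" using psh_map(1)[OF v b] X[OF b] by auto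
      qed
    next
      fix a b g x assume g: "g \<in> hom B a b" and x: "x \<in> Z b"
      note ab = hom_obj[OF B g] and gD = homD[OF g]
      show "SF (NC u a) (r g x) = ?res e g (SF (NC u b) x)"
        using psh_map_natural[OF u g, of x] B x ab gD by (simp add: X_def)
    qed
  qed
  then show ?thesis by (rule that)
qed

text \<open>Sets are the sheaves on the category with one arrow, where only the maximal sieve covers. Colimits of
  sets, over which \<^const>\<open>tilde_yoneda\<close> is formed, thus need no construction of their own.\<close>

lemma setcat_sheaf_model:
  "sheaf_model setcat (discrete {undefined :: 'u::universe}) (\<lambda>_. {{undefined}})
     (\<lambda>A _. A) (\<lambda>_ _ x. x) (\<lambda>f _. SF f)"
proof (unfold_locales)
  let ?B = "discrete {undefined :: 'u}"
  have B: "category ?B" by (rule categoryI) (auto simp: discrete_def hom_def)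
  have "small {undefined :: 'u}" using small_in_finite small_in_self by blast
  then show "small_category ?B" using B by (simp add: small_category_def discrete_def)
  have "sieve ?B undefined R \<Longrightarrow> R = {} \<or> R = {undefined}" for R
    by (auto simp: sieve_def discrete_def)
  then show "grothendieck_topology ?B (\<lambda>_. {{undefined}})"
    by (auto simp: grothendieck_topology_def discrete_def sieve_def sieve_pullback_def)
  show "sheaf_on ?B (\<lambda>_. {{undefined}}) (\<lambda>_. A) (\<lambda>_ x. x)" for A :: "'u set"
    by (auto simp: sheaf_on_def discrete_def)
  show "f = g" if "f \<in> hom setcat A A'" "g \<in> hom setcat A A'"
    "\<And>b x. b \<in> Obj ?B \<Longrightarrow> x \<in> A \<Longrightarrow> SF f x = SF g x" for f g :: "'u sfun" and A A'
    using setcat_eqI[OF that(1,2)] that(3) by (simp add: discrete_def)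
  show "\<exists>f\<in>hom setcat A A'. \<forall>b\<in>Obj ?B. \<forall>x\<in>A. SF f x = \<phi> b x"
    if "A \<in> Obj setcat" "A' \<in> Obj setcat" "\<And>b x. b \<in> Obj ?B \<Longrightarrow> x \<in> A \<Longrightarrow> \<phi> b x \<in> A'"
    for A A' and \<phi> :: "'u \<Rightarrow> 'u \<Rightarrow> 'u"
    using that by (intro bexI[of _ "\<lparr>SD = A, SC = A', SF = \<lambda>x\<in>A. \<phi> undefined x\<rparr>"])
      (auto simp: hom_setcat discrete_def)
  show "\<exists>e\<in>Obj (setcat :: ('u set, 'u sfun) cat). \<exists>\<phi>. (\<forall>b\<in>Obj ?B. bij_betw (\<phi> b) (Z b) e) \<and>
      (\<forall>a b. \<forall>g\<in>hom ?B a b. \<forall>x\<in>Z b. \<phi> a (r g x) = \<phi> b x)"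
    if "sheaf_on ?B (\<lambda>_. {{undefined}}) Z r" "\<And>b. b \<in> Obj ?B \<Longrightarrow> small (Z b)"
    for Z :: "'u \<Rightarrow> 'u set" and r
  proof (rule bexI, rule exI[of _ "\<lambda>_ x. x"], intro conjI ballI allI)
    show "Z undefined \<in> Obj setcat" using that(2) by (simp add: discrete_def)
    show "bij_betw (\<lambda>x. x) (Z b) (Z undefined)" if "b \<in> Obj ?B" for b
      using that by (simp add: discrete_def bij_betw_def)
    show "r g x = x" if g: "g \<in> hom ?B a b" and x: "x \<in> Z b" for a b g x
    proof -
      have "g = Ide ?B b" "b \<in> Obj ?B" using g by (auto simp: discrete_def hom_def)
      then show ?thesis using sheaf_on_ide[OF \<open>sheaf_on ?B _ Z r\<close> _ x] by simp
    qed
  qed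
qed (auto simp: category_setcat hom_setcat)

section \<open>Limits and colimits of sheaves\<close>

text \<open>Limits are indexed by graphs rather than categories: \<open>V\<close> is the set of vertices, and an edge
  \<open>(v, w, h)\<close> asks that \<open>h\<close> commutes with the projections to \<open>X v\<close> and \<open>X w\<close>.\<close>

definition limit_cone ::
  "('o, 'a) cat \<Rightarrow> 'v set \<Rightarrow> ('v \<Rightarrow> 'o) \<Rightarrow> ('v \<times> 'v \<times> 'a) set \<Rightarrow> 'o \<Rightarrow> ('v \<Rightarrow> 'a) \<Rightarrow> bool" where
  "limit_cone E V X Ed L p \<longleftrightarrow> L \<in> Obj E \<and> (\<forall>v\<in>V. p v \<in> hom E L (X v)) \<and>
     (\<forall>(v, w, h)\<in>Ed. h \<cdot>\<^bsub>E\<^esub> p v = p w) \<and>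
     (\<forall>A q. A \<in> Obj E \<longrightarrow> (\<forall>v\<in>V. q v \<in> hom E A (X v)) \<longrightarrow> (\<forall>(v, w, h)\<in>Ed. h \<cdot>\<^bsub>E\<^esub> q v = q w) \<longrightarrow>
        (\<exists>!x. x \<in> hom E A L \<and> (\<forall>v\<in>V. p v \<cdot>\<^bsub>E\<^esub> x = q v)))"

lemma limit_cone_arr:
  assumes "limit_cone E V X Ed L p"
  shows "L \<in> Obj E" "v \<in> V \<Longrightarrow> p v \<in> hom E L (X v)" "(v, w, h) \<in> Ed \<Longrightarrow> h \<cdot>\<^bsub>E\<^esub> p v = p w"
  using assms by (auto simp: limit_cone_def)

lemma limit_cone_universal:
  assumes "limit_cone E V X Ed L p" "A \<in> Obj E" "\<And>v. v \<in> V \<Longrightarrow> q v \<in> hom E A (X v)"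
    and "\<And>v w h. (v, w, h) \<in> Ed \<Longrightarrow> h \<cdot>\<^bsub>E\<^esub> q v = q w"
  shows "\<exists>!x. x \<in> hom E A L \<and> (\<forall>v\<in>V. p v \<cdot>\<^bsub>E\<^esub> x = q v)"
proof -
  have *: "\<forall>A q. A \<in> Obj E \<longrightarrow> (\<forall>v\<in>V. q v \<in> hom E A (X v)) \<longrightarrow> (\<forall>(v, w, h)\<in>Ed. h \<cdot>\<^bsub>E\<^esub> q v = q w) \<longrightarrow>
        (\<exists>!x. x \<in> hom E A L \<and> (\<forall>v\<in>V. p v \<cdot>\<^bsub>E\<^esub> x = q v))"
    using assms(1) unfolding limit_cone_def by (elim conjE)
  show ?thesis by (rule *[rule_format]) (use assms(2-) in auto)
qed

text \<open>Being a sheaf is invariant under bijections of the sets of sections. This is what allows sections to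
be described in any type and encoded afterwards.\<close>

lemma sheaf_on_transport:
  assumes Z: "sheaf_on B J Z r" and B: "category B" and sv: "\<And>b S. b \<in> Obj B \<Longrightarrow> S \<in> J b \<Longrightarrow> sieve B b S"
    and bij: "\<And>b. b \<in> Obj B \<Longrightarrow> bij_betw (\<phi> b) (Z b) (Z' b)"
    and nat: "\<And>g a b x. g \<in> hom B a b \<Longrightarrow> x \<in> Z b \<Longrightarrow> \<phi> a (r g x) = r' g (\<phi> b x)"
  shows "sheaf_on B J Z' r'"
proof -
  have im: "\<exists>x\<in>Z b. \<phi> b x = y" if "b \<in> Obj B" "y \<in> Z' b" for b y
  proof -
    have "y \<in> \<phi> b ` Z b" using bij_betw_imp_surj_on[OF bij[OF that(1)]] that(2) by simp
    then show ?thesis by blast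
  qed
  have in': "\<phi> b x \<in> Z' b" if "b \<in> Obj B" "x \<in> Z b" for b x
    using bij_betwE[OF bij[OF that(1)]] that(2) by auto
  have inj: "x = y" if "b \<in> Obj B" "x \<in> Z b" "y \<in> Z b" "\<phi> b x = \<phi> b y" for b x y
    using bij_betw_imp_inj_on[OF bij[OF that(1)]] that(2-) by (auto dest: inj_onD)
  have D: "Dom B f \<in> Obj B" "Cod B f \<in> Obj B" "f \<in> hom B (Dom B f) (Cod B f)" if "f \<in> Arr B" for f
    using Dom_obj[OF B that] Cod_obj[OF B that] arr_hom[OF that] by auto
  show ?thesis unfolding sheaf_on_def
  proof (intro conjI ballI allI impI)
    fix f y assume f: "f \<in> Arr B" and y: "y \<in> Z' (Cod B f)"
    obtain x where x: "x \<in> Z (Cod B f)" "\<phi> (Cod B f) x = y" using im[OF D(2)[OF f] y] by blast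
    show "r' f y \<in> Z' (Dom B f)"
      using nat[OF D(3)[OF f] x(1)] in'[OF D(1)[OF f] sheaf_on_in[OF Z D(3)[OF f] x(1)]] x(2) by simp
  next
    fix b y assume b: "b \<in> Obj B" and y: "y \<in> Z' b"
    obtain x where x: "x \<in> Z b" "\<phi> b x = y" using im[OF b y] by blast
    show "r' (Ide B b) y = y" using nat[OF ide_hom[OF B b] x(1)] sheaf_on_ide[OF Z b x(1)] x(2) by simp
  next
    fix f g y assume f: "f \<in> Arr B" and g: "g \<in> Arr B" "Cod B g = Dom B f" and y: "y \<in> Z' (Cod B f)"
    obtain x where x: "x \<in> Z (Cod B f)" "\<phi> (Cod B f) x = y" using im[OF D(2)[OF f] y] by blast
    have gh: "g \<in> hom B (Dom B g) (Dom B f)" using g by (simp add: hom_def)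
    show "r' g (r' f y) = r' (f \<cdot>\<^bsub>B\<^esub> g) y"
      using nat[OF gh sheaf_on_in[OF Z D(3)[OF f] x(1)]] nat[OF D(3)[OF f] x(1)]
        nat[OF comp_hom[OF B gh D(3)[OF f]] x(1)] sheaf_on_comp[OF Z D(3)[OF f] gh x(1)] x(2) by simp
  next
    fix b S m assume b: "b \<in> Obj B" and S: "S \<in> J b" and m: "\<forall>f\<in>S. m f \<in> Z' (Dom B f)"
      and comp: "\<forall>f\<in>S. \<forall>g\<in>Arr B. Cod B g = Dom B f \<longrightarrow> r' g (m f) = m (f \<cdot>\<^bsub>B\<^esub> g)"
    have Sh: "f \<in> hom B (Dom B f) b" "f \<in> Arr B" if "f \<in> S" for f
      using sv[OF b S] that by (auto simp: sieve_def hom_def)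
    have Sc: "f \<cdot>\<^bsub>B\<^esub> g \<in> S" if "f \<in> S" "g \<in> Arr B" "Cod B g = Dom B f" for f g
      using sv[OF b S] that by (auto simp: sieve_def)
    have "\<forall>f\<in>S. \<exists>x\<in>Z (Dom B f). \<phi> (Dom B f) x = m f" using im[OF D(1)[OF Sh(2)]] m by blast
    then obtain n where n: "\<And>f. f \<in> S \<Longrightarrow> n f \<in> Z (Dom B f)" "\<And>f. f \<in> S \<Longrightarrow> \<phi> (Dom B f) (n f) = m f"
      by metis
    have "\<exists>!x. x \<in> Z b \<and> (\<forall>f\<in>S. r f x = n f)"
    proof (rule sheaf_on_glue[OF Z b S n(1)])
      fix f g assume f: "f \<in> S" and g: "g \<in> Arr B" "Cod B g = Dom B f"
      have gh: "g \<in> hom B (Dom B g) (Dom B f)" using g by (simp add: hom_def)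
      have fgD: "Dom B (f \<cdot>\<^bsub>B\<^esub> g) = Dom B g" by (rule homD[OF comp_hom[OF B gh Sh(1)[OF f]]])
      show "r g (n f) = n (f \<cdot>\<^bsub>B\<^esub> g)"
        by (rule inj[OF D(1)[OF g(1)]])
          (use sheaf_on_in[OF Z gh n(1)[OF f]] n[OF Sc[OF f g]] fgD nat[OF gh n(1)[OF f]] n(2)[OF f] comp f g
            in auto)
    qed
    then obtain x where x: "x \<in> Z b" "\<And>f. f \<in> S \<Longrightarrow> r f x = n f"
      and uniq: "\<And>y. y \<in> Z b \<Longrightarrow> \<forall>f\<in>S. r f y = n f \<Longrightarrow> y = x" by (elim ex1E) blast
    show "\<exists>!y. y \<in> Z' b \<and> (\<forall>f\<in>S. r' f y = m f)"
    proof (rule ex1I[of _ "\<phi> b x"])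
      show "\<phi> b x \<in> Z' b \<and> (\<forall>f\<in>S. r' f (\<phi> b x) = m f)"
        using in'[OF b x(1)] nat[OF Sh(1) x(1)] x(2) n(2) by simp
      fix y assume y: "y \<in> Z' b \<and> (\<forall>f\<in>S. r' f y = m f)"
      obtain z where z: "z \<in> Z b" "\<phi> b z = y" using im[OF b] y by blast
      have "r f z = n f" if f: "f \<in> S" for f
        by (rule inj[OF D(1)[OF Sh(2)[OF f]]])
          (use sheaf_on_in[OF Z Sh(1)[OF f] z(1)] n[OF f] nat[OF Sh(1)[OF f] z(1)] z(2) y f in auto)
      then show "y = \<phi> b x" using uniq[OF z(1)] z(2) by blast
    qed
  qed
qed

context sheaf_model
begin

lemma B: "category B"
  using small_B by (simp add: small_category_def)

lemma J_sieve: "b \<in> Obj B \<Longrightarrow> S \<in> J b \<Longrightarrow> sieve B b S"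
  using J by (auto simp: grothendieck_topology_def)

lemma J_max: "b \<in> Obj B \<Longrightarrow> {f \<in> Arr B. Cod B f = b} \<in> J b"
  using J by (auto simp: grothendieck_topology_def)

lemma J_pullback: "S \<in> J b \<Longrightarrow> f \<in> hom B a b \<Longrightarrow> sieve_pullback B f S \<in> J a"
  using J hom_obj[OF B] by (auto simp: grothendieck_topology_def hom_def)

text \<open>The local character of the topology.\<close>

lemma J_trans:
  assumes "b \<in> Obj B" "S \<in> J b" "sieve B b R" "\<And>f. f \<in> S \<Longrightarrow> sieve_pullback B f R \<in> J (Dom B f)"
  shows "R \<in> J b"
proof -
  have "\<forall>S\<in>J b. \<forall>R. sieve B b R \<longrightarrow> (\<forall>f\<in>S. sieve_pullback B f R \<in> J (Dom B f)) \<longrightarrow> R \<in> J b"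
    using bspec[OF J[unfolded grothendieck_topology_def] assms(1)] by (elim conjE)
  then show ?thesis using assms(2-4) by blast
qed

lemma sieve_arr: "b \<in> Obj B \<Longrightarrow> S \<in> J b \<Longrightarrow> f \<in> S \<Longrightarrow> f \<in> hom B (Dom B f) b"
  using J_sieve[of b S] by (auto simp: sieve_def hom_def)

lemma sieve_comp: "b \<in> Obj B \<Longrightarrow> S \<in> J b \<Longrightarrow> f \<in> S \<Longrightarrow> g \<in> hom B a (Dom B f) \<Longrightarrow> f \<cdot>\<^bsub>B\<^esub> g \<in> S"
  using J_sieve[of b S] by (auto simp: sieve_def hom_def)

lemma J_mono:
  assumes b: "b \<in> Obj B" and S: "S \<in> J b" and R: "sieve B b R" "S \<subseteq> R"
  shows "R \<in> J b"
proof (rule J_trans[OF b S R(1)])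
  fix f assume f: "f \<in> S"
  have "sieve_pullback B f R = {g \<in> Arr B. Cod B g = Dom B f}"
    using f R by (auto simp: sieve_pullback_def sieve_def)
  then show "sieve_pullback B f R \<in> J (Dom B f)"
    using J_max[of "Dom B f"] hom_obj(1)[OF B sieve_arr[OF b S f]] by simp
qed

lemma res_in: "e \<in> Obj E \<Longrightarrow> f \<in> hom B a b \<Longrightarrow> x \<in> sec e b \<Longrightarrow> res e f x \<in> sec e a"
  using sheaf_on_in[OF sec_sheaf] by blast

lemma res_comp:
  "e \<in> Obj E \<Longrightarrow> f \<in> hom B b c \<Longrightarrow> g \<in> hom B a b \<Longrightarrow> x \<in> sec e c \<Longrightarrow>
    res e g (res e f x) = res e (f \<cdot>\<^bsub>B\<^esub> g) x"
  using sheaf_on_comp[OF sec_sheaf] by blast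

lemma separated:
  assumes "e \<in> Obj E" "b \<in> Obj B" "S \<in> J b" "x \<in> sec e b" "y \<in> sec e b"
    "\<And>f. f \<in> S \<Longrightarrow> res e f x = res e f y"
  shows "x = y"
  by (rule sheaf_on_separated[OF sec_sheaf[OF assms(1)] B assms(2,3) J_sieve[OF assms(2,3)] assms(4-6)])

text \<open>Codes for the sections over each object are chosen in the universe, and the restriction maps are
transported to them.\<close>

lemma realise:
  assumes Z: "sheaf_on B J (Z :: 'u \<Rightarrow> 't set) r" and small: "\<And>b. b \<in> Obj B \<Longrightarrow> small_in TYPE('u) (Z b)"
  obtains e \<phi> where "e \<in> Obj E" "\<And>b. b \<in> Obj B \<Longrightarrow> bij_betw (\<phi> b) (Z b) (sec e b)"
    "\<And>g a b x. g \<in> hom B a b \<Longrightarrow> x \<in> Z b \<Longrightarrow> \<phi> a (r g x) = res e g (\<phi> b x)"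
proof -
  have "\<forall>b\<in>Obj B. \<exists>f :: 't \<Rightarrow> 'u. inj_on f (Z b) \<and> Defs.small (f ` Z b)"
    using small_in_encode[OF small] by metis
  then obtain enc :: "'u \<Rightarrow> 't \<Rightarrow> 'u"
    where enc: "\<And>b. b \<in> Obj B \<Longrightarrow> inj_on (enc b) (Z b)" "\<And>b. b \<in> Obj B \<Longrightarrow> Defs.small (enc b ` Z b)"
    by metis
  define r' where "r' g y = enc (Dom B g) (r g (inv_into (Z (Cod B g)) (enc (Cod B g)) y))" for g y
  have bij: "bij_betw (enc b) (Z b) (enc b ` Z b)" if "b \<in> Obj B" for b
    using enc(1)[OF that] by (rule inj_on_imp_bij_betw)
  have nat: "enc a (r g x) = r' g (enc b x)" if g: "g \<in> hom B a b" and x: "x \<in> Z b" for g a b x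
    using homD[OF g] x inv_into_f_f[OF enc(1)[OF hom_obj(2)[OF B g]] x] by (simp add: r'_def)
  have "sheaf_on B J (\<lambda>b. enc b ` Z b) r'"
    by (rule sheaf_on_transport[OF Z B J_sieve bij nat])
  from realise_universe[OF this enc(2)] obtain e \<phi> where e: "e \<in> Obj E"
    and \<phi>: "\<forall>b\<in>Obj B. bij_betw (\<phi> b) (enc b ` Z b) (sec e b)"
    and \<phi>n: "\<forall>a b. \<forall>g\<in>hom B a b. \<forall>x\<in>enc b ` Z b. \<phi> a (r' g x) = res e g (\<phi> b x)"
    by blast
  show ?thesis
  proof (rule that[OF e, of "\<lambda>b. \<phi> b \<circ> enc b"])
    show "bij_betw (\<phi> b \<circ> enc b) (Z b) (sec e b)" if "b \<in> Obj B" for b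
      by (rule bij_betw_trans[OF bij[OF that] \<phi>[rule_format, OF that]])
    show "(\<phi> a \<circ> enc a) (r g x) = res e g ((\<phi> b \<circ> enc b) x)" if g: "g \<in> hom B a b" and x: "x \<in> Z b"
      for g a b x
      using nat[OF g x] \<phi>n[rule_format, OF g, of "enc b x"] x by simp
  qed
qed

subsection \<open>Limits\<close>

text \<open>Limits of sheaves are computed sectionwise; the second claim characterizes the sections of any
  limit, however it was chosen.\<close>

lemma limits_exist:
  fixes V :: "'v set"
  assumes V: "small_in TYPE('u) V" and X: "\<And>v. v \<in> V \<Longrightarrow> X v \<in> Obj E"
    and Ed: "\<And>v w h. (v, w, h) \<in> Ed \<Longrightarrow> v \<in> V \<and> w \<in> V \<and> h \<in> hom E (X v) (X w)"
  shows "\<exists>L p. limit_cone E V X Ed L p \<and> (\<forall>b\<in>Obj B. \<forall>y. (\<forall>v\<in>V. y v \<in> sec (X v) b) \<longrightarrow>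
    (\<forall>(v, w, h)\<in>Ed. app h b (y v) = y w) \<longrightarrow> (\<exists>!z. z \<in> sec L b \<and> (\<forall>v\<in>V. app (p v) b z = y v)))"
proof -
  define Z where "Z b = {y \<in> PiE V (\<lambda>v. sec (X v) b). \<forall>(v, w, h)\<in>Ed. app h b (y v) = y w}" for b
  define r where "r f y = (\<lambda>v\<in>V. res (X v) f (y v))" for f y
  have ZI: "y \<in> Z b" if "y \<in> extensional V" "\<And>v. v \<in> V \<Longrightarrow> y v \<in> sec (X v) b"
    "\<And>v w h. (v, w, h) \<in> Ed \<Longrightarrow> app h b (y v) = y w" for y b
    using that by (auto simp: Z_def PiE_iff)
  have ZD: "y \<in> extensional V" "\<And>v. v \<in> V \<Longrightarrow> y v \<in> sec (X v) b"
    "\<And>v w h. (v, w, h) \<in> Ed \<Longrightarrow> app h b (y v) = y w" if "y \<in> Z b" for y b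
    using that by (auto simp: Z_def PiE_iff)
  have rZ: "r f y \<in> Z a" if f: "f \<in> hom B a b" and y: "y \<in> Z b" for f a b y
  proof (rule ZI)
    show "r f y v \<in> sec (X v) a" if "v \<in> V" for v
      using res_in[OF X[OF that] f ZD(2)[OF y that]] that by (simp add: r_def)
    show "app h a (r f y v) = r f y w" if "(v, w, h) \<in> Ed" for v w h
      using Ed[OF that] app_res[of h "X v" "X w" f a b "y v"] f ZD[OF y] that by (simp add: r_def)
  qed (simp add: r_def)
  have sheaf: "sheaf_on B J Z r" unfolding sheaf_on_def
  proof (intro conjI ballI allI impI)
    show "r f x \<in> Z (Dom B f)" if "f \<in> Arr B" "x \<in> Z (Cod B f)" for f x
      by (rule rZ[OF arr_hom[OF that(1)] that(2)])
    show "r (Ide B b) x = x" if b: "b \<in> Obj B" and x: "x \<in> Z b" for b x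
      by (rule extensionalityI[of _ V])
        (use ZD[OF x] sheaf_on_ide[OF sec_sheaf[OF X] b] in \<open>auto simp: r_def\<close>)
    show "r g (r f x) = r (f \<cdot>\<^bsub>B\<^esub> g) x"
      if "f \<in> Arr B" "g \<in> Arr B" "Cod B g = Dom B f" "x \<in> Z (Cod B f)" for f g x
      by (rule extensionalityI[of _ V])
        (use ZD[OF that(4)] res_comp[OF X, of _ f "Dom B f" "Cod B f" g "Dom B g"] that in
          \<open>auto simp: r_def hom_def\<close>)
  next
    fix b S m assume b: "b \<in> Obj B" and S: "S \<in> J b" and m: "\<forall>f\<in>S. m f \<in> Z (Dom B f)"
      and comp: "\<forall>f\<in>S. \<forall>g\<in>Arr B. Cod B g = Dom B f \<longrightarrow> r g (m f) = m (f \<cdot>\<^bsub>B\<^esub> g)"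
    have "\<exists>!z. z \<in> sec (X v) b \<and> (\<forall>f\<in>S. res (X v) f z = m f v)" if v: "v \<in> V" for v
    proof (rule sheaf_on_glue[OF sec_sheaf[OF X[OF v]] b S])
      show "m f v \<in> sec (X v) (Dom B f)" if "f \<in> S" for f using ZD(2)[OF m[rule_format, OF that] v] .
      show "res (X v) g (m f v) = m (f \<cdot>\<^bsub>B\<^esub> g) v" if "f \<in> S" "g \<in> Arr B" "Cod B g = Dom B f" for f g
        using comp[rule_format, OF that] v by (auto simp: r_def fun_eq_iff dest: spec[of _ v])
    qed
    then have "\<forall>v\<in>V. \<exists>z. z \<in> sec (X v) b \<and> (\<forall>f\<in>S. res (X v) f z = m f v)" by (blast elim: ex1E)
    then obtain z where z: "\<And>v. v \<in> V \<Longrightarrow> z v \<in> sec (X v) b"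
      "\<And>v f. v \<in> V \<Longrightarrow> f \<in> S \<Longrightarrow> res (X v) f (z v) = m f v" by metis
    show "\<exists>!x. x \<in> Z b \<and> (\<forall>f\<in>S. r f x = m f)"
    proof (rule ex1I[of _ "restrict z V"], intro conjI ballI)
      show "restrict z V \<in> Z b"
      proof (rule ZI)
        fix v w h assume e: "(v, w, h) \<in> Ed"
        then have v: "v \<in> V" and w: "w \<in> V" and h: "h \<in> hom E (X v) (X w)" using Ed by auto
        have "app h b (z v) = z w"
        proof (rule separated[OF X[OF w] b S app_in[OF h b z(1)[OF v]] z(1)[OF w]])
          fix f assume f: "f \<in> S"
          show "res (X w) f (app h b (z v)) = res (X w) f (z w)"
            using app_res[OF h sieve_arr[OF b S f] z(1)[OF v]] z(2)[OF v f] z(2)[OF w f]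
              ZD(3)[OF m[rule_format, OF f] e] by simp
        qed
        then show "app h b (restrict z V v) = restrict z V w" using v w by simp
      qed (use z in auto)
      show "r f (restrict z V) = m f" if "f \<in> S" for f
        by (rule extensionalityI[of _ V]) (use that z(2) ZD(1)[OF m[rule_format, OF that]] in \<open>auto simp: r_def\<close>)
      fix x assume x: "x \<in> Z b \<and> (\<forall>f\<in>S. r f x = m f)"
      show "x = restrict z V"
      proof (rule extensionalityI[of _ V])
        fix v assume v: "v \<in> V"
        have "x v = z v"
        proof (rule separated[OF X[OF v] b S _ z(1)[OF v]])
          show "x v \<in> sec (X v) b" using ZD(2) x v by blast
          fix f assume f: "f \<in> S"
          then have "r f x v = m f v" using x by simp
          then show "res (X v) f (x v) = res (X v) f (z v)" using z(2)[OF v f] v by (simp add: r_def)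
        qed
        then show "x v = restrict z V v" using v by simp
      qed (use ZD(1) x in auto)
    qed
  qed
  have "small_in TYPE('u) (Z b)" if b: "b \<in> Obj B" for b
  proof (rule small_in_subset)
    show "Z b \<subseteq> PiE V (\<lambda>v. sec (X v) b)" by (auto simp: Z_def)
    show "small_in TYPE('u) (PiE V (\<lambda>v. sec (X v) b))"
      by (rule small_in_PiE[OF V]) (use sec_small[OF X b] small_in_self in blast)
  qed
  from realise[OF sheaf this] obtain L \<phi> where L: "L \<in> Obj E"
    and bij: "\<And>b. b \<in> Obj B \<Longrightarrow> bij_betw (\<phi> b) (Z b) (sec L b)"
    and nat: "\<And>g a b x. g \<in> hom B a b \<Longrightarrow> x \<in> Z b \<Longrightarrow> \<phi> a (r g x) = res L g (\<phi> b x)" by blast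
  define \<psi> where "\<psi> b = inv_into (Z b) (\<phi> b)" for b
  have \<psi>: "\<psi> b x \<in> Z b" "\<phi> b (\<psi> b x) = x" if "b \<in> Obj B" "x \<in> sec L b" for b x
    using bij_betw_inv_into_right[OF bij[OF that(1)] that(2)]
      bij_betwE[OF bij_betw_inv_into[OF bij[OF that(1)]]] that(2) by (auto simp: \<psi>_def)
  have \<psi>\<phi>: "\<psi> b (\<phi> b y) = y" "\<phi> b y \<in> sec L b" if "b \<in> Obj B" "y \<in> Z b" for b y
    using bij_betw_inv_into_left[OF bij[OF that(1)] that(2)] bij_betwE[OF bij[OF that(1)]] that(2)
    by (auto simp: \<psi>_def)
  have \<psi>n: "\<psi> a (res L g x) = r g (\<psi> b x)" if g: "g \<in> hom B a b" and x: "x \<in> sec L b" for g a b x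
    using nat[OF g \<psi>(1)[OF hom_obj(2)[OF B g] x]] \<psi>(2)[OF hom_obj(2)[OF B g] x]
      \<psi>\<phi>(1)[OF hom_obj(1)[OF B g] rZ[OF g \<psi>(1)[OF hom_obj(2)[OF B g] x]]] by simp
  have "\<exists>p\<in>hom E L (X v). \<forall>b\<in>Obj B. \<forall>x\<in>sec L b. app p b x = \<psi> b x v" if v: "v \<in> V" for v
    by (rule app_full[OF L X[OF v]]) (use \<psi>(1) \<psi>n ZD(2) v in \<open>auto simp: r_def\<close>)
  then obtain p where p: "\<And>v. v \<in> V \<Longrightarrow> p v \<in> hom E L (X v)"
    and papp: "\<And>v b x. v \<in> V \<Longrightarrow> b \<in> Obj B \<Longrightarrow> x \<in> sec L b \<Longrightarrow> app (p v) b x = \<psi> b x v"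
    by metis
  have sections: "\<exists>!z. z \<in> sec L b \<and> (\<forall>v\<in>V. app (p v) b z = y v)"
    if b: "b \<in> Obj B" and y: "\<And>v. v \<in> V \<Longrightarrow> y v \<in> sec (X v) b"
      "\<And>v w h. (v, w, h) \<in> Ed \<Longrightarrow> app h b (y v) = y w" for b y
  proof -
    have yZ: "restrict y V \<in> Z b" by (rule ZI) (use y Ed in \<open>auto\<close>)
    show ?thesis
    proof (rule ex1I[of _ "\<phi> b (restrict y V)"])
      show "\<phi> b (restrict y V) \<in> sec L b \<and> (\<forall>v\<in>V. app (p v) b (\<phi> b (restrict y V)) = y v)"
        using \<psi>\<phi>[OF b yZ] papp b by simp
      fix z assume z: "z \<in> sec L b \<and> (\<forall>v\<in>V. app (p v) b z = y v)"
      have "\<psi> b z = restrict y V"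
        by (rule extensionalityI[of _ V]) (use z papp b ZD(1)[OF \<psi>(1)[OF b, of z]] in auto)
      then show "z = \<phi> b (restrict y V)" using \<psi>(2)[OF b, of z] z by simp
    qed
  qed
  have "limit_cone E V X Ed L p"
    unfolding limit_cone_def
  proof (intro conjI allI impI L)
    show "\<forall>v\<in>V. p v \<in> hom E L (X v)" using p by blast
    have "h \<cdot> p v = p w" if e: "(v, w, h) \<in> Ed" for v w h
    proof -
      have v: "v \<in> V" and w: "w \<in> V" and h: "h \<in> hom E (X v) (X w)" using Ed[OF e] by auto
      show ?thesis
        by (rule app_ext[OF comp_hom[OF E p[OF v] h] p[OF w]])
          (use app_comp[OF p[OF v] h] papp v w ZD(3)[OF \<psi>(1) e] in auto)
    qed
    then show "\<forall>(v, w, h)\<in>Ed. h \<cdot> p v = p w" by blast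
  next
    fix A q assume A: "A \<in> Obj E" and q: "\<forall>v\<in>V. q v \<in> hom E A (X v)" and qe: "\<forall>(v, w, h)\<in>Ed. h \<cdot> q v = q w"
    define f where "f b a = (\<lambda>v\<in>V. app (q v) b a)" for b a
    have fZ: "f b a \<in> Z b" if b: "b \<in> Obj B" and a: "a \<in> sec A b" for b a
    proof (rule ZI)
      show "f b a v \<in> sec (X v) b" if "v \<in> V" for v using app_in q b a that by (auto simp: f_def)
      show "app h b (f b a v) = f b a w" if e: "(v, w, h) \<in> Ed" for v w h
        using Ed[OF e] app_comp[of "q v" A "X v" h "X w" b a] q qe e b a by (auto simp: f_def)
    qed (simp add: f_def)
    have "\<exists>x\<in>hom E A L. \<forall>b\<in>Obj B. \<forall>a\<in>sec A b. app x b a = \<phi> b (f b a)"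
    proof (rule app_full[OF A L])
      show "\<phi> b (f b a) \<in> sec L b" if "b \<in> Obj B" "a \<in> sec A b" for b a
        using \<psi>\<phi>(2)[OF that(1) fZ[OF that]] .
      fix a b g x assume g: "g \<in> hom B a b" and x: "x \<in> sec A b"
      note ab = hom_obj[OF B g]
      have "f a (res A g x) = r g (f b x)"
        unfolding f_def r_def by (rule restrict_ext) (use app_res[OF _ g x] q in auto)
      then show "\<phi> a (f a (res A g x)) = res L g (\<phi> b (f b x))" using nat[OF g fZ[OF ab(2) x]] by simp
    qed
    then obtain x where x: "x \<in> hom E A L" "\<And>b a. b \<in> Obj B \<Longrightarrow> a \<in> sec A b \<Longrightarrow> app x b a = \<phi> b (f b a)"
      by blast
    show "\<exists>!x. x \<in> hom E A L \<and> (\<forall>v\<in>V. p v \<cdot> x = q v)"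
    proof (rule ex1I[of _ x], intro conjI ballI x(1))
      fix v assume v: "v \<in> V"
      have qv: "q v \<in> hom E A (X v)" using q v by blast
      show "p v \<cdot> x = q v"
      proof (rule app_ext[OF comp_hom[OF E x(1) p[OF v]] qv])
        fix b a assume b: "b \<in> Obj B" and a: "a \<in> sec A b"
        show "app (p v \<cdot> x) b a = app (q v) b a"
          using app_comp[OF x(1) p[OF v] b a] x(2)[OF b a] papp[OF v b \<psi>\<phi>(2)[OF b fZ[OF b a]]]
            \<psi>\<phi>(1)[OF b fZ[OF b a]] v by (simp add: f_def)
      qed
    next
      fix x' assume x': "x' \<in> hom E A L \<and> (\<forall>v\<in>V. p v \<cdot> x' = q v)"
      then have x'h: "x' \<in> hom E A L" by simp
      show "x' = x"
      proof (rule app_ext[OF x'h x(1)])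
        fix b a assume b: "b \<in> Obj B" and a: "a \<in> sec A b"
        have "\<psi> b (app x' b a) = f b a"
        proof (rule extensionalityI[of _ V])
          show "\<psi> b (app x' b a) \<in> extensional V" using ZD(1)[OF \<psi>(1)[OF b app_in[OF x'h b a]]] .
          fix v assume v: "v \<in> V"
          show "\<psi> b (app x' b a) v = f b a v"
            using papp[OF v b app_in[OF x'h b a]] app_comp[OF x'h p[OF v] b a] x' v by (simp add: f_def)
        qed (simp add: f_def)
        then show "app x' b a = app x b a" using \<psi>(2)[OF b app_in[OF x'h b a]] x(2)[OF b a] by simp
      qed
    qed
  qed
  then show ?thesis
  proof (intro exI[of _ L] exI[of _ p] conjI ballI allI impI)
    fix b y assume "b \<in> Obj B" "\<forall>v\<in>V. y v \<in> sec (X v) b" "\<forall>(v, w, h)\<in>Ed. app h b (y v) = y w"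
    then show "\<exists>!z. z \<in> sec L b \<and> (\<forall>v\<in>V. app (p v) b z = y v)" by (intro sections) auto
  qed
qed

text \<open>A limit chosen elsewhere is isomorphic to the one constructed by sections, and the isomorphism carries
the description of the sections over.\<close>

lemma limit_sections:
  fixes V :: "'v set"
  assumes V: "small_in TYPE('u) V" and X: "\<And>v. v \<in> V \<Longrightarrow> X v \<in> Obj E"
    and Ed: "\<And>v w h. (v, w, h) \<in> Ed \<Longrightarrow> v \<in> V \<and> w \<in> V \<and> h \<in> hom E (X v) (X w)"
    and lim: "limit_cone E V X Ed L p" and b: "b \<in> Obj B"
    and y: "\<And>v. v \<in> V \<Longrightarrow> y v \<in> sec (X v) b"
      "\<And>v w h. (v, w, h) \<in> Ed \<Longrightarrow> app h b (y v) = y w"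
  shows "\<exists>!z. z \<in> sec L b \<and> (\<forall>v\<in>V. app (p v) b z = y v)"
proof -
  have "\<exists>L0 p0. limit_cone E V X Ed L0 p0 \<and> (\<forall>b\<in>Obj B. \<forall>y. (\<forall>v\<in>V. y v \<in> sec (X v) b) \<longrightarrow>
      (\<forall>(v, w, h)\<in>Ed. app h b (y v) = y w) \<longrightarrow> (\<exists>!z. z \<in> sec L0 b \<and> (\<forall>v\<in>V. app (p0 v) b z = y v)))"
    by (rule limits_exist[OF V X Ed])
  then obtain L0 p0 where lim0: "limit_cone E V X Ed L0 p0"
    and sec0: "\<forall>b\<in>Obj B. \<forall>y. (\<forall>v\<in>V. y v \<in> sec (X v) b) \<longrightarrow>
      (\<forall>(v, w, h)\<in>Ed. app h b (y v) = y w) \<longrightarrow> (\<exists>!z. z \<in> sec L0 b \<and> (\<forall>v\<in>V. app (p0 v) b z = y v))"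
    by (elim exE conjE)
  note L = limit_cone_arr(1)[OF lim] and p = limit_cone_arr(2)[OF lim]
    and pe = limit_cone_arr(3)[OF lim]
  note L0 = limit_cone_arr(1)[OF lim0] and p0 = limit_cone_arr(2)[OF lim0]
    and p0e = limit_cone_arr(3)[OF lim0]
  have "\<exists>!x. x \<in> hom E L L0 \<and> (\<forall>v\<in>V. p0 v \<cdot> x = p v)"
    by (rule limit_cone_universal[OF lim0 L p pe])
  then obtain x where "x \<in> hom E L L0 \<and> (\<forall>v\<in>V. p0 v \<cdot> x = p v)" by (elim ex1E)
  then have x: "x \<in> hom E L L0" "\<And>v. v \<in> V \<Longrightarrow> p0 v \<cdot> x = p v" by auto
  have "\<exists>!x. x \<in> hom E L0 L \<and> (\<forall>v\<in>V. p v \<cdot> x = p0 v)"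
    by (rule limit_cone_universal[OF lim L0 p0 p0e])
  then obtain x0 where "x0 \<in> hom E L0 L \<and> (\<forall>v\<in>V. p v \<cdot> x0 = p0 v)" by (elim ex1E)
  then have x0: "x0 \<in> hom E L0 L" "\<And>v. v \<in> V \<Longrightarrow> p v \<cdot> x0 = p0 v" by auto
  have "\<exists>!x. x \<in> hom E L L \<and> (\<forall>v\<in>V. p v \<cdot> x = p v)"
    by (rule limit_cone_universal[OF lim L p pe])
  then obtain u where u: "\<forall>x. x \<in> hom E L L \<and> (\<forall>v\<in>V. p v \<cdot> x = p v) \<longrightarrow> x = u" by (elim ex1E)
  have "p v \<cdot> (x0 \<cdot> x) = p v" if "v \<in> V" for v
    using comp_assoc[OF E x(1) x0(1) p[OF that]] x(2)[OF that] x0(2)[OF that] by simp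
  moreover have "p v \<cdot> Ide E L = p v" if "v \<in> V" for v using comp_ide(1)[OF E p[OF that]] .
  ultimately have id: "x0 \<cdot> x = Ide E L"
    using u[rule_format, of "x0 \<cdot> x"] u[rule_format, of "Ide E L"]
      comp_hom[OF E x(1) x0(1)] ide_hom[OF E L] by simp
  have "\<exists>!z. z \<in> sec L0 b \<and> (\<forall>v\<in>V. app (p0 v) b z = y v)" by (rule sec0[rule_format, OF b]) (use y in auto)
  then obtain z0 where z0: "z0 \<in> sec L0 b" "\<And>v. v \<in> V \<Longrightarrow> app (p0 v) b z0 = y v"
    and uniq: "\<And>z. z \<in> sec L0 b \<Longrightarrow> \<forall>v\<in>V. app (p0 v) b z = y v \<Longrightarrow> z = z0" by (elim ex1E) blast
  show ?thesis
  proof (rule ex1I[of _ "app x0 b z0"], intro conjI ballI)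
    show "app x0 b z0 \<in> sec L b" by (rule app_in[OF x0(1) b z0(1)])
    show "app (p v) b (app x0 b z0) = y v" if "v \<in> V" for v
      using app_comp[OF x0(1) p[OF that] b z0(1)] x0(2)[OF that] z0(2)[OF that] by simp
    fix z assume "z \<in> sec L b \<and> (\<forall>v\<in>V. app (p v) b z = y v)"
    then have z: "z \<in> sec L b" "\<And>v. v \<in> V \<Longrightarrow> app (p v) b z = y v" by auto
    have "app (p0 v) b (app x b z) = y v" if "v \<in> V" for v
      using app_comp[OF x(1) p0[OF that] b z(1)] x(2)[OF that] z(2)[OF that] by simp
    then have "app x b z = z0" by (intro uniq app_in[OF x(1) b z(1)]) blast
    then show "z = app x0 b z0" using app_comp[OF x(1) x0(1) b z(1)] id app_ide[OF L b z(1)] by simp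
  qed
qed

lemma terminal_limit: "is_terminal E T \<longleftrightarrow> limit_cone E ({} :: nat set) X {} T p"
  unfolding is_terminal_def limit_cone_def by auto

lemma terminal_exists: "\<exists>T. is_terminal E T"
proof -
  fix X :: "nat \<Rightarrow> 'o"
  have "\<exists>L p. limit_cone E {} X {} L p \<and> (\<forall>b\<in>Obj B. \<forall>y. (\<forall>v\<in>{}. y v \<in> sec (X v) b) \<longrightarrow>
    (\<forall>(v, w, h)\<in>{}. app h b (y v) = y w) \<longrightarrow> (\<exists>!z. z \<in> sec L b \<and> (\<forall>v\<in>{}. app (p v) b z = y v)))"
    by (rule limits_exist) (auto simp: small_in_finite)
  then show ?thesis using terminal_limit by blast
qed

lemma terminal_sections:
  assumes T: "is_terminal E T" and b: "b \<in> Obj B"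
  shows "\<exists>!z. z \<in> sec T b"
proof -
  fix X :: "nat \<Rightarrow> 'o" and p :: "nat \<Rightarrow> 'a" and y :: "nat \<Rightarrow> 'u"
  have "\<exists>!z. z \<in> sec T b \<and> (\<forall>v\<in>{}. app (p v) b z = y v)"
    by (rule limit_sections[OF _ _ _ terminal_limit[THEN iffD1, OF T] b]) (auto simp: small_in_finite)
  then show ?thesis by simp
qed

lemma pullback_exists:
  assumes f: "f \<in> hom E X Z" and g: "g \<in> hom E Y Z"
  shows "\<exists>p q. is_pullback E f g p q"
proof -
  \<comment> \<open>The vertices \<open>0\<close> and \<open>1\<close> are the two domains, \<open>2\<close> is the common codomain.\<close>
  define W where "W v = (if v = 0 then X else if v = 1 then Y else Z)" for v :: nat
  note XYZ = hom_obj[OF E f] hom_obj[OF E g] and fD = homD[OF f] and gD = homD[OF g]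
  let ?V = "{0, 1, 2 :: nat}" and ?Ed = "{(0, 2, f), (1, 2, g)} :: (nat \<times> nat \<times> 'a) set"
  have "\<exists>L p. limit_cone E ?V W ?Ed L p \<and> (\<forall>b\<in>Obj B. \<forall>y. (\<forall>v\<in>?V. y v \<in> sec (W v) b) \<longrightarrow>
    (\<forall>(v, w, h)\<in>?Ed. app h b (y v) = y w) \<longrightarrow> (\<exists>!z. z \<in> sec L b \<and> (\<forall>v\<in>?V. app (p v) b z = y v)))"
    by (rule limits_exist) (use XYZ f g in \<open>auto simp: small_in_finite W_def\<close>)
  then obtain L p where lim: "limit_cone E ?V W ?Ed L p" by (elim exE conjE)
  have p: "p 0 \<in> hom E L X" "p 1 \<in> hom E L Y" "p 2 \<in> hom E L Z"
    "f \<cdot> p 0 = p 2" "g \<cdot> p 1 = p 2"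
    using limit_cone_arr(2)[OF lim, of 0] limit_cone_arr(2)[OF lim, of 1]
      limit_cone_arr(2)[OF lim, of 2] limit_cone_arr(3)[OF lim, of 0 2 f]
      limit_cone_arr(3)[OF lim, of 1 2 g] by (simp_all add: W_def)
  have "\<exists>!h. h \<in> hom E (Dom E r) (Dom E (p 0)) \<and> p 0 \<cdot> h = r \<and> p 1 \<cdot> h = s"
    if r: "r \<in> Arr E" "s \<in> Arr E" "Dom E r = Dom E s" "Cod E r = Dom E f" "Cod E s = Dom E g"
      "f \<cdot> r = g \<cdot> s" for r s
  proof -
    have r': "r \<in> hom E (Dom E r) X" "s \<in> hom E (Dom E r) Y" using r fD gD by (auto simp: hom_def)
    define q where "q v = (if v = 0 then r else if v = 1 then s else f \<cdot> r)" for v :: nat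
    have q: "\<forall>v\<in>{0, 1, 2}. q v \<in> hom E (Dom E r) (W v)" "\<forall>(v, w, h)\<in>{(0, 2, f), (1, 2, g)}. h \<cdot> q v = q w"
      using r' r(6) comp_hom[OF E r'(1) f] by (auto simp: q_def W_def)
    have "\<exists>!x. x \<in> hom E (Dom E r) L \<and> (\<forall>v\<in>{0, 1, 2}. p v \<cdot> x = q v)"
      by (rule limit_cone_universal[OF lim hom_obj(1)[OF E r'(1)]]) (use q in auto)
    moreover have "x \<in> hom E (Dom E r) L \<and> (\<forall>v\<in>{0, 1, 2}. p v \<cdot> x = q v) \<longleftrightarrow>
      x \<in> hom E (Dom E r) (Dom E (p 0)) \<and> p 0 \<cdot> x = r \<and> p 1 \<cdot> x = s" for x
      using homD[OF p(1)] comp_assoc[OF E _ p(1) f, of x] p(4) by (auto simp: q_def)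
    ultimately show ?thesis by simp
  qed
  then have "is_pullback E f g (p 0) (p 1)"
    unfolding is_pullback_def using homD[OF p(1)] homD[OF p(2)] fD gD p(4,5) by auto
  then show ?thesis by blast
qed

end

text \<open>Products are given by cones, as the ones used below arise as chosen pullbacks over the chosen terminal
  object.\<close>

definition product_cone :: "('o, 'a) cat \<Rightarrow> 'o \<Rightarrow> 'o \<Rightarrow> 'o \<Rightarrow> 'a \<Rightarrow> 'a \<Rightarrow> bool" where
  "product_cone E X Y Q p q \<longleftrightarrow> p \<in> hom E Q X \<and> q \<in> hom E Q Y \<and>
     (\<forall>A r s. r \<in> hom E A X \<longrightarrow> s \<in> hom E A Y \<longrightarrow>
        (\<exists>!h. h \<in> hom E A Q \<and> p \<cdot>\<^bsub>E\<^esub> h = r \<and> q \<cdot>\<^bsub>E\<^esub> h = s))"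

lemma product_cone_universal:
  assumes "product_cone E X Y Q p q" "r \<in> hom E A X" "s \<in> hom E A Y"
  shows "\<exists>!h. h \<in> hom E A Q \<and> p \<cdot>\<^bsub>E\<^esub> h = r \<and> q \<cdot>\<^bsub>E\<^esub> h = s"
proof -
  have *: "\<forall>A r s. r \<in> hom E A X \<longrightarrow> s \<in> hom E A Y \<longrightarrow>
        (\<exists>!h. h \<in> hom E A Q \<and> p \<cdot>\<^bsub>E\<^esub> h = r \<and> q \<cdot>\<^bsub>E\<^esub> h = s)"
    using assms(1) unfolding product_cone_def by (elim conjE)
  show ?thesis by (rule *[rule_format, OF assms(2,3)])
qed

text \<open>A product is a limit over two vertices, so that its sections are pairs.\<close>

lemma (in sheaf_model) product_sections:
  assumes Q: "product_cone E X Y Q p q" and b: "b \<in> Obj B" and x: "x \<in> sec X b" and y: "y \<in> sec Y b"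
  shows "\<exists>!z. z \<in> sec Q b \<and> app p b z = x \<and> app q b z = y"
proof -
  define W where "W v = (if v then X else Y)" for v :: bool
  have pq: "p \<in> hom E Q X" "q \<in> hom E Q Y" using Q by (auto simp: product_cone_def)
  have W: "W v \<in> Obj E" for v using hom_obj(2)[OF E pq(1)] hom_obj(2)[OF E pq(2)] by (simp add: W_def)
  have eq: "(\<forall>v\<in>UNIV. P v) \<longleftrightarrow> P True \<and> P False" for P by (simp add: UNIV_bool conj_commute)
  have lim: "limit_cone E UNIV W {} Q (\<lambda>v. if v then p else q)"
    unfolding limit_cone_def
  proof (intro conjI allI impI)
    fix A :: 'o and r :: "bool \<Rightarrow> 'a" assume "\<forall>v\<in>UNIV. r v \<in> hom E A (W v)"
    then have "r True \<in> hom E A X" "r False \<in> hom E A Y" unfolding eq by (simp_all add: W_def)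
    then have "\<exists>!h. h \<in> hom E A Q \<and> p \<cdot> h = r True \<and> q \<cdot> h = r False"
      by (rule product_cone_universal[OF Q])
    then show "\<exists>!h. h \<in> hom E A Q \<and> (\<forall>v\<in>UNIV. (if v then p else q) \<cdot> h = r v)"
      unfolding eq by simp
  qed (use hom_obj(1)[OF E pq(1)] pq in \<open>auto simp: W_def\<close>)
  have "\<exists>!z. z \<in> sec Q b \<and> (\<forall>v\<in>UNIV. app (if v then p else q) b z = (if v then x else y))"
    by (rule limit_sections[OF small_in_finite W _ lim b]) (use x y in \<open>auto simp: W_def\<close>)
  then show ?thesis unfolding eq by simp
qed

subsection \<open>Colimits\<close>

context sheaf_model
begin

definition summands :: "('j, 'k) cat \<Rightarrow> ('j, 'k, 'o, 'a) ftr \<Rightarrow> 'u \<Rightarrow> ('j \<times> 'u) set" where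
  "summands I F b = (SIGMA i:Obj I. sec (FO F i) b)"

definition restr :: "('j, 'k, 'o, 'a) ftr \<Rightarrow> 'u \<Rightarrow> 'j \<times> 'u \<Rightarrow> 'j \<times> 'u" where
  "restr F f p = (fst p, res (FO F (fst p)) f (snd p))"

text \<open>The least congruence which identifies sections along the arrows of the diagram and is local for
  the topology; the colimit is the sheaf of sections given locally modulo it.\<close>

inductive cong :: "('j, 'k) cat \<Rightarrow> ('j, 'k, 'o, 'a) ftr \<Rightarrow> 'u \<Rightarrow> 'j \<times> 'u \<Rightarrow> 'j \<times> 'u \<Rightarrow> bool"
  for I :: "('j, 'k) cat" and F :: "('j, 'k, 'o, 'a) ftr" where
  cong_refl: "b \<in> Obj B \<Longrightarrow> p \<in> summands I F b \<Longrightarrow> cong I F b p p"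
| cong_sym: "cong I F b p q \<Longrightarrow> cong I F b q p"
| cong_trans: "cong I F b p q \<Longrightarrow> cong I F b q r \<Longrightarrow> cong I F b p r"
| cong_edge: "b \<in> Obj B \<Longrightarrow> u \<in> hom I i j \<Longrightarrow> x \<in> sec (FO F i) b \<Longrightarrow>
    cong I F b (i, x) (j, app (FA F u) b x)"
| cong_local: "b \<in> Obj B \<Longrightarrow> S \<in> J b \<Longrightarrow> p \<in> summands I F b \<Longrightarrow> q \<in> summands I F b \<Longrightarrow>
    (\<And>f. f \<in> S \<Longrightarrow> cong I F (Dom B f) (restr F f p) (restr F f q)) \<Longrightarrow> cong I F b p q"

text \<open>A section of the colimit over \<open>b\<close>, represented by the set of all pairs \<open>(f, p)\<close> such that its
  restriction along \<open>f\<close> is the image of \<open>p\<close>. Unlike a family on one cover, this set is determined by the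
  section, so that no quotient has to be taken. The conditions say in turn that \<open>p\<close> is unique modulo the
  congruence, that the set is closed under the congruence and under restriction, that membership is
  local, and that the section is locally in the image of the diagram.\<close>

definition amalgam ::
  "('j, 'k) cat \<Rightarrow> ('j, 'k, 'o, 'a) ftr \<Rightarrow> 'u \<Rightarrow> ('u \<times> 'j \<times> 'u) set \<Rightarrow> bool" where
  "amalgam I F b w \<longleftrightarrow>
     (\<forall>(f, p)\<in>w. f \<in> Arr B \<and> Cod B f = b \<and> p \<in> summands I F (Dom B f)) \<and>
     (\<forall>f p q. (f, p) \<in> w \<longrightarrow> (f, q) \<in> w \<longrightarrow> cong I F (Dom B f) p q) \<and>
     (\<forall>f p q. (f, p) \<in> w \<longrightarrow> cong I F (Dom B f) p q \<longrightarrow> (f, q) \<in> w) \<and>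
     (\<forall>f p a g. (f, p) \<in> w \<longrightarrow> g \<in> hom B a (Dom B f) \<longrightarrow> (f \<cdot>\<^bsub>B\<^esub> g, restr F g p) \<in> w) \<and>
     (\<forall>a f p S. f \<in> hom B a b \<longrightarrow> p \<in> summands I F a \<longrightarrow> S \<in> J a \<longrightarrow>
        (\<forall>g\<in>S. (f \<cdot>\<^bsub>B\<^esub> g, restr F g p) \<in> w) \<longrightarrow> (f, p) \<in> w) \<and>
     fst ` w \<in> J b"

definition amalgam_res ::
  "('j, 'k) cat \<Rightarrow> ('j, 'k, 'o, 'a) ftr \<Rightarrow> 'u \<Rightarrow> ('u \<times> 'j \<times> 'u) set \<Rightarrow> ('u \<times> 'j \<times> 'u) set" where
  "amalgam_res I F g w = {(f, p). f \<in> Arr B \<and> Cod B f = Dom B g \<and> p \<in> summands I F (Dom B f) \<and>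
     (g \<cdot>\<^bsub>B\<^esub> f, p) \<in> w}"

definition germ ::
  "('j, 'k) cat \<Rightarrow> ('j, 'k, 'o, 'a) ftr \<Rightarrow> 'u \<Rightarrow> 'j \<times> 'u \<Rightarrow> ('u \<times> 'j \<times> 'u) set" where
  "germ I F b p = {(f, q). f \<in> Arr B \<and> Cod B f = b \<and> cong I F (Dom B f) (restr F f p) q}"

lemma amalgamI:
  assumes "\<And>f p. (f, p) \<in> w \<Longrightarrow> f \<in> hom B (Dom B f) b" "\<And>f p. (f, p) \<in> w \<Longrightarrow> p \<in> summands I F (Dom B f)"
    and "\<And>f p q. (f, p) \<in> w \<Longrightarrow> (f, q) \<in> w \<Longrightarrow> cong I F (Dom B f) p q"
    and "\<And>f p q. (f, p) \<in> w \<Longrightarrow> cong I F (Dom B f) p q \<Longrightarrow> (f, q) \<in> w"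
    and "\<And>f p a g. (f, p) \<in> w \<Longrightarrow> g \<in> hom B a (Dom B f) \<Longrightarrow> (f \<cdot>\<^bsub>B\<^esub> g, restr F g p) \<in> w"
    and "\<And>a f p S. f \<in> hom B a b \<Longrightarrow> p \<in> summands I F a \<Longrightarrow> S \<in> J a \<Longrightarrow>
        (\<And>g. g \<in> S \<Longrightarrow> (f \<cdot>\<^bsub>B\<^esub> g, restr F g p) \<in> w) \<Longrightarrow> (f, p) \<in> w"
    and "fst ` w \<in> J b"
  shows "amalgam I F b w"
proof -
  have "\<forall>(f, p)\<in>w. f \<in> Arr B \<and> Cod B f = b \<and> p \<in> summands I F (Dom B f)"
    using assms(1,2) by (auto simp: hom_def)
  then show ?thesis unfolding amalgam_def
    by (intro conjI allI impI) (auto intro: assms(3-7))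
qed

lemma amalgamD:
  assumes "amalgam I F b w"
  shows "(f, p) \<in> w \<Longrightarrow> f \<in> hom B (Dom B f) b" "(f, p) \<in> w \<Longrightarrow> p \<in> summands I F (Dom B f)"
    and "(f, p) \<in> w \<Longrightarrow> (f, q) \<in> w \<Longrightarrow> cong I F (Dom B f) p q"
    and "(f, p) \<in> w \<Longrightarrow> cong I F (Dom B f) p q \<Longrightarrow> (f, q) \<in> w"
    and "(f, p) \<in> w \<Longrightarrow> g \<in> hom B a (Dom B f) \<Longrightarrow> (f \<cdot>\<^bsub>B\<^esub> g, restr F g p) \<in> w"
    and "f \<in> hom B a b \<Longrightarrow> p \<in> summands I F a \<Longrightarrow> S \<in> J a \<Longrightarrow>
        (\<And>g. g \<in> S \<Longrightarrow> (f \<cdot>\<^bsub>B\<^esub> g, restr F g p) \<in> w) \<Longrightarrow> (f, p) \<in> w"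
    and "fst ` w \<in> J b"
proof -
  note * = assms[unfolded amalgam_def]
  show "(f, p) \<in> w \<Longrightarrow> f \<in> hom B (Dom B f) b" "(f, p) \<in> w \<Longrightarrow> p \<in> summands I F (Dom B f)"
    using *[THEN conjunct1] by (auto simp: hom_def)
  show "(f, p) \<in> w \<Longrightarrow> (f, q) \<in> w \<Longrightarrow> cong I F (Dom B f) p q"
    by (rule *[THEN conjunct2, THEN conjunct1, rule_format])
  show "(f, p) \<in> w \<Longrightarrow> cong I F (Dom B f) p q \<Longrightarrow> (f, q) \<in> w"
    by (rule *[THEN conjunct2, THEN conjunct2, THEN conjunct1, rule_format])
  show "(f, p) \<in> w \<Longrightarrow> g \<in> hom B a (Dom B f) \<Longrightarrow> (f \<cdot>\<^bsub>B\<^esub> g, restr F g p) \<in> w"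
    by (rule *[THEN conjunct2, THEN conjunct2, THEN conjunct2, THEN conjunct1, rule_format])
  show "f \<in> hom B a b \<Longrightarrow> p \<in> summands I F a \<Longrightarrow> S \<in> J a \<Longrightarrow>
      (\<And>g. g \<in> S \<Longrightarrow> (f \<cdot>\<^bsub>B\<^esub> g, restr F g p) \<in> w) \<Longrightarrow> (f, p) \<in> w"
    by (rule *[THEN conjunct2, THEN conjunct2, THEN conjunct2, THEN conjunct2, THEN conjunct1, rule_format])
  show "fst ` w \<in> J b"
    by (rule *[THEN conjunct2, THEN conjunct2, THEN conjunct2, THEN conjunct2, THEN conjunct2])
qed

end

locale sheaf_diagram = sheaf_model E B J sec res app
  for E :: "('o, 'a) cat" (structure) and B :: "('u::universe, 'u) cat" and J sec res and app :: "'a \<Rightarrow> 'u \<Rightarrow> 'u \<Rightarrow> 'u" +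
  fixes I :: "('j, 'k) cat" and F :: "('j, 'k, 'o, 'a) ftr"
  assumes F: "is_functor I E F" and small_I: "small_in TYPE('u) (Obj I)"
begin

lemma Fo: "i \<in> Obj I \<Longrightarrow> FO F i \<in> Obj E"
  by (rule functor_obj[OF F])

lemma summandsE:
  assumes "p \<in> summands I F b"
  obtains i x where "p = (i, x)" "i \<in> Obj I" "x \<in> sec (FO F i) b"
  using assms by (auto simp: summands_def)

lemma restr_in: "f \<in> hom B a b \<Longrightarrow> p \<in> summands I F b \<Longrightarrow> restr F f p \<in> summands I F a"
  by (auto simp: summands_def restr_def intro: res_in[OF Fo])

lemma restr_comp:
  "f \<in> hom B b c \<Longrightarrow> g \<in> hom B a b \<Longrightarrow> p \<in> summands I F c \<Longrightarrow>
    restr F g (restr F f p) = restr F (f \<cdot>\<^bsub>B\<^esub> g) p"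
  by (auto simp: summands_def restr_def intro!: res_comp[OF Fo])

lemma restr_ide: "b \<in> Obj B \<Longrightarrow> p \<in> summands I F b \<Longrightarrow> restr F (Ide B b) p = p"
  by (auto simp: summands_def restr_def sheaf_on_ide[OF sec_sheaf[OF Fo]])

lemma cong_in:
  assumes "cong I F b p q"
  shows "b \<in> Obj B \<and> p \<in> summands I F b \<and> q \<in> summands I F b"
  using assms
proof (induction rule: cong.induct)
  case (cong_edge b u i j x)
  then show ?case
    using app_in[OF functor_hom[OF F cong_edge(2)] cong_edge(1,3)]
      hom_obj[OF functor_category(1)[OF F] cong_edge(2)] by (auto simp: summands_def)
qed auto

text \<open>For the local rule, the cover is pulled back along the restriction.\<close>

lemma cong_restr:
  assumes "cong I F b p q" "f \<in> hom B a b"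
  shows "cong I F a (restr F f p) (restr F f q)"
  using assms
proof (induction arbitrary: a f rule: cong.induct)
  case (cong_refl b p)
  then show ?case using cong.cong_refl[OF _ restr_in] hom_obj(1)[OF B] by blast
next
  case (cong_sym b p q)
  then show ?case using cong.cong_sym by blast
next
  case (cong_trans b p q r)
  then show ?case using cong.cong_trans by blast
next
  case (cong_edge b u i j x)
  show ?case
    using cong.cong_edge[where F = F, OF hom_obj(1)[OF B cong_edge(4)] cong_edge(2), of "res (FO F i) f x"]
      app_res[OF functor_hom[OF F cong_edge(2)] cong_edge(4,3)]
      res_in[OF Fo cong_edge(4,3)] hom_obj[OF functor_category(1)[OF F] cong_edge(2)]
    by (simp add: restr_def)
next
  case (cong_local b S p q)
  note f = \<open>f \<in> hom B a b\<close>
  show ?case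
  proof (rule cong.cong_local[OF hom_obj(1)[OF B f] J_pullback[OF cong_local(2) f]
        restr_in[OF f cong_local(3)] restr_in[OF f cong_local(4)]])
    fix g assume g: "g \<in> sieve_pullback B f S"
    then have gh: "g \<in> hom B (Dom B g) a" and fg: "f \<cdot>\<^bsub>B\<^esub> g \<in> S"
      using homD[OF f] by (auto simp: sieve_pullback_def hom_def)
    have "Dom B (f \<cdot>\<^bsub>B\<^esub> g) = Dom B g" using homD[OF comp_hom[OF B gh f]] by simp
    then show "cong I F (Dom B g) (restr F g (restr F f p)) (restr F g (restr F f q))"
      using cong_local(5)[OF fg] restr_comp[OF f gh] cong_local(3,4) by simp
  qed
qed

text \<open>Locality of the congruence is what makes membership in the germ local.\<close>

lemma germ_amalgam:
  assumes b: "b \<in> Obj B" and p: "p \<in> summands I F b"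
  shows "amalgam I F b (germ I F b p)"
proof (rule amalgamI)
  fix f q assume "(f, q) \<in> germ I F b p"
  then have f: "f \<in> hom B (Dom B f) b" and q: "cong I F (Dom B f) (restr F f p) q"
    by (auto simp: germ_def hom_def)
  show "f \<in> hom B (Dom B f) b" by (fact f)
  show "q \<in> summands I F (Dom B f)" using cong_in[OF q] by simp
  show "cong I F (Dom B f) q q'" if "(f, q') \<in> germ I F b p" for q'
  proof -
    have "cong I F (Dom B f) (restr F f p) q'" using that by (simp add: germ_def)
    then show ?thesis by (rule cong_trans[OF cong_sym[OF q]])
  qed
  show "(f, q') \<in> germ I F b p" if "cong I F (Dom B f) q q'" for q'
    using cong_trans[OF q that] homD[OF f] by (simp add: germ_def)
  show "(f \<cdot>\<^bsub>B\<^esub> g, restr F g q) \<in> germ I F b p" if g: "g \<in> hom B a (Dom B f)" for a g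
    using homD[OF comp_hom[OF B g f]] cong_restr[OF q g] restr_comp[OF f g p] by (simp add: germ_def)
next
  fix a f q S assume f: "f \<in> hom B a b" and q: "q \<in> summands I F a" and S: "S \<in> J a"
    and *: "\<And>g. g \<in> S \<Longrightarrow> (f \<cdot>\<^bsub>B\<^esub> g, restr F g q) \<in> germ I F b p"
  note a = hom_obj(1)[OF B f]
  have "cong I F a (restr F f p) q"
  proof (rule cong_local[OF a S restr_in[OF f p] q])
    fix g assume g: "g \<in> S"
    note gh = sieve_arr[OF a S g]
    have "Dom B (f \<cdot>\<^bsub>B\<^esub> g) = Dom B g" using homD[OF comp_hom[OF B gh f]] by simp
    then show "cong I F (Dom B g) (restr F g (restr F f p)) (restr F g q)"
      using *[OF g] restr_comp[OF f gh p] by (simp add: germ_def)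
  qed
  then show "(f, q) \<in> germ I F b p" using homD[OF f] by (simp add: germ_def)
next
  have "f \<in> fst ` germ I F b p" if f: "f \<in> Arr B" "Cod B f = b" for f
    by (rule image_eqI[of _ _ "(f, restr F f p)"])
      (use f cong_refl[OF Dom_obj[OF B f(1)] restr_in[OF _ p]] in \<open>auto simp: germ_def hom_def\<close>)
  then have "fst ` germ I F b p = {f \<in> Arr B. Cod B f = b}" by (auto simp: germ_def)
  then show "fst ` germ I F b p \<in> J b" using J_max[OF b] by simp
qed

lemma amalgam_res_amalgam:
  assumes w: "amalgam I F b w" and g: "g \<in> hom B a b"
  shows "amalgam I F a (amalgam_res I F g w)"
proof (rule amalgamI)
  note gD = homD[OF g]
  fix f p assume fp: "(f, p) \<in> amalgam_res I F g w"
  then have f: "f \<in> hom B (Dom B f) a" and p: "p \<in> summands I F (Dom B f)" and gf: "(g \<cdot>\<^bsub>B\<^esub> f, p) \<in> w"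
    using gD by (auto simp: amalgam_res_def hom_def)
  have D: "Dom B (g \<cdot>\<^bsub>B\<^esub> f) = Dom B f" using homD[OF comp_hom[OF B f g]] by simp
  show "f \<in> hom B (Dom B f) a" "p \<in> summands I F (Dom B f)" by (fact f p)+
  show "cong I F (Dom B f) p q" if "(f, q) \<in> amalgam_res I F g w" for q
    using amalgamD(3)[OF w gf, of q] that D by (simp add: amalgam_res_def)
  show "(f, q) \<in> amalgam_res I F g w" if "cong I F (Dom B f) p q" for q
    using amalgamD(4)[OF w gf, of q] that D cong_in[OF that] f gD by (simp add: amalgam_res_def hom_def)
  show "(f \<cdot>\<^bsub>B\<^esub> h, restr F h p) \<in> amalgam_res I F g w" if h: "h \<in> hom B c (Dom B f)" for c h
    using amalgamD(5)[OF w gf, of h c] h D homD[OF comp_hom[OF B h f]] restr_in[OF h p]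
      comp_assoc[OF B h f g] gD by (simp add: amalgam_res_def)
next
  note gD = homD[OF g]
  fix c f p S assume f: "f \<in> hom B c a" and p: "p \<in> summands I F c" and S: "S \<in> J c"
    and *: "\<And>h. h \<in> S \<Longrightarrow> (f \<cdot>\<^bsub>B\<^esub> h, restr F h p) \<in> amalgam_res I F g w"
  have "(g \<cdot>\<^bsub>B\<^esub> f, p) \<in> w"
  proof (rule amalgamD(6)[OF w comp_hom[OF B f g] p S])
    fix h assume h: "h \<in> S"
    show "((g \<cdot>\<^bsub>B\<^esub> f) \<cdot>\<^bsub>B\<^esub> h, restr F h p) \<in> w"
      using *[OF h] comp_assoc[OF B sieve_arr[OF hom_obj(1)[OF B f] S h] f g] by (simp add: amalgam_res_def)
  qed
  then show "(f, p) \<in> amalgam_res I F g w" using homD[OF f] gD p by (simp add: amalgam_res_def)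
next
  note gD = homD[OF g]
  have "fst ` amalgam_res I F g w = sieve_pullback B g (fst ` w)"
  proof (intro set_eqI iffI)
    fix f assume "f \<in> sieve_pullback B g (fst ` w)"
    then obtain p where f: "f \<in> Arr B" "Cod B f = a" and p: "(g \<cdot>\<^bsub>B\<^esub> f, p) \<in> w"
      using gD by (auto simp: sieve_pullback_def)
    have "p \<in> summands I F (Dom B f)"
      using amalgamD(2)[OF w p] homD[OF comp_hom[OF B _ g, of f "Dom B f"]] f by (simp add: hom_def)
    then show "f \<in> fst ` amalgam_res I F g w"
      using p f gD by (intro image_eqI[of _ _ "(f, p)"]) (auto simp: amalgam_res_def)
  qed (auto simp: amalgam_res_def sieve_pullback_def intro: rev_image_eqI)
  then show "fst ` amalgam_res I F g w \<in> J a" using J_pullback[OF amalgamD(7)[OF w] g] by simp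
qed

lemma amalgam_res_ide: "amalgam I F b w \<Longrightarrow> b \<in> Obj B \<Longrightarrow> amalgam_res I F (Ide B b) w = w"
proof -
  assume w: "amalgam I F b w" and b: "b \<in> Obj B"
  have 1: "Ide B b \<cdot>\<^bsub>B\<^esub> f = f" if "f \<in> Arr B" "Cod B f = b" for f
    using comp_ide(2)[OF B arr_hom[OF that(1)]] that by simp
  have 2: "f \<in> Arr B" "Cod B f = b" "p \<in> summands I F (Dom B f)" if "(f, p) \<in> w" for f p
    by (intro amalgamD(2)[OF w that] homD[OF amalgamD(1)[OF w that]])+
  have 3: "Dom B (Ide B b) = b" by (rule homD(2)[OF ide_hom[OF B b]])
  have "(f, p) \<in> amalgam_res I F (Ide B b) w \<longleftrightarrow> (f, p) \<in> w" for f p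
    unfolding amalgam_res_def 3 using 1[of f] 2[of f p] by auto
  then show ?thesis by auto
qed

lemma amalgam_res_comp:
  assumes f: "f \<in> hom B b c" and g: "g \<in> hom B a b"
  shows "amalgam_res I F g (amalgam_res I F f w) = amalgam_res I F (f \<cdot>\<^bsub>B\<^esub> g) w"
proof -
  have *: "f \<cdot>\<^bsub>B\<^esub> (g \<cdot>\<^bsub>B\<^esub> h) = (f \<cdot>\<^bsub>B\<^esub> g) \<cdot>\<^bsub>B\<^esub> h" "Dom B (g \<cdot>\<^bsub>B\<^esub> h) = Dom B h"
    "g \<cdot>\<^bsub>B\<^esub> h \<in> Arr B" "Cod B (g \<cdot>\<^bsub>B\<^esub> h) = b"
    if "h \<in> Arr B" "Cod B h = a" for h
    using comp_assoc[OF B _ g f, of h "Dom B h"] homD[OF comp_hom[OF B _ g, of h "Dom B h"]] that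
    by (auto simp: hom_def)
  show ?thesis
    using homD[OF f] homD[OF g] homD[OF comp_hom[OF B g f]] * by (auto simp: amalgam_res_def)
qed

text \<open>The restriction of an amalgam along \<open>g\<close> knows, at the identity, the pairs over \<open>g\<close>. This reduces
questions about restrictions to membership.\<close>

lemma amalgam_mem_res:
  assumes w: "amalgam I F b w" and g: "g \<in> hom B a b"
  shows "(Ide B a, p) \<in> amalgam_res I F g w \<longleftrightarrow> (g, p) \<in> w"
  using amalgamD(2)[OF w, of g p] comp_ide(1)[OF B g] homD[OF g] homD[OF ide_hom[OF B hom_obj(1)[OF B g]]]
  by (auto simp: amalgam_res_def)

text \<open>A matching family of amalgams glues to the set of all \<open>(h, p)\<close> that belong to it locally, on the part of
  the cover that lies over \<open>h\<close>. This set is covering by the local character of the topology.\<close>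

lemma amalgam_glue:
  assumes b: "b \<in> Obj B" and S: "S \<in> J b" and m: "\<And>f. f \<in> S \<Longrightarrow> amalgam I F (Dom B f) (m f)"
    and comp: "\<And>f g a. f \<in> S \<Longrightarrow> g \<in> hom B a (Dom B f) \<Longrightarrow> amalgam_res I F g (m f) = m (f \<cdot>\<^bsub>B\<^esub> g)"
  shows "\<exists>w. amalgam I F b w \<and> (\<forall>f\<in>S. amalgam_res I F f w = m f)"
proof -
  define w where "w = {(h, p). h \<in> hom B (Dom B h) b \<and> p \<in> summands I F (Dom B h) \<and>
    (\<forall>g a. g \<in> hom B a (Dom B h) \<longrightarrow> h \<cdot>\<^bsub>B\<^esub> g \<in> S \<longrightarrow> (Ide B a, restr F g p) \<in> m (h \<cdot>\<^bsub>B\<^esub> g))}"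
  have D: "Dom B (f \<cdot>\<^bsub>B\<^esub> g) = a" if "f \<in> hom B c d" "g \<in> hom B a c" for f g a c d
    using homD[OF comp_hom[OF B that(2,1)]] by simp
  have wD: "h \<in> hom B (Dom B h) b" "p \<in> summands I F (Dom B h)"
    "\<And>g a. g \<in> hom B a (Dom B h) \<Longrightarrow> h \<cdot>\<^bsub>B\<^esub> g \<in> S \<Longrightarrow> (Ide B a, restr F g p) \<in> m (h \<cdot>\<^bsub>B\<^esub> g)"
    if "(h, p) \<in> w" for h p
    using that unfolding w_def by auto
  have wI: "(h, p) \<in> w" if "h \<in> hom B c b" "p \<in> summands I F c"
    "\<And>g a. g \<in> hom B a c \<Longrightarrow> h \<cdot>\<^bsub>B\<^esub> g \<in> S \<Longrightarrow> (Ide B a, restr F g p) \<in> m (h \<cdot>\<^bsub>B\<^esub> g)" for h p c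
    using that homD[OF that(1)] unfolding w_def by auto
  have res_w: "(f \<cdot>\<^bsub>B\<^esub> g, p) \<in> w \<longleftrightarrow> (g, p) \<in> m f"
    if f: "f \<in> S" and g: "g \<in> hom B a (Dom B f)" and p: "p \<in> summands I F a" for f g p a
  proof
    note fh = sieve_arr[OF b S f]
    assume *: "(f \<cdot>\<^bsub>B\<^esub> g, p) \<in> w"
    have "(Ide B a, restr F (Ide B a) p) \<in> m ((f \<cdot>\<^bsub>B\<^esub> g) \<cdot>\<^bsub>B\<^esub> Ide B a)"
      by (rule wD(3)[OF *]) (use D[OF fh g] ide_hom[OF B hom_obj(1)[OF B g]]
          comp_ide(1)[OF B comp_hom[OF B g fh]] sieve_comp[OF b S f g] in auto)
    then have "(Ide B a, p) \<in> amalgam_res I F g (m f)"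
      using comp_ide(1)[OF B comp_hom[OF B g fh]] restr_ide[OF hom_obj(1)[OF B g] p] comp[OF f g] by simp
    then show "(g, p) \<in> m f" using amalgam_mem_res[OF m[OF f] g] by simp
  next
    note fh = sieve_arr[OF b S f]
    assume *: "(g, p) \<in> m f"
    show "(f \<cdot>\<^bsub>B\<^esub> g, p) \<in> w"
    proof (rule wI[OF comp_hom[OF B g fh] p])
      fix h c assume h: "h \<in> hom B c a"
      have "(g \<cdot>\<^bsub>B\<^esub> h, restr F h p) \<in> m f"
        using amalgamD(5)[OF m[OF f] *, of h c] h homD[OF g] by simp
      then show "(Ide B c, restr F h p) \<in> m ((f \<cdot>\<^bsub>B\<^esub> g) \<cdot>\<^bsub>B\<^esub> h)"
        using amalgam_mem_res[OF m[OF f] comp_hom[OF B h g]] comp[OF f comp_hom[OF B h g]]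
          comp_assoc[OF B h g fh] by simp
    qed
  qed
  have restr_w: "(h \<cdot>\<^bsub>B\<^esub> k, restr F k p) \<in> w" if hp: "(h, p) \<in> w" and k: "k \<in> hom B c (Dom B h)" for h p k c
  proof (rule wI[OF comp_hom[OF B k wD(1)[OF hp]] restr_in[OF k wD(2)[OF hp]]])
    fix g a assume g: "g \<in> hom B a c" and "(h \<cdot>\<^bsub>B\<^esub> k) \<cdot>\<^bsub>B\<^esub> g \<in> S"
    then show "(Ide B a, restr F g (restr F k p)) \<in> m ((h \<cdot>\<^bsub>B\<^esub> k) \<cdot>\<^bsub>B\<^esub> g)"
      using wD(3)[OF hp comp_hom[OF B g k]] comp_assoc[OF B g k wD(1)[OF hp]]
        restr_comp[OF k g wD(2)[OF hp]] by simp
  qed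
  have supp: "sieve B b (fst ` w)"
    unfolding sieve_def
  proof (intro conjI ballI impI subsetI)
    show "f \<in> {f \<in> Arr B. Cod B f = b}" if "f \<in> fst ` w" for f
      using that wD(1) by (auto simp: hom_def)
    fix f g assume f: "f \<in> fst ` w" and g: "g \<in> Arr B" "Cod B g = Dom B f"
    obtain p where "(f, p) \<in> w" using f by auto
    from restr_w[OF this, of g "Dom B g"] show "f \<cdot>\<^bsub>B\<^esub> g \<in> fst ` w"
      using g by (force simp: hom_def)
  qed
  have w: "amalgam I F b w"
  proof (rule amalgamI)
    fix h p assume hp: "(h, p) \<in> w"
    show "h \<in> hom B (Dom B h) b" "p \<in> summands I F (Dom B h)" by (rule wD[OF hp])+
    show "(h \<cdot>\<^bsub>B\<^esub> k, restr F k p) \<in> w" if "k \<in> hom B c (Dom B h)" for k c by (rule restr_w[OF hp that])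
    show "cong I F (Dom B h) p q" if hq: "(h, q) \<in> w" for q
    proof (rule cong_local[OF hom_obj(1)[OF B wD(1)[OF hp]] J_pullback[OF S wD(1)[OF hp]] wD(2)[OF hp] wD(2)[OF hq]])
      fix g assume "g \<in> sieve_pullback B h S"
      then have g: "g \<in> hom B (Dom B g) (Dom B h)" and hg: "h \<cdot>\<^bsub>B\<^esub> g \<in> S"
        by (auto simp: sieve_pullback_def hom_def)
      show "cong I F (Dom B g) (restr F g p) (restr F g q)"
        using amalgamD(3)[OF m[OF hg] wD(3)[OF hp g hg] wD(3)[OF hq g hg]]
          homD[OF ide_hom[OF B hom_obj(1)[OF B g]]] by simp
    qed
    show "(h, q) \<in> w" if pq: "cong I F (Dom B h) p q" for q
    proof (rule wI[OF wD(1)[OF hp]])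
      show "q \<in> summands I F (Dom B h)" using cong_in[OF pq] by simp
      fix g a assume g: "g \<in> hom B a (Dom B h)" and hg: "h \<cdot>\<^bsub>B\<^esub> g \<in> S"
      show "(Ide B a, restr F g q) \<in> m (h \<cdot>\<^bsub>B\<^esub> g)"
        by (rule amalgamD(4)[OF m[OF hg] wD(3)[OF hp g hg]])
          (use cong_restr[OF pq g] homD[OF ide_hom[OF B hom_obj(1)[OF B g]]] in simp)
    qed
  next
    fix a h p T assume h: "h \<in> hom B a b" and p: "p \<in> summands I F a" and T: "T \<in> J a"
      and *: "\<And>g. g \<in> T \<Longrightarrow> (h \<cdot>\<^bsub>B\<^esub> g, restr F g p) \<in> w"
    note a = hom_obj(1)[OF B h]
    show "(h, p) \<in> w"
    proof (rule wI[OF h p])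
      fix k c assume k: "k \<in> hom B c a" and hk: "h \<cdot>\<^bsub>B\<^esub> k \<in> S"
      note c = hom_obj(1)[OF B k]
      note mk = m[OF hk, unfolded D[OF h k]]
      show "(Ide B c, restr F k p) \<in> m (h \<cdot>\<^bsub>B\<^esub> k)"
      proof (rule amalgamD(6)[OF mk ide_hom[OF B c] restr_in[OF k p] J_pullback[OF T k]])
        fix g assume "g \<in> sieve_pullback B k T"
        then have g: "g \<in> hom B (Dom B g) c" and kg: "k \<cdot>\<^bsub>B\<^esub> g \<in> T"
          using homD[OF k] by (auto simp: sieve_pullback_def hom_def)
        have "(h \<cdot>\<^bsub>B\<^esub> (k \<cdot>\<^bsub>B\<^esub> g), restr F (k \<cdot>\<^bsub>B\<^esub> g) p) \<in> w" by (rule *[OF kg])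
        then have "((h \<cdot>\<^bsub>B\<^esub> k) \<cdot>\<^bsub>B\<^esub> g, restr F g (restr F k p)) \<in> w"
          using comp_assoc[OF B g k h] restr_comp[OF k g p] by simp
        then have "(g, restr F g (restr F k p)) \<in> m (h \<cdot>\<^bsub>B\<^esub> k)"
          using res_w[OF hk, of g "Dom B g"] D[OF h k] g restr_in[OF g restr_in[OF k p]] by simp
        then show "(Ide B c \<cdot>\<^bsub>B\<^esub> g, restr F g (restr F k p)) \<in> m (h \<cdot>\<^bsub>B\<^esub> k)"
          using comp_ide(2)[OF B g] by simp
      qed
    qed
  next
    show "fst ` w \<in> J b"
    proof (rule J_trans[OF b S supp])
      fix f assume f: "f \<in> S"
      note fh = sieve_arr[OF b S f]
      note a = hom_obj(1)[OF B fh]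
      show "sieve_pullback B f (fst ` w) \<in> J (Dom B f)"
      proof (rule J_mono[OF a amalgamD(7)[OF m[OF f]]])
        show "sieve B (Dom B f) (sieve_pullback B f (fst ` w))"
          unfolding sieve_def
        proof (intro conjI ballI impI subsetI)
          fix g h assume "g \<in> sieve_pullback B f (fst ` w)" and h: "h \<in> Arr B" "Cod B h = Dom B g"
          then have g: "g \<in> hom B (Dom B g) (Dom B f)" and fg: "f \<cdot>\<^bsub>B\<^esub> g \<in> fst ` w"
            by (auto simp: sieve_pullback_def hom_def)
          have hh: "h \<in> hom B (Dom B h) (Dom B g)" using h by (simp add: hom_def)
          have "(f \<cdot>\<^bsub>B\<^esub> g) \<cdot>\<^bsub>B\<^esub> h \<in> fst ` w"
            using supp fg h D[OF fh g] unfolding sieve_def by auto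
          then show "g \<cdot>\<^bsub>B\<^esub> h \<in> sieve_pullback B f (fst ` w)"
            using comp_assoc[OF B hh g fh] homD[OF comp_hom[OF B hh g]] by (simp add: sieve_pullback_def)
        qed (auto simp: sieve_pullback_def)
        show "fst ` m f \<subseteq> sieve_pullback B f (fst ` w)"
        proof
          fix g assume "g \<in> fst ` m f"
          then obtain p where gp: "(g, p) \<in> m f" by auto
          note g = amalgamD(1)[OF m[OF f] gp]
          have "(f \<cdot>\<^bsub>B\<^esub> g, p) \<in> w" using res_w[OF f g amalgamD(2)[OF m[OF f] gp]] gp by simp
          then show "g \<in> sieve_pullback B f (fst ` w)"
            using homD[OF g] by (force simp: sieve_pullback_def)
        qed
      qed
    qed
  qed
  have "amalgam_res I F f w = m f" if f: "f \<in> S" for f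
  proof (intro set_eqI iffI; clarify)
    fix g p assume "(g, p) \<in> amalgam_res I F f w"
    then have g: "g \<in> hom B (Dom B g) (Dom B f)" and p: "p \<in> summands I F (Dom B g)"
      and fg: "(f \<cdot>\<^bsub>B\<^esub> g, p) \<in> w" by (auto simp: amalgam_res_def hom_def)
    show "(g, p) \<in> m f" using res_w[OF f g p] fg by simp
  next
    fix g i x assume gp: "(g, i, x) \<in> m f"
    note g = amalgamD(1)[OF m[OF f] gp] and p = amalgamD(2)[OF m[OF f] gp]
    show "(g, i, x) \<in> amalgam_res I F f w"
      using res_w[OF f g p] gp p homD[OF g] by (simp add: amalgam_res_def)
  qed
  then show ?thesis using w by blast
qed

text \<open>Gluings are unique because membership in an amalgam is local: two amalgams with the same restrictions
to a cover contain each other.\<close>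

lemma amalgam_sheaf: "sheaf_on B J (\<lambda>b. {w. amalgam I F b w}) (amalgam_res I F)"
  unfolding sheaf_on_def
proof (intro conjI ballI allI impI)
  show "amalgam_res I F f w \<in> {w. amalgam I F (Dom B f) w}"
    if "f \<in> Arr B" "w \<in> {w. amalgam I F (Cod B f) w}" for f w
    using amalgam_res_amalgam[OF _ arr_hom] that by blast
  show "amalgam_res I F (Ide B b) w = w" if "b \<in> Obj B" "w \<in> {w. amalgam I F b w}" for b w
    using amalgam_res_ide that by blast
  show "amalgam_res I F g (amalgam_res I F f w) = amalgam_res I F (f \<cdot>\<^bsub>B\<^esub> g) w"
    if "f \<in> Arr B" "g \<in> Arr B" "Cod B g = Dom B f" for f g w
    by (rule amalgam_res_comp[of f "Dom B f" "Cod B f" g "Dom B g"]) (use that in \<open>auto simp: hom_def\<close>)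
next
  fix b S m assume b: "b \<in> Obj B" and S: "S \<in> J b" and m: "\<forall>f\<in>S. m f \<in> {w. amalgam I F (Dom B f) w}"
    and comp: "\<forall>f\<in>S. \<forall>g\<in>Arr B. Cod B g = Dom B f \<longrightarrow> amalgam_res I F g (m f) = m (f \<cdot>\<^bsub>B\<^esub> g)"
  have m': "\<And>f. f \<in> S \<Longrightarrow> amalgam I F (Dom B f) (m f)" using m by simp
  have c': "\<And>f g a. f \<in> S \<Longrightarrow> g \<in> hom B a (Dom B f) \<Longrightarrow> amalgam_res I F g (m f) = m (f \<cdot>\<^bsub>B\<^esub> g)"
    using comp by (simp add: hom_def)
  have "\<exists>w. amalgam I F b w \<and> (\<forall>f\<in>S. amalgam_res I F f w = m f)" by (rule amalgam_glue[OF b S m' c'])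
  then obtain w where w: "amalgam I F b w" "\<And>f. f \<in> S \<Longrightarrow> amalgam_res I F f w = m f" by blast
  show "\<exists>!w. w \<in> {w. amalgam I F b w} \<and> (\<forall>f\<in>S. amalgam_res I F f w = m f)"
  proof (rule ex1I[of _ w])
    fix v assume "v \<in> {w. amalgam I F b w} \<and> (\<forall>f\<in>S. amalgam_res I F f v = m f)"
    then have v: "amalgam I F b v" "\<And>f. f \<in> S \<Longrightarrow> amalgam_res I F f v = m f" by auto
    have sub: "(h, p) \<in> v2" if hp: "(h, p) \<in> v1" and v1: "amalgam I F b v1" and v2: "amalgam I F b v2"
      and eq: "\<And>f. f \<in> S \<Longrightarrow> amalgam_res I F f v1 = amalgam_res I F f v2" for v1 v2 h p
    proof (rule amalgamD(6)[OF v2 amalgamD(1,2)[OF v1 hp] J_pullback[OF S amalgamD(1)[OF v1 hp]]])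
      note h = amalgamD(1)[OF v1 hp]
      fix g assume "g \<in> sieve_pullback B h S"
      then have g: "g \<in> hom B (Dom B g) (Dom B h)" and hg: "h \<cdot>\<^bsub>B\<^esub> g \<in> S"
        by (auto simp: sieve_pullback_def hom_def)
      show "(h \<cdot>\<^bsub>B\<^esub> g, restr F g p) \<in> v2"
        using amalgamD(5)[OF v1 hp g] eq[OF hg] amalgam_mem_res[OF v1 comp_hom[OF B g h]]
          amalgam_mem_res[OF v2 comp_hom[OF B g h]] by simp
    qed
    show "v = w"
      using sub[OF _ v(1) w(1)] sub[OF _ w(1) v(1)] v(2) w(2) by auto
  qed (use w in simp)
qed

lemma amalgam_small: assumes b: "b \<in> Obj B" shows "small_in TYPE('u) {w. amalgam I F b w}"
proof (rule small_in_subset)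
  show "{w. amalgam I F b w} \<subseteq> Pow (SIGMA f:Arr B. summands I F (Dom B f))"
  proof (intro subsetI PowI)
    fix w fp assume "w \<in> {w. amalgam I F b w}" and m: "fp \<in> w"
    then have w: "amalgam I F b w" by simp
    obtain f p where fp: "fp = (f, p)" by (cases fp)
    show "fp \<in> (SIGMA f:Arr B. summands I F (Dom B f))"
      using amalgamD(2)[OF w m[unfolded fp]] homD(1)[OF amalgamD(1)[OF w m[unfolded fp]]] fp by blast
  qed
  have "small_in TYPE('u) (summands I F a)" if "a \<in> Obj B" for a
    unfolding summands_def by (rule small_in_Sigma[OF small_I]) (simp add: sec_small[OF Fo that] small_in_self)
  moreover have "small_in TYPE('u) (Arr B)"
    using small_B by (simp add: small_category_def small_in_self)
  ultimately show "small_in TYPE('u) (Pow (SIGMA f:Arr B. summands I F (Dom B f)))"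
    by (intro small_in_Pow small_in_Sigma) (auto intro: Dom_obj[OF B])
qed

lemma germ_res:
  assumes g: "g \<in> hom B a b" and p: "p \<in> summands I F b"
  shows "amalgam_res I F g (germ I F b p) = germ I F a (restr F g p)"
proof -
  have "g \<cdot>\<^bsub>B\<^esub> f \<in> Arr B" "Cod B (g \<cdot>\<^bsub>B\<^esub> f) = b" "Dom B (g \<cdot>\<^bsub>B\<^esub> f) = Dom B f"
    "restr F f (restr F g p) = restr F (g \<cdot>\<^bsub>B\<^esub> f) p" if "f \<in> Arr B" "Cod B f = a" for f
    using homD[OF comp_hom[OF B _ g, of f "Dom B f"]] restr_comp[OF g _ p, of f "Dom B f"] that
    by (auto simp: hom_def)
  then show ?thesis
    using homD[OF g] by (auto simp: amalgam_res_def germ_def intro: conjunct2[OF conjunct2[OF cong_in]])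
qed

lemma germ_cong:
  assumes "cong I F b p q"
  shows "germ I F b p = germ I F b q"
proof -
  have "cong I F (Dom B f) (restr F f p) (restr F f q)" if "f \<in> Arr B" "Cod B f = b" for f
    using cong_restr[OF assms, of f "Dom B f"] that by (simp add: hom_def)
  then show ?thesis unfolding germ_def using cong_trans cong_sym by blast
qed

text \<open>An amalgam is the germ of \<open>p\<close> wherever it contains \<open>p\<close>, since \<open>p\<close> is then unique modulo the congruence.\<close>

lemma amalgam_locally_germ:
  assumes w: "amalgam I F b w" and fp: "(f, p) \<in> w"
  shows "amalgam_res I F f w = germ I F (Dom B f) p"
proof -
  note f = amalgamD(1)[OF w fp] and p = amalgamD(2)[OF w fp]
  have *: "(f \<cdot>\<^bsub>B\<^esub> g, q) \<in> w \<longleftrightarrow> cong I F (Dom B g) (restr F g p) q" if g: "g \<in> hom B (Dom B g) (Dom B f)" for g q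
  proof -
    have D: "Dom B (f \<cdot>\<^bsub>B\<^esub> g) = Dom B g" using homD[OF comp_hom[OF B g f]] by simp
    show ?thesis
      using amalgamD(3,4)[OF w amalgamD(5)[OF w fp g], of q] D by auto
  qed
  show ?thesis
    using * by (auto simp: amalgam_res_def germ_def hom_def intro: conjunct2[OF conjunct2[OF cong_in]])
qed

text \<open>A family of maps \<open>A \<times> F i \<rightarrow> Y\<close> compatible with the diagram. Colimits are constructed with the
  parameter \<open>A\<close> because then the universal property also says that they are preserved by products
  with \<open>A\<close>.\<close>

definition bilinear :: "'o \<Rightarrow> 'o \<Rightarrow> ('j \<Rightarrow> 'u \<Rightarrow> 'u \<Rightarrow> 'u \<Rightarrow> 'u) \<Rightarrow> bool" where
  "bilinear A Y l \<longleftrightarrow> A \<in> Obj E \<and> Y \<in> Obj E \<and>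
     (\<forall>i\<in>Obj I. \<forall>b\<in>Obj B. \<forall>s\<in>sec A b. \<forall>x\<in>sec (FO F i) b. l i b s x \<in> sec Y b) \<and>
     (\<forall>i\<in>Obj I. \<forall>a b. \<forall>g\<in>hom B a b. \<forall>s\<in>sec A b. \<forall>x\<in>sec (FO F i) b.
        l i a (res A g s) (res (FO F i) g x) = res Y g (l i b s x)) \<and>
     (\<forall>i j. \<forall>u\<in>hom I i j. \<forall>b\<in>Obj B. \<forall>s\<in>sec A b. \<forall>x\<in>sec (FO F i) b.
        l j b s (app (FA F u) b x) = l i b s x)"

definition bilinear_extension ::
  "'o \<Rightarrow> ('j \<Rightarrow> 'a) \<Rightarrow> 'o \<Rightarrow> 'o \<Rightarrow> ('j \<Rightarrow> 'u \<Rightarrow> 'u \<Rightarrow> 'u \<Rightarrow> 'u) \<Rightarrow> ('u \<Rightarrow> 'u \<Rightarrow> 'u \<Rightarrow> 'u) \<Rightarrow> bool" where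
  "bilinear_extension X k A Y l h \<longleftrightarrow>
     (\<forall>b\<in>Obj B. \<forall>s\<in>sec A b. \<forall>z\<in>sec X b. h b s z \<in> sec Y b) \<and>
     (\<forall>a b. \<forall>g\<in>hom B a b. \<forall>s\<in>sec A b. \<forall>z\<in>sec X b. h a (res A g s) (res X g z) = res Y g (h b s z)) \<and>
     (\<forall>i\<in>Obj I. \<forall>b\<in>Obj B. \<forall>s\<in>sec A b. \<forall>x\<in>sec (FO F i) b. h b s (app (k i) b x) = l i b s x)"

definition generated :: "'o \<Rightarrow> ('j \<Rightarrow> 'a) \<Rightarrow> bool" where
  "generated X k \<longleftrightarrow> (\<forall>b\<in>Obj B. \<forall>z\<in>sec X b. \<exists>S\<in>J b. \<forall>f\<in>S. \<exists>i\<in>Obj I. \<exists>x\<in>sec (FO F i) (Dom B f).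
     res X f z = app (k i) (Dom B f) x)"

lemma bilinearD:
  assumes "bilinear A Y l"
  shows "A \<in> Obj E" "Y \<in> Obj E"
    and "i \<in> Obj I \<Longrightarrow> b \<in> Obj B \<Longrightarrow> s \<in> sec A b \<Longrightarrow> x \<in> sec (FO F i) b \<Longrightarrow> l i b s x \<in> sec Y b"
    and "i \<in> Obj I \<Longrightarrow> g \<in> hom B a b \<Longrightarrow> s \<in> sec A b \<Longrightarrow> x \<in> sec (FO F i) b \<Longrightarrow>
      l i a (res A g s) (res (FO F i) g x) = res Y g (l i b s x)"
    and "u \<in> hom I i j \<Longrightarrow> b \<in> Obj B \<Longrightarrow> s \<in> sec A b \<Longrightarrow> x \<in> sec (FO F i) b \<Longrightarrow>
      l j b s (app (FA F u) b x) = l i b s x"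
proof -
  note * = assms[unfolded bilinear_def]
  show "A \<in> Obj E" "Y \<in> Obj E" by (rule *[THEN conjunct1], rule *[THEN conjunct2, THEN conjunct1])
  show "i \<in> Obj I \<Longrightarrow> b \<in> Obj B \<Longrightarrow> s \<in> sec A b \<Longrightarrow> x \<in> sec (FO F i) b \<Longrightarrow> l i b s x \<in> sec Y b"
    by (rule *[THEN conjunct2, THEN conjunct2, THEN conjunct1, rule_format])
  show "i \<in> Obj I \<Longrightarrow> g \<in> hom B a b \<Longrightarrow> s \<in> sec A b \<Longrightarrow> x \<in> sec (FO F i) b \<Longrightarrow>
      l i a (res A g s) (res (FO F i) g x) = res Y g (l i b s x)"
    by (rule *[THEN conjunct2, THEN conjunct2, THEN conjunct2, THEN conjunct1, rule_format])
  show "u \<in> hom I i j \<Longrightarrow> b \<in> Obj B \<Longrightarrow> s \<in> sec A b \<Longrightarrow> x \<in> sec (FO F i) b \<Longrightarrow>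
      l j b s (app (FA F u) b x) = l i b s x"
    by (rule *[THEN conjunct2, THEN conjunct2, THEN conjunct2, THEN conjunct2, rule_format])
qed

lemma bilinear_extensionD:
  assumes "bilinear_extension X k A Y l h"
  shows "b \<in> Obj B \<Longrightarrow> s \<in> sec A b \<Longrightarrow> z \<in> sec X b \<Longrightarrow> h b s z \<in> sec Y b"
    and "g \<in> hom B a b \<Longrightarrow> s \<in> sec A b \<Longrightarrow> z \<in> sec X b \<Longrightarrow> h a (res A g s) (res X g z) = res Y g (h b s z)"
    and "i \<in> Obj I \<Longrightarrow> b \<in> Obj B \<Longrightarrow> s \<in> sec A b \<Longrightarrow> x \<in> sec (FO F i) b \<Longrightarrow>
      h b s (app (k i) b x) = l i b s x"
proof -
  note * = assms[unfolded bilinear_extension_def]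
  show "b \<in> Obj B \<Longrightarrow> s \<in> sec A b \<Longrightarrow> z \<in> sec X b \<Longrightarrow> h b s z \<in> sec Y b"
    by (rule *[THEN conjunct1, rule_format])
  show "g \<in> hom B a b \<Longrightarrow> s \<in> sec A b \<Longrightarrow> z \<in> sec X b \<Longrightarrow> h a (res A g s) (res X g z) = res Y g (h b s z)"
    by (rule *[THEN conjunct2, THEN conjunct1, rule_format])
  show "i \<in> Obj I \<Longrightarrow> b \<in> Obj B \<Longrightarrow> s \<in> sec A b \<Longrightarrow> x \<in> sec (FO F i) b \<Longrightarrow>
      h b s (app (k i) b x) = l i b s x"
    by (rule *[THEN conjunct2, THEN conjunct2, rule_format])
qed

text \<open>The congruence is the least one of its kind, and equality after \<open>l\<close> is one too: it respects the diagram,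
and it is local since sections of \<open>Y\<close> that agree on a cover are equal.\<close>

lemma cong_sound:
  assumes l: "bilinear A Y l" and pq: "cong I F b p q" and s: "s \<in> sec A b"
  shows "l (fst p) b s (snd p) = l (fst q) b s (snd q)"
  using pq s
proof (induction arbitrary: s rule: cong.induct)
  case (cong_trans b p q r)
  then show ?case by metis
next
  case (cong_edge b u i j x)
  then show ?case using bilinearD(5)[OF l] by simp
next
  case (cong_local b S p q)
  note b = cong_local(1) and S = cong_local(2)
  obtain i x where p: "p = (i, x)" "i \<in> Obj I" "x \<in> sec (FO F i) b" using cong_local(3) by (rule summandsE)
  obtain j y where q: "q = (j, y)" "j \<in> Obj I" "y \<in> sec (FO F j) b" using cong_local(4) by (rule summandsE)
  have "l i b s x = l j b s y"
  proof (rule separated[OF bilinearD(2)[OF l] b S])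
    fix f assume f: "f \<in> S"
    note fh = sieve_arr[OF b S f]
    show "res Y f (l i b s x) = res Y f (l j b s y)"
      using cong_local(6)[OF f res_in[OF bilinearD(1)[OF l] fh \<open>s \<in> sec A b\<close>]]
        bilinearD(4)[OF l p(2) fh \<open>s \<in> sec A b\<close> p(3)] bilinearD(4)[OF l q(2) fh \<open>s \<in> sec A b\<close> q(3)]
      by (simp add: restr_def p q)
  qed (use bilinearD(3)[OF l _ b \<open>s \<in> sec A b\<close>] p q in auto)
  then show ?case by (simp add: p q)
qed auto

text \<open>The values of \<open>l\<close> on the pairs in \<open>w\<close> form a matching family on the support of \<open>w\<close>: they do not depend on
the choice of \<open>p\<close> by \<open>cong_sound\<close>.\<close>

lemma amalgam_value:
  assumes l: "bilinear A Y l" and b: "b \<in> Obj B" and w: "amalgam I F b w" and s: "s \<in> sec A b"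
  shows "\<exists>!y. y \<in> sec Y b \<and> (\<forall>f p. (f, p) \<in> w \<longrightarrow> res Y f y = l (fst p) (Dom B f) (res A f s) (snd p))"
proof -
  note A = bilinearD(1)[OF l] and Y = bilinearD(2)[OF l]
  define P where "P f = (SOME p. (f, p) \<in> w)" for f
  have P: "(f, P f) \<in> w" if "f \<in> fst ` w" for f
    using that unfolding P_def by (auto intro: someI)
  define m where "m f = l (fst (P f)) (Dom B f) (res A f s) (snd (P f))" for f
  have m: "l (fst p) (Dom B f) (res A f s) (snd p) = m f" if fp: "(f, p) \<in> w" for f p
    unfolding m_def
    by (rule cong_sound[OF l amalgamD(3)[OF w fp P] res_in[OF A amalgamD(1)[OF w fp] s]])
      (use fp in force)
  have "\<exists>!y. y \<in> sec Y b \<and> (\<forall>f\<in>fst ` w. res Y f y = m f)"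
  proof (rule sheaf_on_glue[OF sec_sheaf[OF Y] b amalgamD(7)[OF w]])
    fix f assume "f \<in> fst ` w"
    then have fp: "(f, P f) \<in> w" by (rule P)
    obtain i x where p: "P f = (i, x)" "i \<in> Obj I" "x \<in> sec (FO F i) (Dom B f)"
      using amalgamD(2)[OF w fp] by (rule summandsE)
    note fh = amalgamD(1)[OF w fp]
    show "m f \<in> sec Y (Dom B f)"
      using bilinearD(3)[OF l p(2) hom_obj(1)[OF B fh] res_in[OF A fh s] p(3)] p(1) by (simp add: m_def)
    fix g assume g: "g \<in> Arr B" "Cod B g = Dom B f"
    then have gh: "g \<in> hom B (Dom B g) (Dom B f)" by (simp add: hom_def)
    have D: "Dom B (f \<cdot>\<^bsub>B\<^esub> g) = Dom B g" using homD[OF comp_hom[OF B gh fh]] by simp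
    show "res Y g (m f) = m (f \<cdot>\<^bsub>B\<^esub> g)"
      using m[OF amalgamD(5)[OF w fp gh]] bilinearD(4)[OF l p(2) gh res_in[OF A fh s] p(3)]
        res_comp[OF A fh gh s] p(1) D by (simp add: restr_def m_def)
  qed
  moreover have "(\<forall>f\<in>fst ` w. res Y f y = m f) \<longleftrightarrow>
    (\<forall>f p. (f, p) \<in> w \<longrightarrow> res Y f y = l (fst p) (Dom B f) (res A f s) (snd p))" for y
    using m by force
  ultimately show ?thesis by simp
qed

text \<open>The amalgams are the colimit. That they are locally germs makes extensions unique, and gluing the
values of a compatible family makes them exist.\<close>

lemma stable_colimit_exists:
  "\<exists>X k. cocone E I F X k \<and> generated X k \<and>
     (\<forall>A Y l. bilinear A Y l \<longrightarrow> (\<exists>h. bilinear_extension X k A Y l h))"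
proof -
  obtain X \<phi> where X: "X \<in> Obj E"
    and bij: "\<And>b. b \<in> Obj B \<Longrightarrow> bij_betw (\<phi> b) {w. amalgam I F b w} (sec X b)"
    and nat: "\<And>g a b w. g \<in> hom B a b \<Longrightarrow> w \<in> {w. amalgam I F b w} \<Longrightarrow>
      \<phi> a (amalgam_res I F g w) = res X g (\<phi> b w)"
    using realise[OF amalgam_sheaf amalgam_small] by blast
  define \<psi> where "\<psi> b = inv_into {w. amalgam I F b w} (\<phi> b)" for b
  have \<psi>: "amalgam I F b (\<psi> b x)" "\<phi> b (\<psi> b x) = x" if "b \<in> Obj B" "x \<in> sec X b" for b x
    using bij_betw_inv_into_right[OF bij[OF that(1)] that(2)]
      bij_betwE[OF bij_betw_inv_into[OF bij[OF that(1)]]] that(2) by (auto simp: \<psi>_def)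
  have \<psi>\<phi>: "\<psi> b (\<phi> b y) = y" "\<phi> b y \<in> sec X b" if "b \<in> Obj B" "amalgam I F b y" for b y
    using bij_betw_inv_into_left[OF bij[OF that(1)]] bij_betwE[OF bij[OF that(1)]] that(2)
    by (auto simp: \<psi>_def)
  have \<psi>n: "\<psi> a (res X g x) = amalgam_res I F g (\<psi> b x)" if g: "g \<in> hom B a b" and x: "x \<in> sec X b" for g a b x
  proof -
    note ab = hom_obj[OF B g]
    have "res X g x = \<phi> a (amalgam_res I F g (\<psi> b x))"
      using nat[OF g, of "\<psi> b x"] \<psi>[OF ab(2) x] by simp
    then show ?thesis using \<psi>\<phi>(1)[OF ab(1) amalgam_res_amalgam[OF \<psi>(1)[OF ab(2) x] g]] by simp
  qed
  have "\<exists>k\<in>hom E (FO F i) X. \<forall>b\<in>Obj B. \<forall>x\<in>sec (FO F i) b. app k b x = \<phi> b (germ I F b (i, x))"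
    if i: "i \<in> Obj I" for i
  proof (rule app_full[OF Fo[OF i] X])
    fix b x assume b: "b \<in> Obj B" and x: "x \<in> sec (FO F i) b"
    then have "(i, x) \<in> summands I F b" using i by (simp add: summands_def)
    then show "\<phi> b (germ I F b (i, x)) \<in> sec X b" using \<psi>\<phi>(2)[OF b germ_amalgam[OF b]] by blast
  next
    fix a b g x assume g: "g \<in> hom B a b" and x: "x \<in> sec (FO F i) b"
    then have p: "(i, x) \<in> summands I F b" using i by (simp add: summands_def)
    show "\<phi> a (germ I F a (i, res (FO F i) g x)) = res X g (\<phi> b (germ I F b (i, x)))"
      using nat[OF g, of "germ I F b (i, x)"] germ_amalgam[OF hom_obj(2)[OF B g] p] germ_res[OF g p]
      by (simp add: restr_def)
  qed
  then obtain k where k: "\<And>i. i \<in> Obj I \<Longrightarrow> k i \<in> hom E (FO F i) X"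
    and kapp: "\<And>i b x. i \<in> Obj I \<Longrightarrow> b \<in> Obj B \<Longrightarrow> x \<in> sec (FO F i) b \<Longrightarrow>
      app (k i) b x = \<phi> b (germ I F b (i, x))" by metis
  have coc: "cocone E I F X k" unfolding cocone_def
  proof (intro conjI ballI X)
    show "k i \<in> hom E (FO F i) X" if "i \<in> Obj I" for i by (rule k[OF that])
    fix u assume "u \<in> Arr I"
    then have u: "u \<in> hom I (Dom I u) (Cod I u)" by (rule arr_hom)
    note ij = hom_obj[OF functor_category(1)[OF F] u] and Fu = functor_hom[OF F u]
    show "k (Cod I u) \<cdot> FA F u = k (Dom I u)"
    proof (rule app_ext[OF comp_hom[OF E Fu k[OF ij(2)]] k[OF ij(1)]])
      fix b x assume b: "b \<in> Obj B" and x: "x \<in> sec (FO F (Dom I u)) b"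
      show "app (k (Cod I u) \<cdot> FA F u) b x = app (k (Dom I u)) b x"
        using app_comp[OF Fu k[OF ij(2)] b x] kapp[OF ij(2) b app_in[OF Fu b x]] kapp[OF ij(1) b x]
          germ_cong[OF cong_edge[where F = F, OF b u x]] by simp
    qed
  qed
  have gen: "generated X k" unfolding generated_def
  proof (intro ballI)
    fix b z assume b: "b \<in> Obj B" and z: "z \<in> sec X b"
    note w = \<psi>(1)[OF b z]
    show "\<exists>S\<in>J b. \<forall>f\<in>S. \<exists>i\<in>Obj I. \<exists>x\<in>sec (FO F i) (Dom B f). res X f z = app (k i) (Dom B f) x"
    proof (intro bexI[OF _ amalgamD(7)[OF w]] ballI)
      fix f assume "f \<in> fst ` \<psi> b z"
      then obtain p where fp: "(f, p) \<in> \<psi> b z" by auto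
      obtain i x where p: "p = (i, x)" "i \<in> Obj I" "x \<in> sec (FO F i) (Dom B f)"
        using amalgamD(2)[OF w fp] by (rule summandsE)
      note fh = amalgamD(1)[OF w fp]
      have "res X f z = app (k i) (Dom B f) x"
        using nat[OF fh, of "\<psi> b z"] w \<psi>(2)[OF b z] amalgam_locally_germ[OF w fp]
          kapp[OF p(2) hom_obj(1)[OF B fh] p(3)] p(1) by simp
      then show "\<exists>i\<in>Obj I. \<exists>x\<in>sec (FO F i) (Dom B f). res X f z = app (k i) (Dom B f) x"
        using p by blast
    qed
  qed
  have "\<exists>h. bilinear_extension X k A Y l h" if l: "bilinear A Y l" for A Y l
  proof -
    note A = bilinearD(1)[OF l] and Y = bilinearD(2)[OF l]
    have "\<exists>y. y \<in> sec Y b \<and> (\<forall>f p. (f, p) \<in> \<psi> b z \<longrightarrow> res Y f y = l (fst p) (Dom B f) (res A f s) (snd p))"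
      if "b \<in> Obj B" "s \<in> sec A b" "z \<in> sec X b" for b s z
      using amalgam_value[OF l that(1) \<psi>(1)[OF that(1,3)] that(2)] by (elim ex1E) blast
    then obtain h where h: "\<And>b s z. b \<in> Obj B \<Longrightarrow> s \<in> sec A b \<Longrightarrow> z \<in> sec X b \<Longrightarrow> h b s z \<in> sec Y b"
      and hp: "\<And>b s z f p. b \<in> Obj B \<Longrightarrow> s \<in> sec A b \<Longrightarrow> z \<in> sec X b \<Longrightarrow> (f, p) \<in> \<psi> b z \<Longrightarrow>
        res Y f (h b s z) = l (fst p) (Dom B f) (res A f s) (snd p)" by metis
    have heq: "h b s z = y" if b: "b \<in> Obj B" and s: "s \<in> sec A b" and z: "z \<in> sec X b" and y: "y \<in> sec Y b"
      and yp: "\<And>f p. (f, p) \<in> \<psi> b z \<Longrightarrow> res Y f y = l (fst p) (Dom B f) (res A f s) (snd p)" for b s z y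
      by (rule separated[OF Y b amalgamD(7)[OF \<psi>(1)[OF b z]] h[OF b s z] y])
        (use hp[OF b s z] yp in force)
    show ?thesis unfolding bilinear_extension_def
    proof (intro exI[of _ h] conjI ballI allI)
      show "h b s z \<in> sec Y b" if "b \<in> Obj B" "s \<in> sec A b" "z \<in> sec X b" for b s z by (rule h[OF that])
    next
      fix a b g s z assume g: "g \<in> hom B a b" and s: "s \<in> sec A b" and z: "z \<in> sec X b"
      note ab = hom_obj[OF B g]
      show "h a (res A g s) (res X g z) = res Y g (h b s z)"
      proof (rule heq[OF ab(1) res_in[OF A g s] res_in[OF X g z] res_in[OF Y g h[OF ab(2) s z]]])
        fix f p assume "(f, p) \<in> \<psi> a (res X g z)"
        then have fp: "(f, p) \<in> amalgam_res I F g (\<psi> b z)" using \<psi>n[OF g z] by simp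
        then have f: "f \<in> hom B (Dom B f) a" and gf: "(g \<cdot>\<^bsub>B\<^esub> f, p) \<in> \<psi> b z"
          using homD[OF g] by (auto simp: amalgam_res_def hom_def)
        have D: "Dom B (g \<cdot>\<^bsub>B\<^esub> f) = Dom B f" using homD[OF comp_hom[OF B f g]] by simp
        show "res Y f (res Y g (h b s z)) = l (fst p) (Dom B f) (res A f (res A g s)) (snd p)"
          using hp[OF ab(2) s z gf] D res_comp[OF Y g f h[OF ab(2) s z]] res_comp[OF A g f s] by simp
      qed
    next
      fix i b s x assume i: "i \<in> Obj I" and b: "b \<in> Obj B" and s: "s \<in> sec A b" and x: "x \<in> sec (FO F i) b"
      show "h b s (app (k i) b x) = l i b s x"
      proof (rule heq[OF b s app_in[OF k[OF i] b x] bilinearD(3)[OF l i b s x]])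
        fix f p assume fp: "(f, p) \<in> \<psi> b (app (k i) b x)"
        have p: "(i, x) \<in> summands I F b" using i x by (simp add: summands_def)
        have "(f, p) \<in> germ I F b (i, x)"
          using fp kapp[OF i b x] \<psi>\<phi>(1)[OF b germ_amalgam[OF b p]] by simp
        then have f: "f \<in> hom B (Dom B f) b" and c: "cong I F (Dom B f) (i, res (FO F i) f x) p"
          by (auto simp: germ_def hom_def restr_def)
        show "res Y f (l i b s x) = l (fst p) (Dom B f) (res A f s) (snd p)"
          using cong_sound[OF l c res_in[OF A f s]] bilinearD(4)[OF l i f s x] by simp
      qed
    qed
  qed
  then show ?thesis using coc gen by blast
qed

end

lemma cocone_arr:
  assumes "cocone E I F X k"
  shows "X \<in> Obj E" "i \<in> Obj I \<Longrightarrow> k i \<in> hom E (FO F i) X"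
    "u \<in> hom I i j \<Longrightarrow> k j \<cdot>\<^bsub>E\<^esub> FA F u = k i"
  using assms by (auto simp: cocone_def hom_def)

lemma coconeI:
  assumes "category I" "X \<in> Obj E" "\<And>i. i \<in> Obj I \<Longrightarrow> k i \<in> hom E (FO F i) X"
    "\<And>u i j. u \<in> hom I i j \<Longrightarrow> i \<in> Obj I \<Longrightarrow> j \<in> Obj I \<Longrightarrow> k j \<cdot>\<^bsub>E\<^esub> FA F u = k i"
  shows "cocone E I F X k"
  using assms(2,3) assms(4)[OF arr_hom] Dom_obj[OF assms(1)] Cod_obj[OF assms(1)]
  by (auto simp: cocone_def)

lemma colimit_cocone: "is_colimit E I F X k \<Longrightarrow> cocone E I F X k"
  by (simp add: is_colimit_def)

lemma colimit_universal:
  assumes "is_colimit E I F X k" "cocone E I F Y l"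
  shows "\<exists>!h. h \<in> hom E X Y \<and> (\<forall>i\<in>Obj I. h \<cdot>\<^bsub>E\<^esub> k i = l i)"
  by (rule assms(1)[unfolded is_colimit_def, THEN conjunct2, rule_format, OF assms(2)])

lemma ex1_eqI: "\<exists>!x. P x \<Longrightarrow> P x \<Longrightarrow> P y \<Longrightarrow> x = y"
  by (elim ex1E) metis

lemma cocone_comp:
  assumes E: "category E" and F: "is_functor I E F" and k: "cocone E I F X k" and h: "h \<in> hom E X Y"
  shows "cocone E I F Y (\<lambda>i. h \<cdot>\<^bsub>E\<^esub> k i)"
proof (rule coconeI[OF functor_category(1)[OF F] hom_obj(2)[OF E h]])
  show "h \<cdot>\<^bsub>E\<^esub> k i \<in> hom E (FO F i) Y" if "i \<in> Obj I" for i
    by (rule comp_hom[OF E cocone_arr(2)[OF k that] h])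
  show "(h \<cdot>\<^bsub>E\<^esub> k j) \<cdot>\<^bsub>E\<^esub> FA F u = h \<cdot>\<^bsub>E\<^esub> k i"
    if u: "u \<in> hom I i j" and "j \<in> Obj I" for u i j
    using comp_assoc[OF E functor_hom[OF F u] cocone_arr(2)[OF k that(2)] h] cocone_arr(3)[OF k u] by simp
qed

lemma colimit_eqI:
  assumes E: "category E" and F: "is_functor I E F" and X: "is_colimit E I F X k"
    and h: "h \<in> hom E X Y" "h' \<in> hom E X Y" "\<And>i. i \<in> Obj I \<Longrightarrow> h \<cdot>\<^bsub>E\<^esub> k i = h' \<cdot>\<^bsub>E\<^esub> k i"
  shows "h = h'"
  by (rule ex1_eqI[OF colimit_universal[OF X cocone_comp[OF E F colimit_cocone[OF X] h(2)]]])
    (use h in auto)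

lemma colimit_chosen:
  assumes "is_colimit E I F X k"
  shows "is_colimit E I F (colim E I F) (colim_arr E I F)"
proof -
  have "(\<lambda>(X, k). is_colimit E I F X k) (SOME (X, k). is_colimit E I F X k)"
    by (rule someI[of _ "(X, k)"]) (use assms in simp)
  then show ?thesis by (simp add: colim_def colim_arr_def colim_data_def case_prod_beta)
qed

lemma terminal_hom: "is_terminal E T \<Longrightarrow> X \<in> Obj E \<Longrightarrow> \<exists>!h. h \<in> hom E X T"
  by (simp add: is_terminal_def)

lemma terminal_eqI: "is_terminal E T \<Longrightarrow> category E \<Longrightarrow> f \<in> hom E X T \<Longrightarrow> g \<in> hom E X T \<Longrightarrow> f = g"
  using ex1_eqI[OF terminal_hom[of E T X]] hom_obj(1)[of E f X T] by blast

lemma terminal_chosen: "is_terminal E T \<Longrightarrow> is_terminal E (terminal E)"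
  unfolding terminal_def by (rule someI)

lemma to_terminal_hom:
  assumes "is_terminal E T" "X \<in> Obj E"
  shows "to_terminal E X \<in> hom E X (terminal E)"
  unfolding to_terminal_def by (rule theI'[OF terminal_hom[OF terminal_chosen[OF assms(1)] assms(2)]])

context sheaf_diagram
begin

text \<open>The universal property for families without parameter is the one for the parameter \<open>1\<close>, which has
  exactly one section \<open>p b\<close> over each object \<open>b\<close>. Uniqueness is local, hence follows from generation.\<close>

lemma generated_colimit:
  assumes k: "cocone E I F X k" and gen: "generated X k"
    and ext: "\<And>A Y l. bilinear A Y l \<Longrightarrow> \<exists>h. bilinear_extension X k A Y l h"
  shows "is_colimit E I F X k"
  unfolding is_colimit_def
proof (intro conjI k allI impI)
  fix Y l assume l: "cocone E I F Y l"
  note X = cocone_arr(1)[OF k] and Y = cocone_arr(1)[OF l]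
  obtain T where T: "is_terminal E T" using terminal_exists by blast
  have "\<forall>b\<in>Obj B. \<exists>z. z \<in> sec T b \<and> (\<forall>z'. z' \<in> sec T b \<longrightarrow> z' = z)"
    using terminal_sections[OF T] by (blast elim: ex1E)
  then obtain p where p: "\<And>b. b \<in> Obj B \<Longrightarrow> p b \<in> sec T b"
    and puniq: "\<And>b z. b \<in> Obj B \<Longrightarrow> z \<in> sec T b \<Longrightarrow> z = p b" by metis
  have To: "T \<in> Obj E" using T by (simp add: is_terminal_def)
  have "bilinear T Y (\<lambda>i b s x. app (l i) b x)"
    unfolding bilinear_def
  proof (intro conjI To Y ballI allI)
    show "app (l i) b x \<in> sec Y b" if "i \<in> Obj I" "b \<in> Obj B" "x \<in> sec (FO F i) b" for i b x
      by (rule app_in[OF cocone_arr(2)[OF l that(1)] that(2,3)])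
    show "app (l i) a (res (FO F i) g x) = res Y g (app (l i) b x)"
      if "i \<in> Obj I" "g \<in> hom B a b" "x \<in> sec (FO F i) b" for i a b g x
      by (rule app_res[OF cocone_arr(2)[OF l that(1)] that(2,3)])
    fix i j u b x assume u: "u \<in> hom I i j" and b: "b \<in> Obj B" and x: "x \<in> sec (FO F i) b"
    show "app (l j) b (app (FA F u) b x) = app (l i) b x"
      using app_comp[OF functor_hom[OF F u] cocone_arr(2)[OF l hom_obj(2)[OF functor_category(1)[OF F] u]] b x]
        cocone_arr(3)[OF l u] by simp
  qed
  from ext[OF this] obtain h where h: "bilinear_extension X k T Y (\<lambda>i b s x. app (l i) b x) h" by blast
  have "\<exists>f\<in>hom E X Y. \<forall>b\<in>Obj B. \<forall>z\<in>sec X b. app f b z = h b (p b) z"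
  proof (rule app_full[OF X Y])
    show "h b (p b) z \<in> sec Y b" if "b \<in> Obj B" "z \<in> sec X b" for b z
      using bilinear_extensionD(1)[OF h that(1) p[OF that(1)] that(2)] .
    fix a b g z assume g: "g \<in> hom B a b" and z: "z \<in> sec X b"
    note ab = hom_obj[OF B g]
    show "h a (p a) (res X g z) = res Y g (h b (p b) z)"
      using bilinear_extensionD(2)[OF h g p[OF ab(2)] z] puniq[OF ab(1) res_in[OF To g p[OF ab(2)]]] by simp
  qed
  then obtain f where f: "f \<in> hom E X Y"
    and fh: "\<And>b z. b \<in> Obj B \<Longrightarrow> z \<in> sec X b \<Longrightarrow> app f b z = h b (p b) z" by blast
  show "\<exists>!f. f \<in> hom E X Y \<and> (\<forall>i\<in>Obj I. f \<cdot> k i = l i)"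
  proof (rule ex1I[of _ f], intro conjI ballI f)
    fix i assume i: "i \<in> Obj I"
    note ki = cocone_arr(2)[OF k i] and li = cocone_arr(2)[OF l i]
    show "f \<cdot> k i = l i"
    proof (rule app_ext[OF comp_hom[OF E ki f] li])
      fix b x assume b: "b \<in> Obj B" and x: "x \<in> sec (FO F i) b"
      show "app (f \<cdot> k i) b x = app (l i) b x"
        using app_comp[OF ki f b x] fh[OF b app_in[OF ki b x]] bilinear_extensionD(3)[OF h i b p[OF b] x]
        by simp
    qed
  next
    fix f' assume "f' \<in> hom E X Y \<and> (\<forall>i\<in>Obj I. f' \<cdot> k i = l i)"
    then have f': "f' \<in> hom E X Y" and f'k: "\<And>i. i \<in> Obj I \<Longrightarrow> f' \<cdot> k i = l i" by auto
    show "f' = f"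
    proof (rule app_ext[OF f' f])
      fix b z assume b: "b \<in> Obj B" and z: "z \<in> sec X b"
      obtain S where S: "S \<in> J b"
        and gS: "\<And>g. g \<in> S \<Longrightarrow> \<exists>i\<in>Obj I. \<exists>x\<in>sec (FO F i) (Dom B g). res X g z = app (k i) (Dom B g) x"
        using gen b z unfolding generated_def by blast
      show "app f' b z = app f b z"
      proof (rule separated[OF Y b S app_in[OF f' b z] app_in[OF f b z]])
        fix g assume g: "g \<in> S"
        note gh = sieve_arr[OF b S g]
        note a = hom_obj(1)[OF B gh]
        obtain i x where i: "i \<in> Obj I" and x: "x \<in> sec (FO F i) (Dom B g)"
          and zx: "res X g z = app (k i) (Dom B g) x" using gS[OF g] by blast
        note ki = cocone_arr(2)[OF k i]
        show "res Y g (app f' b z) = res Y g (app f b z)"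
          using app_res[OF f' gh z] app_res[OF f gh z] zx app_comp[OF ki f' a x] app_comp[OF ki f a x]
            f'k[OF i] fh[OF a app_in[OF ki a x]] bilinear_extensionD(3)[OF h i a p[OF a] x] by simp
      qed
    qed
  qed
qed

lemma colimit_exists: "\<exists>X k. is_colimit E I F X k"
  using stable_colimit_exists generated_colimit by blast

text \<open>The properties of the colimit constructed above pass along the isomorphism to all colimits of the
  diagram, in particular to those chosen by \<^const>\<open>colim\<close>.\<close>

lemma colimit_stable:
  assumes X: "is_colimit E I F X k"
  shows "generated X k" "\<And>A Y l. bilinear A Y l \<Longrightarrow> \<exists>h. bilinear_extension X k A Y l h"
proof -
  obtain X0 k0 where k0: "cocone E I F X0 k0" and gen: "generated X0 k0"
    and ext: "\<And>A Y l. bilinear A Y l \<Longrightarrow> \<exists>h. bilinear_extension X0 k0 A Y l h"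
    using stable_colimit_exists by blast
  have X0: "is_colimit E I F X0 k0" by (rule generated_colimit[OF k0 gen ext])
  note k = colimit_cocone[OF X]
  obtain v where v: "v \<in> hom E X0 X" "\<forall>i\<in>Obj I. v \<cdot> k0 i = k i"
    using colimit_universal[OF X0 k] by (elim ex1E) blast
  obtain u where u: "u \<in> hom E X X0" "\<forall>i\<in>Obj I. u \<cdot> k i = k0 i"
    using colimit_universal[OF X k0] by (elim ex1E) blast
  have vu: "v \<cdot> u = Ide E X"
  proof (rule colimit_eqI[OF E F X comp_hom[OF E u(1) v(1)] ide_hom[OF E cocone_arr(1)[OF k]]])
    fix i assume i: "i \<in> Obj I"
    show "(v \<cdot> u) \<cdot> k i = Ide E X \<cdot> k i"
      using comp_assoc[OF E cocone_arr(2)[OF k i] u(1) v(1)] u(2) v(2) i comp_ide(2)[OF E cocone_arr(2)[OF k i]]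
      by simp
  qed
  have uk: "app u b (app (k i) b x) = app (k0 i) b x" if "i \<in> Obj I" "b \<in> Obj B" "x \<in> sec (FO F i) b" for i b x
    using app_comp[OF cocone_arr(2)[OF k that(1)] u(1) that(2,3)] u(2) that(1) by simp
  have vk: "app v b (app (k0 i) b x) = app (k i) b x" if "i \<in> Obj I" "b \<in> Obj B" "x \<in> sec (FO F i) b" for i b x
    using app_comp[OF cocone_arr(2)[OF k0 that(1)] v(1) that(2,3)] v(2) that(1) by simp
  have vuz: "app v b (app u b z) = z" if "b \<in> Obj B" "z \<in> sec X b" for b z
    using app_comp[OF u(1) v(1) that] vu app_ide[OF cocone_arr(1)[OF k] that] by simp
  show "generated X k" unfolding generated_def
  proof (intro ballI)
    fix b z assume b: "b \<in> Obj B" and z: "z \<in> sec X b"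
    note uz = app_in[OF u(1) b z]
    obtain S where S: "S \<in> J b"
      and gS: "\<And>g. g \<in> S \<Longrightarrow> \<exists>i\<in>Obj I. \<exists>x\<in>sec (FO F i) (Dom B g). res X0 g (app u b z) = app (k0 i) (Dom B g) x"
      using gen b uz unfolding generated_def by blast
    show "\<exists>S\<in>J b. \<forall>f\<in>S. \<exists>i\<in>Obj I. \<exists>x\<in>sec (FO F i) (Dom B f). res X f z = app (k i) (Dom B f) x"
    proof (intro bexI[OF _ S] ballI)
      fix g assume g: "g \<in> S"
      note gh = sieve_arr[OF b S g]
      obtain i x where ix: "i \<in> Obj I" "x \<in> sec (FO F i) (Dom B g)" "res X0 g (app u b z) = app (k0 i) (Dom B g) x"
        using gS[OF g] by blast
      have "res X g z = app (k i) (Dom B g) x"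
        using app_res[OF v(1) gh uz] vuz[OF b z] ix(3) vk[OF ix(1) hom_obj(1)[OF B gh] ix(2)] by simp
      then show "\<exists>i\<in>Obj I. \<exists>x\<in>sec (FO F i) (Dom B g). res X g z = app (k i) (Dom B g) x" using ix by blast
    qed
  qed
  fix A Y l assume l: "bilinear A Y l"
  obtain h where h: "bilinear_extension X0 k0 A Y l h" using ext[OF l] by blast
  have "bilinear_extension X k A Y l (\<lambda>b s z. h b s (app u b z))"
    unfolding bilinear_extension_def
  proof (intro conjI ballI allI)
    show "h b s (app u b z) \<in> sec Y b" if "b \<in> Obj B" "s \<in> sec A b" "z \<in> sec X b" for b s z
      by (rule bilinear_extensionD(1)[OF h that(1,2) app_in[OF u(1) that(1,3)]])
    show "h a (res A g s) (app u a (res X g z)) = res Y g (h b s (app u b z))"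
      if g: "g \<in> hom B a b" and s: "s \<in> sec A b" and z: "z \<in> sec X b" for a b g s z
      using bilinear_extensionD(2)[OF h g s app_in[OF u(1) hom_obj(2)[OF B g] z]] app_res[OF u(1) g z] by simp
    show "h b s (app u b (app (k i) b x)) = l i b s x"
      if "i \<in> Obj I" "b \<in> Obj B" "s \<in> sec A b" "x \<in> sec (FO F i) b" for i b s x
      using uk[OF that(1,2,4)] bilinear_extensionD(3)[OF h that] by simp
  qed
  then show "\<exists>h. bilinear_extension X k A Y l h" by blast
qed

end

lemma discrete_simps [simp]:
  "Obj (discrete S) = S" "Arr (discrete S) = S" "Dom (discrete S) s = s" "Cod (discrete S) s = s"
  "Ide (discrete S) s = s" "t \<cdot>\<^bsub>discrete S\<^esub> s = s"
  by (auto simp: discrete_def)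

lemma category_discrete: "category (discrete S)"
  by (rule categoryI) (auto simp: hom_def)

lemma functor_const_discrete:
  "category E \<Longrightarrow> X \<in> Obj E \<Longrightarrow> is_functor (discrete S) E (const_functor (discrete S) E X)"
proof (rule functorI)
  assume E: "category E" and X: "X \<in> Obj E"
  let ?F = "const_functor (discrete S) E X"
  show "FA ?F (g \<cdot>\<^bsub>discrete S\<^esub> f) = FA ?F g \<cdot>\<^bsub>E\<^esub> FA ?F f"
    if "f \<in> hom (discrete S) a b" "g \<in> hom (discrete S) b c" for f g a b c
    using that comp_ide(1)[OF E ide_hom[OF E X]] by (auto simp: hom_def const_functor_def)
qed (auto simp: category_discrete const_functor_def intro: ide_hom simp: hom_def[of "discrete S"])

lemma cocone_discrete:
  assumes E: "category E" and T: "T \<in> Obj E"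
  shows "cocone E (discrete S) (const_functor (discrete S) E T) X k \<longleftrightarrow>
    X \<in> Obj E \<and> (\<forall>s\<in>S. k s \<in> hom E T X)"
  using comp_ide(1)[OF E] by (auto simp: cocone_def const_functor_def)

context sheaf_model
begin

text \<open>Products distribute over coproducts of the terminal object: \<open>A \<times> (\<Coprod>\<^sub>S 1)\<close> is the coproduct of
  copies of \<open>A\<close>, with the injections \<open>j s\<close>. The maps \<open>l s\<close> are a family with parameter in \<open>A\<close> on the
  diagram of the coproduct, and a section of the product lies locally in one of the summands.\<close>

lemma product_copower:
  assumes S: "small_in TYPE('u) S" and T: "is_terminal E T"
    and X: "is_colimit E (discrete S) (const_functor (discrete S) E T) X k"
    and Q: "product_cone E A X Q p q"
    and j: "\<And>s. s \<in> S \<Longrightarrow> j s \<in> hom E A Q" "\<And>s. s \<in> S \<Longrightarrow> p \<cdot> j s = Ide E A"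
      "\<And>s. s \<in> S \<Longrightarrow> q \<cdot> j s = k s \<cdot> t" and t: "t \<in> hom E A T"
    and Y: "Y \<in> Obj E" and l: "\<And>s. s \<in> S \<Longrightarrow> l s \<in> hom E A Y"
  shows "\<exists>!h. h \<in> hom E Q Y \<and> (\<forall>s\<in>S. h \<cdot> j s = l s)"
proof -
  have To: "T \<in> Obj E" using T by (simp add: is_terminal_def)
  let ?F = "const_functor (discrete S) E T"
  interpret D: sheaf_diagram E B J sec res app "discrete S" ?F
    by unfold_locales (simp_all add: functor_const_discrete[OF E To] S)
  note p = Q[unfolded product_cone_def, THEN conjunct1]
    and q = Q[unfolded product_cone_def, THEN conjunct2, THEN conjunct1]
  note A = hom_obj(1)[OF E t] and Qo = hom_obj(1)[OF E p]
  have k: "k s \<in> hom E T X" if "s \<in> S" for s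
    using cocone_arr(2)[OF colimit_cocone[OF X], of s] that by (simp add: const_functor_def)
  have F: "FO ?F s = T" if "s \<in> S" for s using that by (simp add: const_functor_def)
  have Tuniq: "x = y" if "b \<in> Obj B" "x \<in> sec T b" "y \<in> sec T b" for b x y
    using ex1_eqI[OF terminal_sections[OF T that(1)]] that(2,3) by blast
  have Quniq: "x = y" if b: "b \<in> Obj B" and xy: "x \<in> sec Q b" "y \<in> sec Q b"
    "app p b x = app p b y" "app q b x = app q b y" for b x y
    by (rule ex1_eqI[OF product_sections[OF Q b app_in[OF p b xy(2)] app_in[OF q b xy(2)]]])
      (use xy in auto)
  have "D.bilinear A Y (\<lambda>s b a x. app (l s) b a)"
    unfolding D.bilinear_def
  proof (intro conjI A Y ballI allI)
    show "app (l s) b a \<in> sec Y b" if "s \<in> Obj (discrete S)" "b \<in> Obj B" "a \<in> sec A b" for s b a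
      using app_in[OF l] that by simp
    show "app (l s) a (res A g z) = res Y g (app (l s) b z)"
      if "s \<in> Obj (discrete S)" "g \<in> hom B a b" "z \<in> sec A b" for s a b g z
      using app_res[OF l _ _ ] that by simp
  qed (auto simp: hom_def)
  from D.colimit_stable(2)[OF X this] obtain h
    where h: "D.bilinear_extension X k A Y (\<lambda>s b a x. app (l s) b a) h" by blast
  have "\<exists>f\<in>hom E Q Y. \<forall>b\<in>Obj B. \<forall>z\<in>sec Q b. app f b z = h b (app p b z) (app q b z)"
  proof (rule app_full[OF Qo Y])
    show "h b (app p b z) (app q b z) \<in> sec Y b" if "b \<in> Obj B" "z \<in> sec Q b" for b z
      by (rule D.bilinear_extensionD(1)[OF h that(1) app_in[OF p that] app_in[OF q that]])
    show "h a (app p a (res Q g z)) (app q a (res Q g z)) = res Y g (h b (app p b z) (app q b z))"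
      if g: "g \<in> hom B a b" and z: "z \<in> sec Q b" for a b g z
      using D.bilinear_extensionD(2)[OF h g app_in[OF p hom_obj(2)[OF B g] z] app_in[OF q hom_obj(2)[OF B g] z]]
        app_res[OF p g z] app_res[OF q g z] by simp
  qed
  then obtain f where f: "f \<in> hom E Q Y"
    and fh: "\<And>b z. b \<in> Obj B \<Longrightarrow> z \<in> sec Q b \<Longrightarrow> app f b z = h b (app p b z) (app q b z)" by blast
  have pj: "app p b (app (j s) b a) = a" and qj: "app q b (app (j s) b a) = app (k s) b (app t b a)"
    if "s \<in> S" "b \<in> Obj B" "a \<in> sec A b" for s b a
    using app_comp[OF j(1)[OF that(1)] p that(2,3)] app_comp[OF j(1)[OF that(1)] q that(2,3)]
      j(2,3)[OF that(1)] app_ide[OF A that(2,3)] app_comp[OF t k[OF that(1)] that(2,3)] by simp_all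
  have fj: "f \<cdot> j s = l s" if s: "s \<in> S" for s
    proof (rule app_ext[OF comp_hom[OF E j(1)[OF s] f] l[OF s]])
      fix b a assume b: "b \<in> Obj B" and a: "a \<in> sec A b"
      have "h b a (app (k s) b (app t b a)) = app (l s) b a"
        using D.bilinear_extensionD(3)[OF h _ b a, of s "app t b a"] s app_in[OF t b a] F[OF s] by simp
      then show "app (f \<cdot> j s) b a = app (l s) b a"
        using app_comp[OF j(1)[OF s] f b a] fh[OF b app_in[OF j(1)[OF s] b a]] pj[OF s b a] qj[OF s b a]
        by simp
    qed
  show ?thesis
  proof (rule ex1I[of _ f], intro conjI ballI f fj)
    fix f' assume "f' \<in> hom E Q Y \<and> (\<forall>s\<in>S. f' \<cdot> j s = l s)"
    then have f': "f' \<in> hom E Q Y" and f'j: "\<And>s. s \<in> S \<Longrightarrow> f' \<cdot> j s = l s" by auto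
    show "f' = f"
    proof (rule app_ext[OF f' f])
      fix b z assume b: "b \<in> Obj B" and z: "z \<in> sec Q b"
      note qz = app_in[OF q b z]
      obtain R where R: "R \<in> J b"
        and gR: "\<And>g. g \<in> R \<Longrightarrow> \<exists>s\<in>S. \<exists>x\<in>sec (FO ?F s) (Dom B g). res X g (app q b z) = app (k s) (Dom B g) x"
        using D.colimit_stable(1)[OF X] b qz unfolding D.generated_def by force
      show "app f' b z = app f b z"
      proof (rule separated[OF Y b R app_in[OF f' b z] app_in[OF f b z]])
        fix g assume g: "g \<in> R"
        note gh = sieve_arr[OF b R g]
        note a = hom_obj(1)[OF B gh]
        obtain s x where s: "s \<in> S" and x: "x \<in> sec T (Dom B g)"
          and zx: "res X g (app q b z) = app (k s) (Dom B g) x" using gR[OF g] F by auto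
        note z' = res_in[OF Qo gh z]
        note pz = app_in[OF p a z']
        note jpz = app_in[OF j(1)[OF s] a pz]
        \<comment> \<open>Where \<open>q z\<close> restricts to a section of the summand \<open>s\<close>, \<open>z\<close> lies in the image of \<open>j s\<close>.\<close>
        have zj: "res Q g z = app (j s) (Dom B g) (app p (Dom B g) (res Q g z))"
        proof (rule Quniq[OF a z' jpz])
          show "app p (Dom B g) (res Q g z) = app p (Dom B g) (app (j s) (Dom B g) (app p (Dom B g) (res Q g z)))"
            using pj[OF s a pz] by simp
          show "app q (Dom B g) (res Q g z) = app q (Dom B g) (app (j s) (Dom B g) (app p (Dom B g) (res Q g z)))"
            using qj[OF s a pz] app_res[OF q gh z] zx Tuniq[OF a x app_in[OF t a pz]] by simp
        qed
        have *: "app e (Dom B g) (res Q g z) = app (l s) (Dom B g) (app p (Dom B g) (res Q g z))"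
          if e: "e \<in> hom E Q Y" "e \<cdot> j s = l s" for e
          using app_comp[OF j(1)[OF s] e(1) a pz] zj e(2) by simp
        show "res Y g (app f' b z) = res Y g (app f b z)"
          using *[OF f' f'j[OF s]] *[OF f fj[OF s]] app_res[OF f' gh z] app_res[OF f gh z] by simp
      qed
    qed
  qed
qed

end

section \<open>Coproducts of terminal objects\<close>

text \<open>The categories to which \<^const>\<open>gamma\<close> is applied: \<open>E\<close> itself and its slices.\<close>

locale copowered =
  fixes U :: "'u::universe itself" and E :: "('o, 'a) cat" (structure)
  assumes E: "category E" and terminal: "is_terminal E (terminal E)"
    and copower: "Defs.small (S :: 'u set) \<Longrightarrow>
      is_colimit E (discrete S) (const_functor (discrete S) E (terminal E)) (copower E S) (coproj E S)"
begin

lemma terminal_obj: "terminal E \<in> Obj E"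
  using terminal by (simp add: is_terminal_def)

lemma copower_obj: "Defs.small (S :: 'u set) \<Longrightarrow> copower E S \<in> Obj E"
  using colimit_cocone[OF copower] by (simp add: cocone_discrete[OF E terminal_obj])

lemma coproj_hom: "Defs.small (S :: 'u set) \<Longrightarrow> s \<in> S \<Longrightarrow> coproj E S s \<in> hom E (terminal E) (copower E S)"
  using colimit_cocone[OF copower] by (simp add: cocone_discrete[OF E terminal_obj])

lemma copower_universal:
  assumes "Defs.small (S :: 'u set)" "Y \<in> Obj E" "\<And>s. s \<in> S \<Longrightarrow> l s \<in> hom E (terminal E) Y"
  shows "\<exists>!h. h \<in> hom E (copower E S) Y \<and> (\<forall>s\<in>S. h \<cdot> coproj E S s = l s)"
  using colimit_universal[OF copower[OF assms(1)], of Y l] assms(2,3)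
  by (simp add: cocone_discrete[OF E terminal_obj])

lemma copower_eqI:
  assumes S: "Defs.small (S :: 'u set)" and h: "h \<in> hom E (copower E S) Y" "h' \<in> hom E (copower E S) Y"
    and eq: "\<And>s. s \<in> S \<Longrightarrow> h \<cdot> coproj E S s = h' \<cdot> coproj E S s"
  shows "h = h'"
  by (rule ex1_eqI[OF copower_universal[OF S hom_obj(2)[OF E h(1)] comp_hom[OF E coproj_hom[OF S] h(2)]]])
    (use h eq in auto)

lemma gamma_FO [simp]: "Defs.small (S :: 'u set) \<Longrightarrow> FO (gamma E) S = copower E S"
  by (simp add: gamma_def)

lemma gamma_arr:
  assumes f: "f \<in> hom setcat (S :: 'u set) S'"
  shows "FA (gamma E) f \<in> hom E (copower E S) (copower E S')"
    "s \<in> S \<Longrightarrow> FA (gamma E) f \<cdot> coproj E S s = coproj E S' (SF f s)"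
proof -
  have f': "Defs.small S" "Defs.small S'" "SD f = S" "SC f = S'" "SF f \<in> S \<rightarrow>\<^sub>E S'"
    using f by (auto simp: hom_setcat)
  have "\<exists>!h. h \<in> hom E (copower E S) (copower E S') \<and> (\<forall>s\<in>S. h \<cdot> coproj E S s = coproj E S' (SF f s))"
    by (rule copower_universal[OF f'(1) copower_obj[OF f'(2)] coproj_hom[OF f'(2)]]) (use f'(5) in auto)
  from theI'[OF this] f'
  show "FA (gamma E) f \<in> hom E (copower E S) (copower E S')"
    "s \<in> S \<Longrightarrow> FA (gamma E) f \<cdot> coproj E S s = coproj E S' (SF f s)"
    by (auto simp: gamma_def)
qed

lemma gamma_functor: "is_functor setcat E (gamma E :: ('u set, 'u sfun, 'o, 'a) ftr)"
proof (rule functorI[OF category_setcat E])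
  fix f and S S' :: "'u set" assume "f \<in> hom setcat S S'" "S \<in> Obj setcat" "S' \<in> Obj setcat"
  then show "FA (gamma E) f \<in> hom E (FO (gamma E) S) (FO (gamma E) S')" using gamma_arr by simp
next
  fix S :: "'u set" assume S: "S \<in> Obj setcat"
  then have S': "Defs.small S" by simp
  note i = ide_hom[OF category_setcat S]
  show "FA (gamma E) (Ide setcat S) = Ide E (FO (gamma E) S)"
    unfolding gamma_FO[OF S']
  proof (rule copower_eqI[OF S' gamma_arr(1)[OF i] ide_hom[OF E copower_obj[OF S']]])
    fix s assume s: "s \<in> S"
    show "FA (gamma E) (Ide setcat S) \<cdot> coproj E S s = Ide E (copower E S) \<cdot> coproj E S s"
      using gamma_arr(2)[OF i s] comp_ide(2)[OF E coproj_hom[OF S' s]] s by simp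
  qed
next
  fix f g and S S' S'' :: "'u set" assume f: "f \<in> hom setcat S S'" and g: "g \<in> hom setcat S' S''"
  note gf = comp_hom[OF category_setcat f g]
  have S: "Defs.small S" using f by (simp add: hom_setcat)
  show "FA (gamma E) (g \<cdot>\<^bsub>setcat\<^esub> f) = FA (gamma E) g \<cdot> FA (gamma E) f"
  proof (rule copower_eqI[OF S gamma_arr(1)[OF gf] comp_hom[OF E gamma_arr(1)[OF f] gamma_arr(1)[OF g]]])
    fix s assume s: "s \<in> S"
    have fs: "SF f s \<in> S'" "SF (g \<cdot>\<^bsub>setcat\<^esub> f) s = SF g (SF f s)" using f s by (auto simp: hom_setcat)
    show "FA (gamma E) (g \<cdot>\<^bsub>setcat\<^esub> f) \<cdot> coproj E S s = (FA (gamma E) g \<cdot> FA (gamma E) f) \<cdot> coproj E S s"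
      using gamma_arr(2)[OF gf s] gamma_arr(2)[OF f s] gamma_arr(2)[OF g fs(1)] fs(2)
        comp_assoc[OF E coproj_hom[OF S s] gamma_arr(1)[OF f] gamma_arr(1)[OF g]] by simp
  qed
qed (auto simp: gamma_def copower_obj)

end

section \<open>Slices and generalized elements\<close>

text \<open>The properties of a topos from which the adjunction follows. Index categories have the type of
  categories of elements because the assumptions of a locale cannot be polymorphic. The last assumption is
  the distributive law for the chosen copowers.\<close>

locale topos_like =
  fixes U :: "'u::universe itself" and E :: "('o, 'a) cat" (structure)
  assumes cat: "category E" and has_terminal: "\<exists>T. is_terminal E T"
    and has_pullbacks: "f \<in> hom E X Z \<Longrightarrow> g \<in> hom E Y Z \<Longrightarrow> \<exists>p q. is_pullback E f g p q"
    and has_coproducts: "is_functor (discrete (S :: 'u set)) E H \<Longrightarrow> Defs.small S \<Longrightarrow>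
      \<exists>X k. is_colimit E (discrete S) H X k"
    and has_colimits: "is_functor I E F \<Longrightarrow> small_in TYPE('u) (Obj I) \<Longrightarrow>
      \<exists>X k. is_colimit E (I :: ('u \<times> 'u, ('u \<times> 'u) \<times> 'u \<times> ('u \<times> 'u)) cat) F X k"
    and has_limits: "small_in TYPE('u) (V :: ('u \<times> 'u) set) \<Longrightarrow> (\<And>v. v \<in> V \<Longrightarrow> W v \<in> Obj E) \<Longrightarrow>
      (\<And>v w h. (v, w, h) \<in> Ed \<Longrightarrow> v \<in> V \<and> w \<in> V \<and> h \<in> hom E (W v) (W w)) \<Longrightarrow> \<exists>L p. limit_cone E V W Ed L p"
    and distributive: "Defs.small (S :: 'u set) \<Longrightarrow> product_cone E A (copower E S) Q p q \<Longrightarrow>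
      (\<And>s. s \<in> S \<Longrightarrow> j s \<in> hom E A Q) \<Longrightarrow> (\<And>s. s \<in> S \<Longrightarrow> p \<cdot> j s = Ide E A) \<Longrightarrow>
      (\<And>s. s \<in> S \<Longrightarrow> q \<cdot> j s = coproj E S s \<cdot> to_terminal E A) \<Longrightarrow> A \<in> Obj E \<Longrightarrow> Y \<in> Obj E \<Longrightarrow>
      (\<And>s. s \<in> S \<Longrightarrow> l s \<in> hom E A Y) \<Longrightarrow> \<exists>!h. h \<in> hom E Q Y \<and> (\<forall>s\<in>S. h \<cdot> j s = l s)"

lemma (in sheaf_model) topos_like: "topos_like TYPE('u) E"
proof
  show "category E" "\<exists>T. is_terminal E T" by (rule E terminal_exists)+
  show "\<exists>p q. is_pullback E f g p q" if "f \<in> hom E X Z" "g \<in> hom E Y Z" for f g X Y Z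
    by (rule pullback_exists[OF that])
  show disc: "\<exists>X k. is_colimit E (discrete S) H X k"
    if "is_functor (discrete S) E H" "Defs.small S" for S :: "'u set" and H
  proof -
    interpret sheaf_diagram E B J sec res app "discrete S" H
      by unfold_locales (use that in \<open>simp_all add: small_in_self\<close>)
    show ?thesis by (rule colimit_exists)
  qed
  show "\<exists>X k. is_colimit E I F X k" if "is_functor I E F" "small_in TYPE('u) (Obj I)"
    for I :: "('u \<times> 'u, ('u \<times> 'u) \<times> 'u \<times> ('u \<times> 'u)) cat" and F
  proof -
    interpret sheaf_diagram E B J sec res app I F by unfold_locales (use that in simp_all)
    show ?thesis by (rule colimit_exists)
  qed
  show "\<exists>L p. limit_cone E V W Ed L p" if "small_in TYPE('u) V" "\<And>v. v \<in> V \<Longrightarrow> W v \<in> Obj E"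
    "\<And>v w h. (v, w, h) \<in> Ed \<Longrightarrow> v \<in> V \<and> w \<in> V \<and> h \<in> hom E (W v) (W w)"
    for V :: "('u \<times> 'u) set" and W Ed
  proof -
    have "\<exists>L p. limit_cone E V W Ed L p \<and> (\<forall>b\<in>Obj B. \<forall>y. (\<forall>v\<in>V. y v \<in> sec (W v) b) \<longrightarrow>
      (\<forall>(v, w, h)\<in>Ed. app h b (y v) = y w) \<longrightarrow> (\<exists>!z. z \<in> sec L b \<and> (\<forall>v\<in>V. app (p v) b z = y v)))"
      by (rule limits_exist[OF that])
    then show ?thesis by (elim exE conjE) blast
  qed
  fix S :: "'u set" and A Q Y p q j l
  assume S: "Defs.small S" and Q: "product_cone E A (copower E S) Q p q"
    and j: "\<And>s. s \<in> S \<Longrightarrow> j s \<in> hom E A Q" "\<And>s. s \<in> S \<Longrightarrow> p \<cdot> j s = Ide E A"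
      "\<And>s. s \<in> S \<Longrightarrow> q \<cdot> j s = coproj E S s \<cdot> to_terminal E A"
    and A: "A \<in> Obj E" and Y: "Y \<in> Obj E" and l: "\<And>s. s \<in> S \<Longrightarrow> l s \<in> hom E A Y"
  obtain T where T: "is_terminal E T" using terminal_exists by blast
  note T' = terminal_chosen[OF T]
  have To: "terminal E \<in> Obj E" using T' by (simp add: is_terminal_def)
  obtain X k where X: "is_colimit E (discrete S) (const_functor (discrete S) E (terminal E)) X k"
    using disc[OF functor_const_discrete[OF E To] S] by blast
  show "\<exists>!h. h \<in> hom E Q Y \<and> (\<forall>s\<in>S. h \<cdot> j s = l s)"
    by (rule product_copower[OF _ T' colimit_chosen[OF X, folded copower_def coproj_def] Q j
          to_terminal_hom[OF T A] Y l])
      (use S in \<open>simp_all add: small_in_self\<close>)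
qed

lemma slice_simps [simp]:
  "Obj (slice E A) = {p \<in> Arr E. Cod E p = A}" "Dom (slice E A) (p, h, q) = p" "Cod (slice E A) (p, h, q) = q"
  "Ide (slice E A) p = (p, Ide E (Dom E p), p)" "(q', k, r) \<cdot>\<^bsub>slice E A\<^esub> (p, h, q) = (p, k \<cdot>\<^bsub>E\<^esub> h, r)"
  "underlying (p, h, q) = h"
  by (auto simp: slice_def underlying_def)

text \<open>The target appears twice in an arrow of a slice, in the triple and in its underlying arrow; all facts
about such arrows are reduced to the underlying one.\<close>

lemma hom_slice:
  "t \<in> hom (slice E A) p q \<longleftrightarrow> p \<in> hom E (Dom E p) A \<and> q \<in> hom E (Dom E q) A \<and>
    underlying t \<in> hom E (Dom E p) (Dom E q) \<and> q \<cdot>\<^bsub>E\<^esub> underlying t = p \<and> t = (p, underlying t, q)"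
  by (cases t) (auto simp: hom_def slice_def underlying_def)

lemma hom_sliceD:
  assumes "t \<in> hom (slice E A) p q"
  shows "p \<in> hom E (Dom E p) A" "q \<in> hom E (Dom E q) A" "underlying t \<in> hom E (Dom E p) (Dom E q)"
    "q \<cdot>\<^bsub>E\<^esub> underlying t = p" "t = (p, underlying t, q)"
  using assms unfolding hom_slice by simp_all

lemma slice_eqI:
  assumes "s \<in> hom (slice E A) p q" "t \<in> hom (slice E A) p q" "underlying s = underlying t"
  shows "s = t"
  using hom_sliceD(5)[OF assms(1)] hom_sliceD(5)[OF assms(2)] assms(3) by simp

lemma slice_comp:
  assumes "s \<in> hom (slice E A) p q" "t \<in> hom (slice E A) q r"
  shows "underlying (t \<cdot>\<^bsub>slice E A\<^esub> s) = underlying t \<cdot>\<^bsub>E\<^esub> underlying s"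
    "t \<cdot>\<^bsub>slice E A\<^esub> s = (p, underlying t \<cdot>\<^bsub>E\<^esub> underlying s, r)"
  using hom_sliceD(5)[OF assms(1)] hom_sliceD(5)[OF assms(2)] slice_simps(5,6) by metis+

lemma category_slice:
  assumes E: "category E"
  shows "category (slice E A)"
proof (rule categoryI)
  have arr: "t \<in> hom (slice E A) (Dom (slice E A) t) (Cod (slice E A) t)" if "t \<in> Arr (slice E A)" for t
    using arr_hom[OF that] .
  fix s assume s: "s \<in> Arr (slice E A)"
  note s' = arr[OF s]
  show "Dom (slice E A) s \<in> Obj (slice E A)" "Cod (slice E A) s \<in> Obj (slice E A)"
    using hom_sliceD(1,2)[OF s'] by (auto simp: hom_def)
  show "s \<cdot>\<^bsub>slice E A\<^esub> Ide (slice E A) (Dom (slice E A) s) = s"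
    using hom_sliceD[OF s'] comp_ide(1)[OF E hom_sliceD(3)[OF s']] by (metis slice_simps(4,5))
  show "Ide (slice E A) (Cod (slice E A) s) \<cdot>\<^bsub>slice E A\<^esub> s = s"
    using hom_sliceD[OF s'] comp_ide(2)[OF E hom_sliceD(3)[OF s']] by (metis slice_simps(4,5))
  fix t assume t: "t \<in> Arr (slice E A)" and st: "Cod (slice E A) s = Dom (slice E A) t"
  note t' = arr[OF t, folded st]
  show ts: "t \<cdot>\<^bsub>slice E A\<^esub> s \<in> hom (slice E A) (Dom (slice E A) s) (Cod (slice E A) t)"
    unfolding hom_slice
    using slice_comp[OF s' t'] hom_sliceD[OF s'] hom_sliceD[OF t']
      comp_hom[OF E hom_sliceD(3)[OF s'] hom_sliceD(3)[OF t']]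
      comp_assoc[OF E hom_sliceD(3)[OF s'] hom_sliceD(3)[OF t'] hom_sliceD(2)[OF t']] by simp
next
  fix p assume "p \<in> Obj (slice E A)"
  then have p: "p \<in> hom E (Dom E p) A" by (simp add: hom_def)
  then show "Ide (slice E A) p \<in> hom (slice E A) p p"
    using ide_hom[OF E hom_obj(1)[OF E p]] comp_ide(1)[OF E p] by (simp add: hom_slice)
next
  fix r s t assume r: "r \<in> Arr (slice E A)" and s: "s \<in> Arr (slice E A)" and t: "t \<in> Arr (slice E A)"
    and rs: "Cod (slice E A) r = Dom (slice E A) s" and st: "Cod (slice E A) s = Dom (slice E A) t"
  note r' = arr_hom[OF r] and s' = arr_hom[OF s, folded rs] and t' = arr_hom[OF t, folded st]
  obtain p1 h1 q1 p2 h2 q2 p3 h3 q3 where eq: "r = (p1, h1, q1)" "s = (p2, h2, q2)" "t = (p3, h3, q3)"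
    by (metis prod_cases3)
  show "t \<cdot>\<^bsub>slice E A\<^esub> (s \<cdot>\<^bsub>slice E A\<^esub> r) = (t \<cdot>\<^bsub>slice E A\<^esub> s) \<cdot>\<^bsub>slice E A\<^esub> r"
    using comp_assoc[OF E hom_sliceD(3)[OF r'] hom_sliceD(3)[OF s'] hom_sliceD(3)[OF t']] by (simp add: eq)
qed

text \<open>Colimits in a slice are created by the forgetful functor.\<close>

lemma slice_colimit:
  assumes E: "category E" and A: "A \<in> Obj E" and F: "is_functor I (slice E A) F"
    and ex: "\<And>G. is_functor I E G \<Longrightarrow> \<exists>X k. is_colimit E I G X k"
  shows "\<exists>x k. is_colimit (slice E A) I F x k"
proof -
  note I = functor_category(1)[OF F] and SE = category_slice[OF E, of A]
  define G where "G = \<lparr>FO = \<lambda>i\<in>Obj I. Dom E (FO F i), FA = \<lambda>u\<in>Arr I. underlying (FA F u)\<rparr>"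
  have Fo: "FO F i \<in> hom E (Dom E (FO F i)) A" if "i \<in> Obj I" for i
    using functor_obj[OF F that] by (simp add: hom_def)
  have G: "is_functor I E G"
  proof (rule functorI[OF I E])
    fix u i j assume u: "u \<in> hom I i j" and ij: "i \<in> Obj I" "j \<in> Obj I"
    then show "FA G u \<in> hom E (FO G i) (FO G j)"
      using hom_sliceD(3)[OF functor_hom[OF F u]] homD[OF u] by (simp add: G_def)
  next
    fix i assume i: "i \<in> Obj I"
    show "FA G (Ide I i) = Ide E (FO G i)"
      using functor_ide[OF F i] homD[OF ide_hom[OF I i]] i by (simp add: G_def)
  next
    fix u v i j k assume u: "u \<in> hom I i j" and v: "v \<in> hom I j k"
    show "FA G (v \<cdot>\<^bsub>I\<^esub> u) = FA G v \<cdot>\<^bsub>E\<^esub> FA G u"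
      using functor_comp[OF F u v] slice_comp(1)[OF functor_hom[OF F u] functor_hom[OF F v]]
        homD[OF u] homD[OF v] homD[OF comp_hom[OF I u v]] by (simp add: G_def)
  qed (auto simp: G_def hom_obj(1)[OF E Fo])
  have Gi [simp]: "FO G i = Dom E (FO F i)" if "i \<in> Obj I" for i using that by (simp add: G_def)
  have Gu [simp]: "FA G u = underlying (FA F u)" if "u \<in> hom I i j" for u i j using homD[OF that] by (simp add: G_def)
  obtain X k where X: "is_colimit E I G X k" using ex[OF G] by blast
  note k = colimit_cocone[OF X]
  have "cocone E I G A (FO F)"
    by (rule coconeI[OF I A]) (use Fo hom_sliceD(4)[OF functor_hom[OF F]] in auto)
  from colimit_universal[OF X this] obtain x where x: "x \<in> hom E X A"
    and xk: "\<forall>i\<in>Obj I. x \<cdot>\<^bsub>E\<^esub> k i = FO F i" by (elim ex1E) blast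
  have xD: "Dom E x = X" by (rule homD[OF x])
  have x': "x \<in> Obj (slice E A)" using homD[OF x] by simp
  have ki: "k i \<in> hom E (Dom E (FO F i)) X" if "i \<in> Obj I" for i
    using cocone_arr(2)[OF k that] that by simp
  have sk: "(FO F i, k i, x) \<in> hom (slice E A) (FO F i) x" if "i \<in> Obj I" for i
    using Fo[OF that] x ki[OF that] xk that by (simp add: hom_slice xD)
  have "cocone (slice E A) I F x (\<lambda>i. (FO F i, k i, x))"
  proof (rule coconeI[OF I x' sk])
    fix u i j assume u: "u \<in> hom I i j" and ij: "i \<in> Obj I" "j \<in> Obj I"
    show "(FO F j, k j, x) \<cdot>\<^bsub>slice E A\<^esub> FA F u = (FO F i, k i, x)"
      using slice_comp(2)[OF functor_hom[OF F u] sk[OF ij(2)]] cocone_arr(3)[OF k u] u by simp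
  qed
  moreover have "\<exists>!h. h \<in> hom (slice E A) x y \<and> (\<forall>i\<in>Obj I. h \<cdot>\<^bsub>slice E A\<^esub> (FO F i, k i, x) = l i)"
    if l: "cocone (slice E A) I F y l" for y l
  proof -
    have y: "y \<in> hom E (Dom E y) A" using cocone_arr(1)[OF l] by (simp add: hom_def)
    note li = cocone_arr(2)[OF l]
    have "cocone E I G (Dom E y) (\<lambda>i. underlying (l i))"
    proof (rule coconeI[OF I hom_obj(1)[OF E y]])
      show "underlying (l i) \<in> hom E (FO G i) (Dom E y)" if "i \<in> Obj I" for i
        using hom_sliceD(3)[OF li[OF that]] that by simp
      fix u i j assume u: "u \<in> hom I i j" and ij: "i \<in> Obj I" "j \<in> Obj I"
      show "underlying (l j) \<cdot>\<^bsub>E\<^esub> FA G u = underlying (l i)"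
        using slice_comp(1)[OF functor_hom[OF F u] li[OF ij(2)]] cocone_arr(3)[OF l u] u by simp
    qed
    from colimit_universal[OF X this] obtain h where h: "h \<in> hom E X (Dom E y)"
      and hk: "\<forall>i\<in>Obj I. h \<cdot>\<^bsub>E\<^esub> k i = underlying (l i)"
      by (elim ex1E) blast
    have yh: "y \<cdot>\<^bsub>E\<^esub> h = x"
    proof (rule colimit_eqI[OF E G X comp_hom[OF E h y] x])
      fix i assume i: "i \<in> Obj I"
      show "(y \<cdot>\<^bsub>E\<^esub> h) \<cdot>\<^bsub>E\<^esub> k i = x \<cdot>\<^bsub>E\<^esub> k i"
        using comp_assoc[OF E ki[OF i] h y] hk xk i hom_sliceD(4)[OF li[OF i]] by simp
    qed
    have sh: "(x, h, y) \<in> hom (slice E A) x y" using x y h yh by (simp add: hom_slice xD)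
    show ?thesis
    proof (rule ex1I[of _ "(x, h, y)"], intro conjI sh ballI)
      fix i assume i: "i \<in> Obj I"
      show "(x, h, y) \<cdot>\<^bsub>slice E A\<^esub> (FO F i, k i, x) = l i"
        using hk i hom_sliceD(5)[OF li[OF i]] by simp
    next
      fix h' assume "h' \<in> hom (slice E A) x y \<and> (\<forall>i\<in>Obj I. h' \<cdot>\<^bsub>slice E A\<^esub> (FO F i, k i, x) = l i)"
      then have h': "h' \<in> hom (slice E A) x y"
        and h'k: "\<And>i. i \<in> Obj I \<Longrightarrow> h' \<cdot>\<^bsub>slice E A\<^esub> (FO F i, k i, x) = l i" by auto
      have u: "underlying h' \<in> hom E X (Dom E y)" using hom_sliceD(3)[OF h'] xD by simp
      have "underlying h' = h"
      proof (rule colimit_eqI[OF E G X u h])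
        fix i assume i: "i \<in> Obj I"
        show "underlying h' \<cdot>\<^bsub>E\<^esub> k i = h \<cdot>\<^bsub>E\<^esub> k i"
          using slice_comp(1)[OF sk[OF i] h'] h'k[OF i] hk i by simp
      qed
      then show "h' = (x, h, y)" using hom_sliceD(5)[OF h'] by simp
    qed
  qed
  ultimately have "is_colimit (slice E A) I F x (\<lambda>i. (FO F i, k i, x))" by (simp add: is_colimit_def)
  then show ?thesis by blast
qed

text \<open>Every object \<open>p\<close> of the slice is itself the unique arrow to the identity.\<close>

lemma slice_terminal:
  assumes E: "category E" and A: "A \<in> Obj E"
  shows "is_terminal (slice E A) (Ide E A)"
  unfolding is_terminal_def
proof (intro conjI ballI)
  have i: "Ide E A \<in> hom E A A" by (rule ide_hom[OF E A])
  then show "Ide E A \<in> Obj (slice E A)" by (simp add: hom_def)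
  fix p assume "p \<in> Obj (slice E A)"
  then have p: "p \<in> hom E (Dom E p) A" by (simp add: hom_def)
  show "\<exists>!h. h \<in> hom (slice E A) p (Ide E A)"
  proof (rule ex1I[of _ "(p, p, Ide E A)"])
    show "(p, p, Ide E A) \<in> hom (slice E A) p (Ide E A)"
      using p i homD[OF i] comp_ide(2)[OF E p] by (simp add: hom_slice)
    fix h assume h: "h \<in> hom (slice E A) p (Ide E A)"
    have "underlying h = p" using hom_sliceD(3,4)[OF h] homD[OF i] comp_ide(2)[OF E] by metis
    then show "h = (p, p, Ide E A)" using hom_sliceD(5)[OF h] by simp
  qed
qed

context topos_like
begin

lemma terminal_E: "is_terminal E (terminal E)"
  using has_terminal by (elim exE) (rule terminal_chosen)

lemma to_terminal: "X \<in> Obj E \<Longrightarrow> to_terminal E X \<in> hom E X (terminal E)"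
  by (rule to_terminal_hom[OF terminal_E])

sublocale copowered U E
proof
  show "category E" by (rule cat)
  show "is_terminal E (terminal E)" by (rule terminal_E)
  then have To: "terminal E \<in> Obj E" by (simp add: is_terminal_def)
  fix S :: "'u set" assume "Defs.small S"
  then obtain X k where "is_colimit E (discrete S) (const_functor (discrete S) E (terminal E)) X k"
    using has_coproducts[OF functor_const_discrete[OF cat To]] by blast
  then show "is_colimit E (discrete S) (const_functor (discrete S) E (terminal E)) (copower E S) (coproj E S)"
    unfolding copower_def coproj_def by (rule colimit_chosen)
qed

lemma copowered_slice:
  assumes A: "A \<in> Obj E"
  shows "copowered TYPE('u) (slice E A)"
proof (rule copowered.intro)
  note SE = category_slice[OF E, of A]
  show "category (slice E A)" by (rule SE)
  show t: "is_terminal (slice E A) (terminal (slice E A))" by (rule terminal_chosen[OF slice_terminal[OF E A]])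
  then have To: "terminal (slice E A) \<in> Obj (slice E A)" unfolding is_terminal_def by blast
  fix S :: "'u set" assume S: "Defs.small S"
  have "\<exists>X k. is_colimit (slice E A) (discrete S)
      (const_functor (discrete S) (slice E A) (terminal (slice E A))) X k"
    by (rule slice_colimit[OF E A functor_const_discrete[OF SE To] has_coproducts[OF _ S]])
  then show "is_colimit (slice E A) (discrete S) (const_functor (discrete S) (slice E A) (terminal (slice E A)))
      (copower (slice E A) S) (coproj (slice E A) S)"
    unfolding copower_def coproj_def by (elim exE) (rule colimit_chosen)
qed

subsection \<open>Products\<close>

abbreviation prd :: "'o \<Rightarrow> 'o \<Rightarrow> 'o" where
  "prd A X \<equiv> Dom E (proj1 E A X)"

text \<open>The chosen product is a pullback over the terminal object, where every square commutes.\<close>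

lemma product:
  assumes A: "A \<in> Obj E" and X: "X \<in> Obj E"
  shows "product_cone E A X (prd A X) (proj1 E A X) (proj2 E A X)"
proof -
  note a = to_terminal[OF A] and x = to_terminal[OF X]
  have "\<exists>p q. is_pullback E (to_terminal E A) (to_terminal E X) p q" by (rule has_pullbacks[OF a x])
  then obtain p q where "is_pullback E (to_terminal E A) (to_terminal E X) p q" by (elim exE)
  then have "(\<lambda>(p, q). is_pullback E (to_terminal E A) (to_terminal E X) p q) (p, q)" by simp
  then have "(\<lambda>(p, q). is_pullback E (to_terminal E A) (to_terminal E X) p q)
    (SOME (p, q). is_pullback E (to_terminal E A) (to_terminal E X) p q)"
    by (rule someI)
  then have pb: "is_pullback E (to_terminal E A) (to_terminal E X) (proj1 E A X) (proj2 E A X)"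
    by (simp add: proj1_def proj2_def pullback_def case_prod_beta)
  note aD = homD[OF a] and xD = homD[OF x]
  have p: "proj1 E A X \<in> hom E (prd A X) A" "proj2 E A X \<in> hom E (prd A X) X"
  proof -
    have "proj1 E A X \<in> Arr E" "proj2 E A X \<in> Arr E" "Dom E (proj1 E A X) = Dom E (proj2 E A X)"
      "Cod E (proj1 E A X) = A" "Cod E (proj2 E A X) = X"
      using pb unfolding is_pullback_def aD xD by - (elim conjE, assumption)+
    then show "proj1 E A X \<in> hom E (prd A X) A" "proj2 E A X \<in> hom E (prd A X) X" by (simp_all add: hom_def)
  qed
  have univ: "\<forall>r\<in>Arr E. \<forall>s\<in>Arr E. Dom E r = Dom E s \<longrightarrow> Cod E r = A \<longrightarrow> Cod E s = X \<longrightarrow>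
        to_terminal E A \<cdot> r = to_terminal E X \<cdot> s \<longrightarrow>
        (\<exists>!h. h \<in> hom E (Dom E r) (prd A X) \<and> proj1 E A X \<cdot> h = r \<and> proj2 E A X \<cdot> h = s)"
    using pb unfolding is_pullback_def aD xD by (elim conjE)
  show ?thesis unfolding product_cone_def
  proof (intro conjI p allI impI)
    fix B r s assume r: "r \<in> hom E B A" and s: "s \<in> hom E B X"
    note rD = homD[OF r] and sD = homD[OF s]
    have t: "to_terminal E A \<cdot> r = to_terminal E X \<cdot> s"
      by (rule terminal_eqI[OF terminal_E E comp_hom[OF E r a] comp_hom[OF E s x]])
    show "\<exists>!h. h \<in> hom E B (prd A X) \<and> proj1 E A X \<cdot> h = r \<and> proj2 E A X \<cdot> h = s"
      using univ[rule_format, OF rD(1) sD(1) _ rD(3) sD(3) t] rD sD by simp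
  qed
qed

lemma proj_hom:
  assumes "A \<in> Obj E" "X \<in> Obj E"
  shows "proj1 E A X \<in> hom E (prd A X) A" "proj2 E A X \<in> hom E (prd A X) X"
  using product[OF assms] by (auto simp: product_cone_def)

lemma pair_universal:
  assumes "r \<in> hom E B A" "s \<in> hom E B X"
  shows "\<exists>!h. h \<in> hom E B (prd A X) \<and> proj1 E A X \<cdot> h = r \<and> proj2 E A X \<cdot> h = s"
  by (rule product_cone_universal[OF product[OF hom_obj(2)[OF E assms(1)] hom_obj(2)[OF E assms(2)]] assms])

lemma pair_eqI:
  assumes A: "A \<in> Obj E" and X: "X \<in> Obj E" and h: "h \<in> hom E B (prd A X)" "h' \<in> hom E B (prd A X)"
    and eq: "proj1 E A X \<cdot> h = proj1 E A X \<cdot> h'" "proj2 E A X \<cdot> h = proj2 E A X \<cdot> h'"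
  shows "h = h'"
  by (rule ex1_eqI[OF pair_universal[OF comp_hom[OF E h(2) proj_hom(1)[OF A X]] comp_hom[OF E h(2) proj_hom(2)[OF A X]]]])
    (use h eq in auto)

lemma prod_arr:
  assumes u: "u \<in> hom E B A" and f: "f \<in> hom E X Y"
  shows "prod_arr E u f \<in> hom E (prd B X) (prd A Y)"
    "proj1 E A Y \<cdot> prod_arr E u f = u \<cdot> proj1 E B X"
    "proj2 E A Y \<cdot> prod_arr E u f = f \<cdot> proj2 E B X"
proof -
  note B = hom_obj(1)[OF E u] and X = hom_obj(1)[OF E f]
  from theI'[OF pair_universal[OF comp_hom[OF E proj_hom(1)[OF B X] u] comp_hom[OF E proj_hom(2)[OF B X] f]]]
  show "prod_arr E u f \<in> hom E (prd B X) (prd A Y)"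
    "proj1 E A Y \<cdot> prod_arr E u f = u \<cdot> proj1 E B X"
    "proj2 E A Y \<cdot> prod_arr E u f = f \<cdot> proj2 E B X"
    unfolding prod_arr_def homD(2,3)[OF u] homD(2,3)[OF f] by auto
qed

subsection \<open>Arrows of a slice into a product\<close>

lemma proj1_obj: "A \<in> Obj E \<Longrightarrow> X \<in> Obj E \<Longrightarrow> proj1 E A X \<in> Obj (slice E A)"
  using homD[OF proj_hom(1)] by simp

text \<open>Pullback along \<open>A \<rightarrow> 1\<close> is right adjoint to the forgetful functor: an arrow from \<open>p\<close> to \<open>!\<^sub>A\<^sup>*(Y)\<close> is
  given by its second component.\<close>

lemma slice_transpose:
  assumes p: "p \<in> hom E P A" and y: "y \<in> hom E P Y"
  shows "\<exists>t. t \<in> hom (slice E A) p (proj1 E A Y) \<and> proj2 E A Y \<cdot> underlying t = y"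
proof -
  obtain h where h: "h \<in> hom E P (prd A Y)" "proj1 E A Y \<cdot> h = p" "proj2 E A Y \<cdot> h = y"
    using pair_universal[OF p y] by (elim ex1E) blast
  then show ?thesis
    using p homD(2)[OF p] proj_hom(1)[OF hom_obj(2)[OF E p] hom_obj(2)[OF E y]]
    by (intro exI[of _ "(p, h, proj1 E A Y)"]) (simp add: hom_slice)
qed

lemma slice_transpose_eqI:
  assumes s: "s \<in> hom (slice E A) p (proj1 E A Y)" and t: "t \<in> hom (slice E A) p (proj1 E A Y)"
    and A: "A \<in> Obj E" and Y: "Y \<in> Obj E"
    and eq: "proj2 E A Y \<cdot> underlying s = proj2 E A Y \<cdot> underlying t"
  shows "s = t"
proof (rule slice_eqI[OF s t])
  show "underlying s = underlying t"
    by (rule pair_eqI[OF A Y hom_sliceD(3)[OF s] hom_sliceD(3)[OF t]])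
      (use hom_sliceD(4)[OF s] hom_sliceD(4)[OF t] eq in auto)
qed

lemma base_change_FO [simp]: "X \<in> Obj E \<Longrightarrow> FO (base_change E A) X = proj1 E A X"
  by (simp add: base_change_def)

lemma base_change_arr:
  assumes A: "A \<in> Obj E" and f: "f \<in> hom E X Y"
  shows "FA (base_change E A) f \<in> hom (slice E A) (proj1 E A X) (proj1 E A Y)"
    "proj2 E A Y \<cdot> underlying (FA (base_change E A) f) = f \<cdot> proj2 E A X"
proof -
  note XY = hom_obj[OF E f] and i = ide_hom[OF E A]
  have eq: "FA (base_change E A) f = (proj1 E A X, prod_arr E (Ide E A) f, proj1 E A Y)"
    using homD[OF f] by (simp add: base_change_def)
  show "FA (base_change E A) f \<in> hom (slice E A) (proj1 E A X) (proj1 E A Y)"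
    using proj_hom(1)[OF A XY(1)] proj_hom(1)[OF A XY(2)] prod_arr(1,2)[OF i f]
      comp_ide(2)[OF E proj_hom(1)[OF A XY(1)]] by (simp add: hom_slice eq)
  show "proj2 E A Y \<cdot> underlying (FA (base_change E A) f) = f \<cdot> proj2 E A X"
    using prod_arr(3)[OF i f] by (simp add: eq)
qed

lemma base_change_comp:
  assumes A: "A \<in> Obj E" and f: "f \<in> hom E X Y" and t: "t \<in> hom (slice E A) p (proj1 E A X)"
  shows "proj2 E A Y \<cdot> underlying (FA (base_change E A) f \<cdot>\<^bsub>slice E A\<^esub> t) =
    f \<cdot> (proj2 E A X \<cdot> underlying t)"
proof -
  note bf = base_change_arr[OF A f] and XY = hom_obj[OF E f]
  show ?thesis
    using slice_comp(1)[OF t bf(1)] bf(2)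
      comp_assoc[OF E hom_sliceD(3)[OF t] hom_sliceD(3)[OF bf(1)] proj_hom(2)[OF A XY(2)]]
      comp_assoc[OF E hom_sliceD(3)[OF t] proj_hom(2)[OF A XY(1)] f] by simp
qed

lemma base_change_functor:
  assumes A: "A \<in> Obj E"
  shows "is_functor E (slice E A) (base_change E A)"
proof (rule functorI[OF E category_slice[OF E]])
  show "FA (base_change E A) f \<in> hom (slice E A) (FO (base_change E A) X) (FO (base_change E A) Y)"
    if "f \<in> hom E X Y" "X \<in> Obj E" "Y \<in> Obj E" for f X Y
    using base_change_arr(1)[OF A that(1)] that by simp
  show "FO (base_change E A) X \<in> Obj (slice E A)" if "X \<in> Obj E" for X
    using proj1_obj[OF A that] that by (simp add: base_change_FO)
  fix X assume X: "X \<in> Obj E"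
  note SE = category_slice[OF E, of A] and i = ide_hom[OF E X]
  have "FA (base_change E A) (Ide E X) = Ide (slice E A) (proj1 E A X)"
    by (rule slice_transpose_eqI[OF base_change_arr(1)[OF A i] ide_hom[OF SE proj1_obj[OF A X]] A X])
      (use base_change_arr(2)[OF A i] comp_ide[OF E proj_hom(2)[OF A X]] in simp)
  then show "FA (base_change E A) (Ide E X) = Ide (slice E A) (FO (base_change E A) X)" using X by simp
next
  fix f g X Y Z assume f: "f \<in> hom E X Y" and g: "g \<in> hom E Y Z"
  note bf = base_change_arr[OF A f] and bg = base_change_arr[OF A g] and gf = comp_hom[OF E f g]
  show "FA (base_change E A) (g \<cdot> f) = FA (base_change E A) g \<cdot>\<^bsub>slice E A\<^esub> FA (base_change E A) f"
    by (rule slice_transpose_eqI[OF base_change_arr(1)[OF A gf] comp_hom[OF category_slice[OF E] bf(1) bg(1)]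
          A hom_obj(2)[OF E g]])
      (use base_change_arr(2)[OF A gf] base_change_comp[OF A g bf(1)] bf(2)
        comp_assoc[OF E proj_hom(2)[OF A hom_obj(1)[OF E f]] f g] in simp)
qed (auto simp: base_change_def)

subsection \<open>Global elements of \<open>!\<^sub>A\<^sup>*(Y)\<close>\<close>

lemma slice_terminal_chosen: "A \<in> Obj E \<Longrightarrow> is_terminal (slice E A) (terminal (slice E A))"
  by (rule terminal_chosen[OF slice_terminal[OF E]])

lemma slice_terminal_hom: "A \<in> Obj E \<Longrightarrow> terminal (slice E A) \<in> hom E (Dom E (terminal (slice E A))) A"
  using slice_terminal_chosen[of A] by (auto simp: is_terminal_def hom_def)

text \<open>The chosen terminal object of the slice need not be the identity, but it is invertible, as both are
  terminal. Therefore arrows out of it are generalized elements at stage \<open>A\<close>.\<close>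

lemma slice_terminal_inverse:
  assumes A: "A \<in> Obj E"
  obtains v where "v \<in> hom E A (Dom E (terminal (slice E A)))"
    "terminal (slice E A) \<cdot> v = Ide E A" "v \<cdot> terminal (slice E A) = Ide E (Dom E (terminal (slice E A)))"
proof -
  let ?t = "terminal (slice E A)"
  note t = slice_terminal_hom[OF A] and i = ide_hom[OF E A]
  have "Ide E A \<in> Obj (slice E A)" using homD[OF i] by simp
  from terminal_hom[OF slice_terminal_chosen[OF A] this]
  obtain h where h: "h \<in> hom (slice E A) (Ide E A) ?t" by (elim ex1E)
  have v: "underlying h \<in> hom E A (Dom E ?t)" "?t \<cdot> underlying h = Ide E A"
    using hom_sliceD(3,4)[OF h] homD[OF i] by simp_all
  note vt = comp_hom[OF E t v(1)]
  have to: "?t \<in> Obj (slice E A)" using homD[OF t] by simp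
  have 1: "(?t, underlying h \<cdot> ?t, ?t) \<in> hom (slice E A) ?t ?t"
    using t vt comp_assoc[OF E t v(1) t] v(2) comp_ide(2)[OF E t] by (simp add: hom_slice)
  have "(?t, underlying h \<cdot> ?t, ?t) = Ide (slice E A) ?t"
    by (rule terminal_eqI[OF slice_terminal_chosen[OF A] category_slice[OF E] 1 ide_hom[OF category_slice[OF E] to]])
  then show ?thesis using that[OF v] by simp
qed

lemma global_element:
  assumes A: "A \<in> Obj E" and x: "x \<in> hom E A Y"
  shows "global_element E A Y x \<in> hom (slice E A) (terminal (slice E A)) (proj1 E A Y)"
    "proj2 E A Y \<cdot> underlying (global_element E A Y x) = x \<cdot> terminal (slice E A)"
proof -
  note t = slice_terminal_hom[OF A] and Y = hom_obj(2)[OF E x]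
  have "\<exists>!k. k \<in> hom (slice E A) (terminal (slice E A)) (proj1 E A Y) \<and>
     proj2 E A Y \<cdot> underlying k = x \<cdot> terminal (slice E A)"
    using slice_transpose[OF t comp_hom[OF E t x]] slice_transpose_eqI[OF _ _ A Y] by (elim exE) (rule ex1I, auto)
  from theI'[OF this]
  show "global_element E A Y x \<in> hom (slice E A) (terminal (slice E A)) (proj1 E A Y)"
    "proj2 E A Y \<cdot> underlying (global_element E A Y x) = x \<cdot> terminal (slice E A)"
    using Y by (auto simp: global_element_def)
qed

lemma global_element_surj:
  assumes A: "A \<in> Obj E" and Y: "Y \<in> Obj E" and k: "k \<in> hom (slice E A) (terminal (slice E A)) (proj1 E A Y)"
  shows "\<exists>x\<in>hom E A Y. k = global_element E A Y x"
proof -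
  let ?t = "terminal (slice E A)"
  note t = slice_terminal_hom[OF A]
  obtain v where v: "v \<in> hom E A (Dom E ?t)" "v \<cdot> ?t = Ide E (Dom E ?t)" by (rule slice_terminal_inverse[OF A])
  note y = comp_hom[OF E hom_sliceD(3)[OF k] proj_hom(2)[OF A Y]]
  note x = comp_hom[OF E v(1) y]
  have "k = global_element E A Y ((proj2 E A Y \<cdot> underlying k) \<cdot> v)"
    by (rule slice_transpose_eqI[OF k global_element(1)[OF A x] A Y])
      (use global_element(2)[OF A x] comp_assoc[OF E t v(1) y] v(2) comp_ide(1)[OF E y] in simp)
  then show ?thesis using x by blast
qed

lemma global_element_comp:
  assumes A: "A \<in> Obj E" and x: "x \<in> hom E A X" and f: "f \<in> hom E X Y"
  shows "FA (base_change E A) f \<cdot>\<^bsub>slice E A\<^esub> global_element E A X x = global_element E A Y (f \<cdot> x)"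
  by (rule slice_transpose_eqI[OF comp_hom[OF category_slice[OF E] global_element(1)[OF A x] base_change_arr(1)[OF A f]]
        global_element(1)[OF A comp_hom[OF E x f]] A hom_obj(2)[OF E f]])
    (use base_change_comp[OF A f global_element(1)[OF A x]] global_element(2)[OF A x]
      global_element(2)[OF A comp_hom[OF E x f]] comp_assoc[OF E slice_terminal_hom[OF A] x f] in simp)

end

section \<open>Categories of elements and the functor tilde\<close>

lemma ball_elements:
  "(\<forall>(d, z)\<in>Obj (elements D X). Q d z) \<longleftrightarrow> (\<forall>d\<in>Obj D. \<forall>z\<in>FO X d. Q d z)"
  by (auto simp: elements_def)

lemma elements_simps [simp]:
  "Obj (elements D X) = {(d, z). d \<in> Obj D \<and> z \<in> FO X d}"
  "Dom (elements D X) (i, g, j) = i" "Cod (elements D X) (i, g, j) = j"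
  "Ide (elements D X) (d, z) = ((d, z), Ide D d, (d, z))"
  "(j', h, k) \<cdot>\<^bsub>elements D X\<^esub> (i, g, j) = (i, h \<cdot>\<^bsub>D\<^esub> g, k)"
  by (auto simp: elements_def)

lemma Arr_elements:
  "((d, z), g, (d', z')) \<in> Arr (elements D X) \<longleftrightarrow> d \<in> Obj D \<and> d' \<in> Obj D \<and>
    z \<in> FO X d \<and> z' \<in> FO X d' \<and> g \<in> hom D d d' \<and> SF (FA X g) z' = z"
  by (auto simp: elements_def)

lemma hom_elements:
  "t \<in> hom (elements D X) (d, z) (d', z') \<longleftrightarrow> (\<exists>g. t = ((d, z), g, (d', z')) \<and> d \<in> Obj D \<and> d' \<in> Obj D \<and>
    z \<in> FO X d \<and> z' \<in> FO X d' \<and> g \<in> hom D d d' \<and> SF (FA X g) z' = z)"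
  by (cases t) (auto simp: hom_def[of "elements D X"] Arr_elements)

lemma psh_act:
  assumes X: "is_functor (opp D) setcat X" and g: "g \<in> hom D d d'" and z: "z \<in> FO X d'"
  shows "SF (FA X g) z \<in> FO X d"
  using functor_hom[OF X, of g d' d] g z by (auto simp: hom_setcat)

lemma psh_act_ide:
  assumes X: "is_functor (opp D) setcat X" and d: "d \<in> Obj D" and z: "z \<in> FO X d"
  shows "SF (FA X (Ide D d)) z = z"
  using functor_ide[OF X, of d] d z by simp

lemma psh_act_comp:
  assumes X: "is_functor (opp D) setcat X" and g: "g \<in> hom D d d'" and h: "h \<in> hom D d' d''" and z: "z \<in> FO X d''"
  shows "SF (FA X g) (SF (FA X h) z) = SF (FA X (h \<cdot>\<^bsub>D\<^esub> g)) z"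
  using functor_comp[OF X, of h d'' d' g d] functor_hom[OF X, of h d'' d'] g h z by (simp add: hom_setcat)

text \<open>Composition keeps the condition on the elements because \<open>X\<close> is a functor.\<close>

lemma category_elements:
  assumes D: "category D" and X: "is_functor (opp D) setcat X"
  shows "category (elements D X)"
proof (rule categoryI)
  let ?E = "elements D X"
  have arr: "\<exists>d z d' z' g. t = ((d, z), g, (d', z')) \<and> d \<in> Obj D \<and> d' \<in> Obj D \<and>
    z \<in> FO X d \<and> z' \<in> FO X d' \<and> g \<in> hom D d d' \<and> SF (FA X g) z' = z" if "t \<in> Arr ?E" for t
    using that by (auto simp: elements_def)
  fix s assume s: "s \<in> Arr ?E"
  then obtain d z d' z' g where s': "s = ((d, z), g, (d', z'))" "d \<in> Obj D" "d' \<in> Obj D" "z \<in> FO X d"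
    "z' \<in> FO X d'" "g \<in> hom D d d'" "SF (FA X g) z' = z" using arr by blast
  show "Dom ?E s \<in> Obj ?E" "Cod ?E s \<in> Obj ?E" using s' by auto
  show "s \<cdot>\<^bsub>?E\<^esub> Ide ?E (Dom ?E s) = s" "Ide ?E (Cod ?E s) \<cdot>\<^bsub>?E\<^esub> s = s"
    using s' comp_ide[OF D s'(6)] by auto
  fix t assume t: "t \<in> Arr ?E" and st: "Cod ?E s = Dom ?E t"
  then obtain d'' z'' h where t': "t = ((d', z'), h, (d'', z''))" "d'' \<in> Obj D"
    "z'' \<in> FO X d''" "h \<in> hom D d' d''" "SF (FA X h) z'' = z'" using arr[OF t] s' by auto
  show "t \<cdot>\<^bsub>?E\<^esub> s \<in> hom ?E (Dom ?E s) (Cod ?E t)"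
    using s' t' comp_hom[OF D s'(6) t'(4)] psh_act_comp[OF X s'(6) t'(4,3)] by (simp add: hom_elements)
  fix r assume r: "r \<in> Arr ?E" and tr: "Cod ?E t = Dom ?E r"
  then obtain d3 z3 k where r': "r = ((d'', z''), k, (d3, z3))" "k \<in> hom D d'' d3" using arr[OF r] t' by auto
  show "r \<cdot>\<^bsub>?E\<^esub> (t \<cdot>\<^bsub>?E\<^esub> s) = (r \<cdot>\<^bsub>?E\<^esub> t) \<cdot>\<^bsub>?E\<^esub> s"
    using s' t' r' comp_assoc[OF D s'(6) t'(4) r'(2)] by simp
next
  fix i assume "i \<in> Obj (elements D X)"
  then show "Ide (elements D X) i \<in> hom (elements D X) i i"
    using psh_act_ide[OF X] ide_hom[OF D] by (auto simp: hom_elements)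
qed

lemma elements_proj_simps [simp]:
  "d \<in> Obj D \<Longrightarrow> z \<in> FO X d \<Longrightarrow> FO (elements_proj D X) (d, z) = d"
  "t \<in> hom (elements D X) (d, z) (d', z') \<Longrightarrow> FA (elements_proj D X) t = fst (snd t)"
  by (auto simp: elements_proj_def hom_def[of "elements D X"] split: prod.splits)

lemma elements_proj_functor:
  assumes D: "category D" and X: "is_functor (opp D) setcat X"
  shows "is_functor (elements D X) D (elements_proj D X)"
proof (rule functorI[OF category_elements[OF D X] D])
  show "FO (elements_proj D X) i \<in> Obj D" if "i \<in> Obj (elements D X)" for i using that by auto
  fix s i j assume s: "s \<in> hom (elements D X) i j"
  obtain d z d' z' where ij: "i = (d, z)" "j = (d', z')" by (cases i, cases j)
  obtain g where g: "s = ((d, z), g, (d', z'))" "d \<in> Obj D" "d' \<in> Obj D" "z \<in> FO X d" "z' \<in> FO X d'"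
    "g \<in> hom D d d'" using s unfolding ij hom_elements by blast
  have Fs: "FA (elements_proj D X) s = g"
    using elements_proj_simps(2)[OF s[unfolded ij]] g(1) by simp
  show "FA (elements_proj D X) s \<in> hom D (FO (elements_proj D X) i) (FO (elements_proj D X) j)"
    unfolding Fs using g ij by simp
  fix t k assume t: "t \<in> hom (elements D X) j k"
  obtain d'' z'' where k: "k = (d'', z'')" by (cases k)
  obtain h where h: "t = ((d', z'), h, (d'', z''))" using t unfolding ij k hom_elements by blast
  have Ft: "FA (elements_proj D X) t = h"
    using elements_proj_simps(2)[OF t[unfolded ij k]] h by simp
  show "FA (elements_proj D X) (t \<cdot>\<^bsub>elements D X\<^esub> s) = FA (elements_proj D X) t \<cdot>\<^bsub>D\<^esub> FA (elements_proj D X) s"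
    unfolding Fs Ft
    using elements_proj_simps(2)[OF comp_hom[OF category_elements[OF D X] s t, unfolded ij k]] g(1) h by simp
next
  fix i assume i: "i \<in> Obj (elements D X)"
  obtain d z where dz: "i = (d, z)" by (cases i)
  show "FA (elements_proj D X) (Ide (elements D X) i) = Ide D (FO (elements_proj D X) i)"
    using elements_proj_simps(2)[OF ide_hom[OF category_elements[OF D X] i, unfolded dz]] i dz by auto
qed (auto simp: elements_proj_def)

text \<open>The targets for which \<^const>\<open>tilde\<close> is formed: \<open>E\<close>, the category of sets and the slices of \<open>E\<close>.\<close>

locale tilde_target =
  fixes C D :: "('u::universe, 'u) cat" and P :: "'u prof" and E :: "('o, 'a) cat" (structure)
  assumes C_small: "small_category C" and D_small: "small_category D"
    and P: "is_functor C (fcat (opp D) setcat) P" and E_cat: "category E"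
    and colimits: "is_functor I E F \<Longrightarrow> small_in TYPE('u) (Obj I) \<Longrightarrow>
      \<exists>X k. is_colimit E (I :: ('u \<times> 'u, ('u \<times> 'u) \<times> 'u \<times> ('u \<times> 'u)) cat) F X k"
begin

abbreviation Pset :: "'u \<Rightarrow> 'u \<Rightarrow> 'u set" where
  "Pset c d \<equiv> FO (FO P c) d"

abbreviation act :: "'u \<Rightarrow> 'u \<Rightarrow> 'u \<Rightarrow> 'u" where
  "act c g z \<equiv> SF (FA (FO P c) g) z"

abbreviation push :: "'u \<Rightarrow> 'u \<Rightarrow> 'u \<Rightarrow> 'u" where
  "push f d z \<equiv> SF (NC (FA P f) d) z"

lemma C: "category C" and D: "category D"
  using C_small D_small by (auto simp: small_category_def)

lemma Pc: "c \<in> Obj C \<Longrightarrow> is_functor (opp D) setcat (FO P c)"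
  using functor_obj[OF P] by simp

lemma Pset_small: "c \<in> Obj C \<Longrightarrow> d \<in> Obj D \<Longrightarrow> Defs.small (Pset c d)"
  using functor_obj[OF Pc, of c d] by simp

lemma push_in: "f \<in> hom C c c' \<Longrightarrow> d \<in> Obj D \<Longrightarrow> z \<in> Pset c d \<Longrightarrow> push f d z \<in> Pset c' d"
  using psh_map(1)[OF functor_hom[OF P]] by blast

lemma push_act: "f \<in> hom C c c' \<Longrightarrow> g \<in> hom D d d' \<Longrightarrow> z \<in> Pset c d' \<Longrightarrow>
    push f d (act c g z) = act c' g (push f d' z)"
  using psh_map_natural[OF functor_hom[OF P] _ _ D] by blast

lemma push_ide: "c \<in> Obj C \<Longrightarrow> d \<in> Obj D \<Longrightarrow> z \<in> Pset c d \<Longrightarrow> push (Ide C c) d z = z"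
  using functor_ide[OF P, of c] by simp

lemma push_comp: "f \<in> hom C c c' \<Longrightarrow> f' \<in> hom C c' c'' \<Longrightarrow> d \<in> Obj D \<Longrightarrow> z \<in> Pset c d \<Longrightarrow>
    push (f' \<cdot>\<^bsub>C\<^esub> f) d z = push f' d (push f d z)"
  using functor_comp[OF P, of f c c' f' c''] psh_map(2)[OF functor_hom[OF P], of f c c' d z] by simp

lemma kappa_colimit:
  assumes F: "is_functor D E F" and c: "c \<in> Obj C"
  shows "is_colimit E (elements D (FO P c)) (F \<circ>\<^bsub>elements D (FO P c)\<^esub> elements_proj D (FO P c))
    (tilde_obj_obj D P E F c) (kappa D P E F c)"
proof -
  have "small_in TYPE('u) (Obj (elements D (FO P c)))"
  proof -
    have "Obj (elements D (FO P c)) = (SIGMA d:Obj D. Pset c d)" by auto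
    then show ?thesis
      using D_small Pset_small[OF c] by (simp add: small_in_Sigma small_in_self small_category_def)
  qed
  then obtain X k where "is_colimit E (elements D (FO P c)) (F \<circ>\<^bsub>elements D (FO P c)\<^esub> elements_proj D (FO P c)) X k"
    using colimits[OF functor_fcomp[OF elements_proj_functor[OF D Pc[OF c]] F]] by blast
  then show ?thesis unfolding tilde_obj_obj_def kappa_def by (rule colimit_chosen)
qed

lemma tilde_obj_obj: "is_functor D E F \<Longrightarrow> c \<in> Obj C \<Longrightarrow> tilde_obj_obj D P E F c \<in> Obj E"
  by (rule cocone_arr(1)[OF colimit_cocone[OF kappa_colimit]])

lemma kappa_hom:
  assumes "is_functor D E F" "c \<in> Obj C" "d \<in> Obj D" "z \<in> Pset c d"
  shows "kappa D P E F c (d, z) \<in> hom E (FO F d) (tilde_obj_obj D P E F c)"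
  using cocone_arr(2)[OF colimit_cocone[OF kappa_colimit[OF assms(1,2)]], of "(d, z)"] assms(3,4) by simp

lemma kappa_act:
  assumes F: "is_functor D E F" and c: "c \<in> Obj C" and g: "g \<in> hom D d d'" and z: "z \<in> Pset c d'"
  shows "kappa D P E F c (d', z) \<cdot> FA F g = kappa D P E F c (d, act c g z)"
proof -
  have u: "((d, act c g z), g, (d', z)) \<in> hom (elements D (FO P c)) (d, act c g z) (d', z)"
    using hom_obj[OF D g] g z psh_act[OF Pc[OF c] g z] by (simp add: hom_elements)
  show ?thesis
    using cocone_arr(3)[OF colimit_cocone[OF kappa_colimit[OF F c]] u] homD(1)[OF u]
      elements_proj_simps(2)[OF u] by simp
qed

text \<open>An arrow of the category of elements over \<open>g\<close> is determined by its target, so that cocones are families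
indexed by \<open>d\<close> and \<open>z\<close>, compatible with the action of \<open>g\<close>.\<close>

lemma kappa_universal:
  assumes F: "is_functor D E F" and c: "c \<in> Obj C" and Y: "Y \<in> Obj E"
    and l: "\<And>d z. d \<in> Obj D \<Longrightarrow> z \<in> Pset c d \<Longrightarrow> l d z \<in> hom E (FO F d) Y"
    and nat: "\<And>g d d' z. g \<in> hom D d d' \<Longrightarrow> z \<in> Pset c d' \<Longrightarrow> l d' z \<cdot> FA F g = l d (act c g z)"
  shows "\<exists>!h. h \<in> hom E (tilde_obj_obj D P E F c) Y \<and>
    (\<forall>d\<in>Obj D. \<forall>z\<in>Pset c d. h \<cdot> kappa D P E F c (d, z) = l d z)"
proof -
  let ?I = "elements D (FO P c)"
  have "cocone E ?I (F \<circ>\<^bsub>?I\<^esub> elements_proj D (FO P c)) Y (\<lambda>(d, z). l d z)"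
  proof (rule coconeI[OF category_elements[OF D Pc[OF c]] Y])
    show "(case i of (d, z) \<Rightarrow> l d z) \<in> hom E (FO (F \<circ>\<^bsub>?I\<^esub> elements_proj D (FO P c)) i) Y"
      if "i \<in> Obj ?I" for i using that l by auto
    fix u i j assume u: "u \<in> hom ?I i j"
    obtain d z d' z' where ij: "i = (d, z)" "j = (d', z')" by (cases i, cases j)
    obtain g where g: "u = ((d, z), g, (d', z'))" "z' \<in> Pset c d'" "g \<in> hom D d d'" "act c g z' = z"
      using u unfolding ij hom_elements by blast
    show "(case j of (d, z) \<Rightarrow> l d z) \<cdot> FA (F \<circ>\<^bsub>?I\<^esub> elements_proj D (FO P c)) u = (case i of (d, z) \<Rightarrow> l d z)"
      using nat[OF g(3,2)] g(4) homD(1)[OF u] elements_proj_simps(2)[OF u[unfolded ij]]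
      unfolding g(1) by (simp add: ij)
  qed
  from colimit_universal[OF kappa_colimit[OF F c] this]
  have "\<exists>!h. h \<in> hom E (tilde_obj_obj D P E F c) Y \<and>
    (\<forall>i\<in>Obj ?I. h \<cdot> kappa D P E F c i = (case i of (d, z) \<Rightarrow> l d z))" .
  moreover have "(\<forall>i\<in>Obj ?I. h \<cdot> kappa D P E F c i = (case i of (d, z) \<Rightarrow> l d z)) \<longleftrightarrow>
    (\<forall>d\<in>Obj D. \<forall>z\<in>Pset c d. h \<cdot> kappa D P E F c (d, z) = l d z)" for h by auto
  ultimately show ?thesis by simp
qed

lemma kappa_eqI:
  assumes F: "is_functor D E F" and c: "c \<in> Obj C"
    and h: "h \<in> hom E (tilde_obj_obj D P E F c) Y" "h' \<in> hom E (tilde_obj_obj D P E F c) Y"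
    and eq: "\<And>d z. d \<in> Obj D \<Longrightarrow> z \<in> Pset c d \<Longrightarrow>
      h \<cdot> kappa D P E F c (d, z) = h' \<cdot> kappa D P E F c (d, z)"
  shows "h = h'"
  by (rule colimit_eqI[OF E_cat functor_fcomp[OF elements_proj_functor[OF D Pc[OF c]] F] kappa_colimit[OF F c] h])
    (use eq in auto)

lemma tilde_obj_FO [simp]: "c \<in> Obj C \<Longrightarrow> FO (tilde_obj C D P E F) c = tilde_obj_obj D P E F c"
  by (simp add: tilde_obj_def)

lemma tilde_obj_arr:
  assumes F: "is_functor D E F" and f: "f \<in> hom C c c'"
  shows "FA (tilde_obj C D P E F) f \<in> hom E (tilde_obj_obj D P E F c) (tilde_obj_obj D P E F c')"
    "d \<in> Obj D \<Longrightarrow> z \<in> Pset c d \<Longrightarrow>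
      FA (tilde_obj C D P E F) f \<cdot> kappa D P E F c (d, z) = kappa D P E F c' (d, push f d z)"
proof -
  note c = hom_obj[OF C f]
  have "\<exists>!h. h \<in> hom E (tilde_obj_obj D P E F c) (tilde_obj_obj D P E F c') \<and>
    (\<forall>d\<in>Obj D. \<forall>z\<in>Pset c d. h \<cdot> kappa D P E F c (d, z) = kappa D P E F c' (d, push f d z))"
    by (rule kappa_universal[OF F c(1) tilde_obj_obj[OF F c(2)] kappa_hom[OF F c(2) _ push_in[OF f]]])
      (use kappa_act[OF F c(2)] push_in[OF f] push_act[OF f] hom_obj[OF D] in auto)
  from theI'[OF this] homD[OF f]
  show "FA (tilde_obj C D P E F) f \<in> hom E (tilde_obj_obj D P E F c) (tilde_obj_obj D P E F c')"
    "d \<in> Obj D \<Longrightarrow> z \<in> Pset c d \<Longrightarrow>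
      FA (tilde_obj C D P E F) f \<cdot> kappa D P E F c (d, z) = kappa D P E F c' (d, push f d z)"
    unfolding tilde_obj_def ball_elements by auto
qed

lemma tilde_obj_functor:
  assumes F: "is_functor D E F"
  shows "is_functor C E (tilde_obj C D P E F)"
proof (rule functorI[OF C E_cat])
  show "FA (tilde_obj C D P E F) f \<in> hom E (FO (tilde_obj C D P E F) c) (FO (tilde_obj C D P E F) c')"
    if "f \<in> hom C c c'" "c \<in> Obj C" "c' \<in> Obj C" for f c c'
    using tilde_obj_arr(1)[OF F that(1)] that by simp
  fix c assume c: "c \<in> Obj C"
  note i = ide_hom[OF C c]
  have "FA (tilde_obj C D P E F) (Ide C c) = Ide E (tilde_obj_obj D P E F c)"
  proof (rule kappa_eqI[OF F c tilde_obj_arr(1)[OF F i] ide_hom[OF E_cat tilde_obj_obj[OF F c]]])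
    fix d z assume dz: "d \<in> Obj D" "z \<in> Pset c d"
    show "FA (tilde_obj C D P E F) (Ide C c) \<cdot> kappa D P E F c (d, z) =
      Ide E (tilde_obj_obj D P E F c) \<cdot> kappa D P E F c (d, z)"
      using tilde_obj_arr(2)[OF F i dz] push_ide[OF c dz] comp_ide(2)[OF E_cat kappa_hom[OF F c dz]] by simp
  qed
  then show "FA (tilde_obj C D P E F) (Ide C c) = Ide E (FO (tilde_obj C D P E F) c)" using c by simp
next
  fix f f' c c' c'' assume f: "f \<in> hom C c c'" and f': "f' \<in> hom C c' c''"
  note c = hom_obj(1)[OF C f] and ff = comp_hom[OF C f f']
  note tf = tilde_obj_arr[OF F f] and tf' = tilde_obj_arr[OF F f'] and tff = tilde_obj_arr[OF F ff]
  show "FA (tilde_obj C D P E F) (f' \<cdot>\<^bsub>C\<^esub> f) = FA (tilde_obj C D P E F) f' \<cdot> FA (tilde_obj C D P E F) f"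
  proof (rule kappa_eqI[OF F c tff(1) comp_hom[OF E_cat tf(1) tf'(1)]])
    fix d z assume dz: "d \<in> Obj D" "z \<in> Pset c d"
    show "FA (tilde_obj C D P E F) (f' \<cdot>\<^bsub>C\<^esub> f) \<cdot> kappa D P E F c (d, z) =
      (FA (tilde_obj C D P E F) f' \<cdot> FA (tilde_obj C D P E F) f) \<cdot> kappa D P E F c (d, z)"
      using tff(2)[OF dz] tf(2)[OF dz] tf'(2)[OF dz(1) push_in[OF f dz]] push_comp[OF f f' dz]
        comp_assoc[OF E_cat kappa_hom[OF F c dz] tf(1) tf'(1)] by simp
  qed
qed (auto simp: tilde_obj_def tilde_obj_obj[OF F])

lemma tilde_arr_comp:
  assumes t: "t \<in> hom (fcat D E) F G" and c: "c \<in> Obj C"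
  shows "NC (tilde_arr C D P E t) c \<in> hom E (tilde_obj_obj D P E F c) (tilde_obj_obj D P E G c)"
    "d \<in> Obj D \<Longrightarrow> z \<in> Pset c d \<Longrightarrow>
      NC (tilde_arr C D P E t) c \<cdot> kappa D P E F c (d, z) = kappa D P E G c (d, z) \<cdot> NC t d"
proof -
  note F = hom_fcat(4)[OF t] and G = hom_fcat(5)[OF t] and tD = hom_fcat(2,3)[OF t]
  have "\<exists>!h. h \<in> hom E (tilde_obj_obj D P E F c) (tilde_obj_obj D P E G c) \<and>
    (\<forall>d\<in>Obj D. \<forall>z\<in>Pset c d. h \<cdot> kappa D P E F c (d, z) = kappa D P E G c (d, z) \<cdot> NC t d)"
  proof (rule kappa_universal[OF F c tilde_obj_obj[OF G c]])
    show "kappa D P E G c (d, z) \<cdot> NC t d \<in> hom E (FO F d) (tilde_obj_obj D P E G c)"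
      if "d \<in> Obj D" "z \<in> Pset c d" for d z
      by (rule comp_hom[OF E_cat hom_fcat_comp[OF t that(1)] kappa_hom[OF G c that]])
    fix g d d' z assume g: "g \<in> hom D d d'" and z: "z \<in> Pset c d'"
    note d = hom_obj[OF D g]
    show "(kappa D P E G c (d', z) \<cdot> NC t d') \<cdot> FA F g = kappa D P E G c (d, act c g z) \<cdot> NC t d"
      using comp_assoc[OF E_cat functor_hom[OF F g] hom_fcat_comp[OF t d(2)] kappa_hom[OF G c d(2) z]]
        comp_assoc[OF E_cat hom_fcat_comp[OF t d(1)] functor_hom[OF G g] kappa_hom[OF G c d(2) z]]
        hom_fcat_natural[OF t g] kappa_act[OF G c g z] by simp
  qed
  from theI'[OF this] c tD
  show "NC (tilde_arr C D P E t) c \<in> hom E (tilde_obj_obj D P E F c) (tilde_obj_obj D P E G c)"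
    "d \<in> Obj D \<Longrightarrow> z \<in> Pset c d \<Longrightarrow>
      NC (tilde_arr C D P E t) c \<cdot> kappa D P E F c (d, z) = kappa D P E G c (d, z) \<cdot> NC t d"
    unfolding tilde_arr_def ball_elements by auto
qed

lemma tilde_arr_hom:
  assumes t: "t \<in> hom (fcat D E) F G"
  shows "tilde_arr C D P E t \<in> hom (fcat C E) (tilde_obj C D P E F) (tilde_obj C D P E G)"
proof (rule natI)
  note F = hom_fcat(4)[OF t] and G = hom_fcat(5)[OF t] and tD = hom_fcat(2,3)[OF t]
  show "is_functor C E (tilde_obj C D P E F)" "is_functor C E (tilde_obj C D P E G)"
    by (rule tilde_obj_functor[OF F] tilde_obj_functor[OF G])+
  show "NS (tilde_arr C D P E t) = tilde_obj C D P E F" "NT (tilde_arr C D P E t) = tilde_obj C D P E G"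
    using tD by (simp_all add: tilde_arr_def)
  show "NC (tilde_arr C D P E t) \<in> extensional (Obj C)" by (simp add: tilde_arr_def)
  show "NC (tilde_arr C D P E t) c \<in> hom E (FO (tilde_obj C D P E F) c) (FO (tilde_obj C D P E G) c)"
    if "c \<in> Obj C" for c using tilde_arr_comp(1)[OF t that] that by simp
  fix f c c' assume f: "f \<in> hom C c c'" and c: "c \<in> Obj C" "c' \<in> Obj C"
  note tc = tilde_arr_comp[OF t c(1)] and tc' = tilde_arr_comp[OF t c(2)]
  note Ff = tilde_obj_arr[OF F f] and Gf = tilde_obj_arr[OF G f]
  show "NC (tilde_arr C D P E t) c' \<cdot> FA (tilde_obj C D P E F) f =
    FA (tilde_obj C D P E G) f \<cdot> NC (tilde_arr C D P E t) c"
  proof (rule kappa_eqI[OF F c(1) comp_hom[OF E_cat Ff(1) tc'(1)] comp_hom[OF E_cat tc(1) Gf(1)]])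
    fix d z assume dz: "d \<in> Obj D" "z \<in> Pset c d"
    note k = kappa_hom[OF F c(1) dz] and kG = kappa_hom[OF G c(1) dz]
    show "(NC (tilde_arr C D P E t) c' \<cdot> FA (tilde_obj C D P E F) f) \<cdot> kappa D P E F c (d, z) =
      (FA (tilde_obj C D P E G) f \<cdot> NC (tilde_arr C D P E t) c) \<cdot> kappa D P E F c (d, z)"
      using comp_assoc[OF E_cat k Ff(1) tc'(1)] comp_assoc[OF E_cat k tc(1) Gf(1)] Ff(2)[OF dz] tc(2)[OF dz]
        tc'(2)[OF dz(1) push_in[OF f dz]] comp_assoc[OF E_cat hom_fcat_comp[OF t dz(1)] kG Gf(1)] Gf(2)[OF dz]
      by simp
  qed
qed

lemma tilde_FO [simp]: "is_functor D E F \<Longrightarrow> FO (tilde C D P E) F = tilde_obj C D P E F"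
  and tilde_FA [simp]: "t \<in> hom (fcat D E) F G \<Longrightarrow> FA (tilde C D P E) t = tilde_arr C D P E t"
  by (auto simp: tilde_def hom_def)

text \<open>All equations between arrows out of \<open>tilde F (c)\<close> are checked on the injections \<open>kappa\<close>.\<close>

lemma tilde_functor: "is_functor (fcat D E) (fcat C E) (tilde C D P E)"
proof (rule functorI[OF category_fcat[OF D E_cat] category_fcat[OF C E_cat]])
  show "FO (tilde C D P E) F \<in> Obj (fcat C E)" if "F \<in> Obj (fcat D E)" for F
    using tilde_obj_functor that by simp
  show "FA (tilde C D P E) t \<in> hom (fcat C E) (FO (tilde C D P E) F) (FO (tilde C D P E) G)"
    if "t \<in> hom (fcat D E) F G" for t F G
    using tilde_arr_hom[OF that] that hom_fcat(4,5)[OF that] by simp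
  fix F assume "F \<in> Obj (fcat D E)"
  then have F: "is_functor D E F" by simp
  note i = fcat_ide_hom[OF F] and tF = tilde_obj_functor[OF F]
  have "tilde_arr C D P E (Ide (fcat D E) F) = Ide (fcat C E) (tilde_obj C D P E F)"
  proof (rule ntr_eqI[OF tilde_arr_hom[OF i] fcat_ide_hom[OF tF]])
    fix c assume c: "c \<in> Obj C"
    have "NC (tilde_arr C D P E (Ide (fcat D E) F)) c = Ide E (tilde_obj_obj D P E F c)"
    proof (rule kappa_eqI[OF F c tilde_arr_comp(1)[OF i c] ide_hom[OF E_cat tilde_obj_obj[OF F c]]])
      fix d z assume dz: "d \<in> Obj D" "z \<in> Pset c d"
      show "NC (tilde_arr C D P E (Ide (fcat D E) F)) c \<cdot> kappa D P E F c (d, z) =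
        Ide E (tilde_obj_obj D P E F c) \<cdot> kappa D P E F c (d, z)"
        using tilde_arr_comp(2)[OF i c dz] comp_ide[OF E_cat kappa_hom[OF F c dz]] dz by simp
    qed
    then show "NC (tilde_arr C D P E (Ide (fcat D E) F)) c = NC (Ide (fcat C E) (tilde_obj C D P E F)) c"
      using c by simp
  qed
  then show "FA (tilde C D P E) (Ide (fcat D E) F) = Ide (fcat C E) (FO (tilde C D P E) F)"
    using tilde_FA[OF i] F by simp
next
  fix t s F G H assume t: "t \<in> hom (fcat D E) F G" and s: "s \<in> hom (fcat D E) G H"
  note st = fcat_comp_hom[OF t s]
  note F = hom_fcat(4)[OF t]
  have "tilde_arr C D P E (s \<cdot>\<^bsub>fcat D E\<^esub> t) = tilde_arr C D P E s \<cdot>\<^bsub>fcat C E\<^esub> tilde_arr C D P E t"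
  proof (rule ntr_eqI[OF tilde_arr_hom[OF st] fcat_comp_hom[OF tilde_arr_hom[OF t] tilde_arr_hom[OF s]]])
    fix c assume c: "c \<in> Obj C"
    note tc = tilde_arr_comp[OF t c] and sc = tilde_arr_comp[OF s c] and stc = tilde_arr_comp[OF st c]
    have "NC (tilde_arr C D P E (s \<cdot>\<^bsub>fcat D E\<^esub> t)) c = NC (tilde_arr C D P E s) c \<cdot> NC (tilde_arr C D P E t) c"
    proof (rule kappa_eqI[OF F c stc(1) comp_hom[OF E_cat tc(1) sc(1)]])
      fix d z assume dz: "d \<in> Obj D" "z \<in> Pset c d"
      show "NC (tilde_arr C D P E (s \<cdot>\<^bsub>fcat D E\<^esub> t)) c \<cdot> kappa D P E F c (d, z) =
        (NC (tilde_arr C D P E s) c \<cdot> NC (tilde_arr C D P E t) c) \<cdot> kappa D P E F c (d, z)"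
        using stc(2)[OF dz] tc(2)[OF dz] sc(2)[OF dz] dz
          comp_assoc[OF E_cat kappa_hom[OF F c dz] tc(1) sc(1)]
          comp_assoc[OF E_cat hom_fcat_comp[OF t dz(1)] kappa_hom[OF hom_fcat(4)[OF s] c dz] sc(1)]
          comp_assoc[OF E_cat hom_fcat_comp[OF t dz(1)] hom_fcat_comp[OF s dz(1)] kappa_hom[OF hom_fcat(5)[OF s] c dz]]
        by simp
    qed
    then show "NC (tilde_arr C D P E (s \<cdot>\<^bsub>fcat D E\<^esub> t)) c =
      NC (tilde_arr C D P E s \<cdot>\<^bsub>fcat C E\<^esub> tilde_arr C D P E t) c" using c by simp
  qed
  then show "FA (tilde C D P E) (s \<cdot>\<^bsub>fcat D E\<^esub> t) = FA (tilde C D P E) s \<cdot>\<^bsub>fcat C E\<^esub> FA (tilde C D P E) t"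
    using tilde_FA[OF st] tilde_FA[OF t] tilde_FA[OF s] by simp
qed (auto simp: tilde_def)

end

section \<open>Objects of transformations out of sums of terminal objects\<close>

context topos_like
begin

subsection \<open>The distributive law in a slice\<close>

text \<open>The injection \<open>A \<rightarrow> A \<times> \<Coprod>\<^sub>S 1\<close> of the summand \<open>s\<close>.\<close>

definition copower_inj :: "'o \<Rightarrow> 'u set \<Rightarrow> 'u \<Rightarrow> 'a" where
  "copower_inj A S s = (THE h. h \<in> hom E A (prd A (copower E S)) \<and>
     proj1 E A (copower E S) \<cdot> h = Ide E A \<and>
     proj2 E A (copower E S) \<cdot> h = coproj E S s \<cdot> to_terminal E A)"

text \<open>The same injection as a global element of \<open>!\<^sub>A\<^sup>*(\<Coprod>\<^sub>S 1)\<close> in the slice.\<close>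

definition copower_point :: "'o \<Rightarrow> 'u set \<Rightarrow> 'u \<Rightarrow> 'a \<times> 'a \<times> 'a" where
  "copower_point A S s = global_element E A (copower E S) (coproj E S s \<cdot> to_terminal E A)"

lemma coproj_to_terminal:
  "A \<in> Obj E \<Longrightarrow> Defs.small (S :: 'u set) \<Longrightarrow> s \<in> S \<Longrightarrow>
    coproj E S s \<cdot> to_terminal E A \<in> hom E A (copower E S)"
  by (rule comp_hom[OF E to_terminal coproj_hom])

lemma copower_inj:
  assumes A: "A \<in> Obj E" and S: "Defs.small (S :: 'u set)" and s: "s \<in> S"
  shows "copower_inj A S s \<in> hom E A (prd A (copower E S))"
    "proj1 E A (copower E S) \<cdot> copower_inj A S s = Ide E A"
    "proj2 E A (copower E S) \<cdot> copower_inj A S s = coproj E S s \<cdot> to_terminal E A"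
  using theI'[OF pair_universal[OF ide_hom[OF E A] coproj_to_terminal[OF A S s]]]
  unfolding copower_inj_def by auto

lemma copower_inj_universal:
  assumes A: "A \<in> Obj E" and S: "Defs.small (S :: 'u set)" and Y: "Y \<in> Obj E"
    and l: "\<And>s. s \<in> S \<Longrightarrow> l s \<in> hom E A Y"
  shows "\<exists>!h. h \<in> hom E (prd A (copower E S)) Y \<and> (\<forall>s\<in>S. h \<cdot> copower_inj A S s = l s)"
  by (rule distributive[OF S product[OF A copower_obj[OF S]] copower_inj[OF A S] A Y l])

lemma copower_inj_eqI:
  assumes A: "A \<in> Obj E" and S: "Defs.small (S :: 'u set)"
    and h: "h \<in> hom E (prd A (copower E S)) Y" "h' \<in> hom E (prd A (copower E S)) Y"
    and eq: "\<And>s. s \<in> S \<Longrightarrow> h \<cdot> copower_inj A S s = h' \<cdot> copower_inj A S s"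
  shows "h = h'"
  by (rule ex1_eqI[OF copower_inj_universal[OF A S hom_obj(2)[OF E h(1)] comp_hom[OF E copower_inj(1)[OF A S] h(2)]]])
    (use h eq in auto)

lemma copower_point:
  assumes A: "A \<in> Obj E" and S: "Defs.small (S :: 'u set)" and s: "s \<in> S"
  shows "copower_point A S s \<in> hom (slice E A) (terminal (slice E A)) (proj1 E A (copower E S))"
    "underlying (copower_point A S s) = copower_inj A S s \<cdot> terminal (slice E A)"
proof -
  note x = coproj_to_terminal[OF A S s]
  note g = global_element[OF A x, folded copower_point_def]
  note t = slice_terminal_hom[OF A] and j = copower_inj[OF A S s] and X = copower_obj[OF S]
  show "copower_point A S s \<in> hom (slice E A) (terminal (slice E A)) (proj1 E A (copower E S))" by (rule g(1))
  show "underlying (copower_point A S s) = copower_inj A S s \<cdot> terminal (slice E A)"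
    by (rule pair_eqI[OF A X hom_sliceD(3)[OF g(1)] comp_hom[OF E t j(1)]])
      (use hom_sliceD(4)[OF g(1)] g(2) comp_assoc[OF E t j(1) proj_hom(1)[OF A X]]
        comp_assoc[OF E t j(1) proj_hom(2)[OF A X]] j(2,3) comp_ide(2)[OF E t] in simp_all)
qed

text \<open>The generalized element \<open>A \<rightarrow> Y\<close> obtained by evaluating an arrow \<open>!\<^sub>A\<^sup>*(\<Coprod>\<^sub>S 1) \<rightarrow> !\<^sub>A\<^sup>*(Y)\<close> at the
  summand \<open>s\<close>. These arrows thereby correspond to families of elements of \<open>Y\<close>.\<close>

definition value_at :: "'o \<Rightarrow> 'u set \<Rightarrow> 'o \<Rightarrow> 'a \<times> 'a \<times> 'a \<Rightarrow> 'u \<Rightarrow> 'a" where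
  "value_at A S Y t s = (proj2 E A Y \<cdot> underlying t) \<cdot> copower_inj A S s"

lemma value_at:
  assumes A: "A \<in> Obj E" and S: "Defs.small (S :: 'u set)" and Y: "Y \<in> Obj E" and s: "s \<in> S"
    and t: "t \<in> hom (slice E A) (proj1 E A (copower E S)) (proj1 E A Y)"
  shows "value_at A S Y t s \<in> hom E A Y"
    "t \<cdot>\<^bsub>slice E A\<^esub> copower_point A S s = global_element E A Y (value_at A S Y t s)"
proof -
  note h = comp_hom[OF E hom_sliceD(3)[OF t] proj_hom(2)[OF A Y]]
  note p = copower_point[OF A S s] and j = copower_inj(1)[OF A S s]
  show v: "value_at A S Y t s \<in> hom E A Y"
    unfolding value_at_def by (rule comp_hom[OF E j h])
  note tau = slice_terminal_hom[OF A]
  show "t \<cdot>\<^bsub>slice E A\<^esub> copower_point A S s = global_element E A Y (value_at A S Y t s)"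
    by (rule slice_transpose_eqI[OF comp_hom[OF category_slice[OF E] p(1) t] global_element(1)[OF A v] A Y])
      (use slice_comp(1)[OF p(1) t] global_element(2)[OF A v] p(2)
        comp_assoc[OF E comp_hom[OF E tau j] hom_sliceD(3)[OF t] proj_hom(2)[OF A Y]]
        comp_assoc[OF E tau j h] in \<open>simp add: value_at_def\<close>)
qed

lemma value_at_eqI:
  assumes A: "A \<in> Obj E" and S: "Defs.small (S :: 'u set)" and Y: "Y \<in> Obj E"
    and t: "t \<in> hom (slice E A) (proj1 E A (copower E S)) (proj1 E A Y)"
      "t' \<in> hom (slice E A) (proj1 E A (copower E S)) (proj1 E A Y)"
    and eq: "\<And>s. s \<in> S \<Longrightarrow> value_at A S Y t s = value_at A S Y t' s"
  shows "t = t'"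
  by (rule slice_transpose_eqI[OF t A Y copower_inj_eqI[OF A S comp_hom[OF E hom_sliceD(3)[OF t(1)] proj_hom(2)[OF A Y]]
        comp_hom[OF E hom_sliceD(3)[OF t(2)] proj_hom(2)[OF A Y]] eq[unfolded value_at_def]]])

text \<open>This is where the distributive law enters.\<close>

lemma value_at_surj:
  assumes A: "A \<in> Obj E" and S: "Defs.small (S :: 'u set)" and Y: "Y \<in> Obj E"
    and l: "\<And>s. s \<in> S \<Longrightarrow> l s \<in> hom E A Y"
  shows "\<exists>t\<in>hom (slice E A) (proj1 E A (copower E S)) (proj1 E A Y). \<forall>s\<in>S. value_at A S Y t s = l s"
proof -
  have "\<exists>!h. h \<in> hom E (prd A (copower E S)) Y \<and> (\<forall>s\<in>S. h \<cdot> copower_inj A S s = l s)"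
    by (rule copower_inj_universal[OF A S Y l])
  then obtain h where h: "h \<in> hom E (prd A (copower E S)) Y" "\<forall>s\<in>S. h \<cdot> copower_inj A S s = l s"
    by (elim ex1E conjE)
  obtain t where "t \<in> hom (slice E A) (proj1 E A (copower E S)) (proj1 E A Y)"
    "proj2 E A Y \<cdot> underlying t = h"
    using slice_transpose[OF proj_hom(1)[OF A copower_obj[OF S]] h(1)] by blast
  then show ?thesis using h(2) by (intro bexI[of _ t]) (simp_all add: value_at_def)
qed

lemma value_at_base_change:
  assumes A: "A \<in> Obj E" and S: "Defs.small (S :: 'u set)" and s: "s \<in> S" and f: "f \<in> hom E Y Y'"
    and t: "t \<in> hom (slice E A) (proj1 E A (copower E S)) (proj1 E A Y)"
  shows "value_at A S Y' (FA (base_change E A) f \<cdot>\<^bsub>slice E A\<^esub> t) s = f \<cdot> value_at A S Y t s"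
  using base_change_comp[OF A f t] comp_assoc[OF E copower_inj(1)[OF A S s]
      comp_hom[OF E hom_sliceD(3)[OF t] proj_hom(2)[OF A hom_obj(1)[OF E f]]] f]
  by (simp add: value_at_def)

text \<open>Functions between index sets move the summand: both injections have the same components in the
product.\<close>

lemma value_at_reindex:
  assumes A: "A \<in> Obj E" and S: "Defs.small (S :: 'u set)" "Defs.small S'" and s: "s \<in> S" and s': "s' \<in> S'"
    and Y: "Y \<in> Obj E" and f: "f \<in> hom E (copower E S) (copower E S')"
    and fs: "f \<cdot> coproj E S s = coproj E S' s'"
    and t: "t \<in> hom (slice E A) (proj1 E A (copower E S')) (proj1 E A Y)"
  shows "value_at A S Y (t \<cdot>\<^bsub>slice E A\<^esub> FA (base_change E A) f) s = value_at A S' Y t s'"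
proof -
  note bf = base_change_arr[OF A f] and j = copower_inj[OF A S(1) s] and j' = copower_inj[OF A S(2) s']
  note X = copower_obj[OF S(1)] and X' = copower_obj[OF S(2)]
  note u = hom_sliceD(3)[OF bf(1)]
  have "underlying (FA (base_change E A) f) \<cdot> copower_inj A S s = copower_inj A S' s'"
  proof (rule pair_eqI[OF A X' comp_hom[OF E j(1) u] j'(1)])
    show "proj1 E A (copower E S') \<cdot> (underlying (FA (base_change E A) f) \<cdot> copower_inj A S s) =
      proj1 E A (copower E S') \<cdot> copower_inj A S' s'"
      using comp_assoc[OF E j(1) u proj_hom(1)[OF A X']] hom_sliceD(4)[OF bf(1)] j(2) j'(2) by simp
    show "proj2 E A (copower E S') \<cdot> (underlying (FA (base_change E A) f) \<cdot> copower_inj A S s) =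
      proj2 E A (copower E S') \<cdot> copower_inj A S' s'"
      using comp_assoc[OF E j(1) u proj_hom(2)[OF A X']] bf(2) comp_assoc[OF E j(1) proj_hom(2)[OF A X] f]
        j(3) j'(3) comp_assoc[OF E to_terminal[OF A] coproj_hom[OF S(1) s] f] fs by simp
  qed
  then show ?thesis
    using slice_comp(1)[OF bf(1) t] comp_assoc[OF E u hom_sliceD(3)[OF t] proj_hom(2)[OF A Y]]
      comp_assoc[OF E j(1) u comp_hom[OF E hom_sliceD(3)[OF t] proj_hom(2)[OF A Y]]]
    by (simp add: value_at_def)
qed

subsection \<open>Transformations over \<open>A\<close> as natural families\<close>

text \<open>Transformations \<open>!\<^sub>A\<^sup>* \<circ> \<gamma>\<^sup>* \<circ> T \<rightarrow> !\<^sub>A\<^sup>* \<circ> G\<close> correspond to natural families of maps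
  \<open>T(c) \<rightarrow> Hom(A, G(c))\<close>.\<close>

definition natural_family ::
  "('c, 'd) cat \<Rightarrow> ('c, 'd, 'u set, 'u sfun) ftr \<Rightarrow> ('c, 'd, 'o, 'a) ftr \<Rightarrow> 'o \<Rightarrow> ('c \<Rightarrow> 'u \<Rightarrow> 'a) \<Rightarrow> bool" where
  "natural_family C T G A \<phi> \<longleftrightarrow>
     (\<forall>c\<in>Obj C. \<forall>s\<in>FO T c. \<phi> c s \<in> hom E A (FO G c)) \<and>
     (\<forall>c c'. \<forall>f\<in>hom C c c'. \<forall>s\<in>FO T c. FA G f \<cdot> \<phi> c s = \<phi> c' (SF (FA T f) s))"

lemma natural_familyD:
  assumes "natural_family C T G A \<phi>"
  shows "c \<in> Obj C \<Longrightarrow> s \<in> FO T c \<Longrightarrow> \<phi> c s \<in> hom E A (FO G c)"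
    "f \<in> hom C c c' \<Longrightarrow> s \<in> FO T c \<Longrightarrow> FA G f \<cdot> \<phi> c s = \<phi> c' (SF (FA T f) s)"
  using assms unfolding natural_family_def by blast+

end

text \<open>The functor \<open>T\<close> is the weight of a limit of functors \<open>C \<rightarrow> E\<close>.\<close>

locale weight = topos_like U E for U :: "'u::universe itself" and E :: "('o, 'a) cat" (structure) +
  fixes C :: "('u, 'u) cat" and T :: "('u, 'u, 'u set, 'u sfun) ftr"
  assumes C_small: "small_category C" and T: "is_functor C setcat T"
begin

lemma C: "category C"
  using C_small by (simp add: small_category_def)

lemma T_small: "c \<in> Obj C \<Longrightarrow> Defs.small (FO T c)"
  using functor_obj[OF T] by simp

lemma T_map: "f \<in> hom C c c' \<Longrightarrow> s \<in> FO T c \<Longrightarrow> SF (FA T f) s \<in> FO T c'"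
  using functor_hom[OF T, of f c c'] by (auto simp: hom_setcat)

abbreviation source :: "('u, 'u, 'o, 'a) ftr" where
  "source \<equiv> gamma E \<circ>\<^bsub>C\<^esub> T"

abbreviation over :: "'o \<Rightarrow> ('u, 'u, 'o, 'a) ftr \<Rightarrow> ('u, 'u, 'a, 'a \<times> 'a \<times> 'a) ftr" where
  "over A F \<equiv> base_change E A \<circ>\<^bsub>C\<^esub> F"

lemma source_functor: "is_functor C E source"
  by (rule functor_fcomp[OF T gamma_functor])

lemma source_arr:
  assumes "f \<in> hom C c c'"
  shows "FA source f = FA (gamma E) (FA T f)" "FA source f \<in> hom E (copower E (FO T c)) (copower E (FO T c'))"
    "s \<in> FO T c \<Longrightarrow> FA source f \<cdot> coproj E (FO T c) s = coproj E (FO T c') (SF (FA T f) s)"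
  using homD[OF assms] gamma_arr[OF functor_hom[OF T assms]] by simp_all

lemma over_functor: "A \<in> Obj E \<Longrightarrow> is_functor C E G \<Longrightarrow> is_functor C (slice E A) (over A G)"
  by (rule functor_fcomp[OF _ base_change_functor])

lemma over_source: "c \<in> Obj C \<Longrightarrow> FO (over A source) c = proj1 E A (copower E (FO T c))"
  using copower_obj[OF T_small] T_small by simp

lemma over_target: "is_functor C E G \<Longrightarrow> c \<in> Obj C \<Longrightarrow> FO (over A G) c = proj1 E A (FO G c)"
  using functor_obj[of C E G c] by simp

definition family ::
  "'o \<Rightarrow> ('u, 'u, 'o, 'a) ftr \<Rightarrow> ('u, 'u, 'a, 'a \<times> 'a \<times> 'a) ntr \<Rightarrow> 'u \<Rightarrow> 'u \<Rightarrow> 'a" where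
  "family A G t c s = value_at A (FO T c) (FO G c) (NC t c) s"

lemma over_comp:
  assumes "is_functor C E G" "t \<in> hom (fcat C (slice E A)) (over A source) (over A G)" "c \<in> Obj C"
  shows "NC t c \<in> hom (slice E A) (proj1 E A (copower E (FO T c))) (proj1 E A (FO G c))"
  using hom_fcat_comp[OF assms(2,3)] unfolding over_source[OF assms(3)] over_target[OF assms(1,3)] .

lemma family_natural:
  assumes A: "A \<in> Obj E" and G: "is_functor C E G"
    and t: "t \<in> hom (fcat C (slice E A)) (over A source) (over A G)"
  shows "natural_family C T G A (family A G t)"
  unfolding natural_family_def family_def
proof (intro conjI ballI allI)
  show "value_at A (FO T c) (FO G c) (NC t c) s \<in> hom E A (FO G c)" if "c \<in> Obj C" "s \<in> FO T c" for c s
    by (rule value_at(1)[OF A T_small[OF that(1)] functor_obj[OF G that(1)] that(2) over_comp[OF G t that(1)]])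
  fix c c' f s assume f: "f \<in> hom C c c'" and s: "s \<in> FO T c"
  note c = hom_obj[OF C f]
  have "NC t c' \<cdot>\<^bsub>slice E A\<^esub> FA (base_change E A) (FA source f) =
    FA (base_change E A) (FA G f) \<cdot>\<^bsub>slice E A\<^esub> NC t c"
    using hom_fcat_natural[OF t f] homD[OF f] by simp
  then show "FA G f \<cdot> value_at A (FO T c) (FO G c) (NC t c) s =
      value_at A (FO T c') (FO G c') (NC t c') (SF (FA T f) s)"
    using value_at_base_change[OF A T_small[OF c(1)] s functor_hom[OF G f] over_comp[OF G t c(1)]]
      value_at_reindex[OF A T_small[OF c(1)] T_small[OF c(2)] s T_map[OF f s] functor_obj[OF G c(2)]
        source_arr(2)[OF f] source_arr(3)[OF f s] over_comp[OF G t c(2)]] by simp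
qed

lemma family_eqI:
  assumes A: "A \<in> Obj E" and G: "is_functor C E G"
    and t: "t \<in> hom (fcat C (slice E A)) (over A source) (over A G)"
    and t': "t' \<in> hom (fcat C (slice E A)) (over A source) (over A G)"
    and eq: "\<And>c s. c \<in> Obj C \<Longrightarrow> s \<in> FO T c \<Longrightarrow> family A G t c s = family A G t' c s"
  shows "t = t'"
  by (rule ntr_eqI[OF t t' value_at_eqI[OF A T_small functor_obj[OF G] over_comp[OF G t] over_comp[OF G t']]])
    (use eq in \<open>auto simp: family_def\<close>)

text \<open>Each component is obtained from the distributive law. Naturality of the components is again an equation
between arrows determined by their values.\<close>

lemma family_surj:
  assumes A: "A \<in> Obj E" and G: "is_functor C E G" and \<phi>: "natural_family C T G A \<phi>"
  shows "\<exists>t\<in>hom (fcat C (slice E A)) (over A source) (over A G).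
    \<forall>c\<in>Obj C. \<forall>s\<in>FO T c. family A G t c s = \<phi> c s"
proof -
  have "\<forall>c\<in>Obj C. \<exists>t\<in>hom (slice E A) (proj1 E A (copower E (FO T c))) (proj1 E A (FO G c)).
    \<forall>s\<in>FO T c. value_at A (FO T c) (FO G c) t s = \<phi> c s"
    by (intro ballI value_at_surj[OF A T_small functor_obj[OF G] natural_familyD(1)[OF \<phi>]])
  then obtain k where k: "\<And>c. c \<in> Obj C \<Longrightarrow> k c \<in> hom (slice E A) (proj1 E A (copower E (FO T c))) (proj1 E A (FO G c))"
    and kv: "\<And>c s. c \<in> Obj C \<Longrightarrow> s \<in> FO T c \<Longrightarrow> value_at A (FO T c) (FO G c) (k c) s = \<phi> c s"
    by metis
  define t where "t = \<lparr>NS = over A source, NT = over A G, NC = \<lambda>c\<in>Obj C. k c\<rparr>"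
  have "t \<in> hom (fcat C (slice E A)) (over A source) (over A G)"
  proof (rule natI[OF over_functor[OF A source_functor] over_functor[OF A G]])
    show "NC t c \<in> hom (slice E A) (FO (over A source) c) (FO (over A G) c)" if "c \<in> Obj C" for c
      using k[OF that] that unfolding over_source[OF that] over_target[OF G that] by (simp add: t_def)
    fix f c c' assume f: "f \<in> hom C c c'" and c: "c \<in> Obj C" "c' \<in> Obj C"
    have "k c' \<cdot>\<^bsub>slice E A\<^esub> FA (base_change E A) (FA source f) = FA (base_change E A) (FA G f) \<cdot>\<^bsub>slice E A\<^esub> k c"
    proof (rule value_at_eqI[OF A T_small[OF c(1)] functor_obj[OF G c(2)]])
      show "k c' \<cdot>\<^bsub>slice E A\<^esub> FA (base_change E A) (FA source f) \<in>
          hom (slice E A) (proj1 E A (copower E (FO T c))) (proj1 E A (FO G c'))"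
        by (rule comp_hom[OF category_slice[OF E] base_change_arr(1)[OF A source_arr(2)[OF f]] k[OF c(2)]])
      show "FA (base_change E A) (FA G f) \<cdot>\<^bsub>slice E A\<^esub> k c \<in>
          hom (slice E A) (proj1 E A (copower E (FO T c))) (proj1 E A (FO G c'))"
        by (rule comp_hom[OF category_slice[OF E] k[OF c(1)] base_change_arr(1)[OF A functor_hom[OF G f]]])
      fix s assume s: "s \<in> FO T c"
      show "value_at A (FO T c) (FO G c') (k c' \<cdot>\<^bsub>slice E A\<^esub> FA (base_change E A) (FA source f)) s =
        value_at A (FO T c) (FO G c') (FA (base_change E A) (FA G f) \<cdot>\<^bsub>slice E A\<^esub> k c) s"
        using value_at_base_change[OF A T_small[OF c(1)] s functor_hom[OF G f] k[OF c(1)]]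
          value_at_reindex[OF A T_small[OF c(1)] T_small[OF c(2)] s T_map[OF f s] functor_obj[OF G c(2)]
            source_arr(2)[OF f] source_arr(3)[OF f s] k[OF c(2)]]
          kv[OF c(1) s] kv[OF c(2) T_map[OF f s]] natural_familyD(2)[OF \<phi> f s] by simp
    qed
    then show "NC t c' \<cdot>\<^bsub>slice E A\<^esub> FA (over A source) f = FA (over A G) f \<cdot>\<^bsub>slice E A\<^esub> NC t c"
      using homD[OF f] c by (simp add: t_def)
  qed (simp_all add: t_def)
  then show ?thesis using kv by (intro bexI[of _ t]) (simp_all add: t_def family_def)
qed

lemma natural_family_comp:
  assumes G: "is_functor C E G" and \<phi>: "natural_family C T G A \<phi>" and u: "u \<in> hom E A' A"
  shows "natural_family C T G A' (\<lambda>c s. \<phi> c s \<cdot> u)"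
  unfolding natural_family_def
proof (intro conjI ballI allI)
  show "\<phi> c s \<cdot> u \<in> hom E A' (FO G c)" if "c \<in> Obj C" "s \<in> FO T c" for c s
    by (rule comp_hom[OF E u natural_familyD(1)[OF \<phi> that]])
  show "FA G f \<cdot> (\<phi> c s \<cdot> u) = \<phi> c' (SF (FA T f) s) \<cdot> u"
    if "f \<in> hom C c c'" "s \<in> FO T c" for c c' f s
    using comp_assoc[OF E u natural_familyD(1)[OF \<phi> hom_obj(1)[OF C that(1)] that(2)] functor_hom[OF G that(1)]]
      natural_familyD(2)[OF \<phi> that] by simp
qed

text \<open>Under this correspondence reindexing along \<open>u\<close> is composition with \<open>u\<close>, since \<open>u \<times> 1\<close> maps the injection
  of a summand at stage \<open>A'\<close> to the one at stage \<open>A\<close> precomposed with \<open>u\<close>.\<close>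

lemma reindex:
  assumes G: "is_functor C E G" and u: "u \<in> hom E A' A"
    and t: "t \<in> hom (fcat C (slice E A)) (over A source) (over A G)"
  shows "reindex C E u source G t \<in> hom (fcat C (slice E A')) (over A' source) (over A' G)"
    "c \<in> Obj C \<Longrightarrow> s \<in> FO T c \<Longrightarrow> family A' G (reindex C E u source G t) c s = family A G t c s \<cdot> u"
proof -
  note A' = hom_obj(1)[OF E u] and A = hom_obj(2)[OF E u] and uD = homD[OF u]
  let ?P = "\<lambda>r. r \<in> hom (fcat C (slice E A')) (over A' source) (over A' G) \<and>
    (\<forall>c\<in>Obj C. prod_arr E u (Ide E (FO G c)) \<cdot> underlying (NC r c) =
      underlying (NC t c) \<cdot> prod_arr E u (Ide E (FO source c)))"
  obtain r where r: "r \<in> hom (fcat C (slice E A')) (over A' source) (over A' G)"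
    and rf: "\<forall>c\<in>Obj C. \<forall>s\<in>FO T c. family A' G r c s = family A G t c s \<cdot> u"
    using family_surj[OF A' G natural_family_comp[OF G family_natural[OF A G t] u]] by blast
  \<comment> \<open>The equation that characterizes the reindexed transformation determines its second components.\<close>
  have eq: "proj2 E A' (FO G c) \<cdot> underlying (NC r' c) =
      (proj2 E A (FO G c) \<cdot> underlying (NC t c)) \<cdot> prod_arr E u (Ide E (FO source c))"
    if r': "?P r'" and c: "c \<in> Obj C" for r' c
  proof -
    note Gc = functor_obj[OF G c] and X = copower_obj[OF T_small[OF c]]
    note r'c = over_comp[OF G r'[THEN conjunct1] c] and tc = over_comp[OF G t c]
    have Xs: "FO source c = copower E (FO T c)" using c T_small[OF c] by simp
    note iG = prod_arr[OF u ide_hom[OF E Gc]] and iX = prod_arr[OF u ide_hom[OF E X]]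
    have "proj2 E A' (FO G c) \<cdot> underlying (NC r' c) =
      (proj2 E A (FO G c) \<cdot> prod_arr E u (Ide E (FO G c))) \<cdot> underlying (NC r' c)"
      using iG(3) comp_ide(2)[OF E proj_hom(2)[OF A' Gc]] by simp
    also have "\<dots> = proj2 E A (FO G c) \<cdot> (underlying (NC t c) \<cdot> prod_arr E u (Ide E (FO source c)))"
      using comp_assoc[OF E hom_sliceD(3)[OF r'c] iG(1) proj_hom(2)[OF A Gc]] r'[THEN conjunct2] c by simp
    also have "\<dots> = (proj2 E A (FO G c) \<cdot> underlying (NC t c)) \<cdot> prod_arr E u (Ide E (FO source c))"
      using comp_assoc[OF E iX(1) hom_sliceD(3)[OF tc] proj_hom(2)[OF A Gc]] Xs by simp
    finally show ?thesis .
  qed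
  \<comment> \<open>Conversely, the transformation given by the composed family satisfies this equation.\<close>
  have Pr: "?P r"
  proof (intro conjI r ballI)
    fix c assume c: "c \<in> Obj C"
    note Gc = functor_obj[OF G c] and S = T_small[OF c] and X = copower_obj[OF T_small[OF c]]
    have Xs: "FO source c = copower E (FO T c)" using c T_small[OF c] by simp
    note rc = over_comp[OF G r c] and tc = over_comp[OF G t c]
    note ru = hom_sliceD(3)[OF rc] and tu = hom_sliceD(3)[OF tc]
    note iG = prod_arr[OF u ide_hom[OF E Gc]] and iX = prod_arr[OF u ide_hom[OF E X]]
    note tp = comp_hom[OF E tu proj_hom(2)[OF A Gc]]
    have "prod_arr E u (Ide E (FO G c)) \<cdot> underlying (NC r c) =
      underlying (NC t c) \<cdot> prod_arr E u (Ide E (copower E (FO T c)))"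
    proof (rule pair_eqI[OF A Gc comp_hom[OF E ru iG(1)] comp_hom[OF E iX(1) tu]])
      show "proj1 E A (FO G c) \<cdot> (prod_arr E u (Ide E (FO G c)) \<cdot> underlying (NC r c)) =
        proj1 E A (FO G c) \<cdot> (underlying (NC t c) \<cdot> prod_arr E u (Ide E (copower E (FO T c))))"
        using comp_assoc[OF E ru iG(1) proj_hom(1)[OF A Gc]] iG(2) comp_assoc[OF E ru proj_hom(1)[OF A' Gc] u]
          hom_sliceD(4)[OF rc] comp_assoc[OF E iX(1) tu proj_hom(1)[OF A Gc]] hom_sliceD(4)[OF tc] iX(2) by simp
      have "proj2 E A' (FO G c) \<cdot> underlying (NC r c) =
        (proj2 E A (FO G c) \<cdot> underlying (NC t c)) \<cdot> prod_arr E u (Ide E (copower E (FO T c)))"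
      proof (rule copower_inj_eqI[OF A' S comp_hom[OF E ru proj_hom(2)[OF A' Gc]] comp_hom[OF E iX(1) tp]])
        fix s assume s: "s \<in> FO T c"
        note j' = copower_inj[OF A' S s] and j = copower_inj[OF A S s]
        have "prod_arr E u (Ide E (copower E (FO T c))) \<cdot> copower_inj A' (FO T c) s = copower_inj A (FO T c) s \<cdot> u"
        proof (rule pair_eqI[OF A X comp_hom[OF E j'(1) iX(1)] comp_hom[OF E u j(1)]])
          show "proj1 E A (copower E (FO T c)) \<cdot> (prod_arr E u (Ide E (copower E (FO T c))) \<cdot> copower_inj A' (FO T c) s) =
            proj1 E A (copower E (FO T c)) \<cdot> (copower_inj A (FO T c) s \<cdot> u)"
            using comp_assoc[OF E j'(1) iX(1) proj_hom(1)[OF A X]] iX(2) comp_assoc[OF E j'(1) proj_hom(1)[OF A' X] u]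
              j'(2) comp_assoc[OF E u j(1) proj_hom(1)[OF A X]] j(2) comp_ide[OF E u] by simp
          have "to_terminal E A \<cdot> u = to_terminal E A'"
            by (rule terminal_eqI[OF terminal_E E comp_hom[OF E u to_terminal[OF A]] to_terminal[OF A']])
          then show "proj2 E A (copower E (FO T c)) \<cdot> (prod_arr E u (Ide E (copower E (FO T c))) \<cdot> copower_inj A' (FO T c) s) =
            proj2 E A (copower E (FO T c)) \<cdot> (copower_inj A (FO T c) s \<cdot> u)"
            using comp_assoc[OF E j'(1) iX(1) proj_hom(2)[OF A X]] iX(3) comp_ide(2)[OF E proj_hom(2)[OF A' X]]
              j'(3) comp_assoc[OF E u j(1) proj_hom(2)[OF A X]] j(3)
              comp_assoc[OF E u to_terminal[OF A] coproj_hom[OF S s]] by simp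
        qed
        then show "(proj2 E A' (FO G c) \<cdot> underlying (NC r c)) \<cdot> copower_inj A' (FO T c) s =
          ((proj2 E A (FO G c) \<cdot> underlying (NC t c)) \<cdot> prod_arr E u (Ide E (copower E (FO T c)))) \<cdot>
            copower_inj A' (FO T c) s"
          using rf[rule_format, OF c s] comp_assoc[OF E j'(1) iX(1) tp] comp_assoc[OF E u j(1) tp]
          by (simp add: family_def value_at_def)
      qed
      then show "proj2 E A (FO G c) \<cdot> (prod_arr E u (Ide E (FO G c)) \<cdot> underlying (NC r c)) =
        proj2 E A (FO G c) \<cdot> (underlying (NC t c) \<cdot> prod_arr E u (Ide E (copower E (FO T c))))"
        using comp_assoc[OF E ru iG(1) proj_hom(2)[OF A Gc]] iG(3) comp_ide(2)[OF E proj_hom(2)[OF A' Gc]]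
          comp_assoc[OF E iX(1) tu proj_hom(2)[OF A Gc]] by simp
    qed
    then show "prod_arr E u (Ide E (FO G c)) \<cdot> underlying (NC r c) =
      underlying (NC t c) \<cdot> prod_arr E u (Ide E (FO source c))" unfolding Xs .
  qed
  have "reindex C E u source G t = r"
    unfolding reindex_def uD(2)
  proof (rule the_equality, rule Pr)
    fix r' assume r': "?P r'"
    show "r' = r"
    proof (rule ntr_eqI[OF r'[THEN conjunct1] r])
      fix c assume c: "c \<in> Obj C"
      show "NC r' c = NC r c"
        by (rule slice_transpose_eqI[OF over_comp[OF G r'[THEN conjunct1] c] over_comp[OF G r c] A' functor_obj[OF G c]])
          (use eq[OF r' c] eq[OF Pr c] in simp)
    qed
  qed
  then show "reindex C E u source G t \<in> hom (fcat C (slice E A')) (over A' source) (over A' G)"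
    "c \<in> Obj C \<Longrightarrow> s \<in> FO T c \<Longrightarrow> family A' G (reindex C E u source G t) c s = family A G t c s \<cdot> u"
    using r rf by auto
qed

text \<open>The object of transformations \<open>\<gamma>\<^sup>* \<circ> T \<rightarrow> G\<close> is the limit of \<open>G\<close> weighted by \<open>T\<close>: a generalized
  element of the limit is a natural family.\<close>

lemma weighted_limit:
  assumes G: "is_functor C E G"
  shows "\<exists>H \<omega>. H \<in> Obj E \<and> natural_family C T G H \<omega> \<and>
    (\<forall>A \<phi>. A \<in> Obj E \<longrightarrow> natural_family C T G A \<phi> \<longrightarrow>
      (\<exists>!x. x \<in> hom E A H \<and> (\<forall>c\<in>Obj C. \<forall>s\<in>FO T c. \<omega> c s \<cdot> x = \<phi> c s)))"
proof -
  define V where "V = (SIGMA c:Obj C. FO T c)"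
  define Ed where "Ed = {((c, s), (c', s'), h). \<exists>f\<in>hom C c c'. s \<in> FO T c \<and> s' = SF (FA T f) s \<and> h = FA G f}"
  have V: "small_in TYPE('u) V"
    unfolding V_def using C_small T_small by (simp add: small_in_Sigma small_in_self small_category_def)
  have "\<exists>L p. limit_cone E V (\<lambda>v. FO G (fst v)) Ed L p"
  proof (rule has_limits[OF V])
    show "FO G (fst v) \<in> Obj E" if "v \<in> V" for v using that functor_obj[OF G] by (auto simp: V_def)
    fix v w h assume "(v, w, h) \<in> Ed"
    then obtain c s c' f where "v = (c, s)" "w = (c', SF (FA T f) s)" "h = FA G f" "f \<in> hom C c c'" "s \<in> FO T c"
      by (auto simp: Ed_def)
    then show "v \<in> V \<and> w \<in> V \<and> h \<in> hom E (FO G (fst v)) (FO G (fst w))"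
      using hom_obj[OF C] T_map functor_hom[OF G] by (auto simp: V_def)
  qed
  then obtain L p where lim: "limit_cone E V (\<lambda>v. FO G (fst v)) Ed L p" by (elim exE)
  show ?thesis
  proof (intro exI[of _ L] exI[of _ "\<lambda>c s. p (c, s)"] conjI allI impI)
    show "L \<in> Obj E" by (rule limit_cone_arr(1)[OF lim])
    show "natural_family C T G L (\<lambda>c s. p (c, s))"
      unfolding natural_family_def
    proof (intro conjI ballI allI)
      show "p (c, s) \<in> hom E L (FO G c)" if "c \<in> Obj C" "s \<in> FO T c" for c s
        using limit_cone_arr(2)[OF lim, of "(c, s)"] that by (simp add: V_def)
      show "FA G f \<cdot> p (c, s) = p (c', SF (FA T f) s)" if "f \<in> hom C c c'" "s \<in> FO T c" for c c' f s
        by (rule limit_cone_arr(3)[OF lim]) (use that in \<open>auto simp: Ed_def\<close>)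
    qed
    fix A \<phi> assume A: "A \<in> Obj E" and \<phi>: "natural_family C T G A \<phi>"
    have "\<exists>!x. x \<in> hom E A L \<and> (\<forall>v\<in>V. p v \<cdot> x = \<phi> (fst v) (snd v))"
      by (rule limit_cone_universal[OF lim A]) (use natural_familyD[OF \<phi>] in \<open>auto simp: V_def Ed_def\<close>)
    moreover have "(\<forall>v\<in>V. p v \<cdot> x = \<phi> (fst v) (snd v)) \<longleftrightarrow>
      (\<forall>c\<in>Obj C. \<forall>s\<in>FO T c. p (c, s) \<cdot> x = \<phi> c s)" for x by (auto simp: V_def)
    ultimately show "\<exists>!x. x \<in> hom E A L \<and> (\<forall>c\<in>Obj C. \<forall>s\<in>FO T c. p (c, s) \<cdot> x = \<phi> c s)" by simp
  qed
qed

text \<open>The limit represents natural families, and natural families are transformations; compatibility with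
reindexing is \<open>reindex\<close>.\<close>

lemma hom_object_exists:
  assumes G: "is_functor C E G"
  shows "\<exists>H \<Phi>. is_hom_object C E source G H \<Phi>"
proof -
  obtain H \<omega> where H: "H \<in> Obj E" and \<omega>: "natural_family C T G H \<omega>"
    and univ: "\<forall>A \<phi>. A \<in> Obj E \<longrightarrow> natural_family C T G A \<phi> \<longrightarrow>
      (\<exists>!x. x \<in> hom E A H \<and> (\<forall>c\<in>Obj C. \<forall>s\<in>FO T c. \<omega> c s \<cdot> x = \<phi> c s))"
    using weighted_limit[OF G] by (elim exE conjE)
  have ex: "\<exists>t. t \<in> hom (fcat C (slice E A)) (over A source) (over A G) \<and>
    (\<forall>c\<in>Obj C. \<forall>s\<in>FO T c. family A G t c s = \<omega> c s \<cdot> x)" if "x \<in> hom E A H" for A x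
    using family_surj[OF hom_obj(1)[OF E that] G natural_family_comp[OF G \<omega> that]] by blast
  define \<Phi> where "\<Phi> A x = (SOME t. t \<in> hom (fcat C (slice E A)) (over A source) (over A G) \<and>
    (\<forall>c\<in>Obj C. \<forall>s\<in>FO T c. family A G t c s = \<omega> c s \<cdot> x))" for A x
  have \<Phi>: "\<Phi> A x \<in> hom (fcat C (slice E A)) (over A source) (over A G)"
    "\<And>c s. c \<in> Obj C \<Longrightarrow> s \<in> FO T c \<Longrightarrow> family A G (\<Phi> A x) c s = \<omega> c s \<cdot> x" if "x \<in> hom E A H" for A x
    using someI_ex[OF ex[OF that]] unfolding \<Phi>_def by blast+
  have "is_hom_object C E source G H \<Phi>"
    unfolding is_hom_object_def
  proof (intro conjI H ballI)
    fix A assume A: "A \<in> Obj E"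
    show "bij_betw (\<Phi> A) (hom E A H) (hom (fcat C (slice E A)) (over A source) (over A G))"
      unfolding bij_betw_def
    proof (intro conjI inj_onI set_eqI iffI)
      fix x y assume x: "x \<in> hom E A H" and y: "y \<in> hom E A H" and eq: "\<Phi> A x = \<Phi> A y"
      show "x = y"
        by (rule ex1_eqI[OF univ[rule_format, OF A natural_family_comp[OF G \<omega> y]]])
          (use x y \<Phi>(2)[OF x] \<Phi>(2)[OF y] eq in auto)
    next
      fix t assume "t \<in> \<Phi> A ` hom E A H"
      then show "t \<in> hom (fcat C (slice E A)) (over A source) (over A G)" using \<Phi>(1) by blast
    next
      fix t assume t: "t \<in> hom (fcat C (slice E A)) (over A source) (over A G)"
      obtain x where x: "x \<in> hom E A H" and xf: "\<forall>c\<in>Obj C. \<forall>s\<in>FO T c. \<omega> c s \<cdot> x = family A G t c s"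
        using univ[rule_format, OF A family_natural[OF A G t]] by (elim ex1E conjE)
      have "t = \<Phi> A x" by (rule family_eqI[OF A G t \<Phi>(1)[OF x]]) (use xf \<Phi>(2)[OF x] in simp)
      then show "t \<in> \<Phi> A ` hom E A H" using x by blast
    qed
  next
    fix u x assume u: "u \<in> Arr E" and x: "x \<in> hom E (Cod E u) H"
    note uh = arr_hom[OF u]
    note xu = comp_hom[OF E uh x] and r = reindex[OF G uh \<Phi>(1)[OF x]]
    show "\<Phi> (Dom E u) (x \<cdot> u) = reindex C E u source G (\<Phi> (Cod E u) x)"
      by (rule family_eqI[OF hom_obj(1)[OF E uh] G \<Phi>(1)[OF xu] r(1)])
        (use \<Phi>(2)[OF xu] r(2) \<Phi>(2)[OF x] comp_assoc[OF E uh x natural_familyD(1)[OF \<omega>]] in simp)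
  qed
  then show ?thesis by blast
qed

text \<open>For the chosen object of transformations, the universal natural family is the one given by its
  identity.\<close>

definition hom_proj :: "('u, 'u, 'o, 'a) ftr \<Rightarrow> 'u \<Rightarrow> 'u \<Rightarrow> 'a" where
  "hom_proj G = family (hom_object C E source G) G
     (hom_elem C E source G (hom_object C E source G) (Ide E (hom_object C E source G)))"

lemma hom_object_spec:
  assumes "is_functor C E G"
  shows "is_hom_object C E source G (hom_object C E source G) (hom_elem C E source G)"
proof -
  obtain H \<Phi> where "is_hom_object C E source G H \<Phi>" using hom_object_exists[OF assms] by blast
  then have "(\<lambda>(H, \<Phi>). is_hom_object C E source G H \<Phi>) (H, \<Phi>)" by simp
  then have "(\<lambda>(H, \<Phi>). is_hom_object C E source G H \<Phi>) (SOME (H, \<Phi>). is_hom_object C E source G H \<Phi>)"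
    by (rule someI)
  then show ?thesis by (simp add: hom_object_def hom_elem_def hom_data_def case_prod_beta)
qed

lemma hom_object_obj: "is_functor C E G \<Longrightarrow> hom_object C E source G \<in> Obj E"
  using hom_object_spec[of G] unfolding is_hom_object_def by (rule conjunct1)

lemma hom_elem_hom:
  assumes G: "is_functor C E G" and x: "x \<in> hom E A (hom_object C E source G)"
  shows "hom_elem C E source G A x \<in> hom (fcat C (slice E A)) (over A source) (over A G)"
  using hom_object_spec[OF G, unfolded is_hom_object_def, THEN conjunct2, THEN conjunct1, rule_format, OF hom_obj(1)[OF E x]]
    x by (rule bij_betw_apply)

text \<open>By naturality in the stage, the family of \<open>x\<close> is the one of the identity reindexed along \<open>x\<close>.\<close>

lemma family_hom_elem:
  assumes G: "is_functor C E G" and x: "x \<in> hom E A (hom_object C E source G)" and c: "c \<in> Obj C" and s: "s \<in> FO T c"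
  shows "family A G (hom_elem C E source G A x) c s = hom_proj G c s \<cdot> x"
proof -
  let ?H = "hom_object C E source G"
  note H = hom_object_obj[OF G] and xD = homD[OF x]
  note i = ide_hom[OF E H]
  have "hom_elem C E source G (Dom E x) (Ide E ?H \<cdot> x) = reindex C E x source G (hom_elem C E source G (Cod E x) (Ide E ?H))"
    by (rule hom_object_spec[OF G, unfolded is_hom_object_def, THEN conjunct2, THEN conjunct2, rule_format])
      (use xD i in simp_all)
  then have "hom_elem C E source G A x = reindex C E x source G (hom_elem C E source G ?H (Ide E ?H))"
    using xD comp_ide(2)[OF E x] by simp
  then show ?thesis
    using reindex(2)[OF G x hom_elem_hom[OF G i] c s] by (simp add: hom_proj_def)
qed

lemma hom_proj_natural:
  assumes G: "is_functor C E G"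
  shows "natural_family C T G (hom_object C E source G) (hom_proj G)"
  unfolding hom_proj_def
  by (rule family_natural[OF hom_object_obj[OF G] G hom_elem_hom[OF G ide_hom[OF E hom_object_obj[OF G]]]])

lemma hom_proj_universal:
  assumes G: "is_functor C E G" and A: "A \<in> Obj E" and \<phi>: "natural_family C T G A \<phi>"
  shows "\<exists>!x. x \<in> hom E A (hom_object C E source G) \<and>
    (\<forall>c\<in>Obj C. \<forall>s\<in>FO T c. hom_proj G c s \<cdot> x = \<phi> c s)"
proof -
  let ?H = "hom_object C E source G"
  have bij: "bij_betw (hom_elem C E source G A) (hom E A ?H) (hom (fcat C (slice E A)) (over A source) (over A G))"
    by (rule hom_object_spec[OF G, unfolded is_hom_object_def, THEN conjunct2, THEN conjunct1, rule_format, OF A])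
  obtain t where t: "t \<in> hom (fcat C (slice E A)) (over A source) (over A G)"
    and tf: "\<forall>c\<in>Obj C. \<forall>s\<in>FO T c. family A G t c s = \<phi> c s" using family_surj[OF A G \<phi>] by blast
  obtain x where x: "x \<in> hom E A ?H" "hom_elem C E source G A x = t"
    using t bij_betw_imp_surj_on[OF bij] by (metis imageE)
  show ?thesis
  proof (rule ex1I[of _ x], intro conjI ballI)
    show "x \<in> hom E A ?H" by (rule x(1))
    show "hom_proj G c s \<cdot> x = \<phi> c s" if "c \<in> Obj C" "s \<in> FO T c" for c s
      using family_hom_elem[OF G x(1) that] x(2) tf that by simp
    fix y assume y: "y \<in> hom E A ?H \<and> (\<forall>c\<in>Obj C. \<forall>s\<in>FO T c. hom_proj G c s \<cdot> y = \<phi> c s)"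
    have "hom_elem C E source G A y = t"
      by (rule family_eqI[OF A G hom_elem_hom[OF G] t])
        (use y tf family_hom_elem[OF G y[THEN conjunct1]] in auto)
    then show "y = x" using bij_betw_imp_inj_on[OF bij] x y by (auto dest: inj_onD)
  qed
qed

lemma hom_proj_eqI:
  assumes G: "is_functor C E G" and x: "x \<in> hom E A (hom_object C E source G)" "y \<in> hom E A (hom_object C E source G)"
    and eq: "\<And>c s. c \<in> Obj C \<Longrightarrow> s \<in> FO T c \<Longrightarrow> hom_proj G c s \<cdot> x = hom_proj G c s \<cdot> y"
  shows "x = y"
  by (rule ex1_eqI[OF hom_proj_universal[OF G hom_obj(1)[OF E x(1)] natural_family_comp[OF G hom_proj_natural[OF G] x(2)]]])
    (use x eq in auto)

end

text \<open>A map of weights \<open>\<tau> : T' \<rightarrow> T\<close> induces maps between objects of transformations in the opposite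
direction.\<close>

locale weight_map = W: weight U E C T + W': weight U E C T'
  for U :: "'u::universe itself" and E :: "('o, 'a) cat" (structure) and C :: "('u, 'u) cat" and T T' +
  fixes \<tau> :: "('u, 'u, 'u set, 'u sfun) ntr"
  assumes \<tau>: "\<tau> \<in> hom (fcat C setcat) T' T"
begin

lemma \<tau>_map: "c \<in> Obj C \<Longrightarrow> s \<in> FO T' c \<Longrightarrow> SF (NC \<tau> c) s \<in> FO T c"
  using hom_fcat_comp[OF \<tau>, of c] by (auto simp: hom_setcat)

lemma whisker_gamma:
  shows "whisker_left C (gamma E) \<tau> \<in> hom (fcat C E) W'.source W.source"
  by (rule whisker_left_hom[OF \<tau> W.gamma_functor])

text \<open>Precomposition with \<open>\<gamma>\<^sup>* \<circ> \<tau>\<close> moves the summands along \<open>\<tau>\<close>, postcomposition with \<open>b\<close> acts on the values.\<close>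

lemma family_composite:
  assumes b: "b \<in> hom (fcat C E) G G'" and x: "x \<in> hom E A (hom_object C E W.source G)"
  defines "k \<equiv> whisker_left C (base_change E A) b \<cdot>\<^bsub>fcat C (slice E A)\<^esub> hom_elem C E W.source G A x
    \<cdot>\<^bsub>fcat C (slice E A)\<^esub> whisker_left C (base_change E A) (whisker_left C (gamma E) \<tau>)"
  shows "k \<in> hom (fcat C (slice E A)) (W.over A W'.source) (W.over A G')"
    "c \<in> Obj C \<Longrightarrow> s \<in> FO T' c \<Longrightarrow>
      W'.family A G' k c s = (NC b c \<cdot> W.hom_proj G c (SF (NC \<tau> c) s)) \<cdot> x"
proof -
  note A = hom_obj(1)[OF W.E x] and G = hom_fcat(4)[OF b] and G' = hom_fcat(5)[OF b]
  note bc = W.base_change_functor[OF A] and SE = category_slice[OF W.E, of A]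
  note b' = whisker_left_hom[OF b bc] and a' = whisker_left_hom[OF whisker_gamma bc]
    and h = W.hom_elem_hom[OF G x]
  show k: "k \<in> hom (fcat C (slice E A)) (W.over A W'.source) (W.over A G')"
    unfolding k_def by (rule fcat_comp_hom[OF a' fcat_comp_hom[OF h b']])
  assume c: "c \<in> Obj C" and s: "s \<in> FO T' c"
  note s' = \<tau>_map[OF c s] and S' = W'.T_small[OF c] and S = W.T_small[OF c]
  note \<tau>c = hom_fcat_comp[OF \<tau> c] and bcc = hom_fcat_comp[OF b c] and hc = W.over_comp[OF G h c]
  note g = W.gamma_arr[OF \<tau>c]
  let ?h = "NC (hom_elem C E W.source G A x) c"
  have NCk: "NC k c = (FA (base_change E A) (NC b c) \<cdot>\<^bsub>slice E A\<^esub> ?h) \<cdot>\<^bsub>slice E A\<^esub>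
      FA (base_change E A) (FA (gamma E) (NC \<tau> c))"
    using c by (simp add: k_def)
  have "W'.family A G' k c s =
    W.value_at A (FO T c) (FO G' c) (FA (base_change E A) (NC b c) \<cdot>\<^bsub>slice E A\<^esub> ?h) (SF (NC \<tau> c) s)"
    unfolding W'.family_def NCk
    by (rule W.value_at_reindex[OF A S' S s s' functor_obj[OF G' c] g(1) g(2)[OF s]
          comp_hom[OF SE hc W.base_change_arr(1)[OF A bcc]]])
  also have "\<dots> = NC b c \<cdot> W.family A G (hom_elem C E W.source G A x) c (SF (NC \<tau> c) s)"
    unfolding W.family_def by (rule W.value_at_base_change[OF A S s' bcc hc])
  also have "\<dots> = (NC b c \<cdot> W.hom_proj G c (SF (NC \<tau> c) s)) \<cdot> x"
    using W.family_hom_elem[OF G x c s']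
      comp_assoc[OF W.E x W.natural_familyD(1)[OF W.hom_proj_natural[OF G] c s'] bcc] by simp
  finally show "W'.family A G' k c s = (NC b c \<cdot> W.hom_proj G c (SF (NC \<tau> c) s)) \<cdot> x" .
qed

text \<open>The arrow is given by the universal property of the target. It is the only one compatible with
composition, as is seen on the generalized element given by the identity.\<close>

lemma hom_map:
  assumes b: "b \<in> hom (fcat C E) G G'"
  shows "hom_map C E (whisker_left C (gamma E) \<tau>) b \<in>
      hom E (hom_object C E W.source G) (hom_object C E W'.source G')"
    "c \<in> Obj C \<Longrightarrow> s \<in> FO T' c \<Longrightarrow>
      W'.hom_proj G' c s \<cdot> hom_map C E (whisker_left C (gamma E) \<tau>) b =
      NC b c \<cdot> W.hom_proj G c (SF (NC \<tau> c) s)"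
proof -
  note G = hom_fcat(4)[OF b] and G' = hom_fcat(5)[OF b]
  note \<tau>D = hom_fcat(2,3)[OF \<tau>] and bD = hom_fcat(2,3)[OF b]
  let ?H = "hom_object C E W.source G" and ?H' = "hom_object C E W'.source G'"
  let ?a = "whisker_left C (gamma E) \<tau>"
  let ?\<phi> = "\<lambda>c s. NC b c \<cdot> W.hom_proj G c (SF (NC \<tau> c) s)"
  note H = W.hom_object_obj[OF G] and H' = W'.hom_object_obj[OF G']
  note p = W.hom_proj_natural[OF G]
  have \<phi>: "W.natural_family C T' G' ?H ?\<phi>"
    unfolding W.natural_family_def
  proof (intro conjI ballI allI)
    show "?\<phi> c s \<in> hom E ?H (FO G' c)" if "c \<in> Obj C" "s \<in> FO T' c" for c s
      by (rule comp_hom[OF W.E W.natural_familyD(1)[OF p that(1) \<tau>_map[OF that]] hom_fcat_comp[OF b that(1)]])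
    fix c c' f s assume f: "f \<in> hom C c c'" and s: "s \<in> FO T' c"
    note c = hom_obj[OF W.C f]
    note s' = \<tau>_map[OF c(1) s]
    have "SF (FA T f) (SF (NC \<tau> c) s) = SF (NC \<tau> c') (SF (FA T' f) s)"
      using arg_cong[OF hom_fcat_natural[OF \<tau> f], of "\<lambda>t. SF t s"] s
        hom_fcat_comp[OF \<tau> c(1)] functor_hom[OF W'.T f] by (simp add: hom_setcat)
    then show "FA G' f \<cdot> ?\<phi> c s = ?\<phi> c' (SF (FA T' f) s)"
      using comp_assoc[OF W.E W.natural_familyD(1)[OF p c(1) s'] hom_fcat_comp[OF b c(1)] functor_hom[OF G' f]]
        comp_assoc[OF W.E W.natural_familyD(1)[OF p c(1) s'] functor_hom[OF G f] hom_fcat_comp[OF b c(2)]]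
        hom_fcat_natural[OF b f] W.natural_familyD(2)[OF p f s'] by simp
  qed
  obtain m where m: "m \<in> hom E ?H ?H'" and mp: "\<forall>c\<in>Obj C. \<forall>s\<in>FO T' c. W'.hom_proj G' c s \<cdot> m = ?\<phi> c s"
    using W'.hom_proj_universal[OF G' H \<phi>] by (elim ex1E conjE)
  let ?P = "\<lambda>h. h \<in> hom E ?H ?H' \<and> (\<forall>A\<in>Obj E. \<forall>x\<in>hom E A ?H.
    hom_elem C E W'.source G' A (h \<cdot> x) = whisker_left C (base_change E A) b \<cdot>\<^bsub>fcat C (slice E A)\<^esub>
      hom_elem C E W.source G A x \<cdot>\<^bsub>fcat C (slice E A)\<^esub> whisker_left C (base_change E A) ?a)"
  have Pm: "?P m"
  proof (intro conjI m ballI)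
    fix A x assume A: "A \<in> Obj E" and x: "x \<in> hom E A ?H"
    note k = family_composite[OF b x] and mx = comp_hom[OF W.E x m]
    show "hom_elem C E W'.source G' A (m \<cdot> x) = whisker_left C (base_change E A) b \<cdot>\<^bsub>fcat C (slice E A)\<^esub>
      hom_elem C E W.source G A x \<cdot>\<^bsub>fcat C (slice E A)\<^esub> whisker_left C (base_change E A) ?a"
    proof (rule W'.family_eqI[OF A G' W'.hom_elem_hom[OF G' mx] k(1)])
      fix c s assume c: "c \<in> Obj C" and s: "s \<in> FO T' c"
      show "W'.family A G' (hom_elem C E W'.source G' A (m \<cdot> x)) c s =
        W'.family A G' (whisker_left C (base_change E A) b \<cdot>\<^bsub>fcat C (slice E A)\<^esub>
          hom_elem C E W.source G A x \<cdot>\<^bsub>fcat C (slice E A)\<^esub> whisker_left C (base_change E A) ?a) c s"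
        unfolding k(2)[OF c s] W'.family_hom_elem[OF G' mx c s]
        using mp c s comp_assoc[OF W.E x m W.natural_familyD(1)[OF W'.hom_proj_natural[OF G'] c s]] by simp
    qed
  qed
  have "hom_map C E ?a b = m"
    unfolding hom_map_def whisker_left_simps(1,2) \<tau>D bD
  proof (rule the_equality, rule Pm)
    fix h assume h: "?P h"
    note hh = h[THEN conjunct1] and i = ide_hom[OF W.E H]
    have eq: "hom_elem C E W'.source G' ?H (h \<cdot> Ide E ?H) = hom_elem C E W'.source G' ?H (m \<cdot> Ide E ?H)"
      using h[THEN conjunct2, rule_format, OF H i] Pm[THEN conjunct2, rule_format, OF H i] by simp
    show "h = m"
    proof (rule W'.hom_proj_eqI[OF G' hh m])
      fix c s assume c: "c \<in> Obj C" and s: "s \<in> FO T' c"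
      show "W'.hom_proj G' c s \<cdot> h = W'.hom_proj G' c s \<cdot> m"
        using eq W'.family_hom_elem[OF G' hh c s] W'.family_hom_elem[OF G' m c s]
          comp_ide(1)[OF W.E hh] comp_ide(1)[OF W.E m] by simp
    qed
  qed
  then show "hom_map C E ?a b \<in> hom E ?H ?H'"
    "c \<in> Obj C \<Longrightarrow> s \<in> FO T' c \<Longrightarrow> W'.hom_proj G' c s \<cdot> hom_map C E ?a b = ?\<phi> c s"
    using m mp by auto
qed

end

subsection \<open>The comparison of \<open>\<gamma>\<^sup>*\<close> of a slice with \<open>!\<^sub>A\<^sup>* \<circ> \<gamma>\<^sup>*\<close>\<close>

context topos_like
begin

text \<open>The arrow \<open>1 \<rightarrow> !\<^sub>A\<^sup>*(1)\<close> in the definition is the global element of \<open>A \<rightarrow> 1\<close>, so that the injections are mapped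
to the points given by the summands.\<close>

lemma gamma_slice_comp:
  assumes A: "A \<in> Obj E" and S: "Defs.small (S :: 'u set)"
  shows "NC (gamma_slice E A) S \<in> hom (slice E A) (copower (slice E A) S) (proj1 E A (copower E S))"
    "s \<in> S \<Longrightarrow> NC (gamma_slice E A) S \<cdot>\<^bsub>slice E A\<^esub> coproj (slice E A) S s = copower_point A S s"
proof -
  interpret S: copowered U "slice E A" by (rule copowered_slice[OF A])
  note X = copower_obj[OF S] and t = to_terminal[OF A]
  have can: "(THE k. k \<in> hom (slice E A) (terminal (slice E A)) (FO (base_change E A) (terminal E))) =
    global_element E A (terminal E) (to_terminal E A)"
    unfolding base_change_FO[OF terminal_obj]
  proof (rule the_equality, rule global_element(1)[OF A t])
    fix k assume "k \<in> hom (slice E A) (terminal (slice E A)) (proj1 E A (terminal E))"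
    then obtain x where "x \<in> hom E A (terminal E)" "k = global_element E A (terminal E) x"
      using global_element_surj[OF A terminal_obj] by blast
    then show "k = global_element E A (terminal E) (to_terminal E A)"
      using terminal_eqI[OF terminal_E E _ t] by blast
  qed
  have pt: "FA (base_change E A) (coproj E S s) \<cdot>\<^bsub>slice E A\<^esub> global_element E A (terminal E) (to_terminal E A) =
    copower_point A S s" if "s \<in> S" for s
    unfolding copower_point_def by (rule global_element_comp[OF A t coproj_hom[OF S that]])
  have "\<exists>!h. h \<in> hom (slice E A) (copower (slice E A) S) (proj1 E A (copower E S)) \<and>
    (\<forall>s\<in>S. h \<cdot>\<^bsub>slice E A\<^esub> coproj (slice E A) S s = copower_point A S s)"
    by (rule S.copower_universal[OF S proj1_obj[OF A X] copower_point(1)[OF A S]])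
  moreover have "NC (gamma_slice E A) S = (THE h. h \<in> hom (slice E A) (copower (slice E A) S) (proj1 E A (copower E S)) \<and>
    (\<forall>s\<in>S. h \<cdot>\<^bsub>slice E A\<^esub> coproj (slice E A) S s = copower_point A S s))"
    using S X pt by (simp add: gamma_slice_def can)
  ultimately show "NC (gamma_slice E A) S \<in> hom (slice E A) (copower (slice E A) S) (proj1 E A (copower E S))"
    "s \<in> S \<Longrightarrow> NC (gamma_slice E A) S \<cdot>\<^bsub>slice E A\<^esub> coproj (slice E A) S s = copower_point A S s"
    using theI'[where P = "\<lambda>h. h \<in> hom (slice E A) (copower (slice E A) S) (proj1 E A (copower E S)) \<and>
      (\<forall>s\<in>S. h \<cdot>\<^bsub>slice E A\<^esub> coproj (slice E A) S s = copower_point A S s)"] by auto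
qed

lemma gamma_slice_hom:
  assumes A: "A \<in> Obj E"
  shows "gamma_slice E A \<in> hom (fcat setcat (slice E A)) (gamma (slice E A))
    (base_change E A \<circ>\<^bsub>setcat\<^esub> (gamma E :: ('u set, 'u sfun, 'o, 'a) ftr))"
proof -
  interpret S: copowered U "slice E A" by (rule copowered_slice[OF A])
  note SE = category_slice[OF E, of A]
  show ?thesis
  proof (rule natI[OF S.gamma_functor functor_fcomp[OF gamma_functor base_change_functor[OF A]]])
    fix S :: "'u set" assume "S \<in> Obj setcat"
    then have S: "Defs.small S" by simp
    show "NC (gamma_slice E A) S \<in> hom (slice E A) (FO (gamma (slice E A)) S)
      (FO (base_change E A \<circ>\<^bsub>setcat\<^esub> gamma E) S)"
      using gamma_slice_comp(1)[OF A S] S copower_obj[OF S] by simp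
  next
    fix f and S S' :: "'u set" assume f: "f \<in> hom setcat S S'" and "S \<in> Obj setcat" "S' \<in> Obj setcat"
    then have S: "Defs.small S" and S': "Defs.small S'" by auto
    note gf = gamma_arr[OF f] and gsf = S.gamma_arr[OF f]
    note n = gamma_slice_comp[OF A S] and n' = gamma_slice_comp[OF A S']
    note bf = base_change_arr(1)[OF A gf(1)]
    have "NC (gamma_slice E A) S' \<cdot>\<^bsub>slice E A\<^esub> FA (gamma (slice E A)) f =
      FA (base_change E A) (FA (gamma E) f) \<cdot>\<^bsub>slice E A\<^esub> NC (gamma_slice E A) S"
    proof (rule S.copower_eqI[OF S comp_hom[OF SE gsf(1) n'(1)] comp_hom[OF SE n(1) bf]])
      fix s assume s: "s \<in> S"
      have fs: "SF f s \<in> S'" using f s by (auto simp: hom_setcat)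
      note j = S.coproj_hom[OF S s]
      show "(NC (gamma_slice E A) S' \<cdot>\<^bsub>slice E A\<^esub> FA (gamma (slice E A)) f) \<cdot>\<^bsub>slice E A\<^esub> coproj (slice E A) S s =
        (FA (base_change E A) (FA (gamma E) f) \<cdot>\<^bsub>slice E A\<^esub> NC (gamma_slice E A) S) \<cdot>\<^bsub>slice E A\<^esub> coproj (slice E A) S s"
        using comp_assoc[OF SE j gsf(1) n'(1)] gsf(2)[OF s] n'(2)[OF fs] comp_assoc[OF SE j n(1) bf] n(2)[OF s]
          global_element_comp[OF A coproj_to_terminal[OF A S s] gf(1)]
          comp_assoc[OF E to_terminal[OF A] coproj_hom[OF S s] gf(1)] gf(2)[OF s]
        by (simp add: copower_point_def)
    qed
    then show "NC (gamma_slice E A) S' \<cdot>\<^bsub>slice E A\<^esub> FA (gamma (slice E A)) f =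
      FA (base_change E A \<circ>\<^bsub>setcat\<^esub> gamma E) f \<cdot>\<^bsub>slice E A\<^esub> NC (gamma_slice E A) S"
      using homD(1)[OF f] by simp
  qed (simp_all add: gamma_slice_def)
qed

end

subsection \<open>The comparison of tilde with a functor on the target\<close>

text \<open>A functor \<open>L\<close> between two targets, applied to the diagram of \<open>tilde F\<close>.\<close>

locale tilde_change = X: tilde_target C D P E + Y: tilde_target C D P E'
  for C D :: "('u::universe, 'u) cat" and P :: "'u prof" and E :: "('o, 'a) cat" (structure) and E' :: "('p, 'b) cat" +
  fixes L :: "('o, 'a, 'p, 'b) ftr" and F :: "('u, 'u, 'o, 'a) ftr"
  assumes L: "is_functor E E' L" and F: "is_functor D E F"
begin

lemma LF: "is_functor D E' (L \<circ>\<^bsub>D\<^esub> F)"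
  by (rule functor_fcomp[OF F L])

abbreviation comparison :: "('u, 'u, 'p, 'b) ntr" where
  "comparison \<equiv> tilde_comparison C D P E E' L F"

lemma comparison_comp:
  assumes c: "c \<in> Obj C"
  shows "NC comparison c \<in> hom E' (tilde_obj_obj D P E' (L \<circ>\<^bsub>D\<^esub> F) c) (FO L (tilde_obj_obj D P E F c))"
    "d \<in> Obj D \<Longrightarrow> z \<in> X.Pset c d \<Longrightarrow>
      NC comparison c \<cdot>\<^bsub>E'\<^esub> kappa D P E' (L \<circ>\<^bsub>D\<^esub> F) c (d, z) = FA L (kappa D P E F c (d, z))"
proof -
  have "\<exists>!h. h \<in> hom E' (tilde_obj_obj D P E' (L \<circ>\<^bsub>D\<^esub> F) c) (FO L (tilde_obj_obj D P E F c)) \<and>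
    (\<forall>d\<in>Obj D. \<forall>z\<in>X.Pset c d. h \<cdot>\<^bsub>E'\<^esub> kappa D P E' (L \<circ>\<^bsub>D\<^esub> F) c (d, z) = FA L (kappa D P E F c (d, z)))"
  proof (rule Y.kappa_universal[OF LF c functor_obj[OF L X.tilde_obj_obj[OF F c]]])
    show "FA L (kappa D P E F c (d, z)) \<in> hom E' (FO (L \<circ>\<^bsub>D\<^esub> F) d) (FO L (tilde_obj_obj D P E F c))"
      if "d \<in> Obj D" "z \<in> X.Pset c d" for d z
      using functor_hom[OF L X.kappa_hom[OF F c that]] that by simp
    show "FA L (kappa D P E F c (d', z)) \<cdot>\<^bsub>E'\<^esub> FA (L \<circ>\<^bsub>D\<^esub> F) g = FA L (kappa D P E F c (d, X.act c g z))"
      if g: "g \<in> hom D d d'" and z: "z \<in> X.Pset c d'" for g d d' z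
      using functor_comp[OF L functor_hom[OF F g] X.kappa_hom[OF F c hom_obj(2)[OF X.D g] z]]
        X.kappa_act[OF F c g z] homD[OF g] by simp
  qed
  from theI'[OF this] c
  show "NC comparison c \<in> hom E' (tilde_obj_obj D P E' (L \<circ>\<^bsub>D\<^esub> F) c) (FO L (tilde_obj_obj D P E F c))"
    "d \<in> Obj D \<Longrightarrow> z \<in> X.Pset c d \<Longrightarrow>
      NC comparison c \<cdot>\<^bsub>E'\<^esub> kappa D P E' (L \<circ>\<^bsub>D\<^esub> F) c (d, z) = FA L (kappa D P E F c (d, z))"
    unfolding tilde_comparison_def ball_elements by auto
qed

lemma comparison_hom:
  "comparison \<in> hom (fcat C E') (tilde_obj C D P E' (L \<circ>\<^bsub>D\<^esub> F)) (L \<circ>\<^bsub>C\<^esub> tilde_obj C D P E F)"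
proof (rule natI[OF Y.tilde_obj_functor[OF LF] functor_fcomp[OF X.tilde_obj_functor[OF F] L]])
  show "NS comparison = tilde_obj C D P E' (L \<circ>\<^bsub>D\<^esub> F)" "NT comparison = L \<circ>\<^bsub>C\<^esub> tilde_obj C D P E F"
    using LF F by (simp_all add: tilde_comparison_def)
  show "NC comparison \<in> extensional (Obj C)" by (simp add: tilde_comparison_def)
  show "NC comparison c \<in> hom E' (FO (tilde_obj C D P E' (L \<circ>\<^bsub>D\<^esub> F)) c) (FO (L \<circ>\<^bsub>C\<^esub> tilde_obj C D P E F) c)"
    if "c \<in> Obj C" for c using comparison_comp(1)[OF that] that by simp
  fix f c c' assume f: "f \<in> hom C c c'" and c: "c \<in> Obj C" "c' \<in> Obj C"
  note k = comparison_comp[OF c(1)] and k' = comparison_comp[OF c(2)]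
  note tF = X.tilde_obj_arr[OF F f] and tLF = Y.tilde_obj_arr[OF LF f]
  note LtF = functor_hom[OF L tF(1)]
  have "NC comparison c' \<cdot>\<^bsub>E'\<^esub> FA (tilde_obj C D P E' (L \<circ>\<^bsub>D\<^esub> F)) f =
    FA L (FA (tilde_obj C D P E F) f) \<cdot>\<^bsub>E'\<^esub> NC comparison c"
  proof (rule Y.kappa_eqI[OF LF c(1) comp_hom[OF Y.E_cat tLF(1) k'(1)] comp_hom[OF Y.E_cat k(1) LtF]])
    fix d z assume dz: "d \<in> Obj D" "z \<in> X.Pset c d"
    note kap = Y.kappa_hom[OF LF c(1) dz]
    show "(NC comparison c' \<cdot>\<^bsub>E'\<^esub> FA (tilde_obj C D P E' (L \<circ>\<^bsub>D\<^esub> F)) f) \<cdot>\<^bsub>E'\<^esub> kappa D P E' (L \<circ>\<^bsub>D\<^esub> F) c (d, z) =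
      (FA L (FA (tilde_obj C D P E F) f) \<cdot>\<^bsub>E'\<^esub> NC comparison c) \<cdot>\<^bsub>E'\<^esub> kappa D P E' (L \<circ>\<^bsub>D\<^esub> F) c (d, z)"
      using comp_assoc[OF Y.E_cat kap tLF(1) k'(1)] tLF(2)[OF dz] k'(2)[OF dz(1) X.push_in[OF f dz]]
        comp_assoc[OF Y.E_cat kap k(1) LtF] k(2)[OF dz] functor_comp[OF L X.kappa_hom[OF F c(1) dz] tF(1)]
        tF(2)[OF dz] by simp
  qed
  then show "NC comparison c' \<cdot>\<^bsub>E'\<^esub> FA (tilde_obj C D P E' (L \<circ>\<^bsub>D\<^esub> F)) f =
    FA (L \<circ>\<^bsub>C\<^esub> tilde_obj C D P E F) f \<cdot>\<^bsub>E'\<^esub> NC comparison c"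
    using homD(1)[OF f] by simp
qed

end

section \<open>The adjunction\<close>

lemma setcat_comp_SF: "f \<in> hom setcat A B \<Longrightarrow> x \<in> A \<Longrightarrow> SF (g \<cdot>\<^bsub>setcat\<^esub> f) x = SF g (SF f x)"
  by (simp add: hom_setcat)

lemma setcat_in: "f \<in> hom setcat A B \<Longrightarrow> x \<in> A \<Longrightarrow> SF f x \<in> B"
  by (auto simp: hom_setcat)

lemma setcat_topos_like: "topos_like TYPE('u::universe) (setcat :: ('u set, 'u sfun) cat)"
  by (rule sheaf_model.topos_like[OF setcat_sheaf_model])

locale adjoint_setup = topos_like U E for U :: "'u::universe itself" and E :: "('o, 'a) cat" (structure) +
  fixes C D :: "('u, 'u) cat" and P :: "'u prof"
  assumes small_C: "small_category C" and small_D: "small_category D"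
    and P_functor: "is_functor C (fcat (opp D) setcat) P"
begin

sublocale TE: tilde_target C D P E
  by (unfold_locales; (rule small_C small_D P_functor cat | rule has_colimits, assumption+))

sublocale TS: tilde_target C D P "setcat :: ('u set, 'u sfun) cat"
  by (unfold_locales; (rule small_C small_D P_functor category_setcat
    | rule topos_like.has_colimits[OF setcat_topos_like], assumption+))

text \<open>Colimits in slices are needed for the image under \<^const>\<open>tilde\<close> of transformations over \<open>A\<close>.\<close>

lemma slice_target:
  assumes A: "A \<in> Obj E"
  shows "tilde_target C D P (slice E A)"
proof
  show "\<exists>X k. is_colimit (slice E A) I F X k"
    if "is_functor I (slice E A) F" "small_in TYPE('u) (Obj I)"
    for I :: "('u \<times> 'u, ('u \<times> 'u) \<times> 'u \<times> ('u \<times> 'u)) cat" and F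
    by (rule slice_colimit[OF E A that(1) has_colimits[OF _ that(2)]])
qed (rule small_C small_D P_functor category_slice[OF E])+

subsection \<open>Representable functors\<close>

lemma hom_small: "Defs.small (hom D d e)"
proof -
  have "hom D d e \<subseteq> Arr D" by (auto simp: hom_def)
  then show ?thesis
    using small_D small_in_subset small_in_self unfolding small_category_def by blast
qed

lemma yoneda_simps [simp]:
  "d \<in> Obj D \<Longrightarrow> FO (yoneda D) d = yoneda_obj D d"
  "e \<in> Obj D \<Longrightarrow> FO (yoneda_obj D d) e = hom D d e"
  "h \<in> hom D d e \<Longrightarrow> g \<in> hom D e e' \<Longrightarrow> SF (FA (yoneda_obj D d) g) h = g \<cdot>\<^bsub>D\<^esub> h"
  by (auto simp: yoneda_def yoneda_obj_def hom_def)

lemma yoneda_obj_arr: "g \<in> hom D e e' \<Longrightarrow> FA (yoneda_obj D d) g \<in> hom setcat (hom D d e) (hom D d e')"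
  using comp_hom[OF TE.D _, of _ d e g e'] homD[of g D e e'] by (simp add: yoneda_obj_def hom_setcat hom_small)

lemma yoneda_obj_functor:
  assumes d: "d \<in> Obj D"
  shows "is_functor D setcat (yoneda_obj D d)"
proof (rule functorI[OF TE.D category_setcat])
  show "FA (yoneda_obj D d) g \<in> hom setcat (FO (yoneda_obj D d) e) (FO (yoneda_obj D d) e')"
    if "g \<in> hom D e e'" "e \<in> Obj D" "e' \<in> Obj D" for g e e'
    using yoneda_obj_arr[OF that(1)] that by simp
  fix e assume e: "e \<in> Obj D"
  note i = ide_hom[OF TE.D e]
  have "FA (yoneda_obj D d) (Ide D e) = Ide setcat (hom D d e)"
    by (rule setcat_eqI[OF yoneda_obj_arr[OF i] ide_hom[OF category_setcat]])
      (use yoneda_simps(3)[OF _ i, of _ d] comp_ide(2)[OF TE.D] hom_small in simp_all)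
  then show "FA (yoneda_obj D d) (Ide D e) = Ide setcat (FO (yoneda_obj D d) e)" using e by simp
next
  fix g h e e' e'' assume g: "g \<in> hom D e e'" and h: "h \<in> hom D e' e''"
  note yg = yoneda_obj_arr[OF g, of d] and yh = yoneda_obj_arr[OF h, of d] and hg = comp_hom[OF TE.D g h]
  show "FA (yoneda_obj D d) (h \<cdot>\<^bsub>D\<^esub> g) = FA (yoneda_obj D d) h \<cdot>\<^bsub>setcat\<^esub> FA (yoneda_obj D d) g"
  proof (rule setcat_eqI[OF yoneda_obj_arr[OF hg] comp_hom[OF category_setcat yg yh]])
    fix k assume k: "k \<in> hom D d e"
    show "SF (FA (yoneda_obj D d) (h \<cdot>\<^bsub>D\<^esub> g)) k = SF (FA (yoneda_obj D d) h \<cdot>\<^bsub>setcat\<^esub> FA (yoneda_obj D d) g) k"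
      unfolding setcat_comp_SF[OF yg k] yoneda_simps(3)[OF k g] yoneda_simps(3)[OF k hg]
        yoneda_simps(3)[OF comp_hom[OF TE.D k g] h]
      by (rule comp_assoc[OF TE.D k g h])
  qed
qed (auto simp: yoneda_obj_def hom_small)

lemma yoneda_arr:
  assumes g: "g \<in> hom D d d'"
  shows "FA (yoneda D) g \<in> hom (fcat D setcat) (yoneda_obj D d') (yoneda_obj D d)"
    "e \<in> Obj D \<Longrightarrow> h \<in> hom D d' e \<Longrightarrow> SF (NC (FA (yoneda D) g) e) h = h \<cdot>\<^bsub>D\<^esub> g"
proof -
  note gD = homD[OF g] and d = hom_obj[OF TE.D g]
  have c: "NC (FA (yoneda D) g) e \<in> hom setcat (hom D d' e) (hom D d e)" if "e \<in> Obj D" for e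
    using comp_hom[OF TE.D g] gD that by (simp add: yoneda_def hom_setcat hom_small)
  show v: "SF (NC (FA (yoneda D) g) e) h = h \<cdot>\<^bsub>D\<^esub> g" if "e \<in> Obj D" "h \<in> hom D d' e" for e h
    using gD that by (simp add: yoneda_def)
  show "FA (yoneda D) g \<in> hom (fcat D setcat) (yoneda_obj D d') (yoneda_obj D d)"
  proof (rule natI[OF yoneda_obj_functor[OF d(2)] yoneda_obj_functor[OF d(1)]])
    show "NC (FA (yoneda D) g) e \<in> hom setcat (FO (yoneda_obj D d') e) (FO (yoneda_obj D d) e)"
      if "e \<in> Obj D" for e using c[OF that] that by simp
    fix k e e' assume k: "k \<in> hom D e e'" and e: "e \<in> Obj D" "e' \<in> Obj D"
    note yk' = yoneda_obj_arr[OF k, of d'] and yk = yoneda_obj_arr[OF k, of d]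
    show "NC (FA (yoneda D) g) e' \<cdot>\<^bsub>setcat\<^esub> FA (yoneda_obj D d') k =
      FA (yoneda_obj D d) k \<cdot>\<^bsub>setcat\<^esub> NC (FA (yoneda D) g) e"
    proof (rule setcat_eqI[OF comp_hom[OF category_setcat yk' c[OF e(2)]] comp_hom[OF category_setcat c[OF e(1)] yk]])
      fix h assume h: "h \<in> hom D d' e"
      show "SF (NC (FA (yoneda D) g) e' \<cdot>\<^bsub>setcat\<^esub> FA (yoneda_obj D d') k) h =
        SF (FA (yoneda_obj D d) k \<cdot>\<^bsub>setcat\<^esub> NC (FA (yoneda D) g) e) h"
        unfolding setcat_comp_SF[OF yk' h] setcat_comp_SF[OF c[OF e(1)] h] yoneda_simps(3)[OF h k]
          v[OF e(1) h] v[OF e(2) comp_hom[OF TE.D h k]] yoneda_simps(3)[OF comp_hom[OF TE.D g h] k]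
        by (rule comp_assoc[OF TE.D g h k])
    qed
  qed (use gD in \<open>simp_all add: yoneda_def\<close>)
qed

abbreviation Ty :: "'u \<Rightarrow> 'u psh" where
  "Ty d \<equiv> tilde_yoneda C D P d"

abbreviation Tyc :: "'u \<Rightarrow> 'u \<Rightarrow> 'u set" where
  "Tyc d c \<equiv> tilde_obj_obj D P setcat (yoneda_obj D d) c"

text \<open>The element of \<open>Ty d c\<close> corresponding to \<open>z\<close> under the co-Yoneda isomorphism \<open>Ty d c \<cong> P(c)(d)\<close>.\<close>

definition point :: "'u \<Rightarrow> 'u \<Rightarrow> 'u \<Rightarrow> 'u" where
  "point d c z = SF (kappa D P setcat (yoneda_obj D d) c (d, z)) (Ide D d)"

lemma Ty_eq: "d \<in> Obj D \<Longrightarrow> Ty d = tilde_obj C D P setcat (yoneda_obj D d)"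
  using yoneda_obj_functor[of d] by (simp add: tilde_yoneda_def)

lemma Ty_FO: "d \<in> Obj D \<Longrightarrow> c \<in> Obj C \<Longrightarrow> FO (Ty d) c = Tyc d c"
  by (simp add: Ty_eq)

lemma Ty_functor: "d \<in> Obj D \<Longrightarrow> is_functor C setcat (Ty d)"
  using TS.tilde_obj_functor[OF yoneda_obj_functor] by (simp add: Ty_eq)

lemma Tyc_small: "d \<in> Obj D \<Longrightarrow> c \<in> Obj C \<Longrightarrow> Defs.small (Tyc d c)"
  using TS.tilde_obj_obj[OF yoneda_obj_functor] by simp

lemma weight_Ty: "d \<in> Obj D \<Longrightarrow> weight E C (Ty d)"
  using small_C Ty_functor topos_like_axioms by (auto simp: weight_def weight_axioms_def)

lemma kappa_y:
  assumes "d \<in> Obj D" "c \<in> Obj C" "e \<in> Obj D" "z \<in> TE.Pset c e"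
  shows "kappa D P setcat (yoneda_obj D d) c (e, z) \<in> hom setcat (hom D d e) (Tyc d c)"
  using TS.kappa_hom[OF yoneda_obj_functor[OF assms(1)] assms(2-4)] assms(3) by simp

text \<open>In the colimit, \<open>h\<close> over \<open>(e, z)\<close> is identified with the identity of \<open>d\<close> over \<open>(d, z\<cdot>h)\<close>.\<close>

lemma kappa_point:
  assumes d: "d \<in> Obj D" and c: "c \<in> Obj C" and h: "h \<in> hom D d e" and z: "z \<in> TE.Pset c e"
  shows "SF (kappa D P setcat (yoneda_obj D d) c (e, z)) h = point d c (TE.act c h z)"
proof -
  note i = ide_hom[OF TE.D d]
  have "SF (kappa D P setcat (yoneda_obj D d) c (e, z) \<cdot>\<^bsub>setcat\<^esub> FA (yoneda_obj D d) h) (Ide D d) =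
    point d c (TE.act c h z)"
    unfolding point_def TS.kappa_act[OF yoneda_obj_functor[OF d] c h z] ..
  then show ?thesis
    unfolding setcat_comp_SF[OF yoneda_obj_arr[OF h] i] yoneda_simps(3)[OF i h] comp_ide(1)[OF TE.D h] .
qed

lemma point_in: "d \<in> Obj D \<Longrightarrow> c \<in> Obj C \<Longrightarrow> z \<in> TE.Pset c d \<Longrightarrow> point d c z \<in> Tyc d c"
  unfolding point_def by (rule setcat_in[OF kappa_y ide_hom[OF TE.D]])

text \<open>The co-Yoneda lemma. The inverse \<open>r\<close> of \<open>point\<close> is induced by the maps \<open>Hom(d, e) \<rightarrow> P(c)(d)\<close> which let
  arrows act on a given element of \<open>P(c)(e)\<close>.\<close>

lemma point_bij:
  assumes d: "d \<in> Obj D" and c: "c \<in> Obj C"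
  shows "bij_betw (point d c) (TE.Pset c d) (Tyc d c)"
proof -
  note y = yoneda_obj_functor[OF d] and i = ide_hom[OF TE.D d] and Pd = TE.Pset_small[OF c d]
  define l where "l e z = \<lparr>SD = hom D d e, SC = TE.Pset c d, SF = \<lambda>h\<in>hom D d e. TE.act c h z\<rparr>" for e z
  have l: "l e z \<in> hom setcat (hom D d e) (TE.Pset c d)" if "z \<in> TE.Pset c e" for e z
    using psh_act[OF TE.Pc[OF c] _ that] Pd hom_small by (auto simp: l_def hom_setcat)
  have "\<exists>!r. r \<in> hom setcat (Tyc d c) (TE.Pset c d) \<and>
    (\<forall>e\<in>Obj D. \<forall>z\<in>TE.Pset c e. r \<cdot>\<^bsub>setcat\<^esub> kappa D P setcat (yoneda_obj D d) c (e, z) = l e z)"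
  proof (rule TS.kappa_universal[OF y c])
    show "TE.Pset c d \<in> Obj setcat" using Pd by simp
    show "l e z \<in> hom setcat (FO (yoneda_obj D d) e) (TE.Pset c d)" if "e \<in> Obj D" "z \<in> TE.Pset c e" for e z
      using l[OF that(2)] that(1) by simp
    fix g e e' z assume g: "g \<in> hom D e e'" and z: "z \<in> TE.Pset c e'"
    show "l e' z \<cdot>\<^bsub>setcat\<^esub> FA (yoneda_obj D d) g = l e (TE.act c g z)"
    proof (rule setcat_eqI[OF comp_hom[OF category_setcat yoneda_obj_arr[OF g] l[OF z]] l[OF psh_act[OF TE.Pc[OF c] g z]]])
      fix h assume h: "h \<in> hom D d e"
      show "SF (l e' z \<cdot>\<^bsub>setcat\<^esub> FA (yoneda_obj D d) g) h = SF (l e (TE.act c g z)) h"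
        unfolding setcat_comp_SF[OF yoneda_obj_arr[OF g] h] yoneda_simps(3)[OF h g]
        using h comp_hom[OF TE.D h g] psh_act_comp[OF TE.Pc[OF c] h g z] by (simp add: l_def)
    qed
  qed
  then obtain r where r: "r \<in> hom setcat (Tyc d c) (TE.Pset c d)"
    and rk: "\<forall>e\<in>Obj D. \<forall>z\<in>TE.Pset c e. r \<cdot>\<^bsub>setcat\<^esub> kappa D P setcat (yoneda_obj D d) c (e, z) = l e z"
    by (elim ex1E conjE)
  have rk': "SF r (SF (kappa D P setcat (yoneda_obj D d) c (e, z)) h) = TE.act c h z"
    if e: "e \<in> Obj D" and z: "z \<in> TE.Pset c e" and h: "h \<in> hom D d e" for e z h
    unfolding setcat_comp_SF[OF kappa_y[OF d c e z] h, symmetric] rk[rule_format, OF e z]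
    using h by (simp add: l_def)
  define b where "b = \<lparr>SD = TE.Pset c d, SC = Tyc d c, SF = \<lambda>z\<in>TE.Pset c d. point d c z\<rparr>"
  have b: "b \<in> hom setcat (TE.Pset c d) (Tyc d c)"
    using Pd Tyc_small[OF d c] point_in[OF d c] by (auto simp: b_def hom_setcat)
  note br = comp_hom[OF category_setcat r b] and id = ide_hom[OF category_setcat, of "Tyc d c"]
  have bre: "b \<cdot>\<^bsub>setcat\<^esub> r = Ide setcat (Tyc d c)"
  proof (rule TS.kappa_eqI[OF y c br id])
    show "Tyc d c \<in> Obj setcat" using Tyc_small[OF d c] by simp
    fix e z assume e: "e \<in> Obj D" and z: "z \<in> TE.Pset c e"
    note k = kappa_y[OF d c e z]
    show "(b \<cdot>\<^bsub>setcat\<^esub> r) \<cdot>\<^bsub>setcat\<^esub> kappa D P setcat (yoneda_obj D d) c (e, z) =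
      Ide setcat (Tyc d c) \<cdot>\<^bsub>setcat\<^esub> kappa D P setcat (yoneda_obj D d) c (e, z)"
    proof (rule setcat_eqI[OF comp_hom[OF category_setcat k br] comp_hom[OF category_setcat k id]])
      show "Tyc d c \<in> Obj setcat" using Tyc_small[OF d c] by simp
      fix h assume h: "h \<in> hom D d e"
      note kh = setcat_in[OF k h]
      show "SF ((b \<cdot>\<^bsub>setcat\<^esub> r) \<cdot>\<^bsub>setcat\<^esub> kappa D P setcat (yoneda_obj D d) c (e, z)) h =
        SF (Ide setcat (Tyc d c) \<cdot>\<^bsub>setcat\<^esub> kappa D P setcat (yoneda_obj D d) c (e, z)) h"
        unfolding setcat_comp_SF[OF k h] setcat_comp_SF[OF r kh] rk'[OF e z h]
        using kappa_point[OF d c h z] kh psh_act[OF TE.Pc[OF c] h z] by (simp add: b_def)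
    qed
  qed
  have surj: "point d c (SF r s) = s" if "s \<in> Tyc d c" for s
  proof -
    have "SF b (SF r s) = s"
      unfolding setcat_comp_SF[OF r that, symmetric] bre using that by simp
    then show ?thesis using setcat_in[OF r that] by (simp add: b_def)
  qed
  show ?thesis
  proof (rule bij_betw_byWitness[where f' = "SF r"])
    show "\<forall>z\<in>TE.Pset c d. SF r (point d c z) = z"
      using rk'[OF d _ i] psh_act_ide[OF TE.Pc[OF c] d] by (simp add: point_def)
    show "\<forall>s\<in>Tyc d c. point d c (SF r s) = s" using surj by blast
    show "point d c ` TE.Pset c d \<subseteq> Tyc d c" using point_in[OF d c] by blast
    show "SF r ` Tyc d c \<subseteq> TE.Pset c d" using setcat_in[OF r] by blast
  qed
qed

lemma pointE:
  assumes "d \<in> Obj D" "c \<in> Obj C" "s \<in> Tyc d c"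
  obtains z where "z \<in> TE.Pset c d" "s = point d c z"
  using bij_betw_imp_surj_on[OF point_bij[OF assms(1,2)]] assms(3) by blast

lemma point_push:
  assumes d: "d \<in> Obj D" and f: "f \<in> hom C c c'" and z: "z \<in> TE.Pset c d"
  shows "SF (FA (Ty d) f) (point d c z) = point d c' (TE.push f d z)"
proof -
  note y = yoneda_obj_functor[OF d] and c = hom_obj(1)[OF TE.C f]
  show ?thesis
    unfolding point_def Ty_eq[OF d] setcat_comp_SF[OF kappa_y[OF d c d z] ide_hom[OF TE.D d], symmetric]
      TS.tilde_obj_arr(2)[OF y f d z] ..
qed

text \<open>Precomposition with \<open>g\<close> sends the identity of \<open>d'\<close> to \<open>g\<close>, which the colimit identifies with the identity
  of \<open>d\<close> after \<open>g\<close> has acted on the element.\<close>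

lemma Ty_arr:
  assumes g: "g \<in> hom D d d'"
  shows "FA (tilde C D P setcat) (FA (yoneda D) g) \<in> hom (fcat C setcat) (Ty d') (Ty d)"
    "c \<in> Obj C \<Longrightarrow> z \<in> TE.Pset c d' \<Longrightarrow>
      SF (NC (FA (tilde C D P setcat) (FA (yoneda D) g)) c) (point d' c z) = point d c (TE.act c g z)"
proof -
  note d = hom_obj[OF TE.D g] and yg = yoneda_arr[OF g]
  have eq: "FA (tilde C D P setcat) (FA (yoneda D) g) = tilde_arr C D P setcat (FA (yoneda D) g)"
    by (rule TS.tilde_FA[OF yg(1)])
  show "FA (tilde C D P setcat) (FA (yoneda D) g) \<in> hom (fcat C setcat) (Ty d') (Ty d)"
    unfolding eq Ty_eq[OF d(1)] Ty_eq[OF d(2)] by (rule TS.tilde_arr_hom[OF yg(1)])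
  assume c: "c \<in> Obj C" and z: "z \<in> TE.Pset c d'"
  note i = ide_hom[OF TE.D d(2)]
  have n: "NC (FA (yoneda D) g) d' \<in> hom setcat (hom D d' d') (hom D d d')"
    using hom_fcat_comp[OF yg(1) d(2)] d by simp
  show "SF (NC (FA (tilde C D P setcat) (FA (yoneda D) g)) c) (point d' c z) = point d c (TE.act c g z)"
    unfolding eq point_def[of d'] setcat_comp_SF[OF kappa_y[OF d(2) c d(2) z] i, symmetric]
      TS.tilde_arr_comp(2)[OF yg(1) c d(2) z] setcat_comp_SF[OF n i] yg(2)[OF d(2) i] comp_ide(2)[OF TE.D g]
    by (rule kappa_point[OF d(1) c g z])
qed

subsection \<open>The functor right as a weighted limit\<close>

text \<open>The projections of \<open>G\<^sub>r(d)\<close>, which is the limit of \<open>G\<close> over the elements of \<open>P(-)(d)\<close>.\<close>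

definition rproj :: "('u, 'u, 'o, 'a) ftr \<Rightarrow> 'u \<Rightarrow> 'u \<Rightarrow> 'u \<Rightarrow> 'a" where
  "rproj G d c z = weight.hom_proj E C (Ty d) G c (point d c z)"

lemma right_obj_FO [simp]:
  "d \<in> Obj D \<Longrightarrow> FO (right_obj C D P E G) d = hom_object C E (gamma E \<circ>\<^bsub>C\<^esub> Ty d) G"
  by (simp add: right_obj_def)

lemma rproj_hom:
  assumes G: "is_functor C E G" and d: "d \<in> Obj D" and c: "c \<in> Obj C" and z: "z \<in> TE.Pset c d"
  shows "rproj G d c z \<in> hom E (FO (right_obj C D P E G) d) (FO G c)"
proof -
  interpret weight U E C "Ty d" by (rule weight_Ty[OF d])
  show ?thesis
    using natural_familyD(1)[OF hom_proj_natural[OF G] c, of "point d c z"] point_in[OF d c z] Ty_FO[OF d c] d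
    by (simp add: rproj_def)
qed

lemma rproj_push:
  assumes G: "is_functor C E G" and d: "d \<in> Obj D" and f: "f \<in> hom C c c'" and z: "z \<in> TE.Pset c d"
  shows "FA G f \<cdot> rproj G d c z = rproj G d c' (TE.push f d z)"
proof -
  interpret weight U E C "Ty d" by (rule weight_Ty[OF d])
  note c = hom_obj(1)[OF TE.C f]
  show ?thesis
    using natural_familyD(2)[OF hom_proj_natural[OF G] f, of "point d c z"] point_in[OF d c z] Ty_FO[OF d c]
      point_push[OF d f z] by (simp add: rproj_def)
qed

text \<open>The universal property of the object of transformations, with the elements of \<open>Ty d c\<close> replaced by those
of \<open>P(c)(d)\<close>.\<close>

lemma rproj_universal:
  assumes G: "is_functor C E G" and d: "d \<in> Obj D" and A: "A \<in> Obj E"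
    and l: "\<And>c z. c \<in> Obj C \<Longrightarrow> z \<in> TE.Pset c d \<Longrightarrow> l c z \<in> hom E A (FO G c)"
    and nat: "\<And>f c c' z. f \<in> hom C c c' \<Longrightarrow> z \<in> TE.Pset c d \<Longrightarrow> FA G f \<cdot> l c z = l c' (TE.push f d z)"
  shows "\<exists>!x. x \<in> hom E A (FO (right_obj C D P E G) d) \<and>
    (\<forall>c\<in>Obj C. \<forall>z\<in>TE.Pset c d. rproj G d c z \<cdot> x = l c z)"
proof -
  interpret weight U E C "Ty d" by (rule weight_Ty[OF d])
  \<comment> \<open>The inverse of \<open>point\<close> turns a family on \<open>P(-)(d)\<close> into one on \<open>Ty d\<close>.\<close>
  define q where "q c = inv_into (TE.Pset c d) (point d c)" for c
  have q: "q c (point d c z) = z" if "c \<in> Obj C" "z \<in> TE.Pset c d" for c z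
    using bij_betw_inv_into_left[OF point_bij[OF d that(1)] that(2)] by (simp add: q_def)
  have "natural_family C (Ty d) G A (\<lambda>c s. l c (q c s))"
    unfolding natural_family_def
  proof (intro conjI ballI allI)
    fix c s assume c: "c \<in> Obj C" and s: "s \<in> FO (Ty d) c"
    obtain z where "z \<in> TE.Pset c d" "s = point d c z" using s pointE[OF d c] Ty_FO[OF d c] by metis
    then show "l c (q c s) \<in> hom E A (FO G c)" using l[OF c] q[OF c] by simp
  next
    fix c c' f s assume f: "f \<in> hom C c c'" and s: "s \<in> FO (Ty d) c"
    note c = hom_obj[OF TE.C f]
    obtain z where z: "z \<in> TE.Pset c d" "s = point d c z" using s pointE[OF d c(1)] Ty_FO[OF d c(1)] by metis
    then show "FA G f \<cdot> l c (q c s) = l c' (q c' (SF (FA (Ty d) f) s))"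
      using nat[OF f z(1)] q[OF c(1) z(1)] q[OF c(2) TE.push_in[OF f d z(1)]] point_push[OF d f z(1)] by simp
  qed
  from hom_proj_universal[OF G A this]
  have "\<exists>!x. x \<in> hom E A (FO (right_obj C D P E G) d) \<and>
    (\<forall>c\<in>Obj C. \<forall>s\<in>FO (Ty d) c. hom_proj G c s \<cdot> x = l c (q c s))" using d by simp
  moreover have "(\<forall>c\<in>Obj C. \<forall>s\<in>FO (Ty d) c. hom_proj G c s \<cdot> x = l c (q c s)) \<longleftrightarrow>
    (\<forall>c\<in>Obj C. \<forall>z\<in>TE.Pset c d. rproj G d c z \<cdot> x = l c z)" for x
  proof (rule ball_cong[OF refl])
    fix c assume c: "c \<in> Obj C"
    have im: "FO (Ty d) c = point d c ` TE.Pset c d"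
      using bij_betw_imp_surj_on[OF point_bij[OF d c]] Ty_FO[OF d c] by simp
    show "(\<forall>s\<in>FO (Ty d) c. hom_proj G c s \<cdot> x = l c (q c s)) \<longleftrightarrow>
      (\<forall>z\<in>TE.Pset c d. rproj G d c z \<cdot> x = l c z)"
      unfolding im ball_simps using q[OF c] by (simp add: rproj_def)
  qed
  ultimately show ?thesis by simp
qed

lemma rproj_eqI:
  assumes G: "is_functor C E G" and d: "d \<in> Obj D"
    and x: "x \<in> hom E A (FO (right_obj C D P E G) d)" and y: "y \<in> hom E A (FO (right_obj C D P E G) d)"
    and eq: "\<And>c z. c \<in> Obj C \<Longrightarrow> z \<in> TE.Pset c d \<Longrightarrow> rproj G d c z \<cdot> x = rproj G d c z \<cdot> y"
  shows "x = y"
proof (rule ex1_eqI[OF rproj_universal[OF G d hom_obj(1)[OF E y], of "\<lambda>c z. rproj G d c z \<cdot> y"]])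
  show "rproj G d c z \<cdot> y \<in> hom E A (FO G c)" if "c \<in> Obj C" "z \<in> TE.Pset c d" for c z
    by (rule comp_hom[OF E y rproj_hom[OF G d that]])
  show "FA G f \<cdot> (rproj G d c z \<cdot> y) = rproj G d c' (TE.push f d z) \<cdot> y"
    if f: "f \<in> hom C c c'" and z: "z \<in> TE.Pset c d" for f c c' z
    using comp_assoc[OF E y rproj_hom[OF G d hom_obj(1)[OF TE.C f] z] functor_hom[OF G f]] rproj_push[OF G d f z]
    by simp
qed (use x y eq in auto)

text \<open>The action of \<open>right G\<close> on arrows of \<open>D\<close> reindexes the projections.\<close>

lemma right_obj_arr:
  assumes G: "is_functor C E G" and g: "g \<in> hom D d d'"
  shows "FA (right_obj C D P E G) g \<in> hom E (FO (right_obj C D P E G) d) (FO (right_obj C D P E G) d')"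
    "c \<in> Obj C \<Longrightarrow> z \<in> TE.Pset c d' \<Longrightarrow>
      rproj G d' c z \<cdot> FA (right_obj C D P E G) g = rproj G d c (TE.act c g z)"
proof -
  note d = hom_obj[OF TE.D g]
  interpret W: weight U E C "Ty d" by (rule weight_Ty[OF d(1)])
  interpret W': weight U E C "Ty d'" by (rule weight_Ty[OF d(2)])
  interpret M: weight_map U E C "Ty d" "Ty d'" "FA (tilde C D P setcat) (FA (yoneda D) g)"
    by unfold_locales (rule Ty_arr(1)[OF g])
  have eq: "FA (right_obj C D P E G) g = hom_map C E
    (whisker_left C (gamma E) (FA (tilde C D P setcat) (FA (yoneda D) g))) (Ide (fcat C E) G)"
    using homD(1)[OF g] by (simp add: right_obj_def)
  note m = M.hom_map[OF fcat_ide_hom[OF G]]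
  show "FA (right_obj C D P E G) g \<in> hom E (FO (right_obj C D P E G) d) (FO (right_obj C D P E G) d')"
    unfolding eq right_obj_FO[OF d(1)] right_obj_FO[OF d(2)] by (rule m(1))
  assume c: "c \<in> Obj C" and z: "z \<in> TE.Pset c d'"
  have "point d' c z \<in> FO (Ty d') c" using point_in[OF d(2) c z] Ty_FO[OF d(2) c] by simp
  from m(2)[OF c this]
  have "rproj G d' c z \<cdot> FA (right_obj C D P E G) g = Ide E (FO G c) \<cdot> rproj G d c (TE.act c g z)"
    using Ty_arr(2)[OF g c z] c unfolding eq rproj_def by simp
  then show "rproj G d' c z \<cdot> FA (right_obj C D P E G) g = rproj G d c (TE.act c g z)"
    using comp_ide(2)[OF E rproj_hom[OF G d(1) c psh_act[OF TE.Pc[OF c] g z]]] by simp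
qed

lemma right_obj_functor:
  assumes G: "is_functor C E G"
  shows "is_functor D E (right_obj C D P E G)"
proof (rule functorI[OF TE.D E])
  let ?R = "right_obj C D P E G"
  show "FA ?R g \<in> hom E (FO ?R d) (FO ?R d')" if "g \<in> hom D d d'" for g d d' by (rule right_obj_arr(1)[OF G that])
  show o: "FO ?R d \<in> Obj E" if d: "d \<in> Obj D" for d
  proof -
    interpret weight U E C "Ty d" by (rule weight_Ty[OF d])
    show ?thesis using hom_object_obj[OF G] d by simp
  qed
  fix d assume d: "d \<in> Obj D"
  note i = ide_hom[OF TE.D d]
  show "FA ?R (Ide D d) = Ide E (FO ?R d)"
  proof (rule rproj_eqI[OF G d right_obj_arr(1)[OF G i] ide_hom[OF E o[OF d]]])
    fix c z assume cz: "c \<in> Obj C" "z \<in> TE.Pset c d"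
    show "rproj G d c z \<cdot> FA ?R (Ide D d) = rproj G d c z \<cdot> Ide E (FO ?R d)"
      using right_obj_arr(2)[OF G i cz] comp_ide(1)[OF E rproj_hom[OF G d cz]]
        psh_act_ide[OF TE.Pc[OF cz(1)] d cz(2)] by simp
  qed
next
  let ?R = "right_obj C D P E G"
  fix g h d d' d'' assume g: "g \<in> hom D d d'" and h: "h \<in> hom D d' d''"
  note hg = comp_hom[OF TE.D g h] and rg = right_obj_arr[OF G g] and rh = right_obj_arr[OF G h]
  note d'' = hom_obj(2)[OF TE.D h]
  show "FA ?R (h \<cdot>\<^bsub>D\<^esub> g) = FA ?R h \<cdot> FA ?R g"
  proof (rule rproj_eqI[OF G d'' right_obj_arr(1)[OF G hg] comp_hom[OF E rg(1) rh(1)]])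
    fix c z assume cz: "c \<in> Obj C" "z \<in> TE.Pset c d''"
    show "rproj G d'' c z \<cdot> FA ?R (h \<cdot>\<^bsub>D\<^esub> g) = rproj G d'' c z \<cdot> (FA ?R h \<cdot> FA ?R g)"
      using right_obj_arr(2)[OF G hg cz] comp_assoc[OF E rg(1) rh(1) rproj_hom[OF G d'' cz]] rh(2)[OF cz]
        rg(2)[OF cz(1) psh_act[OF TE.Pc[OF cz(1)] h cz(2)]] psh_act_comp[OF TE.Pc[OF cz(1)] g h cz(2)] by simp
  qed
qed (auto simp: right_obj_def)

lemma right_arr_comp:
  assumes t: "t \<in> hom (fcat C E) G G'" and d: "d \<in> Obj D"
  shows "NC (right_arr C D P E t) d \<in> hom E (FO (right_obj C D P E G) d) (FO (right_obj C D P E G') d)"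
    "c \<in> Obj C \<Longrightarrow> z \<in> TE.Pset c d \<Longrightarrow>
      rproj G' d c z \<cdot> NC (right_arr C D P E t) d = NC t c \<cdot> rproj G d c z"
proof -
  interpret W: weight U E C "Ty d" by (rule weight_Ty[OF d])
  note i = fcat_ide_hom[OF W.T]
  interpret M: weight_map U E C "Ty d" "Ty d" "Ide (fcat C setcat) (Ty d)"
    by unfold_locales (rule i)
  \<comment> \<open>The action on arrows is induced by the identity map of weights.\<close>
  have "whisker_left C (gamma E) (Ide (fcat C setcat) (Ty d)) = Ide (fcat C E) W.source"
    by (rule ntr_eqI[OF M.whisker_gamma fcat_ide_hom[OF W.source_functor]])
      (use functor_ide[OF gamma_functor functor_obj[OF W.T]] in simp)
  then have eq: "NC (right_arr C D P E t) d =
    hom_map C E (whisker_left C (gamma E) (Ide (fcat C setcat) (Ty d))) t"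
    using d by (simp add: right_arr_def)
  note m = M.hom_map[OF t]
  show "NC (right_arr C D P E t) d \<in> hom E (FO (right_obj C D P E G) d) (FO (right_obj C D P E G') d)"
    unfolding eq right_obj_FO[OF d] by (rule m(1))
  assume c: "c \<in> Obj C" and z: "z \<in> TE.Pset c d"
  have p: "point d c z \<in> FO (Ty d) c" using point_in[OF d c z] Ty_FO[OF d c] by simp
  have "SF (NC (Ide (fcat C setcat) (Ty d)) c) (point d c z) = point d c z" using c p by simp
  then show "rproj G' d c z \<cdot> NC (right_arr C D P E t) d = NC t c \<cdot> rproj G d c z"
    using m(2)[OF c p] unfolding eq rproj_def by simp
qed

lemma right_arr_hom:
  assumes t: "t \<in> hom (fcat C E) G G'"
  shows "right_arr C D P E t \<in> hom (fcat D E) (right_obj C D P E G) (right_obj C D P E G')"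
proof -
  note G = hom_fcat(4)[OF t] and G' = hom_fcat(5)[OF t] and tD = hom_fcat(2,3)[OF t]
  show ?thesis
  proof (rule natI[OF right_obj_functor[OF G] right_obj_functor[OF G']])
    show "NC (right_arr C D P E t) d \<in> hom E (FO (right_obj C D P E G) d) (FO (right_obj C D P E G') d)"
      if "d \<in> Obj D" for d by (rule right_arr_comp(1)[OF t that])
    fix g d d' assume g: "g \<in> hom D d d'" and d: "d \<in> Obj D" "d' \<in> Obj D"
    note td = right_arr_comp[OF t d(1)] and td' = right_arr_comp[OF t d(2)]
    note rg = right_obj_arr[OF G g] and rg' = right_obj_arr[OF G' g]
    show "NC (right_arr C D P E t) d' \<cdot> FA (right_obj C D P E G) g =
      FA (right_obj C D P E G') g \<cdot> NC (right_arr C D P E t) d"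
    proof (rule rproj_eqI[OF G' d(2) comp_hom[OF E rg(1) td'(1)] comp_hom[OF E td(1) rg'(1)]])
      fix c z assume c: "c \<in> Obj C" and z: "z \<in> TE.Pset c d'"
      note p' = rproj_hom[OF G' d(2) c z] and z' = psh_act[OF TE.Pc[OF c] g z]
      show "rproj G' d' c z \<cdot> (NC (right_arr C D P E t) d' \<cdot> FA (right_obj C D P E G) g) =
        rproj G' d' c z \<cdot> (FA (right_obj C D P E G') g \<cdot> NC (right_arr C D P E t) d)"
        using comp_assoc[OF E rg(1) td'(1) p'] td'(2)[OF c z]
          comp_assoc[OF E rg(1) rproj_hom[OF G d(2) c z] hom_fcat_comp[OF t c]] rg(2)[OF c z]
          comp_assoc[OF E td(1) rg'(1) p'] rg'(2)[OF c z] td(2)[OF c z'] by simp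
    qed
  qed (use tD in \<open>simp_all add: right_arr_def\<close>)
qed

lemma right_FO [simp]: "is_functor C E G \<Longrightarrow> FO (right C D P E) G = right_obj C D P E G"
  and right_FA [simp]: "t \<in> hom (fcat C E) G G' \<Longrightarrow> FA (right C D P E) t = right_arr C D P E t"
  by (auto simp: right_def hom_def)

lemma right_functor: "is_functor (fcat C E) (fcat D E) (right C D P E)"
proof (rule functorI[OF category_fcat[OF TE.C E] category_fcat[OF TE.D E]])
  show "FO (right C D P E) G \<in> Obj (fcat D E)" if "G \<in> Obj (fcat C E)" for G
    using right_obj_functor that by simp
  show "FA (right C D P E) t \<in> hom (fcat D E) (FO (right C D P E) G) (FO (right C D P E) G')"
    if "t \<in> hom (fcat C E) G G'" for t G G'
    using right_arr_hom[OF that] that hom_fcat(4,5)[OF that] by simp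
  fix G assume "G \<in> Obj (fcat C E)"
  then have G: "is_functor C E G" by simp
  note i = fcat_ide_hom[OF G] and R = right_obj_functor[OF G]
  have "right_arr C D P E (Ide (fcat C E) G) = Ide (fcat D E) (right_obj C D P E G)"
  proof (rule ntr_eqI[OF right_arr_hom[OF i] fcat_ide_hom[OF R]])
    fix d assume d: "d \<in> Obj D"
    have "NC (right_arr C D P E (Ide (fcat C E) G)) d = Ide E (FO (right_obj C D P E G) d)"
      by (rule rproj_eqI[OF G d right_arr_comp(1)[OF i d] ide_hom[OF E functor_obj[OF R d]]])
        (use right_arr_comp(2)[OF i d] comp_ide[OF E rproj_hom[OF G d]] in simp)
    then show "NC (right_arr C D P E (Ide (fcat C E) G)) d = NC (Ide (fcat D E) (right_obj C D P E G)) d"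
      using d by simp
  qed
  then show "FA (right C D P E) (Ide (fcat C E) G) = Ide (fcat D E) (FO (right C D P E) G)"
    using right_FA[OF i] G by simp
next
  fix t s G G' G'' assume t: "t \<in> hom (fcat C E) G G'" and s: "s \<in> hom (fcat C E) G' G''"
  note st = fcat_comp_hom[OF t s] and G = hom_fcat(4)[OF t] and G' = hom_fcat(5)[OF t] and G'' = hom_fcat(5)[OF s]
  have "right_arr C D P E (s \<cdot>\<^bsub>fcat C E\<^esub> t) = right_arr C D P E s \<cdot>\<^bsub>fcat D E\<^esub> right_arr C D P E t"
  proof (rule ntr_eqI[OF right_arr_hom[OF st] fcat_comp_hom[OF right_arr_hom[OF t] right_arr_hom[OF s]]])
    fix d assume d: "d \<in> Obj D"
    note td = right_arr_comp[OF t d] and sd = right_arr_comp[OF s d] and std = right_arr_comp[OF st d]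
    have "NC (right_arr C D P E (s \<cdot>\<^bsub>fcat C E\<^esub> t)) d = NC (right_arr C D P E s) d \<cdot> NC (right_arr C D P E t) d"
    proof (rule rproj_eqI[OF G'' d std(1) comp_hom[OF E td(1) sd(1)]])
      fix c z assume c: "c \<in> Obj C" and z: "z \<in> TE.Pset c d"
      show "rproj G'' d c z \<cdot> NC (right_arr C D P E (s \<cdot>\<^bsub>fcat C E\<^esub> t)) d =
        rproj G'' d c z \<cdot> (NC (right_arr C D P E s) d \<cdot> NC (right_arr C D P E t) d)"
        using std(2)[OF c z] comp_assoc[OF E td(1) sd(1) rproj_hom[OF G'' d c z]] sd(2)[OF c z] td(2)[OF c z] c
          comp_assoc[OF E td(1) rproj_hom[OF G' d c z] hom_fcat_comp[OF s c]]
          comp_assoc[OF E rproj_hom[OF G d c z] hom_fcat_comp[OF t c] hom_fcat_comp[OF s c]] by simp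
    qed
    then show "NC (right_arr C D P E (s \<cdot>\<^bsub>fcat C E\<^esub> t)) d =
      NC (right_arr C D P E s \<cdot>\<^bsub>fcat D E\<^esub> right_arr C D P E t) d" using d by simp
  qed
  then show "FA (right C D P E) (s \<cdot>\<^bsub>fcat C E\<^esub> t) = FA (right C D P E) s \<cdot>\<^bsub>fcat D E\<^esub> FA (right C D P E) t"
    using right_FA[OF st] right_FA[OF t] right_FA[OF s] by simp
qed (auto simp: right_def)

text \<open>The value of the transformation at the summand \<open>point d c z\<close> is the projection with index \<open>z\<close>: the
  comparison \<^const>\<open>gamma_slice\<close> maps the injection of the summand to the point at which
  \<open>value_at\<close> evaluates.\<close>

lemma right_elem:
  assumes G: "is_functor C E G" and d: "d \<in> Obj D"
    and x: "x \<in> hom E A (FO (right_obj C D P E G) d)"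
  shows "right_elem C D P E G d A x \<in> hom (fcat C (slice E A)) (gamma (slice E A) \<circ>\<^bsub>C\<^esub> Ty d) (base_change E A \<circ>\<^bsub>C\<^esub> G)"
    "c \<in> Obj C \<Longrightarrow> z \<in> TE.Pset c d \<Longrightarrow>
      NC (right_elem C D P E G d A x) c \<cdot>\<^bsub>slice E A\<^esub> coproj (slice E A) (Tyc d c) (point d c z) =
      global_element E A (FO G c) (rproj G d c z \<cdot> x)"
proof -
  interpret W: weight U E C "Ty d" by (rule weight_Ty[OF d])
  have A: "A \<in> Obj E" by (rule hom_obj(1)[OF E x])
  interpret S: copowered U "slice E A" by (rule copowered_slice[OF A])
  note SE = category_slice[OF E, of A]
  have x': "x \<in> hom E A (hom_object C E W.source G)" using x d by simp
  note h = W.hom_elem_hom[OF G x']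
  have f1: "is_functor C (slice E A) ((base_change E A \<circ>\<^bsub>setcat\<^esub> gamma E) \<circ>\<^bsub>C\<^esub> Ty d)"
    by (rule functor_fcomp[OF W.T functor_fcomp[OF gamma_functor base_change_functor[OF A]]])
  \<comment> \<open>Composition of functors is associative only up to the restriction to their domains.\<close>
  have eq: "(base_change E A \<circ>\<^bsub>setcat\<^esub> gamma E) \<circ>\<^bsub>C\<^esub> Ty d = W.over A W.source"
    by (rule functor_eqI[OF f1 W.over_functor[OF A W.source_functor]])
      (use functor_obj[OF W.T] functor_hom[OF W.T arr_hom] homD(1) in \<open>fastforce+\<close>)
  have w: "whisker_right C (gamma_slice E A) (Ty d) \<in> hom (fcat C (slice E A)) (gamma (slice E A) \<circ>\<^bsub>C\<^esub> Ty d) (W.over A W.source)"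
    using whisker_right_hom[OF gamma_slice_hom[OF A] W.T] unfolding eq .
  show "right_elem C D P E G d A x \<in> hom (fcat C (slice E A)) (gamma (slice E A) \<circ>\<^bsub>C\<^esub> Ty d) (base_change E A \<circ>\<^bsub>C\<^esub> G)"
    unfolding right_elem_def by (rule fcat_comp_hom[OF w h])
  assume c: "c \<in> Obj C" and z: "z \<in> TE.Pset c d"
  note s = point_in[OF d c z] and Sm = Tyc_small[OF d c]
  have T: "FO (Ty d) c = Tyc d c" by (rule Ty_FO[OF d c])
  note hc = W.over_comp[OF G h c, unfolded T]
  note gs = gamma_slice_comp[OF A Sm] and j = S.coproj_hom[OF Sm s]
  have "NC (right_elem C D P E G d A x) c \<cdot>\<^bsub>slice E A\<^esub> coproj (slice E A) (Tyc d c) (point d c z) =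
    (NC (hom_elem C E W.source G A x) c \<cdot>\<^bsub>slice E A\<^esub> NC (gamma_slice E A) (Tyc d c)) \<cdot>\<^bsub>slice E A\<^esub>
      coproj (slice E A) (Tyc d c) (point d c z)"
    using c T by (simp add: right_elem_def whisker_right_def)
  also have "\<dots> = NC (hom_elem C E W.source G A x) c \<cdot>\<^bsub>slice E A\<^esub> copower_point A (Tyc d c) (point d c z)"
    using comp_assoc[OF SE j gs(1) hc] gs(2)[OF s] by simp
  also have "\<dots> = global_element E A (FO G c) (W.family A G (hom_elem C E W.source G A x) c (point d c z))"
    using value_at(2)[OF A Sm functor_obj[OF G c] s hc] T by (simp add: W.family_def)
  also have "\<dots> = global_element E A (FO G c) (rproj G d c z \<cdot> x)"
    using W.family_hom_elem[OF G x' c, of "point d c z"] s T by (simp add: rproj_def)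
  finally show "NC (right_elem C D P E G d A x) c \<cdot>\<^bsub>slice E A\<^esub> coproj (slice E A) (Tyc d c) (point d c z) =
      global_element E A (FO G c) (rproj G d c z \<cdot> x)" .
qed

end

context adjoint_setup
begin

subsection \<open>The image under tilde of a generalized element\<close>

text \<open>The family \<open>g \<mapsto> F(g) \<circ> x\<close> is natural because \<open>F\<close> is a functor.\<close>

lemma yoneda_elem:
  assumes F: "is_functor D E F" and d: "d \<in> Obj D" and x: "x \<in> hom E A (FO F d)"
  shows "yoneda_elem D E F d A x \<in> hom (fcat D (slice E A))
      (gamma (slice E A) \<circ>\<^bsub>D\<^esub> yoneda_obj D d) (base_change E A \<circ>\<^bsub>D\<^esub> F)"
    "e \<in> Obj D \<Longrightarrow> g \<in> hom D d e \<Longrightarrow>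
      NC (yoneda_elem D E F d A x) e \<cdot>\<^bsub>slice E A\<^esub> coproj (slice E A) (hom D d e) g =
      global_element E A (FO F e) (FA F g \<cdot> x)"
proof -
  let ?t = "yoneda_elem D E F d A x" and ?S = "slice E A"
  have A: "A \<in> Obj E" by (rule hom_obj(1)[OF E x])
  interpret S: copowered U ?S by (rule copowered_slice[OF A])
  note SE = category_slice[OF E, of A]
  have ge: "FA (base_change E A) (FA F g) \<cdot>\<^bsub>?S\<^esub> global_element E A (FO F d) x =
    global_element E A (FO F e) (FA F g \<cdot> x)" if "g \<in> hom D d e" for g e
    by (rule global_element_comp[OF A x functor_hom[OF F that]])
  have comp: "NC ?t e \<in> hom ?S (copower ?S (hom D d e)) (proj1 E A (FO F e)) \<and>
    (\<forall>g\<in>hom D d e. NC ?t e \<cdot>\<^bsub>?S\<^esub> coproj ?S (hom D d e) g = global_element E A (FO F e) (FA F g \<cdot> x))"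
    if e: "e \<in> Obj D" for e
  proof -
    note Fe = functor_obj[OF F e]
    have "\<exists>!h. h \<in> hom ?S (copower ?S (hom D d e)) (proj1 E A (FO F e)) \<and>
      (\<forall>g\<in>hom D d e. h \<cdot>\<^bsub>?S\<^esub> coproj ?S (hom D d e) g = global_element E A (FO F e) (FA F g \<cdot> x))"
      by (rule S.copower_universal[OF hom_small proj1_obj[OF A Fe]
            global_element(1)[OF A comp_hom[OF E x functor_hom[OF F]]]])
    from theI'[OF this] show ?thesis
      using e Fe ge by (simp add: yoneda_elem_def)
  qed
  then show v: "NC ?t e \<cdot>\<^bsub>?S\<^esub> coproj ?S (hom D d e) g = global_element E A (FO F e) (FA F g \<cdot> x)"
    if "e \<in> Obj D" "g \<in> hom D d e" for e g using that by blast
  note y = yoneda_obj_functor[OF d]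
  show "?t \<in> hom (fcat D ?S) (gamma ?S \<circ>\<^bsub>D\<^esub> yoneda_obj D d) (base_change E A \<circ>\<^bsub>D\<^esub> F)"
  proof (rule natI[OF functor_fcomp[OF y S.gamma_functor] functor_fcomp[OF F base_change_functor[OF A]]])
    show "NC ?t e \<in> hom ?S (FO (gamma ?S \<circ>\<^bsub>D\<^esub> yoneda_obj D d) e) (FO (base_change E A \<circ>\<^bsub>D\<^esub> F) e)"
      if "e \<in> Obj D" for e
      using comp[OF that] that hom_small functor_obj[OF F that] by simp
    fix k e e' assume k: "k \<in> hom D e e'" and e: "e \<in> Obj D" "e' \<in> Obj D"
    note yk = yoneda_obj_arr[OF k, of d]
    note c = comp[OF e(1), THEN conjunct1] and c' = comp[OF e(2), THEN conjunct1]
    note gk = S.gamma_arr[OF yk] and bk = base_change_arr(1)[OF A functor_hom[OF F k]]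
    have "NC ?t e' \<cdot>\<^bsub>?S\<^esub> FA (gamma ?S) (FA (yoneda_obj D d) k) = FA (base_change E A) (FA F k) \<cdot>\<^bsub>?S\<^esub> NC ?t e"
    proof (rule S.copower_eqI[OF hom_small comp_hom[OF SE gk(1) c'] comp_hom[OF SE c bk]])
      fix g assume g: "g \<in> hom D d e"
      note j = S.coproj_hom[OF hom_small g] and kg = comp_hom[OF TE.D g k]
      show "(NC ?t e' \<cdot>\<^bsub>?S\<^esub> FA (gamma ?S) (FA (yoneda_obj D d) k)) \<cdot>\<^bsub>?S\<^esub> coproj ?S (hom D d e) g =
        (FA (base_change E A) (FA F k) \<cdot>\<^bsub>?S\<^esub> NC ?t e) \<cdot>\<^bsub>?S\<^esub> coproj ?S (hom D d e) g"
        using comp_assoc[OF SE j gk(1) c'] gk(2)[OF g] yoneda_simps(3)[OF g k] v[OF e(2) kg]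
          comp_assoc[OF SE j c bk] v[OF e(1) g]
          global_element_comp[OF A comp_hom[OF E x functor_hom[OF F g]] functor_hom[OF F k]]
          functor_comp[OF F g k] comp_assoc[OF E x functor_hom[OF F g] functor_hom[OF F k]] by simp
    qed
    then show "NC ?t e' \<cdot>\<^bsub>?S\<^esub> FA (gamma ?S \<circ>\<^bsub>D\<^esub> yoneda_obj D d) k = FA (base_change E A \<circ>\<^bsub>D\<^esub> F) k \<cdot>\<^bsub>?S\<^esub> NC ?t e"
      using homD(1)[OF k] by simp
  qed (use d in \<open>simp_all add: yoneda_elem_def\<close>)
qed

text \<open>\<open>\<gamma>\<^sup>*\<close> of the slice is a left adjoint, so that the comparison of tilde with it is invertible.
  Since every element of \<open>Ty d c\<close> is some \<open>point d c z\<close>, the inverse is explicit.\<close>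

lemma comparison_inverse:
  assumes A: "A \<in> Obj E" and d: "d \<in> Obj D"
  defines "L \<equiv> gamma (slice E A) \<circ>\<^bsub>D\<^esub> yoneda_obj D d"
    and "i \<equiv> inverse_arr (fcat C (slice E A))
      (tilde_comparison C D P setcat (slice E A) (gamma (slice E A)) (yoneda_obj D d))"
  shows "i \<in> hom (fcat C (slice E A)) (gamma (slice E A) \<circ>\<^bsub>C\<^esub> Ty d) (tilde_obj C D P (slice E A) L)"
    "c \<in> Obj C \<Longrightarrow> z \<in> TE.Pset c d \<Longrightarrow>
      NC i c \<cdot>\<^bsub>slice E A\<^esub> coproj (slice E A) (Tyc d c) (point d c z) =
      kappa D P (slice E A) L c (d, z) \<cdot>\<^bsub>slice E A\<^esub> coproj (slice E A) (hom D d d) (Ide D d)"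
proof -
  let ?S = "slice E A"
  interpret S: copowered U ?S by (rule copowered_slice[OF A])
  interpret SL: tilde_target C D P ?S by (rule slice_target[OF A])
  note SE = category_slice[OF E, of A] and y = yoneda_obj_functor[OF d]
  interpret K: tilde_change C D P setcat ?S "gamma ?S" "yoneda_obj D d"
    by unfold_locales (rule S.gamma_functor y)+
  have L: "is_functor D ?S L" unfolding L_def by (rule K.LF)
  let ?k = "\<lambda>c e z. kappa D P ?S L c (e, z)" and ?ky = "\<lambda>c e z. kappa D P setcat (yoneda_obj D d) c (e, z)"
  let ?id = "coproj ?S (hom D d d) (Ide D d)"
  note idd = ide_hom[OF TE.D d]
  note jid = S.coproj_hom[OF hom_small idd]
  have k: "?k c e z \<in> hom ?S (copower ?S (hom D d e)) (tilde_obj_obj D P ?S L c)"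
    if "c \<in> Obj C" "e \<in> Obj D" "z \<in> TE.Pset c e" for c e z
    using SL.kappa_hom[OF L that] that(2) hom_small by (simp add: L_def)
  note cmp = K.comparison_comp[folded L_def]
  have cmph: "NC K.comparison c \<in> hom ?S (tilde_obj_obj D P ?S L c) (copower ?S (Tyc d c))" if "c \<in> Obj C" for c
    using cmp(1)[OF that] Tyc_small[OF d that] by simp
  have "\<exists>r. r \<in> hom ?S (copower ?S (Tyc d c)) (tilde_obj_obj D P ?S L c) \<and>
    (\<forall>z\<in>TE.Pset c d. r \<cdot>\<^bsub>?S\<^esub> coproj ?S (Tyc d c) (point d c z) = ?k c d z \<cdot>\<^bsub>?S\<^esub> ?id)" if c: "c \<in> Obj C" for c
  proof -
    define q where "q = inv_into (TE.Pset c d) (point d c)"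
    have q: "q s \<in> TE.Pset c d" if "s \<in> Tyc d c" for s
      using bij_betwE[OF bij_betw_inv_into[OF point_bij[OF d c]]] that by (simp add: q_def)
    have "\<exists>!r. r \<in> hom ?S (copower ?S (Tyc d c)) (tilde_obj_obj D P ?S L c) \<and>
      (\<forall>s\<in>Tyc d c. r \<cdot>\<^bsub>?S\<^esub> coproj ?S (Tyc d c) s = ?k c d (q s) \<cdot>\<^bsub>?S\<^esub> ?id)"
      by (rule S.copower_universal[OF Tyc_small[OF d c] SL.tilde_obj_obj[OF L c] comp_hom[OF SE jid k[OF c d q]]])
    then obtain r where "r \<in> hom ?S (copower ?S (Tyc d c)) (tilde_obj_obj D P ?S L c)"
      "\<forall>s\<in>Tyc d c. r \<cdot>\<^bsub>?S\<^esub> coproj ?S (Tyc d c) s = ?k c d (q s) \<cdot>\<^bsub>?S\<^esub> ?id" by (elim ex1E conjE)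
    then show ?thesis
      using point_in[OF d c] bij_betw_inv_into_left[OF point_bij[OF d c]] by (intro exI[of _ r]) (auto simp: q_def)
  qed
  then obtain r where r: "\<And>c. c \<in> Obj C \<Longrightarrow> r c \<in> hom ?S (copower ?S (Tyc d c)) (tilde_obj_obj D P ?S L c)"
    and rp: "\<And>c z. c \<in> Obj C \<Longrightarrow> z \<in> TE.Pset c d \<Longrightarrow>
      r c \<cdot>\<^bsub>?S\<^esub> coproj ?S (Tyc d c) (point d c z) = ?k c d z \<cdot>\<^bsub>?S\<^esub> ?id" by metis
  have r1: "r c \<cdot>\<^bsub>?S\<^esub> NC K.comparison c = Ide ?S (tilde_obj_obj D P ?S L c)" if c: "c \<in> Obj C" for c
  proof (rule SL.kappa_eqI[OF L c comp_hom[OF SE cmph[OF c] r[OF c]] ide_hom[OF SE SL.tilde_obj_obj[OF L c]]])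
    fix e z assume e: "e \<in> Obj D" and z: "z \<in> TE.Pset c e"
    note ky = kappa_y[OF d c e z] and kz = k[OF c e z]
    note gky = S.gamma_arr[OF ky]
    have "r c \<cdot>\<^bsub>?S\<^esub> FA (gamma ?S) (?ky c e z) = ?k c e z"
    proof (rule S.copower_eqI[OF hom_small comp_hom[OF SE gky(1) r[OF c]] kz])
      fix g assume g: "g \<in> hom D d e"
      note j = S.coproj_hom[OF hom_small g] and z' = psh_act[OF TE.Pc[OF c] g z]
      have Lg: "FA L g = FA (gamma ?S) (FA (yoneda_obj D d) g)" using homD(1)[OF g] by (simp add: L_def)
      note gyg = S.gamma_arr[OF yoneda_obj_arr[OF g, of d]]
      have "?k c e z \<cdot>\<^bsub>?S\<^esub> coproj ?S (hom D d e) g = (?k c e z \<cdot>\<^bsub>?S\<^esub> FA L g) \<cdot>\<^bsub>?S\<^esub> ?id"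
        using comp_assoc[OF SE jid gyg(1) kz] gyg(2)[OF idd] yoneda_simps(3)[OF idd g] comp_ide(1)[OF TE.D g] Lg by simp
      also have "\<dots> = r c \<cdot>\<^bsub>?S\<^esub> coproj ?S (Tyc d c) (point d c (TE.act c g z))"
        using SL.kappa_act[OF L c g z] rp[OF c z'] by simp
      also have "\<dots> = (r c \<cdot>\<^bsub>?S\<^esub> FA (gamma ?S) (?ky c e z)) \<cdot>\<^bsub>?S\<^esub> coproj ?S (hom D d e) g"
        using comp_assoc[OF SE j gky(1) r[OF c]] gky(2)[OF g] kappa_point[OF d c g z] by simp
      finally show "(r c \<cdot>\<^bsub>?S\<^esub> FA (gamma ?S) (?ky c e z)) \<cdot>\<^bsub>?S\<^esub> coproj ?S (hom D d e) g =
        ?k c e z \<cdot>\<^bsub>?S\<^esub> coproj ?S (hom D d e) g" ..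
    qed
    then show "(r c \<cdot>\<^bsub>?S\<^esub> NC K.comparison c) \<cdot>\<^bsub>?S\<^esub> ?k c e z = Ide ?S (tilde_obj_obj D P ?S L c) \<cdot>\<^bsub>?S\<^esub> ?k c e z"
      using comp_assoc[OF SE kz cmph[OF c] r[OF c]] cmp(2)[OF c e z] comp_ide(2)[OF SE kz] by simp
  qed
  have r2: "NC K.comparison c \<cdot>\<^bsub>?S\<^esub> r c = Ide ?S (copower ?S (Tyc d c))" if c: "c \<in> Obj C" for c
  proof (rule S.copower_eqI[OF Tyc_small[OF d c] comp_hom[OF SE r[OF c] cmph[OF c]]
        ide_hom[OF SE S.copower_obj[OF Tyc_small[OF d c]]]])
    fix s assume s: "s \<in> Tyc d c"
    obtain z where z: "z \<in> TE.Pset c d" "s = point d c z" using pointE[OF d c s] by blast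
    note j = S.coproj_hom[OF Tyc_small[OF d c] s] and kz = k[OF c d z(1)]
    note gky = S.gamma_arr[OF kappa_y[OF d c d z(1)]]
    show "(NC K.comparison c \<cdot>\<^bsub>?S\<^esub> r c) \<cdot>\<^bsub>?S\<^esub> coproj ?S (Tyc d c) s =
      Ide ?S (copower ?S (Tyc d c)) \<cdot>\<^bsub>?S\<^esub> coproj ?S (Tyc d c) s"
      using comp_assoc[OF SE j r[OF c] cmph[OF c]] rp[OF c z(1)] z(2) comp_assoc[OF SE jid kz cmph[OF c]]
        cmp(2)[OF c d z(1)] gky(2)[OF idd] comp_ide(2)[OF SE j] by (simp add: point_def)
  qed
  have Ko: "FO (tilde_obj C D P ?S L) c = tilde_obj_obj D P ?S L c"
    "FO (gamma ?S \<circ>\<^bsub>C\<^esub> tilde_obj C D P setcat (yoneda_obj D d)) c = copower ?S (Tyc d c)" if "c \<in> Obj C" for c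
    using that Tyc_small[OF d that] by simp_all
  note inv = inverse_ntr[where r = r, OF TE.C SE K.comparison_hom[folded L_def], folded i_def Ty_eq[OF d]]
  show "i \<in> hom (fcat C ?S) (gamma ?S \<circ>\<^bsub>C\<^esub> Ty d) (tilde_obj C D P ?S L)"
    by (rule inv(1)) (use r r1 r2 Ko Ty_eq[OF d] in simp_all)
  have "NC i c = r c" if "c \<in> Obj C" for c
    by (rule inv(2)[OF _ _ _ that]) (use r r1 r2 Ko Ty_eq[OF d] in simp_all)
  then show "c \<in> Obj C \<Longrightarrow> z \<in> TE.Pset c d \<Longrightarrow>
    NC i c \<cdot>\<^bsub>?S\<^esub> coproj ?S (Tyc d c) (point d c z) = ?k c d z \<cdot>\<^bsub>?S\<^esub> ?id" using rp by simp
qed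

text \<open>The value at \<open>point d c z\<close> is traced through the three factors: the inverse comparison leads to the
injection of \<open>(d, z)\<close> at the identity of \<open>d\<close>, the image under \<open>tilde\<close> applies \<open>x\<close> there, and the
comparison for \<open>!\<^sub>A\<^sup>*\<close> yields \<open>kappa\<close> in \<open>E\<close>.\<close>

lemma tilde_image:
  assumes F: "is_functor D E F" and d: "d \<in> Obj D" and x: "x \<in> hom E A (FO F d)"
  defines "t \<equiv> tilde_image C D P E F d A (yoneda_elem D E F d A x)"
  shows "t \<in> hom (fcat C (slice E A)) (gamma (slice E A) \<circ>\<^bsub>C\<^esub> Ty d) (base_change E A \<circ>\<^bsub>C\<^esub> tilde_obj C D P E F)"
    "c \<in> Obj C \<Longrightarrow> z \<in> TE.Pset c d \<Longrightarrow>
      NC t c \<cdot>\<^bsub>slice E A\<^esub> coproj (slice E A) (Tyc d c) (point d c z) =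
      global_element E A (tilde_obj_obj D P E F c) (kappa D P E F c (d, z) \<cdot> x)"
proof -
  let ?S = "slice E A"
  have A: "A \<in> Obj E" by (rule hom_obj(1)[OF E x])
  interpret S: copowered U ?S by (rule copowered_slice[OF A])
  interpret SL: tilde_target C D P ?S by (rule slice_target[OF A])
  note SE = category_slice[OF E, of A] and y = yoneda_obj_functor[OF d]
  interpret K: tilde_change C D P E ?S "base_change E A" F
    by unfold_locales (rule base_change_functor[OF A] F)+
  let ?L = "gamma ?S \<circ>\<^bsub>D\<^esub> yoneda_obj D d"
  note ye = yoneda_elem[OF F d x] and ci = comparison_inverse[OF A d]
  let ?y = "yoneda_elem D E F d A x"
  let ?i = "inverse_arr (fcat C ?S) (tilde_comparison C D P setcat ?S (gamma ?S) (yoneda_obj D d))"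
  note th = SL.tilde_arr_hom[OF ye(1)] and tc = SL.tilde_arr_comp[OF ye(1)]
  have t: "t = K.comparison \<cdot>\<^bsub>fcat C ?S\<^esub> tilde_arr C D P ?S ?y \<cdot>\<^bsub>fcat C ?S\<^esub> ?i"
    unfolding t_def tilde_image_def yoneda_simps(1)[OF d] SL.tilde_FA[OF ye(1)] ..
  show "t \<in> hom (fcat C ?S) (gamma ?S \<circ>\<^bsub>C\<^esub> Ty d) (base_change E A \<circ>\<^bsub>C\<^esub> tilde_obj C D P E F)"
    unfolding t by (rule fcat_comp_hom[OF ci(1) fcat_comp_hom[OF th K.comparison_hom]])
  assume c: "c \<in> Obj C" and z: "z \<in> TE.Pset c d"
  let ?k = "kappa D P ?S ?L c (d, z)" and ?j = "coproj ?S (Tyc d c) (point d c z)"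
    and ?id = "coproj ?S (hom D d d) (Ide D d)" and ?n = "NC (tilde_arr C D P ?S ?y) c"
  note idd = ide_hom[OF TE.D d]
  note jid = S.coproj_hom[OF hom_small idd] and j = S.coproj_hom[OF Tyc_small[OF d c] point_in[OF d c z]]
  have k: "?k \<in> hom ?S (copower ?S (hom D d d)) (tilde_obj_obj D P ?S ?L c)"
    using SL.kappa_hom[OF functor_fcomp[OF y S.gamma_functor] c d z] d hom_small by simp
  have i: "NC ?i c \<in> hom ?S (copower ?S (Tyc d c)) (tilde_obj_obj D P ?S ?L c)"
    using hom_fcat_comp[OF ci(1) c] c Ty_FO[OF d c] Tyc_small[OF d c] by simp
  note cm = K.comparison_comp[OF c] and cmh = K.comparison_comp(1)[OF c]
  note n = tc(1)[OF c] and kF = SL.kappa_hom[OF K.LF c d z] and Fd = functor_obj[OF F d]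
  have yd: "NC ?y d \<in> hom ?S (copower ?S (hom D d d)) (FO (base_change E A \<circ>\<^bsub>D\<^esub> F) d)"
    using hom_fcat_comp[OF ye(1) d] d hom_small by simp
  note kE = TE.kappa_hom[OF F c d z]
  have "NC t c \<cdot>\<^bsub>?S\<^esub> ?j = ((NC K.comparison c \<cdot>\<^bsub>?S\<^esub> ?n) \<cdot>\<^bsub>?S\<^esub> NC ?i c) \<cdot>\<^bsub>?S\<^esub> ?j"
    using c by (simp add: t)
  also have "\<dots> = (NC K.comparison c \<cdot>\<^bsub>?S\<^esub> ?n) \<cdot>\<^bsub>?S\<^esub> (?k \<cdot>\<^bsub>?S\<^esub> ?id)"
    using comp_assoc[OF SE j i comp_hom[OF SE n cmh]] ci(2)[OF c z] by simp
  also have "\<dots> = NC K.comparison c \<cdot>\<^bsub>?S\<^esub> ((?n \<cdot>\<^bsub>?S\<^esub> ?k) \<cdot>\<^bsub>?S\<^esub> ?id)"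
    using comp_assoc[OF SE comp_hom[OF SE jid k] n cmh] comp_assoc[OF SE jid k n] by simp
  also have "\<dots> = NC K.comparison c \<cdot>\<^bsub>?S\<^esub> (kappa D P ?S (base_change E A \<circ>\<^bsub>D\<^esub> F) c (d, z) \<cdot>\<^bsub>?S\<^esub> (NC ?y d \<cdot>\<^bsub>?S\<^esub> ?id))"
    using tc(2)[OF c d z] comp_assoc[OF SE jid yd kF] by simp
  also have "\<dots> = FA (base_change E A) (kappa D P E F c (d, z)) \<cdot>\<^bsub>?S\<^esub> (NC ?y d \<cdot>\<^bsub>?S\<^esub> ?id)"
    using comp_assoc[OF SE comp_hom[OF SE jid yd] kF cmh] cm(2)[OF d z] by simp
  also have "\<dots> = FA (base_change E A) (kappa D P E F c (d, z)) \<cdot>\<^bsub>?S\<^esub> global_element E A (FO F d) x"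
    using ye(2)[OF d idd] functor_ide[OF F d] comp_ide(2)[OF E x] by simp
  also have "\<dots> = global_element E A (tilde_obj_obj D P E F c) (kappa D P E F c (d, z) \<cdot> x)"
    by (rule global_element_comp[OF A x kE])
  finally show "NC t c \<cdot>\<^bsub>?S\<^esub> ?j = global_element E A (tilde_obj_obj D P E F c) (kappa D P E F c (d, z) \<cdot> x)" .
qed

subsection \<open>Unit and counit\<close>

text \<open>Both families below are natural in \<open>c\<close> and \<open>d\<close>: \<open>kappa\<close> is a cone over the diagram of \<open>right\<close>, and \<open>rproj\<close>
is a cocone under the diagram of \<open>tilde\<close>.\<close>

definition unit_comp :: "('u, 'u, 'o, 'a) ftr \<Rightarrow> 'u \<Rightarrow> 'a" where
  "unit_comp F d = (THE x. x \<in> hom E (FO F d) (FO (right_obj C D P E (tilde_obj C D P E F)) d) \<and>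
     (\<forall>c\<in>Obj C. \<forall>z\<in>TE.Pset c d. rproj (tilde_obj C D P E F) d c z \<cdot> x = kappa D P E F c (d, z)))"

definition counit_comp :: "('u, 'u, 'o, 'a) ftr \<Rightarrow> 'u \<Rightarrow> 'a" where
  "counit_comp G c = (THE h. h \<in> hom E (tilde_obj_obj D P E (right_obj C D P E G) c) (FO G c) \<and>
     (\<forall>d\<in>Obj D. \<forall>z\<in>TE.Pset c d. h \<cdot> kappa D P E (right_obj C D P E G) c (d, z) = rproj G d c z))"

lemma unit_comp:
  assumes F: "is_functor D E F" and d: "d \<in> Obj D"
  shows "unit_comp F d \<in> hom E (FO F d) (FO (right_obj C D P E (tilde_obj C D P E F)) d)"
    "c \<in> Obj C \<Longrightarrow> z \<in> TE.Pset c d \<Longrightarrow>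
      rproj (tilde_obj C D P E F) d c z \<cdot> unit_comp F d = kappa D P E F c (d, z)"
proof -
  have "\<exists>!x. x \<in> hom E (FO F d) (FO (right_obj C D P E (tilde_obj C D P E F)) d) \<and>
     (\<forall>c\<in>Obj C. \<forall>z\<in>TE.Pset c d. rproj (tilde_obj C D P E F) d c z \<cdot> x = kappa D P E F c (d, z))"
    by (rule rproj_universal[OF TE.tilde_obj_functor[OF F] d functor_obj[OF F d]])
      (use TE.kappa_hom[OF F _ d] TE.tilde_obj_arr(2)[OF F _ d] in auto)
  from theI'[OF this, folded unit_comp_def]
  show "unit_comp F d \<in> hom E (FO F d) (FO (right_obj C D P E (tilde_obj C D P E F)) d)"
    "c \<in> Obj C \<Longrightarrow> z \<in> TE.Pset c d \<Longrightarrow>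
      rproj (tilde_obj C D P E F) d c z \<cdot> unit_comp F d = kappa D P E F c (d, z)" by auto
qed

lemma counit_comp:
  assumes G: "is_functor C E G" and c: "c \<in> Obj C"
  shows "counit_comp G c \<in> hom E (tilde_obj_obj D P E (right_obj C D P E G) c) (FO G c)"
    "d \<in> Obj D \<Longrightarrow> z \<in> TE.Pset c d \<Longrightarrow>
      counit_comp G c \<cdot> kappa D P E (right_obj C D P E G) c (d, z) = rproj G d c z"
proof -
  have "\<exists>!h. h \<in> hom E (tilde_obj_obj D P E (right_obj C D P E G) c) (FO G c) \<and>
     (\<forall>d\<in>Obj D. \<forall>z\<in>TE.Pset c d. h \<cdot> kappa D P E (right_obj C D P E G) c (d, z) = rproj G d c z)"
    by (rule TE.kappa_universal[OF right_obj_functor[OF G] c functor_obj[OF G c] rproj_hom[OF G _ c]])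
      (use right_obj_arr(2)[OF G _ c] in auto)
  from theI'[OF this, folded counit_comp_def]
  show "counit_comp G c \<in> hom E (tilde_obj_obj D P E (right_obj C D P E G) c) (FO G c)"
    "d \<in> Obj D \<Longrightarrow> z \<in> TE.Pset c d \<Longrightarrow>
      counit_comp G c \<cdot> kappa D P E (right_obj C D P E G) c (d, z) = rproj G d c z" by auto
qed

definition unit_at :: "('u, 'u, 'o, 'a) ftr \<Rightarrow> ('u, 'u, 'o, 'a) ntr" where
  "unit_at F = \<lparr>NS = F, NT = right_obj C D P E (tilde_obj C D P E F), NC = \<lambda>d\<in>Obj D. unit_comp F d\<rparr>"

definition counit_at :: "('u, 'u, 'o, 'a) ftr \<Rightarrow> ('u, 'u, 'o, 'a) ntr" where
  "counit_at G = \<lparr>NS = tilde_obj C D P E (right_obj C D P E G), NT = G, NC = \<lambda>c\<in>Obj C. counit_comp G c\<rparr>"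

lemma unit_at_hom:
  assumes F: "is_functor D E F"
  shows "unit_at F \<in> hom (fcat D E) F (right_obj C D P E (tilde_obj C D P E F))"
proof -
  note tF = TE.tilde_obj_functor[OF F]
  let ?R = "right_obj C D P E (tilde_obj C D P E F)"
  show ?thesis
  proof (rule natI[OF F right_obj_functor[OF tF]])
    show "NC (unit_at F) d \<in> hom E (FO F d) (FO ?R d)" if "d \<in> Obj D" for d
      using unit_comp(1)[OF F that] that by (simp add: unit_at_def)
    fix g d d' assume g: "g \<in> hom D d d'" and d: "d \<in> Obj D" "d' \<in> Obj D"
    note u = unit_comp[OF F d(1)] and u' = unit_comp[OF F d(2)]
    note Fg = functor_hom[OF F g] and Rg = right_obj_arr[OF tF g]
    have "unit_comp F d' \<cdot> FA F g = FA ?R g \<cdot> unit_comp F d"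
    proof (rule rproj_eqI[OF tF d(2) comp_hom[OF E Fg u'(1)] comp_hom[OF E u(1) Rg(1)]])
      fix c z assume c: "c \<in> Obj C" and z: "z \<in> TE.Pset c d'"
      note p = rproj_hom[OF tF d(2) c z]
      show "rproj (tilde_obj C D P E F) d' c z \<cdot> (unit_comp F d' \<cdot> FA F g) =
        rproj (tilde_obj C D P E F) d' c z \<cdot> (FA ?R g \<cdot> unit_comp F d)"
        using comp_assoc[OF E Fg u'(1) p] u'(2)[OF c z] TE.kappa_act[OF F c g z] comp_assoc[OF E u(1) Rg(1) p]
          Rg(2)[OF c z] u(2)[OF c psh_act[OF TE.Pc[OF c] g z]] by simp
    qed
    then show "NC (unit_at F) d' \<cdot> FA F g = FA ?R g \<cdot> NC (unit_at F) d" using d by (simp add: unit_at_def)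
  qed (simp_all add: unit_at_def)
qed

lemma counit_at_hom:
  assumes G: "is_functor C E G"
  shows "counit_at G \<in> hom (fcat C E) (tilde_obj C D P E (right_obj C D P E G)) G"
proof -
  note R = right_obj_functor[OF G]
  let ?R = "right_obj C D P E G"
  show ?thesis
  proof (rule natI[OF TE.tilde_obj_functor[OF R] G])
    show "NC (counit_at G) c \<in> hom E (FO (tilde_obj C D P E ?R) c) (FO G c)" if "c \<in> Obj C" for c
      using counit_comp(1)[OF G that] that by (simp add: counit_at_def)
    fix f c c' assume f: "f \<in> hom C c c'" and c: "c \<in> Obj C" "c' \<in> Obj C"
    note e = counit_comp[OF G c(1)] and e' = counit_comp[OF G c(2)]
    note Gf = functor_hom[OF G f] and tf = TE.tilde_obj_arr[OF R f]
    have "counit_comp G c' \<cdot> FA (tilde_obj C D P E ?R) f = FA G f \<cdot> counit_comp G c"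
    proof (rule TE.kappa_eqI[OF R c(1) comp_hom[OF E tf(1) e'(1)] comp_hom[OF E e(1) Gf]])
      fix d z assume d: "d \<in> Obj D" and z: "z \<in> TE.Pset c d"
      note k = TE.kappa_hom[OF R c(1) d z]
      show "(counit_comp G c' \<cdot> FA (tilde_obj C D P E ?R) f) \<cdot> kappa D P E ?R c (d, z) =
        (FA G f \<cdot> counit_comp G c) \<cdot> kappa D P E ?R c (d, z)"
        using comp_assoc[OF E k tf(1) e'(1)] tf(2)[OF d z] e'(2)[OF d TE.push_in[OF f d z]]
          comp_assoc[OF E k e(1) Gf] e(2)[OF d z] rproj_push[OF G d f z] by simp
    qed
    then show "NC (counit_at G) c' \<cdot> FA (tilde_obj C D P E ?R) f = FA G f \<cdot> NC (counit_at G) c"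
      using c by (simp add: counit_at_def)
  qed (simp_all add: counit_at_def)
qed

definition unit where
  "unit = \<lparr>NS = id_functor (fcat D E), NT = right C D P E \<circ>\<^bsub>fcat D E\<^esub> tilde C D P E,
     NC = \<lambda>F\<in>Obj (fcat D E). unit_at F\<rparr>"

definition counit where
  "counit = \<lparr>NS = tilde C D P E \<circ>\<^bsub>fcat C E\<^esub> right C D P E, NT = id_functor (fcat C E),
     NC = \<lambda>G\<in>Obj (fcat C E). counit_at G\<rparr>"

lemma unit_hom:
  "unit \<in> hom (fcat (fcat D E) (fcat D E)) (id_functor (fcat D E)) (right C D P E \<circ>\<^bsub>fcat D E\<^esub> tilde C D P E)"
proof (rule natI[OF functor_id[OF category_fcat[OF TE.D E]] functor_fcomp[OF TE.tilde_functor right_functor]])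
  show "NC unit F \<in> hom (fcat D E) (FO (id_functor (fcat D E)) F) (FO (right C D P E \<circ>\<^bsub>fcat D E\<^esub> tilde C D P E) F)"
    if "F \<in> Obj (fcat D E)" for F
    using that unit_at_hom TE.tilde_obj_functor by (simp add: unit_def)
  fix t F F' assume t: "t \<in> hom (fcat D E) F F'"
  note F = hom_fcat(4)[OF t] and F' = hom_fcat(5)[OF t]
  note th = TE.tilde_arr_hom[OF t]
  note rh = right_arr_hom[OF th] and uF = unit_at_hom[OF F] and uF' = unit_at_hom[OF F']
  have "unit_at F' \<cdot>\<^bsub>fcat D E\<^esub> t = right_arr C D P E (tilde_arr C D P E t) \<cdot>\<^bsub>fcat D E\<^esub> unit_at F"
  proof (rule ntr_eqI[OF fcat_comp_hom[OF t uF'] fcat_comp_hom[OF uF rh]])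
    fix d assume d: "d \<in> Obj D"
    note td = hom_fcat_comp[OF t d] and u = unit_comp[OF F d] and u' = unit_comp[OF F' d]
    note r = right_arr_comp[OF th d]
    note tF' = TE.tilde_obj_functor[OF F'] and tF = TE.tilde_obj_functor[OF F]
    have "unit_comp F' d \<cdot> NC t d = NC (right_arr C D P E (tilde_arr C D P E t)) d \<cdot> unit_comp F d"
    proof (rule rproj_eqI[OF tF' d comp_hom[OF E td u'(1)] comp_hom[OF E u(1) r(1)]])
      fix c z assume c: "c \<in> Obj C" and z: "z \<in> TE.Pset c d"
      note p' = rproj_hom[OF tF' d c z] and tc = TE.tilde_arr_comp[OF t c]
      have p: "rproj (tilde_obj C D P E F) d c z \<in>
        hom E (FO (right_obj C D P E (tilde_obj C D P E F)) d) (tilde_obj_obj D P E F c)"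
        using rproj_hom[OF tF d c z] c by simp
      show "rproj (tilde_obj C D P E F') d c z \<cdot> (unit_comp F' d \<cdot> NC t d) =
        rproj (tilde_obj C D P E F') d c z \<cdot> (NC (right_arr C D P E (tilde_arr C D P E t)) d \<cdot> unit_comp F d)"
        using comp_assoc[OF E td u'(1) p'] u'(2)[OF c z] comp_assoc[OF E u(1) r(1) p'] r(2)[OF c z]
          comp_assoc[OF E u(1) p tc(1)] u(2)[OF c z] tc(2)[OF d z] by simp
    qed
    then show "NC (unit_at F' \<cdot>\<^bsub>fcat D E\<^esub> t) d =
      NC (right_arr C D P E (tilde_arr C D P E t) \<cdot>\<^bsub>fcat D E\<^esub> unit_at F) d" using d by (simp add: unit_at_def)
  qed
  moreover have "FA (right C D P E \<circ>\<^bsub>fcat D E\<^esub> tilde C D P E) t = right_arr C D P E (tilde_arr C D P E t)"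
    unfolding fcomp_FA[OF homD(1)[OF t]] TE.tilde_FA[OF t] right_FA[OF th] ..
  moreover have "FA (id_functor (fcat D E)) t = t" by (rule id_functor_FA[OF homD(1)[OF t]])
  moreover have "NC unit F = unit_at F" "NC unit F' = unit_at F'" using F F' by (simp_all add: unit_def)
  ultimately show "NC unit F' \<cdot>\<^bsub>fcat D E\<^esub> FA (id_functor (fcat D E)) t =
    FA (right C D P E \<circ>\<^bsub>fcat D E\<^esub> tilde C D P E) t \<cdot>\<^bsub>fcat D E\<^esub> NC unit F" by (simp only:)
qed (simp_all add: unit_def)

lemma counit_hom:
  "counit \<in> hom (fcat (fcat C E) (fcat C E)) (tilde C D P E \<circ>\<^bsub>fcat C E\<^esub> right C D P E) (id_functor (fcat C E))"
proof (rule natI[OF functor_fcomp[OF right_functor TE.tilde_functor] functor_id[OF category_fcat[OF TE.C E]]])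
  show "NC counit G \<in> hom (fcat C E) (FO (tilde C D P E \<circ>\<^bsub>fcat C E\<^esub> right C D P E) G) (FO (id_functor (fcat C E)) G)"
    if "G \<in> Obj (fcat C E)" for G
    using that counit_at_hom right_obj_functor by (simp add: counit_def)
  fix t G G' assume t: "t \<in> hom (fcat C E) G G'"
  note G = hom_fcat(4)[OF t] and G' = hom_fcat(5)[OF t]
  note rh = right_arr_hom[OF t]
  note th = TE.tilde_arr_hom[OF rh] and cG = counit_at_hom[OF G] and cG' = counit_at_hom[OF G']
  have "counit_at G' \<cdot>\<^bsub>fcat C E\<^esub> tilde_arr C D P E (right_arr C D P E t) = t \<cdot>\<^bsub>fcat C E\<^esub> counit_at G"
  proof (rule ntr_eqI[OF fcat_comp_hom[OF th cG'] fcat_comp_hom[OF cG t]])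
    fix c assume c: "c \<in> Obj C"
    note tc = hom_fcat_comp[OF t c] and e = counit_comp[OF G c] and e' = counit_comp[OF G' c]
    note n = TE.tilde_arr_comp[OF rh c]
    note R = right_obj_functor[OF G] and R' = right_obj_functor[OF G']
    have "counit_comp G' c \<cdot> NC (tilde_arr C D P E (right_arr C D P E t)) c = NC t c \<cdot> counit_comp G c"
    proof (rule TE.kappa_eqI[OF R c comp_hom[OF E n(1) e'(1)] comp_hom[OF E e(1) tc]])
      fix d z assume d: "d \<in> Obj D" and z: "z \<in> TE.Pset c d"
      note k = TE.kappa_hom[OF R c d z] and k' = TE.kappa_hom[OF R' c d z] and r = right_arr_comp[OF t d]
      show "(counit_comp G' c \<cdot> NC (tilde_arr C D P E (right_arr C D P E t)) c) \<cdot>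
          kappa D P E (right_obj C D P E G) c (d, z) =
        (NC t c \<cdot> counit_comp G c) \<cdot> kappa D P E (right_obj C D P E G) c (d, z)"
        using comp_assoc[OF E k n(1) e'(1)] n(2)[OF d z] comp_assoc[OF E r(1) k' e'(1)] e'(2)[OF d z]
          r(2)[OF c z] comp_assoc[OF E k e(1) tc] e(2)[OF d z] by simp
    qed
    then show "NC (counit_at G' \<cdot>\<^bsub>fcat C E\<^esub> tilde_arr C D P E (right_arr C D P E t)) c =
      NC (t \<cdot>\<^bsub>fcat C E\<^esub> counit_at G) c" using c by (simp add: counit_at_def)
  qed
  moreover have "FA (tilde C D P E \<circ>\<^bsub>fcat C E\<^esub> right C D P E) t = tilde_arr C D P E (right_arr C D P E t)"
    unfolding fcomp_FA[OF homD(1)[OF t]] right_FA[OF t] TE.tilde_FA[OF rh] ..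
  moreover have "FA (id_functor (fcat C E)) t = t" by (rule id_functor_FA[OF homD(1)[OF t]])
  moreover have "NC counit G = counit_at G" "NC counit G' = counit_at G'" using G G' by (simp_all add: counit_def)
  ultimately show "NC counit G' \<cdot>\<^bsub>fcat C E\<^esub> FA (tilde C D P E \<circ>\<^bsub>fcat C E\<^esub> right C D P E) t =
    FA (id_functor (fcat C E)) t \<cdot>\<^bsub>fcat C E\<^esub> NC counit G" by (simp only:)
qed (simp_all add: counit_def)

text \<open>Both triangle identities hold because the unit and the counit are inverse to each other in the
  sense that \<open>rproj \<circ> unit = kappa\<close> and \<open>counit \<circ> kappa = rproj\<close>.\<close>

lemma tilde_right_adjunction:
  "adjunction (fcat D E) (fcat C E) (tilde C D P E) (right C D P E) unit counit"
  unfolding adjunction_def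
proof (intro conjI ballI TE.tilde_functor right_functor unit_hom counit_hom)
  fix F assume "F \<in> Obj (fcat D E)"
  then have F: "is_functor D E F" by simp
  note tF = TE.tilde_obj_functor[OF F] and u = unit_at_hom[OF F]
  note R = right_obj_functor[OF tF] and tu = TE.tilde_arr_hom[OF u] and e = counit_at_hom[OF tF]
  have "counit_at (tilde_obj C D P E F) \<cdot>\<^bsub>fcat C E\<^esub> tilde_arr C D P E (unit_at F) = Ide (fcat C E) (tilde_obj C D P E F)"
  proof (rule ntr_eqI[OF fcat_comp_hom[OF tu e] fcat_ide_hom[OF tF]])
    fix c assume c: "c \<in> Obj C"
    note ec = counit_comp[OF tF c] and n = TE.tilde_arr_comp[OF u c]
    have ech: "counit_comp (tilde_obj C D P E F) c \<in> hom E
        (tilde_obj_obj D P E (right_obj C D P E (tilde_obj C D P E F)) c) (tilde_obj_obj D P E F c)"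
      using ec(1) c by simp
    have "counit_comp (tilde_obj C D P E F) c \<cdot> NC (tilde_arr C D P E (unit_at F)) c = Ide E (tilde_obj_obj D P E F c)"
    proof (rule TE.kappa_eqI[OF F c comp_hom[OF E n(1) ech] ide_hom[OF E TE.tilde_obj_obj[OF F c]]])
      fix d z assume d: "d \<in> Obj D" and z: "z \<in> TE.Pset c d"
      note k = TE.kappa_hom[OF F c d z] and kR = TE.kappa_hom[OF R c d z] and ud = unit_comp[OF F d]
      show "(counit_comp (tilde_obj C D P E F) c \<cdot> NC (tilde_arr C D P E (unit_at F)) c) \<cdot> kappa D P E F c (d, z) =
        Ide E (tilde_obj_obj D P E F c) \<cdot> kappa D P E F c (d, z)"
        using comp_assoc[OF E k n(1) ech] n(2)[OF d z] d comp_assoc[OF E ud(1) kR ech] ec(2)[OF d z]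
          ud(2)[OF c z] comp_ide(2)[OF E k] by (simp add: unit_at_def)
    qed
    then show "NC (counit_at (tilde_obj C D P E F) \<cdot>\<^bsub>fcat C E\<^esub> tilde_arr C D P E (unit_at F)) c =
      NC (Ide (fcat C E) (tilde_obj C D P E F)) c" using c by (simp add: counit_at_def)
  qed
  moreover have "NC unit F = unit_at F" "NC counit (tilde_obj C D P E F) = counit_at (tilde_obj C D P E F)"
    using F tF by (simp_all add: unit_def counit_def)
  ultimately show "NC counit (FO (tilde C D P E) F) \<cdot>\<^bsub>fcat C E\<^esub> FA (tilde C D P E) (NC unit F) =
    Ide (fcat C E) (FO (tilde C D P E) F)"
    using TE.tilde_FO[OF F] TE.tilde_FA[OF u] by (simp only:)
next
  fix G assume "G \<in> Obj (fcat C E)"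
  then have G: "is_functor C E G" by simp
  note R = right_obj_functor[OF G] and e = counit_at_hom[OF G]
  note tR = TE.tilde_obj_functor[OF R] and re = right_arr_hom[OF e] and u = unit_at_hom[OF R]
  let ?R = "right_obj C D P E G"
  have "right_arr C D P E (counit_at G) \<cdot>\<^bsub>fcat D E\<^esub> unit_at ?R = Ide (fcat D E) ?R"
  proof (rule ntr_eqI[OF fcat_comp_hom[OF u re] fcat_ide_hom[OF R]])
    fix d assume d: "d \<in> Obj D"
    note ud = unit_comp[OF R d] and n = right_arr_comp[OF e d]
    have "NC (right_arr C D P E (counit_at G)) d \<cdot> unit_comp ?R d = Ide E (FO ?R d)"
    proof (rule rproj_eqI[OF G d comp_hom[OF E ud(1) n(1)] ide_hom[OF E functor_obj[OF R d]]])
      fix c z assume c: "c \<in> Obj C" and z: "z \<in> TE.Pset c d"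
      note p = rproj_hom[OF G d c z] and ec = counit_comp[OF G c]
      have pt: "rproj (tilde_obj C D P E ?R) d c z \<in>
        hom E (FO (right_obj C D P E (tilde_obj C D P E ?R)) d) (tilde_obj_obj D P E ?R c)"
        using rproj_hom[OF tR d c z] c by simp
      show "rproj G d c z \<cdot> (NC (right_arr C D P E (counit_at G)) d \<cdot> unit_comp ?R d) =
        rproj G d c z \<cdot> Ide E (FO ?R d)"
        using comp_assoc[OF E ud(1) n(1) p] n(2)[OF c z] c comp_assoc[OF E ud(1) pt ec(1)] ud(2)[OF c z]
          ec(2)[OF d z] comp_ide(1)[OF E p] by (simp add: counit_at_def)
    qed
    then show "NC (right_arr C D P E (counit_at G) \<cdot>\<^bsub>fcat D E\<^esub> unit_at ?R) d = NC (Ide (fcat D E) ?R) d"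
      using d by (simp add: unit_at_def)
  qed
  moreover have "NC unit ?R = unit_at ?R" "NC counit G = counit_at G"
    using R G by (simp_all add: unit_def counit_def)
  ultimately show "FA (right C D P E) (NC counit G) \<cdot>\<^bsub>fcat D E\<^esub> NC unit (FO (right C D P E) G) =
    Ide (fcat D E) (FO (right C D P E) G)"
    using right_FO[OF G] right_FA[OF e] by (simp only:)
qed

text \<open>The two descriptions hold since transformations out of \<open>\<gamma>\<^sup>* \<circ> Ty d\<close> are determined by their values
  at the elements \<open>point d c z\<close>.\<close>

lemma unit_description:
  assumes F: "is_functor D E F" and d: "d \<in> Obj D" and x: "x \<in> hom E A (FO F d)"
  shows "right_elem C D P E (tilde_obj C D P E F) d A (unit_comp F d \<cdot> x) =
    tilde_image C D P E F d A (yoneda_elem D E F d A x)"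
proof -
  have A: "A \<in> Obj E" by (rule hom_obj(1)[OF E x])
  interpret S: copowered U "slice E A" by (rule copowered_slice[OF A])
  note tF = TE.tilde_obj_functor[OF F] and u = unit_comp[OF F d]
  note ux = comp_hom[OF E x u(1)]
  note r = right_elem[OF tF d ux] and i = tilde_image[OF F d x]
  show ?thesis
  proof (rule ntr_eqI[OF r(1) i(1)])
    fix c assume c: "c \<in> Obj C"
    have o: "FO (gamma (slice E A) \<circ>\<^bsub>C\<^esub> Ty d) c = copower (slice E A) (Tyc d c)"
      using c Ty_FO[OF d c] Tyc_small[OF d c] by simp
    show "NC (right_elem C D P E (tilde_obj C D P E F) d A (unit_comp F d \<cdot> x)) c =
      NC (tilde_image C D P E F d A (yoneda_elem D E F d A x)) c"
    proof (rule S.copower_eqI[OF Tyc_small[OF d c] hom_fcat_comp[OF r(1) c, unfolded o] hom_fcat_comp[OF i(1) c, unfolded o]])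
      fix s assume s: "s \<in> Tyc d c"
      obtain z where z: "z \<in> TE.Pset c d" "s = point d c z" using pointE[OF d c s] by blast
      note p = rproj_hom[OF tF d c z(1)]
      show "NC (right_elem C D P E (tilde_obj C D P E F) d A (unit_comp F d \<cdot> x)) c \<cdot>\<^bsub>slice E A\<^esub>
          coproj (slice E A) (Tyc d c) s =
        NC (tilde_image C D P E F d A (yoneda_elem D E F d A x)) c \<cdot>\<^bsub>slice E A\<^esub> coproj (slice E A) (Tyc d c) s"
        unfolding z(2) r(2)[OF c z(1)] i(2)[OF c z(1)]
        using comp_assoc[OF E x u(1) p] u(2)[OF c z(1)] c by simp
    qed
  qed
qed

lemma counit_description:
  assumes G: "is_functor C E G" and c: "c \<in> Obj C" and d: "d \<in> Obj D" and z: "z \<in> TE.Pset c d"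
    and x: "x \<in> hom E A (FO (right_obj C D P E G) d)"
  shows "global_element E A (FO G c)
      ((counit_comp G c \<cdot> kappa D P E (right_obj C D P E G) c (d, z)) \<cdot> x) =
    NC (right_elem C D P E G d A x) c \<cdot>\<^bsub>slice E A\<^esub>
    coproj (slice E A) (FO (Ty d) c) (SF (kappa D P setcat (FO (yoneda D) d) c (d, z)) (Ide D d))"
  using right_elem(2)[OF G d x c z] counit_comp(2)[OF G c d z] d Ty_FO[OF d c] by (simp add: point_def)

end

theorem theorem3p12:
  fixes C D :: "('u::universe, 'u) cat"
    and E :: "('o, 'a) cat"
    and P :: "('u, 'u, 'u psh, 'u psh_ntr) ftr"
  assumes "small_category C" and "small_category D"
    and "grothendieck_topos TYPE('u) E"
    and "is_functor C (fcat (opp D) setcat) P"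
  shows "\<exists>\<eta> \<epsilon>.
    adjunction (fcat D E) (fcat C E) (tilde C D P E) (right C D P E) \<eta> \<epsilon> \<and>
    (\<forall>F\<in>Obj (fcat D E). \<forall>d\<in>Obj D. \<forall>A\<in>Obj E. \<forall>x\<in>hom E A (FO F d).
       right_elem C D P E (FO (tilde C D P E) F) d A (NC (NC \<eta> F) d \<cdot>\<^bsub>E\<^esub> x) =
       tilde_image C D P E F d A (yoneda_elem D E F d A x)) \<and>
    (\<forall>G\<in>Obj (fcat C E). \<forall>c\<in>Obj C. \<forall>(d, z)\<in>Obj (elements D (FO P c)).
       \<forall>A\<in>Obj E. \<forall>x\<in>hom E A (FO (FO (right C D P E) G) d).
         global_element E A (FO G c)
           ((NC (NC \<epsilon> G) c \<cdot>\<^bsub>E\<^esub> kappa D P E (FO (right C D P E) G) c (d, z)) \<cdot>\<^bsub>E\<^esub> x) =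
         NC (right_elem C D P E G d A x) c \<cdot>\<^bsub>slice E A\<^esub>
         coproj (slice E A) (FO (tilde_yoneda C D P d) c)
           (SF (kappa D P setcat (FO (yoneda D) d) c (d, z)) (Ide D d)))"
proof -
  obtain B :: "('u, 'u) cat" and J and sec :: "'o \<Rightarrow> 'u \<Rightarrow> 'u set" and res and app :: "'a \<Rightarrow> 'u \<Rightarrow> 'u \<Rightarrow> 'u"
    where "sheaf_model E B J sec res app" by (rule topos_sheaf_model[OF assms(3)])
  then have "topos_like TYPE('u) E" by (rule sheaf_model.topos_like)
  then interpret adjoint_setup "TYPE('u)" E C D P
    using assms by (simp add: adjoint_setup_def adjoint_setup_axioms_def)
  show ?thesis
    unfolding ball_elements
  proof (rule exI[of _ unit], rule exI[of _ counit], intro conjI ballI tilde_right_adjunction)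
    fix F d A x assume "F \<in> Obj (fcat D E)" and d: "d \<in> Obj D" and x: "x \<in> hom E A (FO F d)"
    then have F: "is_functor D E F" by simp
    have "NC (NC unit F) d = unit_comp F d" using F d by (simp add: unit_def unit_at_def)
    then show "right_elem C D P E (FO (tilde C D P E) F) d A (NC (NC unit F) d \<cdot>\<^bsub>E\<^esub> x) =
       tilde_image C D P E F d A (yoneda_elem D E F d A x)"
      using unit_description[OF F d x] TE.tilde_FO[OF F] by (simp only:)
  next
    fix G c d z A x assume "G \<in> Obj (fcat C E)" and c: "c \<in> Obj C" and d: "d \<in> Obj D" and z: "z \<in> FO (FO P c) d"
      and x: "x \<in> hom E A (FO (FO (right C D P E) G) d)"
    then have G: "is_functor C E G" by simp
    have "NC (NC counit G) c = counit_comp G c" using G c by (simp add: counit_def counit_at_def)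
    then show "global_element E A (FO G c)
           ((NC (NC counit G) c \<cdot>\<^bsub>E\<^esub> kappa D P E (FO (right C D P E) G) c (d, z)) \<cdot>\<^bsub>E\<^esub> x) =
         NC (right_elem C D P E G d A x) c \<cdot>\<^bsub>slice E A\<^esub>
         coproj (slice E A) (FO (tilde_yoneda C D P d) c)
           (SF (kappa D P setcat (FO (yoneda D) d) c (d, z)) (Ide D d))"
      using counit_description[OF G c d z] x right_FO[OF G] by (simp only:)
  qed
qed

end
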